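(* Let $G$ be a finite $p$-solvable group and $P$ a Sylow $p$-subgroup of $G$. (1) If $p>2$, then $\ell_p(G)\le \lceil \operatorname{pwc}(P)/(p-2)\rceil$. (2) If $p=2$, then $\ell_2(G)\le \operatorname{pwc}(P)$.
   Context: For a finite $p$-group $P$, a normal subgroup $N$ of $P$ is powerfully embedded in $P$ if $[N,P]\le N^p$ when $p$ is odd, and $[N,P]\le N^4$ when $p=2$ (here $N^{k}$ denotes the subgroup generated by all $k$-th powers of elements of $N$). An $\eta$-series of $P$ is an ascending series $1=N_0\le N_1\le N_2\le\cdots$ of normal subgroups of $P$ such that $N_{i+1}/N_i$ is powerfully embedded in $P/N_i$ for all $i$. For $N\trianglelefteq P$, the powerful height $\operatorname{pwh}_P(N)$ is the smallest $k$ such that there is an $\eta$-series with $N_k=N$. The powerful class of $P$ is $\operatorname{pwc}(P)=\operatorname{pwh}_P(P)$. $\ell_p(G)$ denotes the $p$-length of the $p$-solvable group $G$. *)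

theory Defs
  imports "HOL-Algebra.Algebra" "HOL-Computational_Algebra.Primes"
begin

definition comm_sg :: "('a,'b) monoid_scheme \<Rightarrow> 'a set \<Rightarrow> 'a set \<Rightarrow> 'a set" where
  "comm_sg H N M = generate H {x \<otimes>\<^bsub>H\<^esub> y \<otimes>\<^bsub>H\<^esub> inv\<^bsub>H\<^esub> x \<otimes>\<^bsub>H\<^esub> inv\<^bsub>H\<^esub> y | x y. x \<in> N \<and> y \<in> M}"

definition pow_sg :: "('a,'b) monoid_scheme \<Rightarrow> 'a set \<Rightarrow> nat \<Rightarrow> 'a set" where
  "pow_sg H N k = generate H {x [^]\<^bsub>H\<^esub> k | x. x \<in> N}"

definition powerfully_embedded :: "('a,'b) monoid_scheme \<Rightarrow> nat \<Rightarrow> 'a set \<Rightarrow> bool" where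
  "powerfully_embedded H p N \<longleftrightarrow>
     N \<lhd> H \<and> comm_sg H N (carrier H) \<subseteq> pow_sg H N (if p = 2 then 4 else p)"

definition eta_series :: "('a,'b) monoid_scheme \<Rightarrow> nat \<Rightarrow> (nat \<Rightarrow> 'a set) \<Rightarrow> bool" where
  "eta_series H p Ns \<longleftrightarrow>
     Ns 0 = {\<one>\<^bsub>H\<^esub>} \<and>
     (\<forall>i. Ns i \<subseteq> Ns (Suc i)) \<and>
     (\<forall>i. Ns i \<lhd> H) \<and>
     (\<forall>i. powerfully_embedded (H Mod (Ns i)) p ((\<lambda>x. Ns i #>\<^bsub>H\<^esub> x) ` Ns (Suc i)))"

definition powerful_height :: "('a,'b) monoid_scheme \<Rightarrow> nat \<Rightarrow> 'a set \<Rightarrow> nat" where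
  "powerful_height H p N = (LEAST k. \<exists>Ns. eta_series H p Ns \<and> Ns k = N)"

definition powerful_class :: "('a,'b) monoid_scheme \<Rightarrow> nat \<Rightarrow> nat" where
  "powerful_class H p = powerful_height H p (carrier H)"

definition sylow_subgroup :: "('a,'b) monoid_scheme \<Rightarrow> nat \<Rightarrow> 'a set \<Rightarrow> bool" where
  "sylow_subgroup G p P \<longleftrightarrow> subgroup P G \<and> card P = p ^ multiplicity p (order G)"

definition series_factor :: "('a,'b) monoid_scheme \<Rightarrow> (nat \<Rightarrow> 'a set) \<Rightarrow> nat \<Rightarrow> 'a set monoid" where
  "series_factor G Ns i = (G\<lparr>carrier := Ns (Suc i)\<rparr>) Mod (Ns i)"

definition p_group :: "('a,'b) monoid_scheme \<Rightarrow> nat \<Rightarrow> bool" where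
  "p_group H p \<longleftrightarrow> (\<exists>k. order H = p ^ k)"

definition p'_group :: "('a,'b) monoid_scheme \<Rightarrow> nat \<Rightarrow> bool" where
  "p'_group H p \<longleftrightarrow> coprime (order H) p"

definition p_series :: "('a,'b) monoid_scheme \<Rightarrow> nat \<Rightarrow> (nat \<Rightarrow> 'a set) \<Rightarrow> nat \<Rightarrow> bool" where
  "p_series G p Ns m \<longleftrightarrow>
     Ns 0 = {\<one>\<^bsub>G\<^esub>} \<and> Ns m = carrier G \<and>
     (\<forall>i<m. subgroup (Ns (Suc i)) G \<and> Ns i \<lhd> G\<lparr>carrier := Ns (Suc i)\<rparr> \<and>
            (p_group (series_factor G Ns i) p \<or> p'_group (series_factor G Ns i) p))"

definition p_solvable :: "('a,'b) monoid_scheme \<Rightarrow> nat \<Rightarrow> bool" where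
  "p_solvable G p \<longleftrightarrow> (\<exists>Ns m. p_series G p Ns m)"

definition p_length :: "('a,'b) monoid_scheme \<Rightarrow> nat \<Rightarrow> nat" where
  "p_length G p = (LEAST l. \<exists>Ns m. p_series G p Ns m \<and> (\<forall>i\<le>m. Ns i \<lhd> G) \<and>
        l = card {i. i < m \<and> \<not> p'_group (series_factor G Ns i) p})"

end

theory Submission
  imports Defs
begin

text \<open>
  Put \<open>d = p - 2\<close> for odd \<open>p\<close> and \<open>d = 1\<close> for \<open>p = 2\<close>. The key point is that in a \<open>p\<close>-solvable group the
  first \<open>d\<close> terms of an \<open>\<eta>\<close>-series of \<open>P\<close> lie in the preimage \<open>O\<^bsub>p'p\<^esub>(G)\<close> of \<open>O\<^sub>p(G / O\<^bsub>p'\<^esub>(G))\<close>. Dividing by this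
  subgroup and repeating the argument, every block of \<open>d\<close> terms costs one \<open>p\<close>-factor.

  For the key point, dividing by \<open>O\<^bsub>p'\<^esub>(G)\<close> and then by the Frattini subgroup of the \<open>p\<close>-core makes the
  \<open>p\<close>-core \<open>V\<close> elementary abelian and self-centralizing. Suppose that \<open>N\<^sub>j \<subseteq> V\<close> for \<open>j \<le> i < d\<close> and let \<open>M\<close> be the
  next term, or any subgroup between that is powerfully embedded modulo \<open>N\<^sub>i\<close>. The subgroup \<open>M\<^sup>p N\<^sub>i\<close> is of the
  same kind, so it lies in \<open>V\<close> by induction on \<open>|M|\<close>. Let \<open>K\<close> be the preimage of \<open>O\<^bsub>p'\<^esub>(G / V)\<close>. Up to a
  factor in \<open>V\<close> an element \<open>x\<close> of \<open>M\<close> normalizes a complement \<open>Q\<close> of \<open>V\<close> in \<open>K\<close>, and \<open>[V, x] \<subseteq> M\<^sup>p N\<^sub>i\<close> where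
  \<open>M\<^sup>p\<close> is centralized by \<open>Q\<close>. Hence \<open>(x - 1)\<^bsup>p-2\<^esup>\<close> annihilates \<open>[V, Q]\<close>, and a weak form of the Hall-Higman
  Theorem B shows that \<open>x\<close> and \<open>Q\<close> commute on \<open>V\<close>. So \<open>x\<close> centralizes \<open>K / V\<close>, and the Hall-Higman
  centralizer lemma gives \<open>x \<in> V\<close>. For \<open>p = 2\<close> the fourth powers of \<open>M\<close> vanish, so \<open>x\<close> centralizes \<open>V\<close>.
\<close>

section \<open>Fixed points of \<open>p\<close>-groups\<close>

text \<open>The number \<open>p - 2\<close> has a precise source. For \<open>h\<close> in
  \<open>Q\<close>, the sum of \<open>p\<close> consecutive conjugates of \<open>h\<close> by powers
  of \<open>x\<close> is a \<open>(p-1)\<close>-st difference, and each difference trades for a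
  factor \<open>x - 1\<close> to the left or to the right of \<open>h\<close>. If
  \<open>(x-1)^d = 0\<close>, a further \<open>(x-1)^(d-2)\<close> therefore kills this sum as soon
  as \<open>d - 2 + p - 1 \<ge> 2d - 1\<close>, that is \<open>d \<le> p - 2\<close>. So
  \<open>(x-1)^(d-2)\<close> cannot tell the sum of all \<open>Q\<close>-conjugates of
  \<open>x\<close> from a multiple of \<open>x\<close>; and since that sum commutes with
  \<open>Q\<close> and with \<open>x\<close>, its eigenspaces are submodules, which permits an
  induction lowering \<open>d\<close> to 1. No extension of the field and no reduction to
  extraspecial groups occurs. The complement is the kernel of a crossed homomorphism, the transfer,
  and comparing it with its conjugate by \<open>x\<close> yields the factor in \<open>V\<close> that
  corrects \<open>x\<close>. The price is control over the \<open>p\<close>-th power of the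
  corrected element. This is why two degrees of nilpotency are tracked: one on all of
  \<open>V\<close>, bounded by \<open>p - 1\<close>, and one on \<open>[V, Q]\<close>, bounded by
  \<open>p - 2\<close>.\<close>

lemma p_group_moved_points:
  fixes P (structure)
  assumes "group P" "order P = p ^ k" "Factorial_Ring.prime (p::nat)" "finite S"
    and closed: "\<And>g s. g \<in> carrier P \<Longrightarrow> s \<in> S \<Longrightarrow> act g s \<in> S"
    and one: "\<And>s. s \<in> S \<Longrightarrow> act \<one>\<^bsub>P\<^esub> s = s"
    and mult: "\<And>g h s. g \<in> carrier P \<Longrightarrow> h \<in> carrier P \<Longrightarrow> s \<in> S \<Longrightarrow> act (g \<otimes>\<^bsub>P\<^esub> h) s = act g (act h s)"
  shows "p dvd card {s \<in> S. \<exists>g\<in>carrier P. act g s \<noteq> s}"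
proof -
  interpret group P by fact
  define \<phi> where "\<phi> = (\<lambda>g. restrict (act g) S)"
  have bij: "bij_betw (act g) S S" if g: "g \<in> carrier P" for g
  proof (rule bij_betw_byWitness[where f' = "act (inv g)"])
    show "\<forall>s\<in>S. act (inv g) (act g s) = s" using g one mult[of "inv g" g] by simp
    show "\<forall>s\<in>S. act g (act (inv g) s) = s" using g one mult[of g "inv g"] by simp
  qed (use g closed in auto)
  have "\<phi> \<in> hom P (BijGroup S)"
  proof (rule homI)
    show "\<phi> g \<in> carrier (BijGroup S)" if "g \<in> carrier P" for g
      using that bij by (auto simp: \<phi>_def BijGroup_def Bij_def bij_betw_restrict_eq)
    show "\<phi> (g \<otimes> h) = \<phi> g \<otimes>\<^bsub>BijGroup S\<^esub> \<phi> h" if "g \<in> carrier P" "h \<in> carrier P" for g h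
      using that bij mult closed
      by (auto simp: \<phi>_def BijGroup_def Bij_def bij_betw_restrict_eq compose_def)
  qed
  then interpret act: group_action P S \<phi>
    using group_BijGroup group_axioms
    by (intro group_action.intro) (simp add: group_hom_def group_hom_axioms_def)
  \<comment> \<open>Only the orbits of length above one: they cover exactly the moved points, and
    each length is a power of \<open>p\<close> other than 1. Counting moved instead of fixed points
    makes one divisibility serve whether or not \<open>p\<close> divides the size of
    \<open>S\<close>.\<close>
  define C where "C = {c \<in> orbits P S \<phi>. card c \<noteq> 1}"
  have orb: "orbit P \<phi> s = {act g s | g. g \<in> carrier P}" if "s \<in> S" for s
    using that by (auto simp: orbit_def \<phi>_def)
  have orb_self: "s \<in> orbit P \<phi> s" if "s \<in> S" for s
    unfolding orb[OF that] using one[OF that] one_closed by force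
  have "{s \<in> S. \<exists>g\<in>carrier P. act g s \<noteq> s} = \<Union>C"
  proof (intro equalityI subsetI)
    fix s assume "s \<in> {s \<in> S. \<exists>g\<in>carrier P. act g s \<noteq> s}"
    then obtain g where s: "s \<in> S" "g \<in> carrier P" "act g s \<noteq> s" by blast
    have "orbit P \<phi> s \<noteq> {t}" for t
      using s orb_self[OF s(1)] orb[OF s(1)] by (metis (mono_tags, lifting) mem_Collect_eq singletonD)
    then have "orbit P \<phi> s \<in> C" using s(1) by (auto simp: C_def orbits_def card_1_singleton_iff)
    then show "s \<in> \<Union>C" using orb_self[OF s(1)] by blast
  next
    fix s assume "s \<in> \<Union>C"
    then obtain t where t: "t \<in> S" "s \<in> orbit P \<phi> t" "card (orbit P \<phi> t) \<noteq> 1"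
      by (auto simp: C_def orbits_def)
    then have sS: "s \<in> S" using orb closed by auto
    have eq: "orbit P \<phi> s = orbit P \<phi> t"
      using t(1,2) orb_self[OF sS] act.disjoint_union[of "orbit P \<phi> s" "orbit P \<phi> t"] sS
      by (auto simp: orbits_def)
    have "\<exists>g\<in>carrier P. act g s \<noteq> s"
    proof (rule ccontr)
      assume "\<not> ?thesis"
      then have "orbit P \<phi> s = {s}" unfolding orb[OF sS] using one_closed one[OF sS] by (auto intro!: exI[of _ "\<one>"])
      then show False using t(3) eq by simp
    qed
    then show "s \<in> {s \<in> S. \<exists>g\<in>carrier P. act g s \<noteq> s}" using sS by blast
  qed
  moreover have "p dvd card (\<Union>C)"
  proof (rule dvd_partition)
    have "\<Union>C \<subseteq> S" using act.orbits_coverture by (auto simp: C_def)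
    then show "finite (\<Union>C)" using assms(4) finite_subset by blast
    show "\<forall>c\<in>C. p dvd card c"
    proof
      fix c assume "c \<in> C"
      then obtain t where t: "t \<in> S" "c = orbit P \<phi> t" "card c \<noteq> 1"
        by (auto simp: C_def orbits_def)
      have "card c dvd p ^ k"
        using act.orbit_stabilizer_theorem[OF t(1)] assms(2) t(2) by (metis dvd_triv_left)
      then obtain i where "card c = p ^ i" using divides_primepow_nat[OF assms(3)] by auto
      then show "p dvd card c" using t(3) by (cases i) auto
    qed
    show "\<forall>c1\<in>C. \<forall>c2\<in>C. c1 \<noteq> c2 \<longrightarrow> c1 \<inter> c2 = {}"
      using act.disjoint_union by (auto simp: C_def)
  qed
  ultimately show ?thesis by simp
qed

lemma p_group_fixed_point:
  assumes "group P" "order P = p ^ k" "Factorial_Ring.prime (p::nat)" "finite S"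
    and "\<And>g s. g \<in> carrier P \<Longrightarrow> s \<in> S \<Longrightarrow> act g s \<in> S"
    and "\<And>s. s \<in> S \<Longrightarrow> act \<one>\<^bsub>P\<^esub> s = s"
    and "\<And>g h s. g \<in> carrier P \<Longrightarrow> h \<in> carrier P \<Longrightarrow> s \<in> S \<Longrightarrow> act (g \<otimes>\<^bsub>P\<^esub> h) s = act g (act h s)"
    and "\<not> p dvd card S"
  obtains s where "s \<in> S" "\<forall>g\<in>carrier P. act g s = s"
proof -
  have "{s \<in> S. \<exists>g\<in>carrier P. act g s \<noteq> s} \<noteq> S"
    using p_group_moved_points[OF assms(1-7)] assms(8) by metis
  then show ?thesis using that by blast
qed

text \<open>Were \<open>s0\<close> the only fixed point, \<open>p\<close> would divide both
  \<open>card S\<close> and \<open>card S - 1\<close>. In the applications \<open>S\<close> is a set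
  of cosets and \<open>s0\<close> is the subgroup itself.\<close>

lemma p_group_second_fixed_point:
  assumes "group P" "order P = p ^ k" "Factorial_Ring.prime (p::nat)" "finite S"
    and "\<And>g s. g \<in> carrier P \<Longrightarrow> s \<in> S \<Longrightarrow> act g s \<in> S"
    and "\<And>s. s \<in> S \<Longrightarrow> act \<one>\<^bsub>P\<^esub> s = s"
    and "\<And>g h s. g \<in> carrier P \<Longrightarrow> h \<in> carrier P \<Longrightarrow> s \<in> S \<Longrightarrow> act (g \<otimes>\<^bsub>P\<^esub> h) s = act g (act h s)"
    and "p dvd card S" "s0 \<in> S" "\<forall>g\<in>carrier P. act g s0 = s0"
  obtains s where "s \<in> S" "s \<noteq> s0" "\<forall>g\<in>carrier P. act g s = s"
proof -
  let ?M = "{s \<in> S. \<exists>g\<in>carrier P. act g s \<noteq> s}"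
  have "?M \<noteq> S - {s0}"
  proof
    assume "?M = S - {s0}"
    then have "p dvd card S - 1"
      using p_group_moved_points[OF assms(1-7)] assms(4,9) by (simp add: card_Diff_singleton)
    moreover have "card S > 0" using assms(4,9) card_gt_0_iff by blast
    ultimately have "p dvd 1"
      using assms(8) by (metis One_nat_def Suc_pred dvd_diff_nat diff_Suc_Suc diff_zero Suc_diff_1 dvd_diffD1 less_eq_Suc_le)
    then show False using assms(3) by simp
  qed
  then show ?thesis using that assms(10) by blast
qed

section \<open>Quotients as surjections, orders through kernels, subgroups stable under
  conjugation\<close>

lemma (in group) inv_cancel_left:
  "x \<in> carrier G \<Longrightarrow> y \<in> carrier G \<Longrightarrow> inv x \<otimes> (x \<otimes> y) = y"
  "x \<in> carrier G \<Longrightarrow> y \<in> carrier G \<Longrightarrow> x \<otimes> (inv x \<otimes> y) = y"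
  by (simp_all flip: m_assoc)

lemmas (in group) group_normalize = m_assoc inv_mult_group inv_cancel_left

lemma (in group_hom) subgroup_preimage:
  assumes "subgroup C H"
  shows "subgroup {g \<in> carrier G. h g \<in> C} G"
proof (rule G.subgroupI)
  have "\<one> \<in> {g \<in> carrier G. h g \<in> C}" using subgroup.one_closed[OF assms] by simp
  then show "{g \<in> carrier G. h g \<in> C} \<noteq> {}" by blast
qed (use assms in \<open>auto simp: subgroup.m_closed subgroup.m_inv_closed\<close>)

text \<open>All fibres over the image are translates of the part of the kernel in \<open>E\<close>.
  Orders of images, preimages and quotients are computed from this identity, without an isomorphism
  theorem.\<close>

lemma (in group_hom) card_image_mult_kernel:
  assumes E: "subgroup E G" "finite E"
  shows "card E = card (h ` E) * card {x \<in> E. h x = \<one>\<^bsub>H\<^esub>}"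
proof -
  note Ec = subgroup.mem_carrier[OF E(1)]
  have fib: "card {x \<in> E. h x = y} = card {x \<in> E. h x = \<one>\<^bsub>H\<^esub>}" if "y \<in> h ` E" for y
  proof -
    obtain a where a: "a \<in> E" "y = h a" using \<open>y \<in> h ` E\<close> by blast
    have "bij_betw (\<lambda>x. x \<otimes> inv a) {x \<in> E. h x = y} {x \<in> E. h x = \<one>\<^bsub>H\<^esub>}"
      by (rule bij_betw_byWitness[where f' = "\<lambda>x. x \<otimes> a"])
        (use a E(1) Ec in \<open>auto simp: subgroup.m_closed subgroup.m_inv_closed G.m_assoc\<close>)
    then show ?thesis by (rule bij_betw_same_card)
  qed
  have "card E = (\<Sum>x\<in>E. 1)" by simp
  also have "\<dots> = (\<Sum>y\<in>h ` E. \<Sum>x\<in>{x \<in> E. h x = y}. 1)" by (rule sum.image_gen[OF E(2)])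
  also have "\<dots> = (\<Sum>y\<in>h ` E. card {x \<in> E. h x = \<one>\<^bsub>H\<^esub>})" using fib by simp
  finally show ?thesis by simp
qed

lemma (in group_hom) subgroup_kernel_part:
  assumes E: "subgroup E G"
  shows "subgroup {x \<in> E. h x = \<one>\<^bsub>H\<^esub>} G"
proof -
  have "{x \<in> E. h x = \<one>\<^bsub>H\<^esub>} = E \<inter> {g \<in> carrier G. h g \<in> {\<one>\<^bsub>H\<^esub>}}"
    using subgroup.subset[OF E] by auto
  then show ?thesis
    using G.subgroups_Inter_pair[OF E subgroup_preimage[OF H.triv_subgroup]] by simp
qed

lemma (in group_hom) order_image_dvd:
  assumes "finite (carrier G)" "h ` carrier G = carrier H"
  shows "order H dvd order G"
  unfolding order_def assms(2)[symmetric]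
  by (rule dvdI[OF card_image_mult_kernel[OF G.subgroup_self assms(1)]])

text \<open>Hides the cosets: arguments modulo \<open>N\<close> use only a surjection with kernel
  \<open>N\<close>, which keeps iterated quotients manageable.\<close>

lemma (in group) quotient_group_hom:
  assumes "N \<lhd> G"
  obtains Q :: "'a set monoid" and h where "group_hom G Q h" "h ` carrier G = carrier Q"
    "\<And>a. a \<in> carrier G \<Longrightarrow> h a = \<one>\<^bsub>Q\<^esub> \<longleftrightarrow> a \<in> N"
proof -
  interpret N: normal N G by fact
  have "N #> a = N \<longleftrightarrow> a \<in> N" if "a \<in> carrier G" for a
    using that by (meson coset_join1 coset_join2 N.subgroup_axioms N.subset)
  then show ?thesis
    using that[of "G Mod N" "\<lambda>a. N #> a"] N.r_coset_hom_Mod N.factorgroup_is_group group_axioms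
    by (simp add: group_hom_def group_hom_axioms_def carrier_FactGroup)
qed

text \<open>Covers normality in \<open>G\<close>, normality in a subgroup and invariance under a
  Sylow subgroup alike. All operations are those of \<open>G\<close>, so these notions can be
  compared without changing the carrier.\<close>

definition stable_subgroup :: "('a,'b) monoid_scheme \<Rightarrow> 'a set \<Rightarrow> 'a set \<Rightarrow> bool" where
  "stable_subgroup G D Y \<longleftrightarrow> subgroup Y G \<and> (\<forall>d\<in>D. \<forall>x\<in>Y. d \<otimes>\<^bsub>G\<^esub> x \<otimes>\<^bsub>G\<^esub> inv\<^bsub>G\<^esub> d \<in> Y)"

lemma stable_subgroupD:
  "stable_subgroup G D Y \<Longrightarrow> subgroup Y G"
  "stable_subgroup G D Y \<Longrightarrow> d \<in> D \<Longrightarrow> x \<in> Y \<Longrightarrow> d \<otimes>\<^bsub>G\<^esub> x \<otimes>\<^bsub>G\<^esub> inv\<^bsub>G\<^esub> d \<in> Y"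
  unfolding stable_subgroup_def by blast+

lemma (in group) normal_iff_stable: "N \<lhd> G \<longleftrightarrow> stable_subgroup G (carrier G) N"
  unfolding stable_subgroup_def normal_inv_iff by blast

lemma (in group) normal_in_subgroup_iff:
  assumes "subgroup D G"
  shows "N \<lhd> G\<lparr>carrier := D\<rparr> \<longleftrightarrow> N \<subseteq> D \<and> stable_subgroup G D N"
proof -
  have D: "group (G\<lparr>carrier := D\<rparr>)" using assms subgroup_imp_group by blast
  have sub: "subgroup N (G\<lparr>carrier := D\<rparr>) \<longleftrightarrow> N \<subseteq> D \<and> subgroup N G"
    using incl_subgroup[OF assms] subgroup_incl[OF _ assms] subgroup.subset[of N "G\<lparr>carrier := D\<rparr>"] by auto
  show ?thesis
    unfolding group.normal_inv_iff[OF D] sub stable_subgroup_def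
    using m_inv_consistent[OF assms] by auto
qed

lemma (in group) card_subgroup_pos: "subgroup Y G \<Longrightarrow> finite Y \<Longrightarrow> card Y > 0"
  using subgroup.one_closed card_gt_0_iff by blast

lemma (in group) card_cosets_mult:
  assumes "subgroup Y G" "subgroup D G" "D \<subseteq> Y" "finite Y"
  shows "card {D #> x | x. x \<in> Y} * card D = card Y"
proof -
  interpret Y: group "G\<lparr>carrier := Y\<rparr>" using assms subgroup_imp_group by blast
  have "card (rcosets\<^bsub>G\<lparr>carrier := Y\<rparr>\<^esub> D) * card D = order (G\<lparr>carrier := Y\<rparr>)"
    using Y.lagrange[of D] subgroup_incl[OF assms(2,1,3)] assms(4) by simp
  moreover have "rcosets\<^bsub>G\<lparr>carrier := Y\<rparr>\<^esub> D = {D #> x | x. x \<in> Y}"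
    by (auto simp: RCOSETS_def)
  ultimately show ?thesis by (simp add: order_def)
qed

lemma (in group) card_subgroup_dvd:
  assumes "subgroup Y G" "subgroup D G" "D \<subseteq> Y" "finite Y"
  shows "card D dvd card Y"
  unfolding card_cosets_mult[OF assms, symmetric] by simp

text \<open>The cofactor \<open>n\<close> is the index of the kernel part of \<open>D\<close> in
  that of \<open>E\<close>. Thus the index of the image of \<open>D\<close> in the image of
  \<open>E\<close> divides the index of \<open>D\<close> in \<open>E\<close>; the multiplied form
  avoids division.\<close>

lemma (in group_hom) index_image:
  assumes D: "subgroup D G" and E: "subgroup E G" "D \<subseteq> E" "finite E"
  obtains n where "card E * card (h ` D) = card D * card (h ` E) * n"
proof -
  let ?K = "\<lambda>S. {x \<in> S. h x = \<one>\<^bsub>H\<^esub>}"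
  have fin: "finite D" using E finite_subset by blast
  have "card (?K D) dvd card (?K E)"
    by (rule G.card_subgroup_dvd) (use subgroup_kernel_part D E in auto)
  then obtain n where n: "card (?K E) = card (?K D) * n" by blast
  have "card E * card (h ` D) = card D * card (h ` E) * n"
    using card_image_mult_kernel[OF E(1,3)] card_image_mult_kernel[OF D fin] n by (simp add: mult_ac)
  then show ?thesis using that by blast
qed

lemma (in group) rcos_eq_iff:
  assumes "subgroup D G" "x \<in> carrier G" "y \<in> carrier G"
  shows "D #> x = D #> y \<longleftrightarrow> x \<otimes> inv y \<in> D"
proof
  assume "D #> x = D #> y"
  then have "x \<in> D #> y" using rcos_self[OF assms(2,1)] by simp
  then show "x \<otimes> inv y \<in> D" using subgroup.rcos_module[OF assms(1) is_group assms(3,2)] by simp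
next
  assume "x \<otimes> inv y \<in> D"
  then have "x \<in> D #> y" using subgroup.rcos_module[OF assms(1) is_group assms(3,2)] by simp
  then show "D #> x = D #> y" using repr_independence assms by blast
qed

section \<open>Finite p-groups: central steps, growing normalizers, maximal subgroups\<close>

lemma prime_dvd_of_dvd_power:
  assumes "n \<noteq> 1" "n dvd p ^ k" "Factorial_Ring.prime (p::nat)"
  shows "p dvd n"
proof -
  obtain i where "n = p ^ i" using divides_primepow_nat[OF assms(3)] assms(2) by auto
  then show ?thesis using assms(1) by (cases i) auto
qed

text \<open>\<open>P\<close> permutes the cosets of \<open>D\<close> in \<open>Y\<close> by
  conjugation and fixes \<open>D\<close>. Their number is a power of \<open>p\<close> above 1, so
  another coset \<open>D #> x\<close> is fixed, and being fixed means that all commutators of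
  \<open>x\<close> with \<open>P\<close> lie in \<open>D\<close>.\<close>

lemma (in group) p_group_central_step:
  assumes P: "subgroup P G" "card P = p ^ k" and p: "Factorial_Ring.prime (p::nat)"
    and D: "stable_subgroup G P D" and Y: "stable_subgroup G P Y" "finite Y"
    and "D \<subset> Y" and Yp: "card Y = p ^ j"
  obtains x where "x \<in> Y" "x \<notin> D" "\<forall>g\<in>P. x \<otimes> g \<otimes> inv x \<otimes> inv g \<in> D"
proof -
  interpret Ps: group "G\<lparr>carrier := P\<rparr>" using P subgroup_imp_group by blast
  note sD = stable_subgroupD(1)[OF D] and sY = stable_subgroupD(1)[OF Y(1)]
  note Dc = subgroup.mem_carrier[OF sD] and Yc = subgroup.mem_carrier[OF sY] and Pc = subgroup.mem_carrier[OF P(1)]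
  define S where "S = {D #> x | x. x \<in> Y}"
  have im: "(\<lambda>y. g \<otimes> y \<otimes> inv g) ` (D #> x) = D #> (g \<otimes> x \<otimes> inv g)" if g: "g \<in> P" and x: "x \<in> Y" for g x
  proof (intro equalityI subsetI)
    fix y assume "y \<in> (\<lambda>y. g \<otimes> y \<otimes> inv g) ` (D #> x)"
    then obtain d where d: "d \<in> D" "y = g \<otimes> (d \<otimes> x) \<otimes> inv g" by (auto simp: r_coset_def)
    then have "y = (g \<otimes> d \<otimes> inv g) \<otimes> (g \<otimes> x \<otimes> inv g)"
      using g x by (simp add: group_normalize Dc Yc Pc)
    then show "y \<in> D #> (g \<otimes> x \<otimes> inv g)"
      using stable_subgroupD(2)[OF D g d(1)] by (auto simp: r_coset_def)
  next
    fix y assume "y \<in> D #> (g \<otimes> x \<otimes> inv g)"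
    then obtain d where d: "d \<in> D" "y = d \<otimes> (g \<otimes> x \<otimes> inv g)" by (auto simp: r_coset_def)
    have "inv g \<otimes> d \<otimes> g \<in> D"
      using stable_subgroupD(2)[OF D _ d(1), of "inv g"] g P(1) by (simp add: subgroup.m_inv_closed Pc)
    moreover have "y = g \<otimes> ((inv g \<otimes> d \<otimes> g) \<otimes> x) \<otimes> inv g"
      using d g x by (simp add: group_normalize Dc Yc Pc)
    ultimately show "y \<in> (\<lambda>y. g \<otimes> y \<otimes> inv g) ` (D #> x)" by (auto simp: r_coset_def)
  qed
  have mult: "card S * card D = card Y"
    unfolding S_def using card_cosets_mult[OF sY sD] assms by blast
  have "card S \<noteq> 1" using mult psubset_card_mono[OF Y(2) assms(7)] by auto
  moreover have "card S dvd p ^ j" using mult Yp by (metis dvd_triv_left)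
  ultimately have pS: "p dvd card S" using p by (rule prime_dvd_of_dvd_power)
  have "D = D #> \<one>" using coset_mult_one[OF subgroup.subset[OF sD]] by simp
  then have oneD: "D \<in> S" unfolding S_def using subgroup.one_closed[OF sY] by blast
  obtain c where c: "c \<in> S" "c \<noteq> D" "\<forall>g\<in>carrier (G\<lparr>carrier := P\<rparr>). (\<lambda>y. g \<otimes> y \<otimes> inv g) ` c = c"
  proof (rule p_group_second_fixed_point[of "G\<lparr>carrier := P\<rparr>" p k S "\<lambda>g c. (\<lambda>y. g \<otimes> y \<otimes> inv g) ` c" D])
    show "finite S" unfolding S_def using Y(2) by simp
    show "(\<lambda>y. g \<otimes> y \<otimes> inv g) ` c \<in> S" if "g \<in> carrier (G\<lparr>carrier := P\<rparr>)" "c \<in> S" for g c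
      using that im stable_subgroupD(2)[OF Y(1)] by (fastforce simp: S_def)
    show "(\<lambda>y. \<one>\<^bsub>G\<lparr>carrier := P\<rparr>\<^esub> \<otimes> y \<otimes> inv \<one>\<^bsub>G\<lparr>carrier := P\<rparr>\<^esub>) ` c = c" if "c \<in> S" for c
      using that im[of \<one>] subgroup.one_closed[OF P(1)] by (auto simp: S_def Yc)
    show "(\<lambda>y. (g \<otimes>\<^bsub>G\<lparr>carrier := P\<rparr>\<^esub> h) \<otimes> y \<otimes> inv (g \<otimes>\<^bsub>G\<lparr>carrier := P\<rparr>\<^esub> h)) ` c
        = (\<lambda>y. g \<otimes> y \<otimes> inv g) ` (\<lambda>y. h \<otimes> y \<otimes> inv h) ` c"
      if "g \<in> carrier (G\<lparr>carrier := P\<rparr>)" "h \<in> carrier (G\<lparr>carrier := P\<rparr>)" "c \<in> S" for g h c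
      unfolding image_image
    proof (rule image_cong)
      fix y assume "y \<in> c"
      then have "y \<in> carrier G" using that(3) Yc Dc by (auto simp: S_def r_coset_def)
      then show "g \<otimes>\<^bsub>G\<lparr>carrier := P\<rparr>\<^esub> h \<otimes> y \<otimes> inv (g \<otimes>\<^bsub>G\<lparr>carrier := P\<rparr>\<^esub> h) = g \<otimes> (h \<otimes> y \<otimes> inv h) \<otimes> inv g"
        using that by (simp add: group_normalize Pc)
    qed simp
    show "\<forall>g\<in>carrier (G\<lparr>carrier := P\<rparr>). (\<lambda>y. g \<otimes> y \<otimes> inv g) ` D = D"
      using im[of _ \<one>] subgroup.one_closed[OF sY] subgroup.subset[OF sD] by (simp add: Pc)
  qed (use P p pS oneD Ps.group_axioms in \<open>auto simp: order_def\<close>)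
  then obtain x where x: "x \<in> Y" "c = D #> x" by (auto simp: S_def)
  have "x \<notin> D" using c(2) x(2) coset_join2[OF _ sD] Dc by blast
  moreover have "x \<otimes> g \<otimes> inv x \<otimes> inv g \<in> D" if g: "g \<in> P" for g
  proof -
    have "D #> x = D #> (g \<otimes> x \<otimes> inv g)" using c(3) g im[OF g x(1)] x(2) by simp
    then have "x \<otimes> inv (g \<otimes> x \<otimes> inv g) \<in> D" using rcos_eq_iff[OF sD] g x by (simp add: Pc Yc)
    then show ?thesis using g x by (simp add: group_normalize Pc Yc)
  qed
  ultimately show ?thesis using that x(1) by blast
qed

text \<open>The same count with \<open>A\<close> acting on its own cosets: a fixed coset
  \<open>A #> x\<close> other than \<open>A\<close> gives an \<open>x\<close> outside
  \<open>A\<close> that conjugates \<open>A\<close> into itself.\<close>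

lemma (in group) p_group_normalizer_grows:
  assumes A: "subgroup A G" "A \<subset> carrier G" and fin: "finite (carrier G)"
    and p: "Factorial_Ring.prime (p::nat)" "order G = p ^ k"
  obtains x where "x \<in> carrier G" "x \<notin> A" "\<forall>a\<in>A. x \<otimes> a \<otimes> inv x \<in> A"
proof -
  note Ac = subgroup.mem_carrier[OF A(1)]
  have cG: "card (carrier G) = p ^ k" using p(2) by (simp add: order_def)
  have mult: "card (rcosets A) * card A = p ^ k" using lagrange[OF A(1)] p(2) by simp
  have "card (rcosets A) \<noteq> 1" using mult cG psubset_card_mono[OF fin A(2)] by auto
  moreover have "card (rcosets A) dvd p ^ k" using mult by (metis dvd_triv_left)
  ultimately have pS: "p dvd card (rcosets A)" using p(1) by (rule prime_dvd_of_dvd_power)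
  have "card A dvd p ^ k" using mult by (metis dvd_triv_right)
  then obtain i where i: "card A = p ^ i" using divides_primepow_nat[OF p(1)] by auto
  \<comment> \<open>The inverse turns right multiplication into a left action.\<close>
  obtain c where c: "c \<in> rcosets A" "c \<noteq> A" "\<forall>g\<in>carrier (G\<lparr>carrier := A\<rparr>). c #> inv g = c"
  proof (rule p_group_second_fixed_point[of "G\<lparr>carrier := A\<rparr>" p i "rcosets A" "\<lambda>g c. c #> inv g" A])
    show "finite (rcosets A)" using fin A(1)
      by (simp add: RCOSETS_def)
    show "c #> inv g \<in> rcosets A" if "g \<in> carrier (G\<lparr>carrier := A\<rparr>)" "c \<in> rcosets A" for g c
      using that Ac subgroup.subset[OF A(1)] by (auto simp: RCOSETS_def coset_mult_assoc)
    show "c #> inv \<one>\<^bsub>G\<lparr>carrier := A\<rparr>\<^esub> = c" if "c \<in> rcosets A" for c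
      using that subgroup.subset[OF A(1)] r_coset_subset_G by (auto simp: RCOSETS_def)
    show "c #> inv (g \<otimes>\<^bsub>G\<lparr>carrier := A\<rparr>\<^esub> h) = c #> inv h #> inv g"
      if "g \<in> carrier (G\<lparr>carrier := A\<rparr>)" "h \<in> carrier (G\<lparr>carrier := A\<rparr>)" "c \<in> rcosets A" for g h c
      using that Ac subgroup.subset[OF A(1)] r_coset_subset_G
      by (auto simp: RCOSETS_def coset_mult_assoc inv_mult_group m_assoc)
    show "A \<in> rcosets A" using A(1) subgroup.subgroup_in_rcosets by blast
    show "\<forall>g\<in>carrier (G\<lparr>carrier := A\<rparr>). A #> inv g = A"
      using A(1) Ac coset_join2 subgroup.m_inv_closed by fastforce
  qed (use p i pS subgroup_imp_group[OF A(1)] in \<open>auto simp: order_def\<close>)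
  then obtain x where x: "x \<in> carrier G" "c = A #> x" by (auto simp: RCOSETS_def)
  have "x \<notin> A" using c(2) x(2) coset_join2[OF _ A(1)] Ac by blast
  moreover have "x \<otimes> a \<otimes> inv x \<in> A" if a: "a \<in> A" for a
  proof -
    have "A #> x = A #> (x \<otimes> inv a)"
      using c(3) a x subgroup.subset[OF A(1)] by (simp add: Ac coset_mult_assoc)
    then have "x \<otimes> inv (x \<otimes> inv a) \<in> A" using rcos_eq_iff[OF A(1)] a x by (simp add: Ac)
    then show ?thesis using a x by (simp add: group_normalize Ac)
  qed
  ultimately show ?thesis using that x(1) by blast
qed

text \<open>Every nontrivial element generates the whole group. If \<open>x [^] p\<close> were
  nontrivial, \<open>x\<close> would be a power of it, so the order of \<open>x\<close>, a multiple
  of \<open>p\<close>, would divide some \<open>p * i - 1\<close>.\<close>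

lemma (in group) simple_p_group:
  assumes fin: "finite (carrier G)" and p: "Factorial_Ring.prime (p::nat)" "order G = p ^ k"
    and simple: "\<And>B. subgroup B G \<Longrightarrow> B = {\<one>} \<or> B = carrier G"
    and x: "x \<in> carrier G" and y: "y \<in> carrier G"
  shows "x [^] p = \<one>" and "x \<otimes> y = y \<otimes> x"
proof -
  have gen: "generate G {w} = carrier G" if "w \<in> carrier G" "w \<noteq> \<one>" for w
    using simple[of "generate G {w}"] generate_is_subgroup[of "{w}"] that
    by (metis empty_subsetI generate.incl insertI1 insert_subset singletonD)
  show "x [^] p = \<one>"
  proof (rule ccontr)
    assume np: "x [^] p \<noteq> \<one>"
    then have "generate G {x [^] p} = carrier G" using gen x by simp
    then obtain i :: int where "x = (x [^] p) [^] i" using x generate_pow[of "x [^] p"] by auto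
    then have "x [^] (int p * i) = x [^] (1::int)"
      using x by (metis int_pow_1 int_pow_int int_pow_pow)
    then have "x [^] (int p * i - 1) = \<one>" using x by (simp add: int_pow_diff)
    then have d: "int (ord x) dvd int p * i - 1" using int_pow_eq_id x by blast
    have "ord x dvd p ^ k" using ord_dvd_group_order[OF x] p(2) by simp
    then obtain j where j: "ord x = p ^ j" using divides_primepow_nat[OF p(1)] by auto
    have "j \<noteq> 0" using j x ord_eq_1[OF x] np by auto
    then have "int p dvd int (ord x)" using j by (simp add: dvd_power)
    then have "int p dvd int p * i - 1" using d dvd_trans by blast
    then have "int p dvd 1" by (metis dvd_diff_right_iff dvd_triv_left)
    then show False using p(1) by simp
  qed
  show "x \<otimes> y = y \<otimes> x"
  proof (cases "x = \<one>")
    case False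
    then obtain i :: int where i: "y = x [^] i" using y gen[OF x False] generate_pow[OF x] by auto
    have "x [^] (1::int) \<otimes> x [^] i = x [^] i \<otimes> x [^] (1::int)"
      using x by (simp only: int_pow_mult[symmetric] add.commute)
    then show ?thesis using x i by simp
  qed (use y in simp)
qed

text \<open>A maximal subgroup above \<open>A\<close> is strictly smaller than its normalizer, so it
  is normal; the quotient has no proper nontrivial subgroups, hence is abelian of exponent
  \<open>p\<close>. The non-generator property of the Frattini subgroup rests on this.\<close>

lemma (in group) p_group_proper_subgroup:
  assumes fin: "finite (carrier G)" and p: "Factorial_Ring.prime (p::nat)" "order G = p ^ k"
    and A: "subgroup A G" "A \<subset> carrier G"
  obtains D where "subgroup D G" "A \<subseteq> D" "D \<subset> carrier G" "\<forall>x\<in>carrier G. x [^] p \<in> D"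
    "\<forall>x\<in>carrier G. \<forall>y\<in>carrier G. x \<otimes> y \<otimes> inv x \<otimes> inv y \<in> D"
proof -
  define \<C> where "\<C> = {D. subgroup D G \<and> A \<subseteq> D \<and> D \<subset> carrier G}"
  have "\<C> \<subseteq> Pow (carrier G)" by (auto simp: \<C>_def)
  then have fC: "finite \<C>" using fin finite_subset by blast
  have "A \<in> \<C>" using A by (simp add: \<C>_def)
  then obtain M where M: "M \<in> \<C>" "\<And>D. D \<in> \<C> \<Longrightarrow> M \<subseteq> D \<Longrightarrow> D = M"
    using finite_has_maximal2[OF fC] by metis
  then have sM: "subgroup M G" "M \<subset> carrier G" by (auto simp: \<C>_def)
  note Mc = subgroup.mem_carrier[OF sM(1)]
  have max: "B = M \<or> B = carrier G" if "subgroup B G" "M \<subseteq> B" for B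
    using M that subgroup.subset[OF that(1)] by (auto simp: \<C>_def)
  obtain x where x: "x \<in> carrier G" "x \<notin> M" "\<forall>a\<in>M. x \<otimes> a \<otimes> inv x \<in> M"
    using p_group_normalizer_grows[OF sM fin p] by blast
  \<comment> \<open>The normalizer of \<open>M\<close>. By finiteness, conjugating \<open>M\<close>
    into itself is enough to belong to it (\<open>BI\<close>).\<close>
  define B where "B = {g \<in> carrier G. (\<lambda>a. g \<otimes> a \<otimes> inv g) ` M = M}"
  have BI: "g \<in> B" if g: "g \<in> carrier G" and "\<forall>a\<in>M. g \<otimes> a \<otimes> inv g \<in> M" for g
  proof -
    have "inj_on (\<lambda>a. g \<otimes> a \<otimes> inv g) M" using g by (auto simp: inj_on_def Mc)
    then have "(\<lambda>a. g \<otimes> a \<otimes> inv g) ` M = M"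
      using that(2) finite_subset[OF subgroup.subset[OF sM(1)] fin] by (simp add: endo_inj_surj image_subset_iff)
    then show ?thesis using g by (simp add: B_def)
  qed
  have "subgroup B G"
  proof (rule subgroupI)
    show "B \<subseteq> carrier G" by (auto simp: B_def)
    show "B \<noteq> {}" using BI x by blast
    show "inv g \<in> B" if g: "g \<in> B" for g
    proof (rule BI)
      show "\<forall>a\<in>M. inv g \<otimes> a \<otimes> inv (inv g) \<in> M"
      proof
        fix a assume "a \<in> M"
        then obtain b where b: "b \<in> M" "a = g \<otimes> b \<otimes> inv g" using g by (auto simp: B_def)
        then show "inv g \<otimes> a \<otimes> inv (inv g) \<in> M" using g by (simp add: B_def group_normalize Mc)
      qed
    qed (use g in \<open>simp add: B_def\<close>)
    show "g \<otimes> h \<in> B" if g: "g \<in> B" and h: "h \<in> B" for g h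
    proof (rule BI)
      show "\<forall>a\<in>M. g \<otimes> h \<otimes> a \<otimes> inv (g \<otimes> h) \<in> M"
      proof
        fix a assume a: "a \<in> M"
        then have "g \<otimes> (h \<otimes> a \<otimes> inv h) \<otimes> inv g \<in> M" using g h unfolding B_def by blast
        then show "g \<otimes> h \<otimes> a \<otimes> inv (g \<otimes> h) \<in> M" using g h a by (simp add: B_def group_normalize Mc)
      qed
    qed (use g h in \<open>simp add: B_def\<close>)
  qed
  moreover have "M \<subseteq> B" using BI Mc sM(1) by (meson subgroup.m_closed subgroup.m_inv_closed subsetI)
  moreover have "B \<noteq> M" using BI x by blast
  ultimately have "B = carrier G" using max by blast
  then interpret M: normal M G using sM(1) by (auto simp: normal_inv_iff B_def)
  have nM: "M \<lhd> G" using M.normal_axioms .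
  obtain Q :: "'a set monoid" and h where q: "group_hom G Q h" and sur: "h ` carrier G = carrier Q"
    and ker: "\<And>a. a \<in> carrier G \<Longrightarrow> h a = \<one>\<^bsub>Q\<^esub> \<longleftrightarrow> a \<in> M" using quotient_group_hom[OF nM] by blast
  interpret q: group_hom G Q h by (rule q)
  have fq: "finite (carrier Q)" using fin sur by (metis finite_imageI)
  have "order Q dvd p ^ k" using q.order_image_dvd sur fin p(2) by simp
  then obtain j where j: "order Q = p ^ j" using divides_primepow_nat[OF p(1)] by auto
  have simple: "C = {\<one>\<^bsub>Q\<^esub>} \<or> C = carrier Q" if C: "subgroup C Q" for C
  proof -
    define E where "E = {g \<in> carrier G. h g \<in> C}"
    have "subgroup E G" unfolding E_def by (rule q.subgroup_preimage[OF C])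
    moreover have "M \<subseteq> E"
    proof
      fix a assume a: "a \<in> M"
      then have "h a = \<one>\<^bsub>Q\<^esub>" using ker Mc by blast
      then show "a \<in> E" using a Mc subgroup.one_closed[OF C] by (simp add: E_def)
    qed
    ultimately consider "E = M" | "E = carrier G" using max by blast
    then show ?thesis
    proof cases
      case 1
      have "C \<subseteq> {\<one>\<^bsub>Q\<^esub>}"
      proof
        fix c assume c: "c \<in> C"
        then obtain g where g: "g \<in> carrier G" "c = h g"
          using subgroup.mem_carrier[OF C c] sur by auto
        then have "g \<in> M" using 1 c by (auto simp: E_def)
        then show "c \<in> {\<one>\<^bsub>Q\<^esub>}" using g ker by simp
      qed
      then show ?thesis using subgroup.one_closed[OF C] by auto
    next
      case 2
      then have "carrier Q \<subseteq> C" unfolding sur[symmetric] E_def by blast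
      then show ?thesis using subgroup.subset[OF C] by blast
    qed
  qed
  note S = q.H.simple_p_group[OF fq p(1) j simple]
  have "x [^] p \<in> M" if "x \<in> carrier G" for x
    using S(1)[of "h x" "h x"] q.hom_nat_pow[OF that, of p] ker[of "x [^] p"] that by simp
  moreover have "x \<otimes> y \<otimes> inv x \<otimes> inv y \<in> M" if xy: "x \<in> carrier G" "y \<in> carrier G" for x y
  proof -
    have "h x \<otimes>\<^bsub>Q\<^esub> h y = h y \<otimes>\<^bsub>Q\<^esub> h x" using S(2)[of "h x" "h y"] xy by simp
    then have "h (x \<otimes> y) \<otimes>\<^bsub>Q\<^esub> inv\<^bsub>Q\<^esub> h (y \<otimes> x) = \<one>\<^bsub>Q\<^esub>"
      using xy by (metis q.hom_mult q.hom_closed q.H.r_inv m_closed)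
    then have 1: "h (x \<otimes> y \<otimes> inv (y \<otimes> x)) = \<one>\<^bsub>Q\<^esub>" using xy by simp
    have "x \<otimes> y \<otimes> inv (y \<otimes> x) \<in> carrier G" using xy by simp
    from ker[OF this] 1 have "x \<otimes> y \<otimes> inv (y \<otimes> x) \<in> M" by (rule iffD1)
    then show ?thesis using xy by (simp add: group_normalize)
  qed
  ultimately show ?thesis using that[of M] sM M(1) by (auto simp: \<C>_def)
qed

section \<open>Crossed homomorphisms into an abelian normal subgroup\<close>

lemma (in comm_group) hom_finprod:
  assumes "h \<in> hom G G" "f \<in> A \<rightarrow> carrier G"
  shows "h (finprod G f A) = finprod G (\<lambda>a. h (f a)) A"
  using assms(2)
proof (induction A rule: infinite_finite_induct)
  case (insert a A)
  then have "finprod G f A \<in> carrier G" "f a \<in> carrier G" by auto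
  moreover have "(\<lambda>a. h (f a)) \<in> A \<rightarrow> carrier G" "h (f a) \<in> carrier G"
    using insert.prems hom_in_carrier[OF assms(1)] by auto
  ultimately show ?case using insert hom_mult[OF assms(1)] by simp
qed (use hom_one[OF assms(1)] is_group in auto)

text \<open>A 1-cocycle for the conjugation action of \<open>E\<close> on \<open>V\<close>, pinned
  down on \<open>V\<close> as the \<open>n\<close>-th power map. If \<open>n\<close> is prime to the
  order of an abelian \<open>V\<close>, this restriction is bijective, and the elements sent to the
  identity form a complement of \<open>V\<close> in \<open>E\<close>.\<close>

definition crossed_power_hom :: "('a,'b) monoid_scheme \<Rightarrow> 'a set \<Rightarrow> 'a set \<Rightarrow> nat \<Rightarrow> ('a \<Rightarrow> 'a) \<Rightarrow> bool" where
  "crossed_power_hom G V E n F \<longleftrightarrow> (\<forall>a\<in>E. F a \<in> V)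
    \<and> (\<forall>a\<in>E. \<forall>b\<in>E. F (a \<otimes>\<^bsub>G\<^esub> b) = F a \<otimes>\<^bsub>G\<^esub> (a \<otimes>\<^bsub>G\<^esub> F b \<otimes>\<^bsub>G\<^esub> inv\<^bsub>G\<^esub> a)) \<and> (\<forall>v\<in>V. F v = v [^]\<^bsub>G\<^esub> n)"

locale abelian_normal_pair = group +
  fixes V E
  assumes V: "subgroup V G" and E: "subgroup E G" and VE: "V \<subseteq> E" and finE: "finite E"
    and comm: "\<And>u v. u \<in> V \<Longrightarrow> v \<in> V \<Longrightarrow> u \<otimes> v = v \<otimes> u"
    and conj: "\<And>a v. a \<in> E \<Longrightarrow> v \<in> V \<Longrightarrow> a \<otimes> v \<otimes> inv a \<in> V"
begin

abbreviation "GV \<equiv> G\<lparr>carrier := V\<rparr>"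
abbreviation "n \<equiv> card E div card V"

lemma Vc: "v \<in> V \<Longrightarrow> v \<in> carrier G" using subgroup.mem_carrier[OF V] .
lemma Ec: "a \<in> E \<Longrightarrow> a \<in> carrier G" using subgroup.mem_carrier[OF E] .

lemmas E_mult = subgroup.m_closed[OF E] and E_inv = subgroup.m_inv_closed[OF E]
  and V_mult = subgroup.m_closed[OF V] and V_inv = subgroup.m_inv_closed[OF V]

lemma V_comm_group: "comm_group GV"
  using V comm subgroup_imp_group by (intro group.group_comm_groupI) auto

lemma conj_hom: "a \<in> E \<Longrightarrow> (\<lambda>v. a \<otimes> v \<otimes> inv a) \<in> hom GV GV"
  using conj by (intro homI) (auto simp: group_normalize Vc Ec)

lemma V_pow: "v \<in> V \<Longrightarrow> v [^] (k::nat) \<in> V"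
  by (induction k) (simp_all add: V_mult subgroup.one_closed[OF V])

lemma conj_pow: "a \<in> E \<Longrightarrow> v \<in> V \<Longrightarrow> a \<otimes> v [^] (k::nat) \<otimes> inv a = (a \<otimes> v \<otimes> inv a) [^] k"
proof (induction k)
  case (Suc k)
  have "a \<otimes> v [^] Suc k \<otimes> inv a = (a \<otimes> v [^] k \<otimes> inv a) \<otimes> (a \<otimes> v \<otimes> inv a)"
    using Suc.prems by (simp add: Vc Ec group_normalize V_pow)
  then show ?case using Suc by simp
qed (simp add: Ec)

definition cosets where "cosets = {V #> a | a. a \<in> E}"
definition rep where "rep c = (SOME a. a \<in> E \<and> c = V #> a)"
text \<open>Left multiplication on right cosets; it does not depend on the representative because
  \<open>E\<close> normalizes \<open>V\<close> (\<open>shift_coset\<close>).\<close>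

definition shift where "shift a c = V #> (a \<otimes> rep c)"

lemma rep: assumes "c \<in> cosets" shows "rep c \<in> E" "V #> rep c = c"
proof -
  have "\<exists>a. a \<in> E \<and> c = V #> a" using assms by (auto simp: cosets_def)
  from someI_ex[OF this] show "rep c \<in> E" "V #> rep c = c" by (auto simp: rep_def)
qed

lemma coset_in: "a \<in> E \<Longrightarrow> V #> a \<in> cosets" by (auto simp: cosets_def)

lemma rep_coset: "a \<in> E \<Longrightarrow> rep (V #> a) \<otimes> inv a \<in> V"
  using rep[of "V #> a"] rcos_eq_iff[OF V, of "rep (V #> a)" a] Ec by (auto simp: cosets_def)

lemma card_cosets: "card cosets = n"
proof -
  have "card cosets * card V = card E"
    unfolding cosets_def by (rule card_cosets_mult[OF E V VE finE])
  moreover have "card V > 0" using card_subgroup_pos[OF V] finE VE finite_subset by blast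
  ultimately show ?thesis by (metis div_mult_self_is_m)
qed

lemma shift_coset: assumes "a \<in> E" "b \<in> E" shows "shift a (V #> b) = V #> (a \<otimes> b)"
proof -
  have "a \<otimes> (rep (V #> b) \<otimes> inv b) \<otimes> inv a \<in> V" using rep_coset conj assms by blast
  moreover have "a \<otimes> (rep (V #> b) \<otimes> inv b) \<otimes> inv a = (a \<otimes> rep (V #> b)) \<otimes> inv (a \<otimes> b)"
    using assms rep(1)[OF coset_in[OF assms(2)]] by (simp add: Ec group_normalize)
  ultimately show ?thesis
    unfolding shift_def using rcos_eq_iff[OF V] assms rep(1)[OF coset_in[OF assms(2)]] by (simp add: Ec)
qed

lemma shift_closed: "a \<in> E \<Longrightarrow> c \<in> cosets \<Longrightarrow> shift a c \<in> cosets"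
  unfolding shift_def by (intro coset_in E_mult rep(1))

lemma shift_mult: "a \<in> E \<Longrightarrow> b \<in> E \<Longrightarrow> c \<in> cosets \<Longrightarrow> shift (a \<otimes> b) c = shift a (shift b c)"
  unfolding shift_def[of b c] shift_def[of "a \<otimes> b" c]
  by (simp add: shift_coset E_mult rep(1) m_assoc Ec)

lemma shift_V: assumes "v \<in> V" "c \<in> cosets" shows "shift v c = c"
proof -
  have "V #> (v \<otimes> rep c) = V #> rep c"
    using rcos_eq_iff[OF V, of "v \<otimes> rep c" "rep c"] assms rep(1)[of c] by (simp add: Vc Ec m_assoc)
  then show ?thesis using rep assms by (simp add: shift_def)
qed

lemma shift_bij: assumes "a \<in> E" shows "bij_betw (shift a) cosets cosets"
proof (rule bij_betw_byWitness[where f' = "shift (inv a)"])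
  have i: "inv a \<in> E" using assms by (rule E_inv)
  have 1: "shift \<one> c = c" if "c \<in> cosets" for c using shift_V[OF _ that] subgroup.one_closed[OF V] by blast
  show "\<forall>c\<in>cosets. shift (inv a) (shift a c) = c"
    using shift_mult[OF i assms, symmetric] 1 Ec[OF assms] by simp
  show "\<forall>c\<in>cosets. shift a (shift (inv a) c) = c"
    using shift_mult[OF assms i, symmetric] 1 Ec[OF assms] by simp
  show "shift a ` cosets \<subseteq> cosets" using shift_closed[OF assms] by blast
  show "shift (inv a) ` cosets \<subseteq> cosets" using shift_closed[OF i] by blast
qed

text \<open>The transfer of \<open>E\<close> into \<open>V\<close>, only a crossed homomorphism since \<open>V\<close> need not be central.\<close>
definition transfer where
  "transfer a = finprod GV (\<lambda>c. a \<otimes> rep c \<otimes> inv (rep (shift a c))) cosets"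

lemma transfer_factor: assumes "a \<in> E" "c \<in> cosets"
  shows "a \<otimes> rep c \<otimes> inv (rep (shift a c)) \<in> V"
proof -
  have ar: "a \<otimes> rep c \<in> E" using assms by (intro E_mult rep(1))
  then have "inv (rep (V #> (a \<otimes> rep c)) \<otimes> inv (a \<otimes> rep c)) \<in> V"
    by (intro V_inv rep_coset)
  moreover have "rep (V #> (a \<otimes> rep c)) \<in> E" using rep(1)[OF coset_in[OF ar]] .
  ultimately show ?thesis using ar assms rep(1) unfolding shift_def by (simp add: group_normalize Ec)
qed

lemma finprod_const_V: "v \<in> V \<Longrightarrow> finprod GV (\<lambda>c. v) cosets = v [^] n"
  using comm_group.axioms(1)[OF V_comm_group, THEN comm_monoid.finprod_const, of v cosets] card_cosets nat_pow_consistent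
  by simp

text \<open>Inserting \<open>rep (shift b c)\<close> splits the factor of
  \<open>a \<otimes> b\<close> at \<open>c\<close> into the factor of \<open>a\<close> at
  \<open>shift b c\<close> and the \<open>a\<close>-conjugate of the factor of \<open>b\<close> at
  \<open>c\<close>; the first kind is then reindexed by the permutation \<open>shift b\<close>. For
  an element \<open>v\<close> of \<open>V\<close> nothing is shifted and all \<open>n\<close>
  factors equal \<open>v\<close>.\<close>

lemma crossed_transfer: "crossed_power_hom G V E n transfer"
  unfolding crossed_power_hom_def
proof (intro conjI ballI)
  interpret GV: comm_group GV by (rule V_comm_group)
  let ?f = "\<lambda>a c. a \<otimes> rep c \<otimes> inv (rep (shift a c))"
  have fV: "?f a \<in> cosets \<rightarrow> carrier GV" if "a \<in> E" for a using transfer_factor that by simp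
  show "transfer a \<in> V" if "a \<in> E" for a
    using GV.finprod_closed[OF fV[OF that]] by (simp add: transfer_def)
  show "transfer v = v [^] n" if "v \<in> V" for v
  proof -
    have "transfer v = finprod GV (\<lambda>c. v) cosets"
      unfolding transfer_def
      by (rule GV.finprod_cong') (use that shift_V rep VE in \<open>auto simp: Vc Ec m_assoc\<close>)
    then show ?thesis using finprod_const_V that by simp
  qed
  show "transfer (a \<otimes> b) = transfer a \<otimes> (a \<otimes> transfer b \<otimes> inv a)" if a: "a \<in> E" and b: "b \<in> E" for a b
  proof -
    have ab: "a \<otimes> b \<in> E" using a b by (rule E_mult)
    have fb: "(\<lambda>c. ?f a (shift b c)) \<in> cosets \<rightarrow> carrier GV"
      using transfer_factor[OF a] shift_closed[OF b] by simp
    have cb: "(\<lambda>c. a \<otimes> ?f b c \<otimes> inv a) \<in> cosets \<rightarrow> carrier GV"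
      using transfer_factor[OF b] conj[OF a] by simp
    have "transfer (a \<otimes> b) = finprod GV (\<lambda>c. ?f a (shift b c) \<otimes>\<^bsub>GV\<^esub> (a \<otimes> ?f b c \<otimes> inv a)) cosets"
      unfolding transfer_def
    proof (rule GV.finprod_cong')
      fix c assume c: "c \<in> cosets"
      note r = Ec[OF rep(1)[OF c]] Ec[OF rep(1)[OF shift_closed[OF b c]]]
        Ec[OF rep(1)[OF shift_closed[OF a shift_closed[OF b c]]]]
      have "?f (a \<otimes> b) c = a \<otimes> ?f b c \<otimes> inv a \<otimes> ?f a (shift b c)"
        using r a b shift_mult[OF a b c] by (simp add: group_normalize Ec)
      also have "\<dots> = ?f a (shift b c) \<otimes> (a \<otimes> ?f b c \<otimes> inv a)"
        using comm transfer_factor[OF a shift_closed[OF b c]] conj[OF a transfer_factor[OF b c]] by blast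
      finally show "?f (a \<otimes> b) c = ?f a (shift b c) \<otimes>\<^bsub>GV\<^esub> (a \<otimes> ?f b c \<otimes> inv a)" by simp
    next
      show "(\<lambda>c. ?f a (shift b c) \<otimes>\<^bsub>GV\<^esub> (a \<otimes> ?f b c \<otimes> inv a)) \<in> cosets \<rightarrow> carrier GV"
        using fb cb GV.m_closed by blast
    qed simp
    also have "\<dots> = finprod GV (\<lambda>c. ?f a (shift b c)) cosets \<otimes>\<^bsub>GV\<^esub> finprod GV (\<lambda>c. a \<otimes> ?f b c \<otimes> inv a) cosets"
      by (rule GV.finprod_multf[OF fb cb])
    also have "finprod GV (\<lambda>c. ?f a (shift b c)) cosets = transfer a"
      using GV.finprod_reindex[of "?f a" "shift b" cosets] shift_bij[OF b] fV[OF a]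
      unfolding transfer_def bij_betw_def by simp
    also have "finprod GV (\<lambda>c. a \<otimes> ?f b c \<otimes> inv a) cosets = a \<otimes> transfer b \<otimes> inv a"
      using GV.hom_finprod[OF conj_hom[OF a] fV[OF b]] unfolding transfer_def by simp
    finally show ?thesis by simp
  qed
qed

text \<open>The quotient of two such maps is a cocycle that is trivial on \<open>V\<close>, hence
  lives on \<open>E / V\<close>. Multiplying the cocycle law over all cosets shows that its
  \<open>n\<close>-th power is a coboundary: the index annihilates the first cohomology.\<close>

lemma crossed_power_hom_diff:
  assumes F1: "crossed_power_hom G V E n F1" and F2: "crossed_power_hom G V E n F2"
  obtains w where "w \<in> V" "\<forall>a\<in>E. (F1 a \<otimes> inv (F2 a)) [^] n = w \<otimes> (a \<otimes> inv w \<otimes> inv a)"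
proof -
  interpret GV: comm_group GV by (rule V_comm_group)
  define \<delta> where "\<delta> = (\<lambda>a. F1 a \<otimes> inv (F2 a))"
  have \<delta>V: "\<delta> a \<in> V" if "a \<in> E" for a
    using that F1 F2 unfolding \<delta>_def crossed_power_hom_def by (blast intro: V_mult V_inv)
  have \<delta>1: "\<delta> v = \<one>" if "v \<in> V" for v
    using that F1 F2 by (simp add: \<delta>_def crossed_power_hom_def Vc)
  have \<delta>m: "\<delta> (a \<otimes> b) = \<delta> a \<otimes> (a \<otimes> \<delta> b \<otimes> inv a)" if a: "a \<in> E" and b: "b \<in> E" for a b
  proof -
    have F: "F1 a \<in> V" "F1 b \<in> V" "F2 a \<in> V" "F2 b \<in> V" using F1 F2 a b by (auto simp: crossed_power_hom_def)
    have "\<delta> (a \<otimes> b) = F1 a \<otimes> (a \<otimes> F1 b \<otimes> inv a) \<otimes> inv (a \<otimes> F2 b \<otimes> inv a) \<otimes> inv (F2 a)"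
      using F1 F2 a b F conj by (simp add: \<delta>_def crossed_power_hom_def group_normalize Vc Ec)
    also have "\<dots> = F1 a \<otimes> (a \<otimes> \<delta> b \<otimes> inv a) \<otimes> inv (F2 a)"
      using a F by (simp add: \<delta>_def group_normalize Vc Ec)
    also have "\<dots> = F1 a \<otimes> (inv (F2 a) \<otimes> (a \<otimes> \<delta> b \<otimes> inv a))"
      using comm[of "a \<otimes> \<delta> b \<otimes> inv a" "inv (F2 a)"] conj[OF a \<delta>V[OF b]] F a Ec \<delta>V[OF b] Vc
      by (simp add: m_assoc V_inv)
    also have "\<dots> = \<delta> a \<otimes> (a \<otimes> \<delta> b \<otimes> inv a)"
      using a F \<delta>V[OF b] by (simp add: \<delta>_def m_assoc Vc Ec)
    finally show ?thesis .
  qed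
  have \<delta>c: "\<delta> (rep (V #> a)) = \<delta> a" if a: "a \<in> E" for a
  proof -
    have r: "rep (V #> a) \<in> E" using rep(1)[OF coset_in[OF a]] .
    have "\<delta> (rep (V #> a)) = \<delta> ((rep (V #> a) \<otimes> inv a) \<otimes> a)" using r a by (simp add: m_assoc Ec)
    also have "\<dots> = \<delta> (rep (V #> a) \<otimes> inv a) \<otimes> ((rep (V #> a) \<otimes> inv a) \<otimes> \<delta> a \<otimes> inv (rep (V #> a) \<otimes> inv a))"
      using \<delta>m[of "rep (V #> a) \<otimes> inv a" a] rep_coset[OF a] VE a by blast
    also have "\<dots> = \<one> \<otimes> (\<delta> a \<otimes> (rep (V #> a) \<otimes> inv a) \<otimes> inv (rep (V #> a) \<otimes> inv a))"
      using \<delta>1[OF rep_coset[OF a]] comm[OF rep_coset[OF a] \<delta>V[OF a]] by simp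
    also have "\<dots> = \<delta> a" using \<delta>V[OF a] rep_coset[OF a] by (simp add: m_assoc Vc)
    finally show ?thesis .
  qed
  \<comment> \<open>Reindexing this product by \<open>shift a\<close> yields \<open>w = \<delta> a
    [^] n \<otimes> (a \<otimes> w \<otimes> inv a)\<close>.\<close>
  define w where "w = finprod GV (\<lambda>c. \<delta> (rep c)) cosets"
  have fr: "(\<lambda>c. \<delta> (rep c)) \<in> cosets \<rightarrow> carrier GV" using \<delta>V rep by simp
  have wV: "w \<in> V" using GV.finprod_closed[OF fr] by (simp add: w_def)
  have "\<delta> a [^] n = w \<otimes> (a \<otimes> inv w \<otimes> inv a)" if a: "a \<in> E" for a
  proof -
    have cr: "(\<lambda>c. a \<otimes> \<delta> (rep c) \<otimes> inv a) \<in> cosets \<rightarrow> carrier GV" using conj[OF a] \<delta>V rep by simp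
    have "w = finprod GV (\<lambda>c. \<delta> (rep (shift a c))) cosets"
      using GV.finprod_reindex[of "\<lambda>c. \<delta> (rep c)" "shift a" cosets] shift_bij[OF a] fr
      unfolding w_def bij_betw_def by simp
    also have "\<dots> = finprod GV (\<lambda>c. \<delta> a \<otimes>\<^bsub>GV\<^esub> (a \<otimes> \<delta> (rep c) \<otimes> inv a)) cosets"
      by (rule GV.finprod_cong')
        (use a conj \<delta>V[OF a] in \<open>simp_all add: shift_def \<delta>c \<delta>m \<delta>V E_mult V_mult rep(1)\<close>)
    also have "\<dots> = finprod GV (\<lambda>c. \<delta> a) cosets \<otimes>\<^bsub>GV\<^esub> finprod GV (\<lambda>c. a \<otimes> \<delta> (rep c) \<otimes> inv a) cosets"
      by (rule GV.finprod_multf) (use cr \<delta>V[OF a] in auto)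
    also have "\<dots> = \<delta> a [^] n \<otimes> (a \<otimes> w \<otimes> inv a)"
      using GV.hom_finprod[OF conj_hom[OF a] fr] finprod_const_V[OF \<delta>V[OF a]] unfolding w_def by simp
    finally have "w \<otimes> inv (a \<otimes> w \<otimes> inv a) = \<delta> a [^] n"
      using wV a \<delta>V[OF a] by (metis Ec Vc conj inv_solve_right' V_pow)
    then show ?thesis using wV a by (simp add: group_normalize Vc Ec)
  qed
  then show ?thesis using that wV by (auto simp: \<delta>_def)
qed

end

section \<open>Separable groups and the Hall-Higman centralizer lemma\<close>

text \<open>One flag for the dual cases: \<open>True\<close> means a power of \<open>p\<close>,
  \<open>False\<close> prime to \<open>p\<close>. Cores and the centralizer lemma are thereby
  treated once and used for both.\<close>

definition pi_number :: "bool \<Rightarrow> nat \<Rightarrow> nat \<Rightarrow> bool" where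
  "pi_number b p n \<longleftrightarrow> (if b then \<exists>k. n = p ^ k else coprime n p)"

lemma pi_number_1 [simp]: "pi_number b p 1" "pi_number b p (Suc 0)"
  by (cases b; auto simp: pi_number_def intro: exI[of _ 0])+

lemma pi_number_mult:
  assumes "pi_number b p m" "pi_number b p n"
  shows "pi_number b p (m * n)"
proof (cases b)
  case True
  then obtain i j where "m = p ^ i" "n = p ^ j" using assms by (auto simp: pi_number_def)
  then have "m * n = p ^ (i + j)" by (simp add: power_add)
  then show ?thesis using True unfolding pi_number_def by auto
qed (use assms in \<open>simp add: pi_number_def\<close>)

lemma pi_number_dvd:
  assumes "Factorial_Ring.prime p" "pi_number b p n" "m dvd n"
  shows "pi_number b p m"
proof (cases b)
  case True
  then show ?thesis using assms divides_primepow_nat[OF assms(1)] by (auto simp: pi_number_def)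
next
  case False
  then show ?thesis using assms coprime_divisors[of m n p p] by (simp add: pi_number_def)
qed

lemma pi_number_coprime: "pi_number b p m \<Longrightarrow> pi_number (\<not> b) p n \<Longrightarrow> coprime m n"
  by (cases b) (auto simp: pi_number_def coprime_commute)

text \<open>\<open>O_p(G)\<close> for \<open>True\<close> and \<open>O_p'(G)\<close> for
  \<open>False\<close>. That this union is itself a normal subgroup of the same kind is the lemma
  \<open>pi_core\<close>.\<close>

definition pi_core :: "bool \<Rightarrow> nat \<Rightarrow> ('a,'b) monoid_scheme \<Rightarrow> 'a set" where
  "pi_core b p G = \<Union>{N. N \<lhd> G \<and> pi_number b p (card N)}"

lemma (in group_hom) card_preimage:
  assumes "finite (carrier G)" "subgroup C H" "C \<subseteq> h ` carrier G"
  shows "card {g \<in> carrier G. h g \<in> C} = card C * card {g \<in> carrier G. h g = \<one>\<^bsub>H\<^esub>}"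
proof -
  have "h ` {g \<in> carrier G. h g \<in> C} = C" using assms(3) by auto
  moreover have "{x \<in> {g \<in> carrier G. h g \<in> C}. h x = \<one>\<^bsub>H\<^esub>} = {g \<in> carrier G. h g = \<one>\<^bsub>H\<^esub>}"
    using subgroup.one_closed[OF assms(2)] by auto
  ultimately show ?thesis
    using card_image_mult_kernel[OF subgroup_preimage[OF assms(2)]] assms(1) by simp
qed

lemma (in group_hom) normal_image:
  assumes "h ` carrier G = carrier H" "N \<lhd> G"
  shows "h ` N \<lhd> H"
  unfolding H.normal_inv_iff
proof (intro conjI ballI)
  have N: "subgroup N G" "\<And>g x. g \<in> carrier G \<Longrightarrow> x \<in> N \<Longrightarrow> g \<otimes> x \<otimes> inv g \<in> N"
    using assms(2) by (auto simp: G.normal_inv_iff)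
  note Nc = subgroup.mem_carrier[OF N(1)]
  show "subgroup (h ` N) H" by (rule subgroup_img_is_subgroup[OF N(1)])
  fix y z assume "y \<in> carrier H" "z \<in> h ` N"
  then obtain g x where gx: "g \<in> carrier G" "y = h g" "x \<in> N" "z = h x" using assms(1) by blast
  then have "y \<otimes>\<^bsub>H\<^esub> z \<otimes>\<^bsub>H\<^esub> inv\<^bsub>H\<^esub> y = h (g \<otimes> x \<otimes> inv g)" by (simp add: Nc)
  then show "y \<otimes>\<^bsub>H\<^esub> z \<otimes>\<^bsub>H\<^esub> inv\<^bsub>H\<^esub> y \<in> h ` N" using N(2)[OF gx(1,3)] by blast
qed

lemma (in group_hom) normal_preimage:
  assumes "N \<lhd> H"
  shows "{g \<in> carrier G. h g \<in> N} \<lhd> G"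
  unfolding G.normal_inv_iff
proof (intro conjI ballI)
  have N: "subgroup N H" "\<And>g x. g \<in> carrier H \<Longrightarrow> x \<in> N \<Longrightarrow> g \<otimes>\<^bsub>H\<^esub> x \<otimes>\<^bsub>H\<^esub> inv\<^bsub>H\<^esub> g \<in> N"
    using assms by (auto simp: H.normal_inv_iff)
  show "subgroup {g \<in> carrier G. h g \<in> N} G" by (rule subgroup_preimage[OF N(1)])
  fix g x assume "g \<in> carrier G" "x \<in> {g \<in> carrier G. h g \<in> N}"
  then show "g \<otimes> x \<otimes> inv g \<in> {g \<in> carrier G. h g \<in> N}" using N(2)[of "h g" "h x"] by simp
qed

text \<open>\<open>C\<close> is the product of \<open>A\<close> and \<open>B\<close>, obtained as
  the preimage of the image of \<open>B\<close> modulo \<open>A\<close>; its order is a divisor of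
  \<open>card B\<close> times \<open>card A\<close>.\<close>

lemma (in group) normal_pi_join:
  assumes fin: "finite (carrier G)" and p: "Factorial_Ring.prime p"
    and A: "A \<lhd> G" "pi_number b p (card A)" and B: "B \<lhd> G" "pi_number b p (card B)"
  obtains C where "C \<lhd> G" "A \<subseteq> C" "B \<subseteq> C" "pi_number b p (card C)"
proof -
  obtain Q :: "'a set monoid" and h where q: "group_hom G Q h" and sur: "h ` carrier G = carrier Q"
    and ker: "\<And>a. a \<in> carrier G \<Longrightarrow> h a = \<one>\<^bsub>Q\<^esub> \<longleftrightarrow> a \<in> A" using quotient_group_hom[OF A(1)] by blast
  interpret q: group_hom G Q h by (rule q)
  have sA: "subgroup A G" and sB: "subgroup B G" using A B by (simp_all add: normal_imp_subgroup)
  define C where "C = {g \<in> carrier G. h g \<in> h ` B}"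
  have hB: "h ` B \<lhd> Q" by (rule q.normal_image[OF sur B(1)])
  have kA: "{g \<in> carrier G. h g = \<one>\<^bsub>Q\<^esub>} = A" using ker subgroup.subset[OF sA] by auto
  have "card C = card (h ` B) * card A"
    unfolding C_def using q.card_preimage[OF fin normal_imp_subgroup[OF hB]] subgroup.subset[OF sB] kA by auto
  moreover have "card (h ` B) dvd card B"
    using q.card_image_mult_kernel[OF sB] fin subgroup.subset[OF sB] finite_subset by fastforce
  ultimately have "pi_number b p (card C)"
    using pi_number_mult pi_number_dvd[OF p B(2)] A(2) by metis
  moreover have "C \<lhd> G" unfolding C_def by (rule q.normal_preimage[OF hB])
  moreover have "B \<subseteq> C" using subgroup.subset[OF sB] by (auto simp: C_def)
  moreover have "A \<subseteq> C"
  proof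
    fix a assume a: "a \<in> A"
    have "\<one>\<^bsub>Q\<^esub> \<in> h ` B" using subgroup.one_closed[OF normal_imp_subgroup[OF hB]] .
    then show "a \<in> C" using ker[of a] a subgroup.subset[OF sA] by (auto simp: C_def)
  qed
  ultimately show ?thesis using that by blast
qed

text \<open>A maximal member of the finite family absorbs every other one, by the join, and so
  equals the union.\<close>

lemma (in group) pi_core:
  assumes fin: "finite (carrier G)" and p: "Factorial_Ring.prime p"
  shows "pi_core b p G \<lhd> G" "pi_number b p (card (pi_core b p G))"
    and "\<And>N. N \<lhd> G \<Longrightarrow> pi_number b p (card N) \<Longrightarrow> N \<subseteq> pi_core b p G"
proof -
  define \<C> where "\<C> = {N. N \<lhd> G \<and> pi_number b p (card N)}"
  have "\<C> \<subseteq> Pow (carrier G)"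
  proof (intro subsetI PowI)
    fix N x assume "N \<in> \<C>" "x \<in> N"
    then show "x \<in> carrier G" using subgroup.mem_carrier[OF normal_imp_subgroup, of N G x] by (simp add: \<C>_def)
  qed
  then have fC: "finite \<C>" using fin finite_subset by blast
  have "{\<one>} \<in> \<C>" by (simp add: \<C>_def one_is_normal)
  then obtain M where M: "M \<in> \<C>" "\<And>D. D \<in> \<C> \<Longrightarrow> M \<subseteq> D \<Longrightarrow> D = M"
    using finite_has_maximal2[OF fC] by metis
  have "N \<subseteq> M" if N: "N \<in> \<C>" for N
  proof -
    obtain C where "C \<lhd> G" "M \<subseteq> C" "N \<subseteq> C" "pi_number b p (card C)"
      using normal_pi_join[OF fin p, of M b N] M(1) N by (auto simp: \<C>_def)
    then show ?thesis using M(2)[of C] by (auto simp: \<C>_def)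
  qed
  then have "pi_core b p G = M" using M(1) by (auto simp: pi_core_def \<C>_def)
  then show "pi_core b p G \<lhd> G" "pi_number b p (card (pi_core b p G))" using M(1) by (auto simp: \<C>_def)
  show "\<And>N. N \<lhd> G \<Longrightarrow> pi_number b p (card N) \<Longrightarrow> N \<subseteq> pi_core b p G" by (auto simp: pi_core_def)
qed

lemma (in group) subgroup_conj:
  assumes S: "subgroup S G" and g: "g \<in> carrier G"
  shows "subgroup ((\<lambda>x. g \<otimes> x \<otimes> inv g) ` S) G"
proof -
  note Sc = subgroup.mem_carrier[OF S]
  have "(\<lambda>x. g \<otimes> x \<otimes> inv g) \<in> hom G G" using g by (intro homI) (auto simp: group_normalize)
  then interpret c: group_hom G G "\<lambda>x. g \<otimes> x \<otimes> inv g"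
    using is_group by (simp add: group_hom_def group_hom_axioms_def)
  show ?thesis by (rule c.subgroup_img_is_subgroup[OF S])
qed

text \<open>The core is characteristic. Only conjugations by elements normalizing \<open>D\<close>
  occur here, which is what lets cores climb along a subnormal series.\<close>

lemma (in group) pi_core_conj:
  assumes D: "subgroup D G" "finite D" and g: "g \<in> carrier G" and gD: "\<And>d. d \<in> D \<Longrightarrow> g \<otimes> d \<otimes> inv g \<in> D"
    and x: "x \<in> pi_core b p (G\<lparr>carrier := D\<rparr>)"
  shows "g \<otimes> x \<otimes> inv g \<in> pi_core b p (G\<lparr>carrier := D\<rparr>)"
proof -
  note Dc = subgroup.mem_carrier[OF D(1)]
  obtain N where N: "N \<lhd> G\<lparr>carrier := D\<rparr>" "pi_number b p (card N)" "x \<in> N"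
    using x by (auto simp: pi_core_def)
  then have ND: "N \<subseteq> D" and st: "stable_subgroup G D N" using normal_in_subgroup_iff[OF D(1)] by auto
  note sN = stable_subgroupD(1)[OF st]
  let ?c = "\<lambda>x. g \<otimes> x \<otimes> inv g"
  have inj: "inj_on ?c D" using g by (auto simp: inj_on_def Dc)
  then have surj: "?c ` D = D" using gD D(2) by (simp add: endo_inj_surj image_subset_iff)
  have "stable_subgroup G D (?c ` N)"
    unfolding stable_subgroup_def
  proof (intro conjI ballI)
    show "subgroup (?c ` N) G" by (rule subgroup_conj[OF sN g])
    fix d y assume "d \<in> D" "y \<in> ?c ` N"
    then obtain e n where e: "e \<in> D" "d = ?c e" "n \<in> N" "y = ?c n" using surj by blast
    then have "d \<otimes> y \<otimes> inv d = ?c (e \<otimes> n \<otimes> inv e)"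
      using g Dc ND by (simp add: group_normalize subset_iff)
    then show "d \<otimes> y \<otimes> inv d \<in> ?c ` N" using stable_subgroupD(2)[OF st e(1,3)] by blast
  qed
  moreover have "?c ` N \<subseteq> D" using ND surj by blast
  moreover have "card (?c ` N) = card N" using inj ND by (meson card_image inj_on_subset)
  ultimately have "?c ` N \<lhd> G\<lparr>carrier := D\<rparr>" "pi_number b p (card (?c ` N))"
    using normal_in_subgroup_iff[OF D(1)] N by auto
  then show ?thesis using N(3) unfolding pi_core_def by blast
qed

text \<open>The factors enter only through their orders, so that images are handled by counting. As
  in the definition of \<open>p_solvable\<close>, a term is normal in its successor and not
  necessarily in \<open>G\<close>.\<close>

definition pi_separable :: "('a,'b) monoid_scheme \<Rightarrow> nat \<Rightarrow> bool" where
  "pi_separable G p \<longleftrightarrow> (\<exists>Ns m. Ns 0 = {\<one>\<^bsub>G\<^esub>} \<and> Ns m = carrier G \<and> (\<forall>i\<le>m. subgroup (Ns i) G) \<and>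
     (\<forall>i<m. Ns i \<subseteq> Ns (Suc i) \<and> stable_subgroup G (Ns (Suc i)) (Ns i) \<and>
        (\<exists>n b. card (Ns (Suc i)) = n * card (Ns i) \<and> pi_number b p n)))"

lemma (in group) p_solvable_imp_pi_separable:
  assumes "finite (carrier G)" "p_solvable G p"
  shows "pi_separable G p"
proof -
  obtain Ns m where N: "p_series G p Ns m" using assms(2) by (auto simp: p_solvable_def)
  then have 0: "Ns 0 = {\<one>}" "Ns m = carrier G"
    and step: "\<And>i. i < m \<Longrightarrow> subgroup (Ns (Suc i)) G \<and> Ns i \<lhd> G\<lparr>carrier := Ns (Suc i)\<rparr> \<and>
            (p_group (series_factor G Ns i) p \<or> p'_group (series_factor G Ns i) p)"
    by (auto simp: p_series_def)
  have sub: "subgroup (Ns i) G" if "i \<le> m" for i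
    using that 0(1) step[of "i - 1"] triv_subgroup by (cases i) auto
  have "Ns i \<subseteq> Ns (Suc i) \<and> stable_subgroup G (Ns (Suc i)) (Ns i) \<and>
        (\<exists>n b. card (Ns (Suc i)) = n * card (Ns i) \<and> pi_number b p n)" if i: "i < m" for i
  proof -
    have s: "subgroup (Ns (Suc i)) G" and nn: "Ns i \<lhd> G\<lparr>carrier := Ns (Suc i)\<rparr>" using step[OF i] by auto
    have f: "finite (Ns (Suc i))" using assms(1) subgroup.subset[OF s] finite_subset by blast
    interpret S: group "G\<lparr>carrier := Ns (Suc i)\<rparr>" using subgroup_imp_group[OF s] .
    have "order (series_factor G Ns i) * card (Ns i) = card (Ns (Suc i))"
      using S.lagrange[OF normal_imp_subgroup[OF nn]] f by (simp add: series_factor_def FactGroup_def order_def)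
    moreover have "\<exists>b. pi_number b p (order (series_factor G Ns i))"
      using step[OF i] unfolding p_group_def p'_group_def pi_number_def by metis
    ultimately show ?thesis using nn unfolding normal_in_subgroup_iff[OF s] by metis
  qed
  then show ?thesis unfolding pi_separable_def using 0 sub by blast
qed

lemma (in group_hom) pi_separable_image:
  assumes fin: "finite (carrier G)" and p: "Factorial_Ring.prime p" and sur: "h ` carrier G = carrier H"
    and sep: "pi_separable G p"
  shows "pi_separable H p"
proof -
  obtain Ns m where 0: "Ns 0 = {\<one>}" "Ns m = carrier G" and sub: "\<And>i. i \<le> m \<Longrightarrow> subgroup (Ns i) G" and
     step: "\<And>i. i < m \<Longrightarrow> Ns i \<subseteq> Ns (Suc i) \<and> stable_subgroup G (Ns (Suc i)) (Ns i) \<and>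
        (\<exists>n b. card (Ns (Suc i)) = n * card (Ns i) \<and> pi_number b p n)"
    using sep unfolding pi_separable_def by blast
  have img: "subgroup (h ` Ns i) H" if "i \<le> m" for i using subgroup_img_is_subgroup[OF sub[OF that]] .
  have "h ` Ns i \<subseteq> h ` Ns (Suc i) \<and> stable_subgroup H (h ` Ns (Suc i)) (h ` Ns i) \<and>
        (\<exists>n b. card (h ` Ns (Suc i)) = n * card (h ` Ns i) \<and> pi_number b p n)" if i: "i < m" for i
  proof (intro conjI)
    let ?D = "Ns i" and ?E = "Ns (Suc i)"
    have D: "subgroup ?D G" and E: "subgroup ?E G" using sub i by auto
    have DE: "?D \<subseteq> ?E" and st: "stable_subgroup G ?E ?D" using step[OF i] by auto
    show sh: "h ` ?D \<subseteq> h ` ?E" using DE by blast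
    have fE: "finite ?E" using fin subgroup.subset[OF E] finite_subset by blast
    show "stable_subgroup H (h ` ?E) (h ` ?D)"
      unfolding stable_subgroup_def
    proof (intro conjI ballI)
      show "subgroup (h ` ?D) H" using img i by simp
      fix d x assume "d \<in> h ` ?E" "x \<in> h ` ?D"
      then obtain e y where ey: "e \<in> ?E" "d = h e" "y \<in> ?D" "x = h y" by blast
      then have "d \<otimes>\<^bsub>H\<^esub> x \<otimes>\<^bsub>H\<^esub> inv\<^bsub>H\<^esub> d = h (e \<otimes> y \<otimes> inv e)"
        using subgroup.mem_carrier[OF E] subgroup.mem_carrier[OF D] by simp
      then show "d \<otimes>\<^bsub>H\<^esub> x \<otimes>\<^bsub>H\<^esub> inv\<^bsub>H\<^esub> d \<in> h ` ?D" using stable_subgroupD(2)[OF st ey(1,3)] by blast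
    qed
    obtain n b where n: "card ?E = n * card ?D" "pi_number b p n" using step[OF i] by blast
    obtain n' where n': "card ?E * card (h ` ?D) = card ?D * card (h ` ?E) * n'"
      using index_image[OF D E DE fE] .
    have "card (h ` ?D) dvd card (h ` ?E)"
      by (rule H.card_subgroup_dvd) (use img[of i] img[of "Suc i"] i sh fE in auto)
    then obtain k where k: "card (h ` ?E) = card (h ` ?D) * k" by (rule dvdE)
    have pos: "card ?D > 0" using G.card_subgroup_pos[OF D] DE fE finite_subset by blast
    have pos2: "card (h ` ?D) > 0" using H.card_subgroup_pos[OF img[of i]] DE fE i finite_subset by auto
    \<comment> \<open>The index of the image divides \<open>n\<close>, so it is of the same
      kind.\<close>
    have "card ?D * card (h ` ?D) * n = card ?D * card (h ` ?D) * (k * n')"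
      using n' unfolding n(1) k by (simp add: mult_ac)
    then have "n = k * n'" using pos pos2 by simp
    then have "pi_number b p k" using pi_number_dvd[OF p n(2)] by simp
    then show "\<exists>n b. card (h ` ?E) = n * card (h ` ?D) \<and> pi_number b p n"
      using k by (metis mult.commute)
  qed
  moreover have "h ` Ns 0 = {\<one>\<^bsub>H\<^esub>}" "h ` Ns m = carrier H" using 0 sur by auto
  ultimately show ?thesis unfolding pi_separable_def using img by (intro exI[of _ "\<lambda>i. h ` Ns i"] exI[of _ m]) blast
qed

text \<open>The series is only subnormal, so its first term meeting \<open>C\<close> nontrivially
  need not be normal. That intersection embeds in one factor and is of one kind; the cores of the
  later intersections then ascend, because each is characteristic in a normal subgroup of the next.
  The last one is characteristic in \<open>C\<close>, hence normal in \<open>G\<close>.\<close>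

lemma (in group) normal_pi_subgroup:
  assumes fin: "finite (carrier G)" and p: "Factorial_Ring.prime p"
    and sep: "pi_separable G p" and C: "C \<lhd> G" "C \<noteq> {\<one>}"
  obtains E b where "E \<lhd> G" "E \<subseteq> C" "E \<noteq> {\<one>}" "pi_number b p (card E)"
proof -
  obtain Ns m where 0: "Ns 0 = {\<one>}" "Ns m = carrier G" and sub: "\<And>i. i \<le> m \<Longrightarrow> subgroup (Ns i) G" and
     stp: "\<And>i. i < m \<Longrightarrow> Ns i \<subseteq> Ns (Suc i) \<and> stable_subgroup G (Ns (Suc i)) (Ns i) \<and>
        (\<exists>n b. card (Ns (Suc i)) = n * card (Ns i) \<and> pi_number b p n)"
    using sep unfolding pi_separable_def by blast
  have sC: "subgroup C G" and cC: "\<And>g x. g \<in> carrier G \<Longrightarrow> x \<in> C \<Longrightarrow> g \<otimes> x \<otimes> inv g \<in> C"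
    using C(1) by (auto simp: normal_inv_iff)
  have finS: "finite S" if "subgroup S G" for S using fin subgroup.subset[OF that] finite_subset by blast
  define D where "D = (\<lambda>i. Ns i \<inter> C)"
  have sD: "subgroup (D i) G" if "i \<le> m" for i
    unfolding D_def by (rule subgroups_Inter_pair[OF sub[OF that] sC])
  have Dm: "D m = C" using 0 subgroup.subset[OF sC] by (auto simp: D_def)
  \<comment> \<open>Minimality makes \<open>D j\<close> trivial for the predecessor
    \<open>j\<close>, so \<open>D i\<close> maps injectively into the quotient of
    \<open>Ns i\<close> by \<open>Ns j\<close>.\<close>
  define i where "i = (LEAST i. D i \<noteq> {\<one>})"
  have Di: "D i \<noteq> {\<one>}" unfolding i_def by (rule LeastI[of _ m]) (simp add: Dm C(2))
  have im: "i \<le> m" unfolding i_def by (rule Least_le) (simp add: Dm C(2))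
  have "i \<noteq> 0" using Di 0(1) subgroup.one_closed[OF sC] by (auto simp: D_def)
  then obtain j where j: "i = Suc j" using not0_implies_Suc by blast
  have Dj: "D j = {\<one>}" using not_less_Least[of j "\<lambda>i. D i \<noteq> {\<one>}"] j by (auto simp: i_def)
  obtain n b where n: "card (Ns i) = n * card (Ns j)" "pi_number b p n" using stp[of j] j im by auto
  have pD: "pi_number b p (card (D i))"
  proof -
    let ?N = "G\<lparr>carrier := Ns i\<rparr>"
    have sN: "subgroup (Ns i) G" "subgroup (Ns j) G" using sub im j by auto
    interpret N: group ?N using subgroup_imp_group[OF sN(1)] .
    have "Ns j \<lhd> ?N" using stp[of j] j im normal_in_subgroup_iff[OF sN(1)] by auto
    then obtain Q :: "'a set monoid" and h where q: "group_hom ?N Q h" and sur: "h ` carrier ?N = carrier Q"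
      and ker: "\<And>a. a \<in> carrier ?N \<Longrightarrow> h a = \<one>\<^bsub>Q\<^esub> \<longleftrightarrow> a \<in> Ns j" using N.quotient_group_hom by blast
    interpret q: group_hom ?N Q h by (rule q)
    have DN: "D i \<subseteq> Ns i" by (auto simp: D_def)
    have sDN: "subgroup (D i) ?N" by (rule subgroup_incl[OF sD[OF im] sN(1) DN])
    have "{x \<in> D i. h x = \<one>\<^bsub>Q\<^esub>} = D j"
      using ker stp[of j] j im unfolding D_def by auto
    then have "card (D i) = card (h ` D i)"
      using q.card_image_mult_kernel[OF sDN] finS[OF sD[OF im]] Dj by simp
    moreover have "card (h ` D i) dvd order Q"
      unfolding order_def
    proof (rule q.H.card_subgroup_dvd[OF q.H.subgroup_self q.subgroup_img_is_subgroup[OF sDN]])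
      show "h ` D i \<subseteq> carrier Q" by (rule subgroup.subset[OF q.subgroup_img_is_subgroup[OF sDN]])
      show "finite (carrier Q)" unfolding sur[symmetric] using finS[OF sN(1)] by simp
    qed
    moreover have "order Q = n"
    proof -
      have k: "{x \<in> Ns i. h x = \<one>\<^bsub>Q\<^esub>} = Ns j" using ker stp[of j] j im by auto
      have "card (Ns i) = order Q * card (Ns j)"
        using q.card_image_mult_kernel[OF N.subgroup_self] finS[OF sN(1)] sur k by (simp add: order_def)
      moreover have "card (Ns j) > 0" using card_subgroup_pos[OF sN(2) finS[OF sN(2)]] .
      ultimately show ?thesis using n(1) by simp
    qed
    ultimately show ?thesis using pi_number_dvd[OF p n(2)] by simp
  qed
  define R where "R = (\<lambda>k. pi_core b p (G\<lparr>carrier := D k\<rparr>))"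
  have R: "R k \<lhd> G\<lparr>carrier := D k\<rparr>" "pi_number b p (card (R k))"
    "\<And>N. N \<lhd> G\<lparr>carrier := D k\<rparr> \<Longrightarrow> pi_number b p (card N) \<Longrightarrow> N \<subseteq> R k" if "k \<le> m" for k
    using group.pi_core[OF subgroup_imp_group[OF sD[OF that]] _ p] finS[OF sD[OF that]] unfolding R_def by auto
  have "D i \<subseteq> R k" if "i \<le> k" "k \<le> m" for k
    using that
  proof (induction k rule: dec_induct)
    case base
    have "stable_subgroup G (D i) (D i)"
      unfolding stable_subgroup_def using sD[OF im] subgroup.m_closed[OF sD[OF im]] subgroup.m_inv_closed[OF sD[OF im]] by simp
    then have "D i \<lhd> G\<lparr>carrier := D i\<rparr>" using normal_in_subgroup_iff[OF sD[OF im]] by simp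
    then show ?case using R(3)[OF im] pD by blast
  next
    case (step k)
    then have k: "k \<le> m" "Suc k \<le> m" "k < m" by auto
    note sk = sD[OF k(1)] and sk' = sD[OF k(2)]
    have Rk: "R k \<subseteq> D k" "stable_subgroup G (D k) (R k)" using R(1)[OF k(1)] normal_in_subgroup_iff[OF sk] by auto
    have st: "stable_subgroup G (Ns (Suc k)) (Ns k)" and inc: "Ns k \<subseteq> Ns (Suc k)" using stp[OF k(3)] by auto
    have conj: "d \<otimes> x \<otimes> inv d \<in> D k" if "d \<in> D (Suc k)" "x \<in> D k" for d x
      using stable_subgroupD(2)[OF st] cC[of d x] subgroup.mem_carrier[OF sk'] that unfolding D_def by simp
    have "stable_subgroup G (D (Suc k)) (R k)"
      unfolding stable_subgroup_def
    proof (intro conjI ballI)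
      show "subgroup (R k) G" by (rule stable_subgroupD(1)[OF Rk(2)])
      fix d x assume d: "d \<in> D (Suc k)" and x: "x \<in> R k"
      show "d \<otimes> x \<otimes> inv d \<in> R k"
        unfolding R_def
        by (rule pi_core_conj[OF sk finS[OF sk] subgroup.mem_carrier[OF sk' d]]) (use conj d x in \<open>auto simp: R_def\<close>)
    qed
    moreover have "R k \<subseteq> D (Suc k)" using Rk(1) inc by (auto simp: D_def)
    ultimately have "R k \<lhd> G\<lparr>carrier := D (Suc k)\<rparr>" using normal_in_subgroup_iff[OF sk'] by simp
    then have "R k \<subseteq> R (Suc k)" using R(3)[OF k(2)] R(2)[OF k(1)] by blast
    then show ?case using step.IH k(1) by blast
  qed
  then have DR: "D i \<subseteq> R m" using im by blast
  have RC: "R m \<subseteq> C" "stable_subgroup G C (R m)" using R(1)[of m] Dm normal_in_subgroup_iff[OF sC] by auto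
  have "R m \<lhd> G"
    unfolding normal_inv_iff
  proof (intro conjI ballI)
    show "subgroup (R m) G" by (rule stable_subgroupD(1)[OF RC(2)])
    fix g x assume g: "g \<in> carrier G" and x: "x \<in> R m"
    show "g \<otimes> x \<otimes> inv g \<in> R m"
      unfolding R_def Dm by (rule pi_core_conj[OF sC finS[OF sC] g]) (use cC g x in \<open>auto simp: R_def Dm\<close>)
  qed
  moreover have "R m \<noteq> {\<one>}" using DR Di subgroup.one_closed[OF sD[OF im]] by blast
  ultimately show ?thesis using that RC(1) R(2)[of m] by blast
qed

text \<open>\<open>m\<close> is an inverse of \<open>n\<close> modulo the order of \<open>V\<close>,
  from a Bezout identity.\<close>

lemma (in group) coprime_root:
  assumes V: "subgroup V G" "finite V" and n: "coprime n (card V)"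
  obtains m :: nat where "\<And>v. v \<in> V \<Longrightarrow> (v [^] m) [^] n = v"
proof -
  have pow: "v [^] card V = \<one>" if "v \<in> V" for v
    using group.pow_order_eq_1[OF subgroup_imp_group[OF V(1)], of v] that
    by (simp add: order_def nat_pow_consistent flip: nat_pow_consistent)
  show ?thesis
  proof (cases "n = 0")
    \<comment> \<open>Bezout's identity is used for nonzero \<open>n\<close>; and
      \<open>n = 0\<close> is coprime to \<open>card V\<close> only if \<open>V\<close> is
      trivial.\<close>
    case True
    then have "card V = 1" using n by simp
    then have "v [^] (0::nat) = v" if "v \<in> V" for v
      using that subgroup.one_closed[OF V(1)] by (metis card_1_singletonE nat_pow_0 singletonD)
    then show ?thesis using that[of 0] True by simp
  next
    case False
    then obtain x y where "n * x = card V * y + 1" using bezout_nat[of n "card V"] n by auto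
    moreover have "v [^] (card V * y + 1) = v" if "v \<in> V" for v
      using pow[OF that] subgroup.mem_carrier[OF V(1) that] nat_pow_pow[of v "card V" y] by simp
    ultimately show ?thesis
      using that[of x] subgroup.mem_carrier[OF V(1)] by (metis nat_pow_pow mult.commute)
  qed
qed

text \<open>Comparing a crossed homomorphism with its conjugate by \<open>g\<close> measures how far
  \<open>g\<close> is from normalizing the kernel. Both agree on \<open>V\<close>, so
  \<open>crossed_power_hom_diff\<close> applies to them.\<close>

lemma (in abelian_normal_pair) crossed_conj:
  assumes F: "crossed_power_hom G V E k F" and g: "g \<in> carrier G"
    and gV: "\<And>v. v \<in> V \<Longrightarrow> g \<otimes> v \<otimes> inv g \<in> V" "\<And>v. v \<in> V \<Longrightarrow> inv g \<otimes> v \<otimes> g \<in> V"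
    and gE: "\<And>a. a \<in> E \<Longrightarrow> inv g \<otimes> a \<otimes> g \<in> E"
  shows "crossed_power_hom G V E k (\<lambda>a. g \<otimes> F (inv g \<otimes> a \<otimes> g) \<otimes> inv g)"
  unfolding crossed_power_hom_def
proof (intro conjI ballI)
  have F1: "F a \<in> V" if "a \<in> E" for a using F that by (simp add: crossed_power_hom_def)
  have F2: "F (a \<otimes> b) = F a \<otimes> (a \<otimes> F b \<otimes> inv a)" if "a \<in> E" "b \<in> E" for a b
    using F that by (simp add: crossed_power_hom_def)
  show "g \<otimes> F (inv g \<otimes> a \<otimes> g) \<otimes> inv g \<in> V" if "a \<in> E" for a using that by (intro gV(1) F1 gE)
  show "g \<otimes> F (inv g \<otimes> (a \<otimes> b) \<otimes> g) \<otimes> inv g =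
      g \<otimes> F (inv g \<otimes> a \<otimes> g) \<otimes> inv g \<otimes> (a \<otimes> (g \<otimes> F (inv g \<otimes> b \<otimes> g) \<otimes> inv g) \<otimes> inv a)"
    if a: "a \<in> E" and b: "b \<in> E" for a b
  proof -
    have "inv g \<otimes> (a \<otimes> b) \<otimes> g = (inv g \<otimes> a \<otimes> g) \<otimes> (inv g \<otimes> b \<otimes> g)"
      using a b g by (simp add: group_normalize Ec)
    then have "F (inv g \<otimes> (a \<otimes> b) \<otimes> g) = F (inv g \<otimes> a \<otimes> g) \<otimes> ((inv g \<otimes> a \<otimes> g) \<otimes> F (inv g \<otimes> b \<otimes> g) \<otimes> inv (inv g \<otimes> a \<otimes> g))"
      using F2[OF gE[OF a] gE[OF b]] by simp
    then show ?thesis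
      using Vc[OF F1[OF gE[OF a]]] Vc[OF F1[OF gE[OF b]]] Ec[OF a] Ec[OF b] g
      by (simp add: inv_mult_group m_assoc inv_cancel_left)
  qed
  show "g \<otimes> F (inv g \<otimes> v \<otimes> g) \<otimes> inv g = v [^] k" if v: "v \<in> V" for v
  proof -
    have "F (inv g \<otimes> v \<otimes> g) = (inv g \<otimes> v \<otimes> g) [^] k"
      using F gV(2)[OF v] by (simp add: crossed_power_hom_def)
    moreover have "g \<otimes> (inv g \<otimes> v \<otimes> g) [^] j \<otimes> inv g = v [^] j" for j :: nat
    proof (induction j)
      case (Suc j)
      have "g \<otimes> (inv g \<otimes> v \<otimes> g) [^] Suc j \<otimes> inv g = (g \<otimes> (inv g \<otimes> v \<otimes> g) [^] j \<otimes> inv g) \<otimes> v"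
        using g Vc[OF v] by (simp add: m_assoc inv_cancel_left)
      then show ?case using Suc by simp
    qed (use g in simp)
    ultimately show ?thesis by simp
  qed
qed

lemma (in group) coprime_pow_eq_one:
  assumes V: "subgroup V G" "finite V" and n: "coprime n (card V)" and v: "v \<in> V" "v [^] n = \<one>"
  shows "v = \<one>"
proof -
  have vc: "v \<in> carrier G" by (rule subgroup.mem_carrier[OF V(1) v(1)])
  obtain m :: nat where "(v [^] m) [^] n = v" using coprime_root[OF V n] v(1) by blast
  moreover have "(v [^] m) [^] n = (v [^] n) [^] m" using vc by (simp add: nat_pow_pow mult.commute)
  ultimately show ?thesis using v(2) by simp
qed

section \<open>Centralizers and the centralizer lemma\<close>

lemma (in group) centralizer_subgroup:
  assumes "T \<subseteq> carrier G"
  shows "subgroup {x \<in> carrier G. \<forall>t\<in>T. x \<otimes> t = t \<otimes> x} G"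
proof (rule subgroupI)
  show "{x \<in> carrier G. \<forall>t\<in>T. x \<otimes> t = t \<otimes> x} \<noteq> {}"
    using assms by (auto intro!: exI[of _ \<one>])
  fix a assume "a \<in> {x \<in> carrier G. \<forall>t\<in>T. x \<otimes> t = t \<otimes> x}"
  then have a: "a \<in> carrier G" "\<And>t. t \<in> T \<Longrightarrow> a \<otimes> t = t \<otimes> a" by auto
  have "inv a \<otimes> t = t \<otimes> inv a" if t: "t \<in> T" for t
  proof -
    have tc: "t \<in> carrier G" using t assms by blast
    have "inv a \<otimes> t = inv a \<otimes> (t \<otimes> a) \<otimes> inv a" using a(1) tc by (simp add: m_assoc)
    also have "\<dots> = t \<otimes> inv a" unfolding a(2)[OF t, symmetric] using a(1) tc by (simp add: group_normalize)
    finally show ?thesis .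
  qed
  then show "inv a \<in> {x \<in> carrier G. \<forall>t\<in>T. x \<otimes> t = t \<otimes> x}" using a(1) by simp
  fix c assume "c \<in> {x \<in> carrier G. \<forall>t\<in>T. x \<otimes> t = t \<otimes> x}"
  then have c: "c \<in> carrier G" "\<And>t. t \<in> T \<Longrightarrow> c \<otimes> t = t \<otimes> c" by auto
  have "a \<otimes> c \<otimes> t = t \<otimes> (a \<otimes> c)" if t: "t \<in> T" for t
  proof -
    have tc: "t \<in> carrier G" using t assms by blast
    have "a \<otimes> c \<otimes> t = a \<otimes> t \<otimes> c" using a(1) c tc t by (simp add: m_assoc)
    then show ?thesis using a c(1) tc t by (simp add: m_assoc)
  qed
  then show "a \<otimes> c \<in> {x \<in> carrier G. \<forall>t\<in>T. x \<otimes> t = t \<otimes> x}" using a(1) c(1) by simp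
qed auto

lemma (in group) centralizer_normal:
  assumes "T \<lhd> G"
  shows "{x \<in> carrier G. \<forall>t\<in>T. x \<otimes> t = t \<otimes> x} \<lhd> G"
  unfolding normal_inv_iff
proof (intro conjI ballI)
  have T: "subgroup T G" and cT: "\<And>g t. g \<in> carrier G \<Longrightarrow> t \<in> T \<Longrightarrow> g \<otimes> t \<otimes> inv g \<in> T"
    using assms by (auto simp: normal_inv_iff)
  note Tc = subgroup.mem_carrier[OF T]
  show "subgroup {x \<in> carrier G. \<forall>t\<in>T. x \<otimes> t = t \<otimes> x} G"
    by (rule centralizer_subgroup[OF subgroup.subset[OF T]])
  fix g c assume g: "g \<in> carrier G" and "c \<in> {x \<in> carrier G. \<forall>t\<in>T. x \<otimes> t = t \<otimes> x}"
  then have c: "c \<in> carrier G" "\<And>t. t \<in> T \<Longrightarrow> c \<otimes> t = t \<otimes> c" by auto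
  have "g \<otimes> c \<otimes> inv g \<otimes> t = t \<otimes> (g \<otimes> c \<otimes> inv g)" if t: "t \<in> T" for t
  proof -
    have t': "inv g \<otimes> t \<otimes> g \<in> T" using cT[of "inv g" t] g t by simp
    have "g \<otimes> c \<otimes> inv g \<otimes> t = g \<otimes> (c \<otimes> (inv g \<otimes> t \<otimes> g)) \<otimes> inv g"
      using g c(1) Tc[OF t] by (simp add: group_normalize)
    also have "\<dots> = t \<otimes> (g \<otimes> c \<otimes> inv g)"
      unfolding c(2)[OF t'] using g c(1) Tc[OF t] by (simp add: group_normalize)
    finally show ?thesis .
  qed
  then show "g \<otimes> c \<otimes> inv g \<in> {x \<in> carrier G. \<forall>t\<in>T. x \<otimes> t = t \<otimes> x}" using g c(1) by simp
qed

text \<open>Let \<open>Z = C \<inter> T\<close> for the centralizer \<open>C\<close> of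
  \<open>T\<close>. If \<open>C\<close> is not inside \<open>T\<close>, some nontrivial normal
  \<open>E / Z\<close> inside \<open>C / Z\<close> is of one of the two kinds. If its kind is that
  of \<open>T\<close>, then \<open>E\<close> lies in \<open>T\<close> by maximality. Otherwise
  \<open>Z\<close> is central in \<open>E\<close> and of order prime to its index, the transfer is a
  genuine homomorphism onto \<open>Z\<close>, and its kernel is a nontrivial normal subgroup of the
  kind whose core is trivial.\<close>

lemma (in group) hall_higman_centralizer:
  assumes fin: "finite (carrier G)" and p: "Factorial_Ring.prime p"
    and sep: "pi_separable G p" and core: "pi_core b p G = {\<one>}"
    and T: "T = pi_core (\<not> b) p G"
    and x: "x \<in> carrier G" "\<And>t. t \<in> T \<Longrightarrow> x \<otimes> t = t \<otimes> x"
  shows "x \<in> T"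
proof (rule ccontr)
  assume xT: "x \<notin> T"
  define C where "C = {x \<in> carrier G. \<forall>t\<in>T. x \<otimes> t = t \<otimes> x}"
  have nT: "T \<lhd> G" "pi_number (\<not> b) p (card T)" and maxT: "\<And>N. N \<lhd> G \<Longrightarrow> pi_number (\<not> b) p (card N) \<Longrightarrow> N \<subseteq> T"
    unfolding T using pi_core[OF fin p] by auto
  have sT: "subgroup T G" and cT: "\<And>g t. g \<in> carrier G \<Longrightarrow> t \<in> T \<Longrightarrow> g \<otimes> t \<otimes> inv g \<in> T"
    using nT(1) by (auto simp: normal_inv_iff)
  note Tc = subgroup.mem_carrier[OF sT]
  have finS: "finite S" if "subgroup S G" for S using fin subgroup.subset[OF that] finite_subset by blast
  have Ccomm: "c \<otimes> t = t \<otimes> c" if "c \<in> C" "t \<in> T" for c t using that by (simp add: C_def)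
  have Cc: "c \<in> carrier G" if "c \<in> C" for c using that by (simp add: C_def)
  have sC: "subgroup C G" unfolding C_def by (rule centralizer_subgroup[OF subgroup.subset[OF sT]])
  have nC: "C \<lhd> G" unfolding C_def by (rule centralizer_normal[OF nT(1)])
  define Z where "Z = C \<inter> T"
  have nZ: "Z \<lhd> G" unfolding Z_def by (rule normal_subgroup_intersect[OF nC nT(1)])
  have sZ: "subgroup Z G" by (rule normal_imp_subgroup[OF nZ])
  note Zc = subgroup.mem_carrier[OF sZ]
  obtain Q :: "'a set monoid" and h where q: "group_hom G Q h" and sur: "h ` carrier G = carrier Q"
    and ker: "\<And>a. a \<in> carrier G \<Longrightarrow> h a = \<one>\<^bsub>Q\<^esub> \<longleftrightarrow> a \<in> Z" using quotient_group_hom[OF nZ] by blast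
  interpret q: group_hom G Q h by (rule q)
  have finQ: "finite (carrier Q)" unfolding sur[symmetric] using fin by simp
  have kZ: "{g \<in> carrier G. h g = \<one>\<^bsub>Q\<^esub>} = Z" using ker subgroup.subset[OF sZ] by auto
  have "x \<in> C" using x by (simp add: C_def)
  then have "h x \<noteq> \<one>\<^bsub>Q\<^esub>" using ker[OF x(1)] xT by (simp add: Z_def)
  then have "h ` C \<noteq> {\<one>\<^bsub>Q\<^esub>}" using \<open>x \<in> C\<close> by blast
  then obtain E' b' where E': "E' \<lhd> Q" "E' \<subseteq> h ` C" "E' \<noteq> {\<one>\<^bsub>Q\<^esub>}" "pi_number b' p (card E')"
    using q.H.normal_pi_subgroup[OF finQ p q.pi_separable_image[OF fin p sur sep] q.normal_image[OF sur nC]] by blast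
  define E where "E = {g \<in> carrier G. h g \<in> E'}"
  have nE: "E \<lhd> G" unfolding E_def by (rule q.normal_preimage[OF E'(1)])
  have sE: "subgroup E G" and cE: "\<And>g a. g \<in> carrier G \<Longrightarrow> a \<in> E \<Longrightarrow> g \<otimes> a \<otimes> inv g \<in> E"
    using nE by (auto simp: normal_inv_iff)
  have sE': "subgroup E' Q" by (rule normal_imp_subgroup[OF E'(1)])
  note Ec = subgroup.mem_carrier[OF sE]
  have hZ: "h z = \<one>\<^bsub>Q\<^esub>" if "z \<in> Z" for z by (rule iffD2[OF ker[OF Zc[OF that]] that])
  have ZE: "Z \<subseteq> E" using subgroup.one_closed[OF sE'] by (auto simp: E_def hZ Zc)
  have EC: "E \<subseteq> C"
  proof
    fix a assume a: "a \<in> E"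
    then have "h a \<in> h ` C" using E'(2) by (auto simp: E_def)
    then obtain c where c: "c \<in> C" "h a = h c" by blast
    then have "h (a \<otimes> inv c) = \<one>\<^bsub>Q\<^esub>" using Ec[OF a] Cc by simp
    then have "a \<otimes> inv c \<in> Z" using iffD1[OF ker[of "a \<otimes> inv c"]] Ec[OF a] Cc[OF c(1)] by simp
    then have "a \<otimes> inv c \<otimes> c \<in> C" using subgroup.m_closed[OF sC _ c(1)] by (simp add: Z_def)
    then show "a \<in> C" using Ec[OF a] Cc[OF c(1)] by (simp add: m_assoc)
  qed
  have cardE: "card E = card E' * card Z"
    unfolding E_def using q.card_preimage[OF fin sE'] subgroup.subset[OF sE'] sur kZ by simp
  have pZ: "pi_number (\<not> b) p (card Z)"
    by (rule pi_number_dvd[OF p nT(2) card_subgroup_dvd[OF sT sZ _ finS[OF sT]]]) (simp add: Z_def)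
  have E'1: "card E' \<noteq> 1" using E'(3) subgroup.one_closed[OF sE'] by (auto simp: card_1_singleton_iff)
  show False
  proof (cases "b' = b")
    case False
    then have "pi_number (\<not> b) p (card E)" unfolding cardE using E'(4) pZ
      by (cases b; cases b') (auto intro: pi_number_mult)
    then have "E \<subseteq> Z" using maxT[OF nE] EC by (auto simp: Z_def)
    then have "card E = card Z" using ZE by (simp add: antisym)
    then show False using cardE E'1 card_subgroup_pos[OF sZ finS[OF sZ]] by simp
  next
    case True
    interpret ab: abelian_normal_pair G Z E
    proof (intro abelian_normal_pair.intro abelian_normal_pair_axioms.intro)
      show "u \<otimes> v = v \<otimes> u" if "u \<in> Z" "v \<in> Z" for u v using Ccomm that by (simp add: Z_def)
      show "a \<otimes> v \<otimes> inv a \<in> Z" if "a \<in> E" "v \<in> Z" for a v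
        using nZ Ec[OF that(1)] that(2) by (simp add: normal_inv_iff)
    qed (use sZ sE ZE finS group_axioms in auto)
    \<comment> \<open>\<open>E\<close> centralizes \<open>Z\<close>, so the conjugation in the
      crossed law disappears.\<close>
    have central: "a \<otimes> v \<otimes> inv a = v" if "a \<in> E" "v \<in> Z" for a v
    proof -
      have "a \<otimes> v = v \<otimes> a" using Ccomm[of a v] that EC by (auto simp: Z_def)
      then show ?thesis using Zc[OF that(2)] Ec[OF that(1)] by (simp add: m_assoc)
    qed
    have nE': "ab.n = card E'" using cardE card_subgroup_pos[OF sZ finS[OF sZ]] by simp
    have cop: "coprime ab.n (card Z)" unfolding nE' using pi_number_coprime[of b p "card E'" "card Z"] E'(4) pZ True
      by simp
    let ?F = "ab.transfer"
    have F: "crossed_power_hom G Z E ab.n ?F" by (rule ab.crossed_transfer)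
    then have FV: "\<And>a. a \<in> E \<Longrightarrow> ?F a \<in> Z" and Fp: "\<And>v. v \<in> Z \<Longrightarrow> ?F v = v [^] ab.n"
      and Fm: "\<And>a c. a \<in> E \<Longrightarrow> c \<in> E \<Longrightarrow> ?F (a \<otimes> c) = ?F a \<otimes> ?F c"
      using central by (simp_all add: crossed_power_hom_def)
    have "group_hom (G\<lparr>carrier := E\<rparr>) (G\<lparr>carrier := Z\<rparr>) ?F"
      using subgroup_imp_group[OF sE] subgroup_imp_group[OF sZ] FV Fm
      by (auto simp: group_hom_def group_hom_axioms_def hom_def)
    then interpret F: group_hom "G\<lparr>carrier := E\<rparr>" "G\<lparr>carrier := Z\<rparr>" ?F .
    define K where "K = {a \<in> E. ?F a = \<one>}"
    have "?F ` E = Z"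
    proof
      show "Z \<subseteq> ?F ` E"
      proof
        fix v assume v: "v \<in> Z"
        obtain m :: nat where "(v [^] m) [^] ab.n = v" using coprime_root[OF sZ finS[OF sZ] cop] v by blast
        then have "?F (v [^] m) = v" using Fp ab.V_pow[OF v] by simp
        then show "v \<in> ?F ` E" using ab.V_pow[OF v] ZE by (metis image_eqI subsetD)
      qed
    qed (use FV in auto)
    then have "card E = card Z * card K"
      using F.card_image_mult_kernel[OF F.G.subgroup_self] finS[OF sE] by (simp add: K_def)
    then have cardK: "card K = card E'" using cardE card_subgroup_pos[OF sZ finS[OF sZ]] by simp
    have "K \<lhd> G"
      unfolding normal_inv_iff
    proof (intro conjI ballI)
      have "subgroup K (G\<lparr>carrier := E\<rparr>)" using F.subgroup_kernel_part[OF F.G.subgroup_self] by (simp add: K_def)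
      then show "subgroup K G" by (rule incl_subgroup[OF sE])
      fix g a assume g: "g \<in> carrier G" and a: "a \<in> K"
      let ?a = "g \<otimes> a \<otimes> inv g"
      have ac: "a \<in> E" "?F a = \<one>" using a by (simp_all add: K_def)
      have aE: "?a \<in> E" by (rule cE[OF g ac(1)])
      have cZ: "\<And>g v. g \<in> carrier G \<Longrightarrow> v \<in> Z \<Longrightarrow> g \<otimes> v \<otimes> inv g \<in> Z" using nZ by (simp add: normal_inv_iff)
      \<comment> \<open>The transfer and its conjugate differ, up to an \<open>n\<close>-th power,
        by a coboundary, and coboundaries are trivial because \<open>Z\<close> is central. So the
        kernel is invariant under \<open>g\<close>.\<close>
      have F2: "crossed_power_hom G Z E ab.n (\<lambda>a. g \<otimes> ?F (inv g \<otimes> a \<otimes> g) \<otimes> inv g)"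
        by (rule ab.crossed_conj[OF F g]) (use cZ cE g inv_closed[OF g] inv_inv[OF g] in metis)+
      obtain w where w: "w \<in> Z" "\<forall>a\<in>E. ((g \<otimes> ?F (inv g \<otimes> a \<otimes> g) \<otimes> inv g) \<otimes> inv (?F a)) [^] ab.n = w \<otimes> (a \<otimes> inv w \<otimes> inv a)"
        using ab.crossed_power_hom_diff[OF F2 F] .
      have "inv g \<otimes> ?a \<otimes> g = a" using g Ec[OF ac(1)] by (simp add: group_normalize)
      then have "(inv (?F ?a)) [^] ab.n = w \<otimes> (?a \<otimes> inv w \<otimes> inv ?a)"
        using w(2)[rule_format, OF aE] ac(2) g Zc[OF FV[OF aE]] by simp
      also have "\<dots> = \<one>" using central[OF aE ab.V_inv[OF w(1)]] Zc[OF w(1)] by simp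
      finally have "inv (?F ?a) = \<one>"
        using coprime_pow_eq_one[OF sZ finS[OF sZ] cop ab.V_inv[OF FV[OF aE]]] by simp
      then show "?a \<in> K" using aE Zc[OF FV[OF aE]] by (simp add: K_def)
    qed
    then have "K \<subseteq> {\<one>}" using pi_core(3)[OF fin p, of K b] cardK E'(4) True core by simp
    then have "card K \<le> 1" using card_mono[of "{\<one>}" K] by simp
    moreover have "card E' > 0" using q.H.card_subgroup_pos[OF sE'] finQ subgroup.subset[OF sE'] finite_subset by blast
    ultimately show False using cardK E'1 by simp
  qed
qed

section \<open>A weak form of the Hall-Higman Theorem B\<close>

lemma (in group) div_eq_one:
  assumes "a \<in> carrier G" "b \<in> carrier G" "a \<otimes> inv b = \<one>"
  shows "a = b"
proof -
  have "a = a \<otimes> inv b \<otimes> b" using assms(1,2) by (simp add: m_assoc)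
  then show ?thesis using assms by simp
qed

section \<open>Finite differences and products over orbits in abelian groups\<close>

context comm_group
begin

definition fdiff :: "(nat \<Rightarrow> 'a) \<Rightarrow> nat \<Rightarrow> 'a" where
  "fdiff a i = a (Suc i) \<otimes> inv (a i)"

lemma fdiff_closed: "(\<And>i. a i \<in> carrier G) \<Longrightarrow> (fdiff ^^ k) a i \<in> carrier G"
  by (induction k arbitrary: i) (auto simp: fdiff_def)

lemma fdiff_shift: "(fdiff ^^ k) (\<lambda>i. a (Suc i)) i = (fdiff ^^ k) a (Suc i)"
  by (induction k arbitrary: i) (auto simp: fdiff_def)

lemma fdiff_Suc: "(\<And>i. a i \<in> carrier G) \<Longrightarrow> (fdiff ^^ k) a (Suc i) = (fdiff ^^ k) a i \<otimes> (fdiff ^^ Suc k) a i"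
  using fdiff_closed[of a k] m_lcomm[of "(fdiff ^^ k) a i" "(fdiff ^^ k) a (Suc i)"] by (simp add: fdiff_def)

lemma fdiff_div:
  assumes "\<And>i. u i \<in> carrier G" "\<And>i. v i \<in> carrier G"
  shows "(fdiff ^^ k) (\<lambda>i. u i \<otimes> inv (v i)) i = (fdiff ^^ k) u i \<otimes> inv ((fdiff ^^ k) v i)"
  using fdiff_closed[of u, OF assms(1)] fdiff_closed[of v, OF assms(2)]
  by (induction k arbitrary: i) (auto simp: fdiff_def inv_mult m_ac)

lemma fdiff_hom:
  assumes "h \<in> hom G G" "\<And>i. u i \<in> carrier G"
  shows "(fdiff ^^ k) (\<lambda>i. h (u i)) i = h ((fdiff ^^ k) u i)"
proof -
  interpret h: group_hom G G h using assms(1) is_group by (simp add: group_hom_def group_hom_axioms_def)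
  show ?thesis
    using fdiff_closed[of u, OF assms(2)] by (induction k arbitrary: i) (auto simp: fdiff_def)
qed

text \<open>Newton's forward difference formula in summed form, written multiplicatively. The
  induction removes the first term and joins the two resulting sums by Pascal's rule.\<close>

lemma finprod_newton:
  assumes "\<And>i. a i \<in> carrier G"
  shows "finprod G a {..n} = finprod G (\<lambda>k. (fdiff ^^ k) a 0 [^] (Suc n choose Suc k)) {..n}"
  using assms
proof (induction n arbitrary: a)
  case 0
  then show ?case by simp
next
  case (Suc n)
  let ?d = "\<lambda>k. (fdiff ^^ k) a 0"
  have d: "?d k \<in> carrier G" for k by (rule fdiff_closed[OF Suc.prems])
  have "finprod G a {..Suc n} = finprod G (\<lambda>i. a (Suc i)) {..n} \<otimes> a 0"
    by (rule finprod_Suc2) (use Suc.prems in auto)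
  also have "finprod G (\<lambda>i. a (Suc i)) {..n}
      = finprod G (\<lambda>k. (?d k \<otimes> ?d (Suc k)) [^] (Suc n choose Suc k)) {..n}"
    using Suc.IH[of "\<lambda>i. a (Suc i)"] Suc.prems by (simp only: fdiff_shift fdiff_Suc)
  also have "\<dots> = finprod G (\<lambda>k. ?d k [^] (Suc n choose Suc k) \<otimes> ?d (Suc k) [^] (Suc n choose Suc k)) {..n}"
    using d by (simp only: nat_pow_distrib)
  also have "\<dots> = finprod G (\<lambda>k. ?d k [^] (Suc n choose Suc k)) {..n} \<otimes> finprod G (\<lambda>k. ?d (Suc k) [^] (Suc n choose Suc k)) {..n}"
    by (rule finprod_multf) (use d in \<open>auto simp del: funpow.simps binomial_Suc_Suc\<close>)
  finally have L: "finprod G a {..Suc n} = finprod G (\<lambda>k. ?d k [^] (Suc n choose Suc k)) {..n}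
      \<otimes> finprod G (\<lambda>k. ?d (Suc k) [^] (Suc n choose Suc k)) {..n} \<otimes> a 0" .
  have c1: "finprod G (\<lambda>k. ?d k [^] (Suc n choose Suc k)) {..n} \<in> carrier G"
    and c2: "finprod G (\<lambda>k. ?d (Suc k) [^] (Suc n choose Suc k)) {..n} \<in> carrier G"
    by (rule finprod_closed, use d in \<open>auto simp del: funpow.simps binomial_Suc_Suc\<close>)+
  have "finprod G (\<lambda>k. ?d k [^] (Suc (Suc n) choose Suc k)) {..Suc n}
      = finprod G (\<lambda>k. ?d k [^] (Suc n choose Suc k) \<otimes> ?d k [^] (Suc n choose k)) {..Suc n}"
    using d by (simp only: binomial_Suc_Suc[of "Suc n"] nat_pow_mult add.commute)
  also have "\<dots> = finprod G (\<lambda>k. ?d k [^] (Suc n choose Suc k)) {..Suc n} \<otimes> finprod G (\<lambda>k. ?d k [^] (Suc n choose k)) {..Suc n}"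
    by (rule finprod_multf) (use d in \<open>auto simp del: funpow.simps binomial_Suc_Suc\<close>)
  also have "finprod G (\<lambda>k. ?d k [^] (Suc n choose Suc k)) {..Suc n} = finprod G (\<lambda>k. ?d k [^] (Suc n choose Suc k)) {..n}"
    using d by (subst finprod_Suc) (auto simp: binomial_eq_0 Pi_def simp del: binomial_Suc_Suc)
  also have "finprod G (\<lambda>k. ?d k [^] (Suc n choose k)) {..Suc n} = finprod G (\<lambda>k. ?d (Suc k) [^] (Suc n choose Suc k)) {..n} \<otimes> a 0"
    using d Suc.prems by (subst finprod_Suc2) (auto simp del: binomial_Suc_Suc)
  finally show ?case using L m_assoc[OF c1 c2 Suc.prems] by (simp only:)
qed

text \<open>In exponent \<open>p\<close> all binomial coefficients but the last drop out. This is
  the identity \<open>1 + x + ... + x^(p-1) = (x - 1)^(p-1)\<close>, for sequences that need not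
  consist of the powers of one operator applied to a vector.\<close>

lemma finprod_prime_newton:
  assumes "\<And>i. a i \<in> carrier G" and p: "Factorial_Ring.prime p" and exp: "\<And>w. w \<in> carrier G \<Longrightarrow> w [^] p = \<one>"
  shows "finprod G a {..<p} = (fdiff ^^ (p - 1)) a 0"
proof -
  obtain n where n: "p = Suc n" using prime_gt_0_nat[OF p] gr0_implies_Suc by blast
  let ?d = "\<lambda>k. (fdiff ^^ k) a 0"
  have d: "?d k \<in> carrier G" for k by (rule fdiff_closed[OF assms(1)])
  have one: "?d k [^] (p choose Suc k) = \<one>" if "k < n" for k
  proof -
    have "p dvd (p choose Suc k)" by (rule dvd_choose_prime) (use that n p in auto)
    then obtain j where "p choose Suc k = p * j" by (rule dvdE)
    then show ?thesis using exp d[of k] by (simp flip: nat_pow_pow)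
  qed
  have "finprod G a {..<p} = finprod G (\<lambda>k. ?d k [^] (p choose Suc k)) {..n}"
    using finprod_newton[where n = n, OF assms(1)] n by (simp add: lessThan_Suc_atMost)
  also have "{..n} = insert n {..<n}" by auto
  also have "finprod G (\<lambda>k. ?d k [^] (p choose Suc k)) (insert n {..<n})
     = ?d n [^] (p choose Suc n) \<otimes> finprod G (\<lambda>k. ?d k [^] (p choose Suc k)) {..<n}"
    by (rule finprod_insert) (use d in auto)
  also have "finprod G (\<lambda>k. ?d k [^] (p choose Suc k)) {..<n} = \<one>"
    by (rule finprod_one_eqI) (use one in auto)
  finally show ?thesis using d n by simp
qed

text \<open>A map of order dividing the prime \<open>p\<close> without fixed points has all orbits
  of length exactly \<open>p\<close>; they are split off one at a time.\<close>

lemma finprod_free_orbits: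
  fixes p :: nat
  assumes "finite S" and p: "Factorial_Ring.prime p" and f: "\<And>s. s \<in> S \<Longrightarrow> f s \<in> S"
    and fp: "\<And>s. s \<in> S \<Longrightarrow> (f ^^ p) s = s" and free: "\<And>s. s \<in> S \<Longrightarrow> f s \<noteq> s"
    and u: "u \<in> S \<rightarrow> carrier G" and orb: "\<And>s. s \<in> S \<Longrightarrow> finprod G (\<lambda>i. u ((f ^^ i) s)) {..<p} = \<one>"
  shows "finprod G u S = \<one>"
  using assms(1) f fp free u orb
proof (induction S rule: finite_psubset_induct)
  case (psubset S)
  show ?case
  proof (cases "S = {}")
    case False
    then obtain s where s: "s \<in> S" by blast
    have fi: "(f ^^ i) t \<in> S" if "t \<in> S" for i t using that psubset.prems(1) by (induction i) auto
    define B where "B = (\<lambda>i. (f ^^ i) s) ` {..<p}"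
    have p0: "p > 0" by (rule prime_gt_0_nat[OF p])
    have BI: "(f ^^ i) s \<in> B" for i
    proof -
      have "(f ^^ i) s = (f ^^ (i mod p)) s" using funpow_mod_eq[OF psubset.prems(2)[OF s]] by simp
      then show ?thesis unfolding B_def using p0 by auto
    qed
    have inj: "inj_on (\<lambda>i. (f ^^ i) s) {..<p}"
    proof (rule linorder_inj_onI')
      fix i j assume ij: "i \<in> {..<p}" "j \<in> {..<p}" "i < j"
      show "(f ^^ i) s \<noteq> (f ^^ j) s"
      proof
        assume e: "(f ^^ i) s = (f ^^ j) s"
        have "s = (f ^^ (p - i)) ((f ^^ i) s)"
          using ij psubset.prems(2)[OF s] by (simp flip: funpow_add[THEN fun_cong, unfolded comp_apply])
        also have "\<dots> = (f ^^ (j - i)) ((f ^^ p) s)"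
          unfolding e using ij by (simp add: add.commute flip: funpow_add[THEN fun_cong, unfolded comp_apply])
        finally have d: "(f ^^ (j - i)) s = s" using psubset.prems(2)[OF s] by simp
        \<comment> \<open>A collision gives a period \<open>j - i\<close> prime to \<open>p\<close>;
          together with the period \<open>p\<close> it makes \<open>s\<close> a fixed point.\<close>
        have "coprime (j - i) p"
          using ij p by (metis coprime_commute diff_is_0_eq dvd_imp_le lessThan_iff less_imp_diff_less not_le prime_imp_coprime zero_less_diff)
        then obtain y z where yz: "(j - i) * y = p * z + 1"
          using bezout_nat[of "j - i" p] ij by auto
        have "(f ^^ ((j - i) * y)) s = s" using d by (metis funpow_mod_eq mod_mult_self1_is_0 funpow_0)
        moreover have "(f ^^ (p * z + 1)) s = f s"
          using psubset.prems(2)[OF s] by (metis add.commute funpow_0 funpow_mod_eq mod_mult_self1_is_0 One_nat_def funpow.simps(2) comp_apply plus_1_eq_Suc)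
        ultimately show False using yz psubset.prems(3)[OF s] by simp
      qed
    qed
    have BS: "B \<subseteq> S" using fi[OF s] by (auto simp: B_def)
    have sB: "s \<in> B" using BI[of 0] by simp
    have "finprod G u B = \<one>"
      using finprod_reindex[of u "\<lambda>i. (f ^^ i) s" "{..<p}"] inj psubset.prems(4,5) s BS unfolding B_def
        by (auto simp: Pi_def)
    moreover have "finprod G u (S - B) = \<one>"
    proof (rule psubset.IH)
      show "S - B \<subset> S" using sB s by blast
      show "f t \<in> S - B" if t: "t \<in> S - B" for t
      proof -
        have "f t \<notin> B"
        proof
          assume "f t \<in> B"
          then obtain i where i: "f t = (f ^^ i) s" by (auto simp: B_def)
          have "t = (f ^^ (p - 1)) (f t)" using psubset.prems(2)[of t] t p0
            by (metis DiffD1 Suc_diff_1 funpow_swap1 funpow.simps(2) comp_apply)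
          also have "\<dots> = (f ^^ (p - 1 + i)) s" unfolding i by (simp add: funpow_add)
          finally show False using BI[of "p - 1 + i"] t by simp
        qed
        then show ?thesis using psubset.prems(1) t by blast
      qed
    qed (use psubset.prems in auto)
    moreover have "finprod G u S = finprod G u B \<otimes> finprod G u (S - B)"
    proof -
      have "finprod G u (B \<union> (S - B)) = finprod G u B \<otimes> finprod G u (S - B)"
        by (rule finprod_Un_disjoint) (use psubset.hyps BS psubset.prems(4) finite_subset in \<open>auto simp: Pi_def\<close>)
      moreover have "B \<union> (S - B) = S" using BS by blast
      ultimately show ?thesis by simp
    qed
    ultimately show ?thesis by simp
  qed simp
qed

end

text \<open>A module for \<open>H\<close> over the field of \<open>p\<close> elements in
  multiplicative notation: sums are \<open>finprod\<close>, scalar multiples are powers.\<close>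

locale p_module = comm_group W + H: group H for W (structure) and H (structure) +
  fixes act :: "'c \<Rightarrow> 'a \<Rightarrow> 'a" and p :: nat
  assumes act_hom: "h \<in> carrier H \<Longrightarrow> act h \<in> hom W W"
    and act_mult: "g \<in> carrier H \<Longrightarrow> h \<in> carrier H \<Longrightarrow> w \<in> carrier W \<Longrightarrow> act (g \<otimes>\<^bsub>H\<^esub> h) w = act g (act h w)"
    and act_one: "w \<in> carrier W \<Longrightarrow> act \<one>\<^bsub>H\<^esub> w = w"
    and prime_p: "Factorial_Ring.prime p"
    and exp_p: "w \<in> carrier W \<Longrightarrow> w [^] p = \<one>"
begin

lemma act_group_hom: "h \<in> carrier H \<Longrightarrow> group_hom W W (act h)"
  using act_hom is_group by (simp add: group_hom_def group_hom_axioms_def)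

lemma act_closed: "h \<in> carrier H \<Longrightarrow> w \<in> carrier W \<Longrightarrow> act h w \<in> carrier W"
  using group_hom.hom_closed[OF act_group_hom] .

lemma act_m: "h \<in> carrier H \<Longrightarrow> w \<in> carrier W \<Longrightarrow> v \<in> carrier W \<Longrightarrow> act h (w \<otimes> v) = act h w \<otimes> act h v"
  using group_hom.hom_mult[OF act_group_hom] .

lemma act_inv: "h \<in> carrier H \<Longrightarrow> w \<in> carrier W \<Longrightarrow> act h (inv w) = inv (act h w)"
  using group_hom.hom_inv[OF act_group_hom] .

lemma act_unit: "h \<in> carrier H \<Longrightarrow> act h \<one> = \<one>"
  using group_hom.hom_one[OF act_group_hom] .

lemma act_pow: "h \<in> carrier H \<Longrightarrow> w \<in> carrier W \<Longrightarrow> act h (w [^] (n::nat)) = act h w [^] n"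
  using group_hom.hom_nat_pow[OF act_group_hom] .

lemma act_inv_cancel:
  "h \<in> carrier H \<Longrightarrow> w \<in> carrier W \<Longrightarrow> act (inv\<^bsub>H\<^esub> h) (act h w) = w"
  "h \<in> carrier H \<Longrightarrow> w \<in> carrier W \<Longrightarrow> act h (act (inv\<^bsub>H\<^esub> h) w) = w"
  by (simp_all add: act_one flip: act_mult)

lemmas act_simps = act_closed act_m act_inv act_unit act_pow act_inv_cancel

lemma coprime_pow_one:
  assumes "w \<in> carrier W" "w [^] n = \<one>" "coprime n p"
  shows "w = \<one>"
proof -
  have "n \<noteq> 0" using assms(3) prime_p prime_gt_1_nat[OF prime_p] by (intro notI) simp
  then obtain y z where "n * y = p * z + 1" using bezout_nat[of n p] assms(3) by auto
  moreover have "w [^] (n * y) = \<one>" using assms by (simp flip: nat_pow_pow)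
  moreover have "w [^] (p * z + 1) = w" using assms(1) exp_p by (simp flip: nat_pow_pow)
  ultimately show ?thesis by simp
qed

text \<open>The trace of \<open>Q\<close>. When the order of \<open>Q\<close> is prime to
  \<open>p\<close>, its kernel is the complement \<open>[W, Q]\<close> of the fixed points of
  \<open>Q\<close>; this is how \<open>[W, Q]\<close> is expressed throughout.\<close>

definition orbit_prod :: "'c set \<Rightarrow> 'a \<Rightarrow> 'a" where
  "orbit_prod Q w = finprod W (\<lambda>g. act g w) Q"

lemma orbit_prod_closed: "Q \<subseteq> carrier H \<Longrightarrow> w \<in> carrier W \<Longrightarrow> orbit_prod Q w \<in> carrier W"
  unfolding orbit_prod_def by (rule finprod_closed) (auto simp: act_closed)

lemma finprod_act_group_hom:
  assumes "f \<in> A \<rightarrow> carrier H"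
  shows "group_hom W W (\<lambda>w. finprod W (\<lambda>a. act (f a) w) A)"
proof -
  have "(\<lambda>w. finprod W (\<lambda>a. act (f a) w) A) \<in> hom W W"
  proof (rule homI)
    show "finprod W (\<lambda>a. act (f a) w) A \<in> carrier W" if "w \<in> carrier W" for w
      by (rule finprod_closed) (use assms that act_closed in auto)
    show "finprod W (\<lambda>a. act (f a) (w \<otimes> v)) A = finprod W (\<lambda>a. act (f a) w) A \<otimes> finprod W (\<lambda>a. act (f a) v) A"
      if wv: "w \<in> carrier W" "v \<in> carrier W" for w v
    proof -
      have "finprod W (\<lambda>a. act (f a) (w \<otimes> v)) A = finprod W (\<lambda>a. act (f a) w \<otimes> act (f a) v) A"
        by (rule finprod_cong') (use assms[THEN funcset_mem] wv in \<open>auto simp: act_m act_closed\<close>)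
      also have "\<dots> = finprod W (\<lambda>a. act (f a) w) A \<otimes> finprod W (\<lambda>a. act (f a) v) A"
        by (rule finprod_multf) (use assms[THEN funcset_mem] wv in \<open>auto simp: act_closed\<close>)
      finally show ?thesis .
    qed
  qed
  then show ?thesis using is_group by (simp add: group_hom_def group_hom_axioms_def)
qed

lemma orbit_prod_hom: "Q \<subseteq> carrier H \<Longrightarrow> group_hom W W (orbit_prod Q)"
  using finprod_act_group_hom[of "\<lambda>g. g" Q] by (auto simp: orbit_prod_def[abs_def])

lemma orbit_prod_act:
  assumes Q: "subgroup Q H" and h: "h \<in> Q" and w: "w \<in> carrier W"
  shows "orbit_prod Q (act h w) = orbit_prod Q w" "act h (orbit_prod Q w) = orbit_prod Q w"
proof -
  note Qc = subgroup.mem_carrier[OF Q]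
  have f: "(\<lambda>g. act g w) \<in> Q \<rightarrow> carrier W" using Qc w act_closed by auto
  have inj1: "inj_on (\<lambda>g. g \<otimes>\<^bsub>H\<^esub> h) Q" using Qc h by (auto simp: inj_on_def)
  have im1: "(\<lambda>g. g \<otimes>\<^bsub>H\<^esub> h) ` Q = Q"
  proof
    show "Q \<subseteq> (\<lambda>g. g \<otimes>\<^bsub>H\<^esub> h) ` Q"
    proof
      fix g assume g: "g \<in> Q"
      have "g = (g \<otimes>\<^bsub>H\<^esub> inv\<^bsub>H\<^esub> h) \<otimes>\<^bsub>H\<^esub> h" using Qc g h by (simp add: H.m_assoc)
      then show "g \<in> (\<lambda>g. g \<otimes>\<^bsub>H\<^esub> h) ` Q"
        using subgroup.m_closed[OF Q g subgroup.m_inv_closed[OF Q h]] by blast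
    qed
  qed (use subgroup.m_closed[OF Q _ h] in auto)
  have "orbit_prod Q w = finprod W (\<lambda>g. act (g \<otimes>\<^bsub>H\<^esub> h) w) Q"
    unfolding orbit_prod_def using finprod_reindex[of "\<lambda>g. act g w" "\<lambda>g. g \<otimes>\<^bsub>H\<^esub> h" Q] im1 inj1 f by simp
  also have "\<dots> = orbit_prod Q (act h w)"
    unfolding orbit_prod_def by (rule finprod_cong') (use Qc h w act_mult act_closed in auto)
  finally show "orbit_prod Q (act h w) = orbit_prod Q w" by simp
  have inj2: "inj_on (\<lambda>g. h \<otimes>\<^bsub>H\<^esub> g) Q" using Qc h by (auto simp: inj_on_def)
  have im2: "(\<lambda>g. h \<otimes>\<^bsub>H\<^esub> g) ` Q = Q"
  proof
    show "Q \<subseteq> (\<lambda>g. h \<otimes>\<^bsub>H\<^esub> g) ` Q"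
    proof
      fix g assume g: "g \<in> Q"
      have "g = h \<otimes>\<^bsub>H\<^esub> (inv\<^bsub>H\<^esub> h \<otimes>\<^bsub>H\<^esub> g)" using Qc g h by (simp add: H.inv_cancel_left)
      then show "g \<in> (\<lambda>g. h \<otimes>\<^bsub>H\<^esub> g) ` Q"
        using subgroup.m_closed[OF Q subgroup.m_inv_closed[OF Q h] g] by blast
    qed
  qed (use subgroup.m_closed[OF Q h] in auto)
  have "orbit_prod Q w = finprod W (\<lambda>g. act (h \<otimes>\<^bsub>H\<^esub> g) w) Q"
    unfolding orbit_prod_def using finprod_reindex[of "\<lambda>g. act g w" "\<lambda>g. h \<otimes>\<^bsub>H\<^esub> g" Q] im2 inj2 f by simp
  also have "\<dots> = finprod W (\<lambda>g. act h (act g w)) Q"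
    by (rule finprod_cong') (use Qc h w act_mult act_closed in auto)
  also have "\<dots> = act h (orbit_prod Q w)"
    unfolding orbit_prod_def using hom_finprod[OF act_hom[OF Qc[OF h]] f] by simp
  finally show "act h (orbit_prod Q w) = orbit_prod Q w" by simp
qed

end

text \<open>\<open>x\<close> may have any order; the last two assumptions say that it behaves like
  an element of order \<open>p\<close> both on \<open>Q\<close> and on \<open>W\<close>.\<close>

locale p_module_operator = p_module +
  fixes x and Q
  assumes x: "x \<in> carrier H" and Q: "subgroup Q H" "finite Q" and cop: "coprime (card Q) p"
    and xQ: "\<And>g. g \<in> Q \<Longrightarrow> x \<otimes>\<^bsub>H\<^esub> g \<otimes>\<^bsub>H\<^esub> inv\<^bsub>H\<^esub> x \<in> Q"
    and xp_comm: "\<And>g. g \<in> Q \<Longrightarrow> x [^]\<^bsub>H\<^esub> p \<otimes>\<^bsub>H\<^esub> g = g \<otimes>\<^bsub>H\<^esub> x [^]\<^bsub>H\<^esub> p"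
    and xp_act: "\<And>w. w \<in> carrier W \<Longrightarrow> act (x [^]\<^bsub>H\<^esub> p) w = w"
begin

text \<open>The operator \<open>x - 1\<close> in multiplicative notation.\<close>

definition delta where "delta w = act x w \<otimes> inv w"

lemma Qc: "g \<in> Q \<Longrightarrow> g \<in> carrier H" using subgroup.mem_carrier[OF Q(1)] .

lemma delta_group_hom: "group_hom W W delta"
proof -
  have "delta \<in> hom W W"
    by (rule homI) (use x act_closed act_m in \<open>auto simp: delta_def inv_mult m_ac\<close>)
  then show ?thesis using is_group by (simp add: group_hom_def group_hom_axioms_def)
qed

sublocale delta: group_hom W W delta by (rule delta_group_hom)

lemma delta_pow_group_hom: "group_hom W W (delta ^^ n)"
proof -
  have "(delta ^^ n) \<in> hom W W"
    by (induction n) (auto simp: hom_def Pi_iff)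
  then show ?thesis using is_group by (simp add: group_hom_def group_hom_axioms_def)
qed

lemma delta_commute:
  assumes "w \<in> carrier W" shows "delta (act x w) = act x (delta w)" "delta (act (inv\<^bsub>H\<^esub> x) w) = act (inv\<^bsub>H\<^esub> x) (delta w)"
  using assms x by (simp_all add: delta_def act_simps)

text \<open>A submodule for the group generated by \<open>Q\<close> and \<open>x\<close>. Closure
  under \<open>inv x\<close> is listed because differences of conjugates are expanded at a vector
  pulled back by \<open>inv x\<close>.\<close>

definition stable_set where
  "stable_set Y \<longleftrightarrow> Y \<subseteq> carrier W \<and> (\<forall>w\<in>Y. \<forall>v\<in>Y. w \<otimes> v \<in> Y) \<and> (\<forall>w\<in>Y. inv w \<in> Y)
     \<and> (\<forall>w\<in>Y. \<forall>g\<in>Q. act g w \<in> Y) \<and> (\<forall>w\<in>Y. act x w \<in> Y \<and> act (inv\<^bsub>H\<^esub> x) w \<in> Y)"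

lemma stable_delta: "stable_set Y \<Longrightarrow> w \<in> Y \<Longrightarrow> (delta ^^ n) w \<in> Y"
  by (induction n) (auto simp: stable_set_def delta_def)

lemma delta_pow_vanish:
  assumes "stable_set Y" "\<And>w. w \<in> Y \<Longrightarrow> (delta ^^ d) w = \<one>" "w \<in> Y" "d \<le> n"
  shows "(delta ^^ n) w = \<one>"
proof -
  have "(delta ^^ n) w = (delta ^^ d) ((delta ^^ (n - d)) w)"
    using assms(4) by (simp flip: funpow_add[THEN fun_cong, unfolded comp_apply])
  then show ?thesis using assms(2) stable_delta[OF assms(1,3)] by simp
qed

lemma xpow_conj_Q: "g \<in> Q \<Longrightarrow> x [^]\<^bsub>H\<^esub> (i::nat) \<otimes>\<^bsub>H\<^esub> g \<otimes>\<^bsub>H\<^esub> inv\<^bsub>H\<^esub> (x [^]\<^bsub>H\<^esub> i) \<in> Q"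
proof (induction i)
  case (Suc i)
  have "x [^]\<^bsub>H\<^esub> Suc i = x \<otimes>\<^bsub>H\<^esub> x [^]\<^bsub>H\<^esub> i" using x by (rule H.nat_pow_Suc2)
  then have "x [^]\<^bsub>H\<^esub> Suc i \<otimes>\<^bsub>H\<^esub> g \<otimes>\<^bsub>H\<^esub> inv\<^bsub>H\<^esub> (x [^]\<^bsub>H\<^esub> Suc i)
      = x \<otimes>\<^bsub>H\<^esub> (x [^]\<^bsub>H\<^esub> i \<otimes>\<^bsub>H\<^esub> g \<otimes>\<^bsub>H\<^esub> inv\<^bsub>H\<^esub> (x [^]\<^bsub>H\<^esub> i)) \<otimes>\<^bsub>H\<^esub> inv\<^bsub>H\<^esub> x"
    using x Qc[OF Suc.prems] by (simp only: H.group_normalize H.nat_pow_closed H.m_closed H.inv_closed)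
  then show ?case using xQ[OF Suc.IH[OF Suc.prems]] by simp
qed (use Qc in simp)

text \<open>The conjugates of \<open>h\<close> by powers of \<open>x\<close>, applied to a fixed vector, have iterated differences
  in which every difference trades one factor \<open>delta\<close> to the left or to the right of \<open>h\<close>.\<close>
lemma fdiff_conj_vanish:
  assumes Y: "stable_set Y" and van: "\<And>w. w \<in> Y \<Longrightarrow> (delta ^^ d) w = \<one>" and h: "h \<in> Q"
    and "r \<in> Y" "s + t + k \<ge> 2 * d - 1"
  shows "(delta ^^ s) ((fdiff ^^ k) (\<lambda>i. act (x [^]\<^bsub>H\<^esub> i \<otimes>\<^bsub>H\<^esub> h \<otimes>\<^bsub>H\<^esub> inv\<^bsub>H\<^esub> (x [^]\<^bsub>H\<^esub> i)) ((delta ^^ t) r)) i) = \<one>"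
  using assms(4,5)
proof (induction k arbitrary: r s t i)
  case 0
  let ?h = "x [^]\<^bsub>H\<^esub> i \<otimes>\<^bsub>H\<^esub> h \<otimes>\<^bsub>H\<^esub> inv\<^bsub>H\<^esub> (x [^]\<^bsub>H\<^esub> i)"
  have hQ: "?h \<in> Q" by (rule xpow_conj_Q[OF h])
  interpret s: group_hom W W "delta ^^ s" by (rule delta_pow_group_hom)
  \<comment> \<open>No differences are left and \<open>s + t \<ge> 2 * d - 1\<close>, so at least
    \<open>d\<close> factors stand on one side.\<close>
  show ?case
  proof (cases "d \<le> t")
    case True
    then have "(delta ^^ t) r = \<one>" using delta_pow_vanish[OF Y van 0(1)] by simp
    then show ?thesis using act_unit[OF Qc[OF hQ]] by simp
  next
    case False
    then have "d \<le> s" using 0(2) by simp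
    moreover have "act ?h ((delta ^^ t) r) \<in> Y"
      using Y hQ stable_delta[OF Y 0(1)] unfolding stable_set_def by blast
    ultimately show ?thesis using delta_pow_vanish[OF Y van] by simp
  qed
next
  case (Suc k)
  define c where "c = (\<lambda>i. x [^]\<^bsub>H\<^esub> i \<otimes>\<^bsub>H\<^esub> h \<otimes>\<^bsub>H\<^esub> inv\<^bsub>H\<^esub> (x [^]\<^bsub>H\<^esub> (i::nat)))"
  have cQ: "c i \<in> Q" for i unfolding c_def by (rule xpow_conj_Q[OF h])
  have cc: "c i \<in> carrier H" for i by (rule Qc[OF cQ])
  have cS: "c (Suc i) = x \<otimes>\<^bsub>H\<^esub> c i \<otimes>\<^bsub>H\<^esub> inv\<^bsub>H\<^esub> x" for i
    unfolding c_def H.nat_pow_Suc2[OF x] using x Qc[OF h]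
      by (simp only: H.group_normalize H.nat_pow_closed H.m_closed H.inv_closed)
  \<comment> \<open>Now \<open>r = x r' = r' + delta r'\<close> additively. Hence the difference of
    \<open>x c x^-1\<close> and \<open>c\<close> at \<open>r\<close> is
    \<open>delta (c r') - c (delta r')\<close>: one factor appears on the left in the first term and
    on the right in the second.\<close>
  define r' where "r' = act (inv\<^bsub>H\<^esub> x) r"
  have rW: "r \<in> carrier W" using Suc.prems(1) Y by (auto simp: stable_set_def)
  have r'Y: "r' \<in> Y" using Suc.prems(1) Y by (auto simp: stable_set_def r'_def)
  then have r'W: "r' \<in> carrier W" using Y by (auto simp: stable_set_def)
  have r: "r = r' \<otimes> delta r'" using x r'W rW by (simp add: delta_def r'_def act_simps m_lcomm[of "act (inv\<^bsub>H\<^esub> x) r" r])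
  interpret t: group_hom W W "delta ^^ t" by (rule delta_pow_group_hom)
  interpret s: group_hom W W "delta ^^ s" by (rule delta_pow_group_hom)
  have tinv: "(delta ^^ t) r' = act (inv\<^bsub>H\<^esub> x) ((delta ^^ t) r)"
    unfolding r'_def using rW x by (induction t) (auto simp: delta_commute act_closed delta_pow_group_hom[THEN group_hom.hom_closed])
  define u where "u = (\<lambda>i. act (c i) ((delta ^^ t) r'))"
  define v where "v = (\<lambda>i. act (c i) ((delta ^^ Suc t) r'))"
  have uW: "u i \<in> carrier W" for i unfolding u_def using act_closed[OF cc] r'W by simp
  have vW: "v i \<in> carrier W" for i
    unfolding v_def using act_closed[OF cc] delta_pow_group_hom[THEN group_hom.hom_closed, of r' "Suc t"] r'W by blast
  have "fdiff (\<lambda>i. act (c i) ((delta ^^ t) r)) i = delta (u i) \<otimes> inv (v i)" for i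
  proof -
    have "act (c (Suc i)) ((delta ^^ t) r) = act x (u i)"
      unfolding cS u_def tinv using x cc[of i] rW by (simp add: act_mult act_closed)
    moreover have "act (c i) ((delta ^^ t) r) = u i \<otimes> v i"
    proof -
      have "(delta ^^ t) r = (delta ^^ t) r' \<otimes> (delta ^^ Suc t) r'"
        using r'W by (subst r) (simp add: funpow_swap1)
      then show ?thesis unfolding u_def v_def using act_m[OF cc] r'W by simp
    qed
    ultimately show ?thesis
      unfolding fdiff_def delta_def[of "u i"] using uW vW x act_closed by (simp add: inv_mult m_ac)
  qed
  then have "fdiff (\<lambda>i. act (c i) ((delta ^^ t) r)) = (\<lambda>i. delta (u i) \<otimes> inv (v i))" by blast
  then have "(fdiff ^^ Suc k) (\<lambda>i. act (c i) ((delta ^^ t) r)) i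
      = delta ((fdiff ^^ k) u i) \<otimes> inv ((fdiff ^^ k) v i)"
    unfolding funpow_Suc_right comp_apply
    using fdiff_div[of "\<lambda>i. delta (u i)" v k i] fdiff_hom[OF delta.homh, of u k i] uW vW by simp
  moreover have "(delta ^^ s) (delta ((fdiff ^^ k) u i)) = \<one>"
    using Suc.IH[OF r'Y, of "Suc s" t i] Suc.prems(2) unfolding u_def c_def by (simp add: funpow_swap1)
  moreover have "(delta ^^ s) ((fdiff ^^ k) v i) = \<one>"
    using Suc.IH[OF r'Y, of s "Suc t" i] Suc.prems(2) unfolding v_def c_def by simp
  ultimately show ?case
    using fdiff_closed[of u k i, OF uW] fdiff_closed[of v k i, OF vW] unfolding c_def by simp
qed

text \<open>The product over \<open>p\<close> consecutive conjugates is a \<open>(p-1)\<close>-st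
  difference. With \<open>d - 2\<close> factors on the left the count needed is
  \<open>(d - 2) + (p - 1) \<ge> 2 * d - 1\<close>, which is exactly \<open>d \<le> p - 2\<close>:
  this inequality is the origin of \<open>p - 2\<close> in the theorem.\<close>

lemma prod_conj_vanish:
  assumes Y: "stable_set Y" and van: "\<And>w. w \<in> Y \<Longrightarrow> (delta ^^ d) w = \<one>" and h: "h \<in> Q"
    and r: "r \<in> Y" and d: "2 \<le> d" "d \<le> p - 2"
  shows "finprod W (\<lambda>i. (delta ^^ (d - 2)) (act (x [^]\<^bsub>H\<^esub> i \<otimes>\<^bsub>H\<^esub> h \<otimes>\<^bsub>H\<^esub> inv\<^bsub>H\<^esub> (x [^]\<^bsub>H\<^esub> i)) r)) {..<p} = \<one>"
proof -
  let ?a = "\<lambda>i. act (x [^]\<^bsub>H\<^esub> (i::nat) \<otimes>\<^bsub>H\<^esub> h \<otimes>\<^bsub>H\<^esub> inv\<^bsub>H\<^esub> (x [^]\<^bsub>H\<^esub> i)) r"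
  have rW: "r \<in> carrier W" using Y r by (auto simp: stable_set_def)
  have aW: "?a i \<in> carrier W" for i using act_closed[OF Qc[OF xpow_conj_Q[OF h]] rW] .
  interpret N: group_hom W W "delta ^^ (d - 2)" by (rule delta_pow_group_hom)
  have "finprod W (\<lambda>i. (delta ^^ (d - 2)) (?a i)) {..<p} = (delta ^^ (d - 2)) (finprod W ?a {..<p})"
    using hom_finprod[OF N.homh, of ?a "{..<p}"] aW by simp
  also have "finprod W ?a {..<p} = (fdiff ^^ (p - 1)) ?a 0"
    by (rule finprod_prime_newton[OF aW prime_p exp_p])
  also have "(delta ^^ (d - 2)) \<dots> = \<one>"
    using fdiff_conj_vanish[OF Y van h r, of "d - 2" 0 "p - 1" 0] d by simp
  finally show ?thesis .
qed

definition Qx where "Qx = {g \<in> Q. x \<otimes>\<^bsub>H\<^esub> g \<otimes>\<^bsub>H\<^esub> inv\<^bsub>H\<^esub> x = g}"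
text \<open>The sum of all \<open>Q\<close>-conjugates of \<open>x\<close>. It commutes with
  \<open>Q\<close>, and also with \<open>x\<close> because \<open>x\<close> permutes
  \<open>Q\<close>, whereas \<open>delta\<close> need not commute with \<open>Q\<close>.\<close>

definition conj_sum where "conj_sum w = finprod W (\<lambda>g. act (g \<otimes>\<^bsub>H\<^esub> x \<otimes>\<^bsub>H\<^esub> inv\<^bsub>H\<^esub> g) w) Q"
text \<open>\<open>card Qx\<close> counts the \<open>g\<close> for which the conjugate of
  \<open>x\<close> is \<open>x\<close> itself. With this scalar subtracted,
  \<open>delta ^^ (d - 2)\<close> cannot tell the operator from \<open>card Qx\<close> times
  \<open>delta\<close> (\<open>defect_vanish\<close>).\<close>

definition defect where "defect w = conj_sum w \<otimes> inv (w [^] card Qx)"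

lemma Qx_coprime: "coprime (card Qx) p"
proof -
  have "subgroup Qx H"
  proof (rule H.subgroupI)
    show "Qx \<noteq> {}" using subgroup.one_closed[OF Q(1)] x by (auto simp: Qx_def)
    fix g assume "g \<in> Qx"
    then have g: "g \<in> Q" "x \<otimes>\<^bsub>H\<^esub> g \<otimes>\<^bsub>H\<^esub> inv\<^bsub>H\<^esub> x = g" by (auto simp: Qx_def)
    have "x \<otimes>\<^bsub>H\<^esub> inv\<^bsub>H\<^esub> g \<otimes>\<^bsub>H\<^esub> inv\<^bsub>H\<^esub> x = inv\<^bsub>H\<^esub> (x \<otimes>\<^bsub>H\<^esub> g \<otimes>\<^bsub>H\<^esub> inv\<^bsub>H\<^esub> x)"
      using x Qc[OF g(1)] by (simp add: H.group_normalize)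
    then show "inv\<^bsub>H\<^esub> g \<in> Qx" using g subgroup.m_inv_closed[OF Q(1)] by (simp add: Qx_def)
    fix h assume "h \<in> Qx"
    then have h: "h \<in> Q" "x \<otimes>\<^bsub>H\<^esub> h \<otimes>\<^bsub>H\<^esub> inv\<^bsub>H\<^esub> x = h" by (auto simp: Qx_def)
    have "x \<otimes>\<^bsub>H\<^esub> (g \<otimes>\<^bsub>H\<^esub> h) \<otimes>\<^bsub>H\<^esub> inv\<^bsub>H\<^esub> x = (x \<otimes>\<^bsub>H\<^esub> g \<otimes>\<^bsub>H\<^esub> inv\<^bsub>H\<^esub> x) \<otimes>\<^bsub>H\<^esub> (x \<otimes>\<^bsub>H\<^esub> h \<otimes>\<^bsub>H\<^esub> inv\<^bsub>H\<^esub> x)"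
      using x Qc[OF g(1)] Qc[OF h(1)] by (simp add: H.group_normalize)
    then show "g \<otimes>\<^bsub>H\<^esub> h \<in> Qx" using g h subgroup.m_closed[OF Q(1)] by (simp add: Qx_def)
  qed (use Qc in \<open>auto simp: Qx_def\<close>)
  then have "card Qx dvd card Q"
    by (rule H.card_subgroup_dvd[OF Q(1) _ _ Q(2)]) (auto simp: Qx_def)
  then show ?thesis using cop coprime_divisors[of "card Qx" "card Q" p p] by simp
qed

lemma gxg_c: "g \<in> Q \<Longrightarrow> g \<otimes>\<^bsub>H\<^esub> x \<otimes>\<^bsub>H\<^esub> inv\<^bsub>H\<^esub> g \<in> carrier H" using x Qc by simp

lemma conj_sum_group_hom: "group_hom W W conj_sum"
  unfolding conj_sum_def[abs_def] by (rule finprod_act_group_hom) (use gxg_c in auto)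

sublocale cs: group_hom W W conj_sum by (rule conj_sum_group_hom)

lemma defect_group_hom: "group_hom W W defect"
proof -
  have "defect \<in> hom W W"
    by (rule homI) (auto simp: defect_def nat_pow_distrib inv_mult m_ac)
  then show ?thesis using is_group by (simp add: group_hom_def group_hom_axioms_def)
qed

sublocale df: group_hom W W defect by (rule defect_group_hom)

text \<open>Replacing \<open>g\<close> by \<open>h^-1 g\<close> in the product moves
  \<open>h\<close> to the other side.\<close>

lemma conj_sum_Q:
  assumes h: "h \<in> Q" and w: "w \<in> carrier W"
  shows "conj_sum (act h w) = act h (conj_sum w)"
proof -
  let ?f = "\<lambda>g. act (g \<otimes>\<^bsub>H\<^esub> x \<otimes>\<^bsub>H\<^esub> inv\<^bsub>H\<^esub> g) w"
  have f: "?f \<in> Q \<rightarrow> carrier W" using act_closed[OF gxg_c w] by auto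
  have hc: "h \<in> carrier H" by (rule Qc[OF h])
  have inj: "inj_on (\<lambda>g. inv\<^bsub>H\<^esub> h \<otimes>\<^bsub>H\<^esub> g) Q" using Qc h by (auto simp: inj_on_def)
  have im: "(\<lambda>g. inv\<^bsub>H\<^esub> h \<otimes>\<^bsub>H\<^esub> g) ` Q = Q"
    using Q(2) inj subgroup.m_closed[OF Q(1) subgroup.m_inv_closed[OF Q(1) h]]
    by (simp add: endo_inj_surj image_subset_iff)
  have "conj_sum (act h w) = finprod W (\<lambda>g. act h (?f (inv\<^bsub>H\<^esub> h \<otimes>\<^bsub>H\<^esub> g))) Q"
    unfolding conj_sum_def
  proof (rule finprod_cong')
    fix g assume g: "g \<in> Q"
    have gc: "g \<in> carrier H" by (rule Qc[OF g])
    have "act (g \<otimes>\<^bsub>H\<^esub> x \<otimes>\<^bsub>H\<^esub> inv\<^bsub>H\<^esub> g) (act h w) = act (g \<otimes>\<^bsub>H\<^esub> x \<otimes>\<^bsub>H\<^esub> inv\<^bsub>H\<^esub> g \<otimes>\<^bsub>H\<^esub> h) w"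
      using act_mult[OF gxg_c[OF g] hc w] by simp
    also have "g \<otimes>\<^bsub>H\<^esub> x \<otimes>\<^bsub>H\<^esub> inv\<^bsub>H\<^esub> g \<otimes>\<^bsub>H\<^esub> h
        = h \<otimes>\<^bsub>H\<^esub> ((inv\<^bsub>H\<^esub> h \<otimes>\<^bsub>H\<^esub> g) \<otimes>\<^bsub>H\<^esub> x \<otimes>\<^bsub>H\<^esub> inv\<^bsub>H\<^esub> (inv\<^bsub>H\<^esub> h \<otimes>\<^bsub>H\<^esub> g))"
      using gc hc x by (simp add: H.group_normalize)
    also have "act \<dots> w = act h (?f (inv\<^bsub>H\<^esub> h \<otimes>\<^bsub>H\<^esub> g))"
      by (rule act_mult) (use gc hc x w in auto)
    finally show "act (g \<otimes>\<^bsub>H\<^esub> x \<otimes>\<^bsub>H\<^esub> inv\<^bsub>H\<^esub> g) (act h w) = act h (?f (inv\<^bsub>H\<^esub> h \<otimes>\<^bsub>H\<^esub> g))" .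
  qed (use act_closed x Qc hc w in auto)
  also have "\<dots> = act h (finprod W (\<lambda>g. ?f (inv\<^bsub>H\<^esub> h \<otimes>\<^bsub>H\<^esub> g)) Q)"
    by (rule hom_finprod[OF act_hom[OF hc], symmetric]) (use act_closed x Qc hc w in auto)
  also have "finprod W (\<lambda>g. ?f (inv\<^bsub>H\<^esub> h \<otimes>\<^bsub>H\<^esub> g)) Q = conj_sum w"
    unfolding conj_sum_def using finprod_reindex[of ?f "\<lambda>g. inv\<^bsub>H\<^esub> h \<otimes>\<^bsub>H\<^esub> g" Q] im inj f by simp
  finally show ?thesis .
qed

lemma conj_sum_x:
  assumes w: "w \<in> carrier W"
  shows "conj_sum (act x w) = act x (conj_sum w)"
proof -
  let ?f = "\<lambda>g. act (g \<otimes>\<^bsub>H\<^esub> x \<otimes>\<^bsub>H\<^esub> inv\<^bsub>H\<^esub> g) (act x w)"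
  let ?c = "\<lambda>g. x \<otimes>\<^bsub>H\<^esub> g \<otimes>\<^bsub>H\<^esub> inv\<^bsub>H\<^esub> x"
  have f: "?f \<in> Q \<rightarrow> carrier W" using act_closed[OF gxg_c act_closed[OF x w]] by auto
  have inj: "inj_on ?c Q" using Qc x by (auto simp: inj_on_def)
  have im: "?c ` Q = Q" using Q(2) inj xQ by (simp add: endo_inj_surj image_subset_iff)
  have "act x (conj_sum w) = finprod W (\<lambda>g. act x (act (g \<otimes>\<^bsub>H\<^esub> x \<otimes>\<^bsub>H\<^esub> inv\<^bsub>H\<^esub> g) w)) Q"
    unfolding conj_sum_def by (rule hom_finprod[OF act_hom[OF x]]) (use act_closed gxg_c w in auto)
  also have "\<dots> = finprod W (\<lambda>g. ?f (?c g)) Q"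
  proof (rule finprod_cong')
    fix g assume g: "g \<in> Q"
    have gc: "g \<in> carrier H" by (rule Qc[OF g])
    have "act x (act (g \<otimes>\<^bsub>H\<^esub> x \<otimes>\<^bsub>H\<^esub> inv\<^bsub>H\<^esub> g) w) = act (x \<otimes>\<^bsub>H\<^esub> (g \<otimes>\<^bsub>H\<^esub> x \<otimes>\<^bsub>H\<^esub> inv\<^bsub>H\<^esub> g)) w"
      using act_mult[OF x gxg_c[OF g] w] by simp
    also have "x \<otimes>\<^bsub>H\<^esub> (g \<otimes>\<^bsub>H\<^esub> x \<otimes>\<^bsub>H\<^esub> inv\<^bsub>H\<^esub> g) = ?c g \<otimes>\<^bsub>H\<^esub> x \<otimes>\<^bsub>H\<^esub> inv\<^bsub>H\<^esub> (?c g) \<otimes>\<^bsub>H\<^esub> x"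
      using gc x by (simp add: H.group_normalize)
    also have "act \<dots> w = ?f (?c g)" by (rule act_mult) (use gc x w in auto)
    finally show "act x (act (g \<otimes>\<^bsub>H\<^esub> x \<otimes>\<^bsub>H\<^esub> inv\<^bsub>H\<^esub> g) w) = ?f (?c g)" .
  qed (use act_closed x Qc w in auto)
  also have "\<dots> = conj_sum (act x w)"
    unfolding conj_sum_def using finprod_reindex[of ?f ?c Q] im inj f by simp
  finally show ?thesis by simp
qed

lemma defect_Q: "h \<in> Q \<Longrightarrow> w \<in> carrier W \<Longrightarrow> defect (act h w) = act h (defect w)"
  by (simp add: defect_def conj_sum_Q act_simps Qc)

lemma defect_x: "w \<in> carrier W \<Longrightarrow> defect (act x w) = act x (defect w)"
  by (simp add: defect_def conj_sum_x act_simps x)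

lemma defect_delta: "w \<in> carrier W \<Longrightarrow> defect ((delta ^^ n) w) = (delta ^^ n) (defect w)"
  by (induction n) (auto simp: delta_def defect_x act_closed x delta_pow_group_hom[THEN group_hom.hom_closed])

text \<open>The comparison of \<open>conj_sum\<close> with the action of \<open>x\<close>: the factors of
  \<open>g \<otimes> x \<otimes> inv g \<otimes> inv x\<close> with \<open>g\<close> outside \<open>Qx\<close> fall into regular orbits of \<open>x\<close>.\<close>
lemma defect_vanish:
  assumes Y: "stable_set Y" and van: "\<And>w. w \<in> Y \<Longrightarrow> (delta ^^ d) w = \<one>"
    and w: "w \<in> Y" and d: "2 \<le> d" "d \<le> p - 2"
  shows "(delta ^^ (d - 2)) (defect w) = (delta ^^ (d - 1)) w [^] card Qx"
proof -
  have wW: "w \<in> carrier W" using Y w by (auto simp: stable_set_def)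
  define r where "r = act x w"
  have r: "r \<in> Y" "r \<in> carrier W" using Y w by (auto simp: stable_set_def r_def)
  interpret N: group_hom W W "delta ^^ (d - 2)" by (rule delta_pow_group_hom)
  \<comment> \<open>\<open>g x g^-1 = h(g) x\<close> with \<open>h(g)\<close> in \<open>Q\<close>,
    so the product of conjugates becomes a product of elements of \<open>Q\<close> applied to the
    one vector \<open>r\<close>.\<close>
  define h where "h = (\<lambda>g. g \<otimes>\<^bsub>H\<^esub> (x \<otimes>\<^bsub>H\<^esub> inv\<^bsub>H\<^esub> g \<otimes>\<^bsub>H\<^esub> inv\<^bsub>H\<^esub> x))"
  have hQ: "h g \<in> Q" if "g \<in> Q" for g
    unfolding h_def by (intro subgroup.m_closed[OF Q(1)] xQ subgroup.m_inv_closed[OF Q(1)] that)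
  define u where "u = (\<lambda>g. (delta ^^ (d - 2)) (act (h g) r))"
  have uW: "u \<in> Q \<rightarrow> carrier W" unfolding u_def using act_closed[OF Qc[OF hQ] r(2)] by auto
  let ?c = "\<lambda>g. x \<otimes>\<^bsub>H\<^esub> g \<otimes>\<^bsub>H\<^esub> inv\<^bsub>H\<^esub> x"
  have cpow: "(?c ^^ i) g = x [^]\<^bsub>H\<^esub> i \<otimes>\<^bsub>H\<^esub> g \<otimes>\<^bsub>H\<^esub> inv\<^bsub>H\<^esub> (x [^]\<^bsub>H\<^esub> i)" if "g \<in> Q" for g and i :: nat
  proof (induction i)
    case (Suc i)
    have e: "x [^]\<^bsub>H\<^esub> Suc i = x \<otimes>\<^bsub>H\<^esub> x [^]\<^bsub>H\<^esub> i" using x by (rule H.nat_pow_Suc2)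
    show ?case unfolding e funpow.simps comp_apply Suc
      using x Qc[OF that] by (simp only: H.group_normalize H.nat_pow_closed H.m_closed H.inv_closed)
  qed (use Qc[OF that] in simp)
  \<comment> \<open>\<open>h\<close> commutes with conjugation by \<open>x\<close>, so the orbit of
    \<open>g\<close> contributes the conjugates of \<open>h g\<close> by successive powers of
    \<open>x\<close>.\<close>
  have hc: "h ((?c ^^ i) g) = x [^]\<^bsub>H\<^esub> i \<otimes>\<^bsub>H\<^esub> h g \<otimes>\<^bsub>H\<^esub> inv\<^bsub>H\<^esub> (x [^]\<^bsub>H\<^esub> i)" if "g \<in> Q" for g and i :: nat
  proof -
    have "x [^]\<^bsub>H\<^esub> i \<otimes>\<^bsub>H\<^esub> x = x \<otimes>\<^bsub>H\<^esub> x [^]\<^bsub>H\<^esub> i" using H.nat_pow_Suc2[OF x, of i] by simp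
    then have "inv\<^bsub>H\<^esub> (x [^]\<^bsub>H\<^esub> i) \<otimes>\<^bsub>H\<^esub> inv\<^bsub>H\<^esub> x = inv\<^bsub>H\<^esub> x \<otimes>\<^bsub>H\<^esub> inv\<^bsub>H\<^esub> (x [^]\<^bsub>H\<^esub> i)"
      and "inv\<^bsub>H\<^esub> (x [^]\<^bsub>H\<^esub> i) \<otimes>\<^bsub>H\<^esub> x = x \<otimes>\<^bsub>H\<^esub> inv\<^bsub>H\<^esub> (x [^]\<^bsub>H\<^esub> i)"
      using x by (metis H.inv_mult_group H.nat_pow_closed, metis H.inv_solve_left' H.inv_solve_right' H.m_assoc H.m_closed H.nat_pow_closed H.inv_closed)
    note e = this
    have a: "inv\<^bsub>H\<^esub> (x [^]\<^bsub>H\<^esub> i) \<otimes>\<^bsub>H\<^esub> (x \<otimes>\<^bsub>H\<^esub> z) = x \<otimes>\<^bsub>H\<^esub> (inv\<^bsub>H\<^esub> (x [^]\<^bsub>H\<^esub> i) \<otimes>\<^bsub>H\<^esub> z)" if "z \<in> carrier H" for z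
      using e(2) x that by (metis H.inv_closed H.m_assoc H.nat_pow_closed)
    show ?thesis unfolding cpow[OF that] h_def
      using x Qc[OF that] by (simp add: H.group_normalize a e(1))
  qed
  have fin: "finite (Q - Qx)" using Q(2) by simp
  have "finprod W u (Q - Qx) = \<one>"
  proof (rule finprod_free_orbits[OF fin prime_p, of ?c])
    fix g assume g: "g \<in> Q - Qx"
    then have gQ: "g \<in> Q" by simp
    show "?c g \<in> Q - Qx"
    proof -
      have "?c g \<notin> Qx"
      proof
        assume "?c g \<in> Qx"
        then have "?c (?c g) = ?c g" by (simp add: Qx_def)
        then have "?c g = g" using x Qc[OF gQ] by simp
        then show False using g by (simp add: Qx_def)
      qed
      then show ?thesis using xQ[OF gQ] by simp
    qed
    show "?c g \<noteq> g" using g by (auto simp: Qx_def)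
    show "(?c ^^ p) g = g" unfolding cpow[OF gQ] xp_comm[OF gQ] using x Qc[OF gQ] by (simp add: H.m_assoc)
    show "finprod W (\<lambda>i. u ((?c ^^ i) g)) {..<p} = \<one>"
      unfolding u_def hc[OF gQ] by (rule prod_conj_vanish[OF Y van hQ[OF gQ] r(1) d])
  qed (use uW in auto)
  \<comment> \<open>For \<open>g\<close> commuting with \<open>x\<close> the element
    \<open>h g\<close> is trivial, so these factors are all equal.\<close>
  moreover have "finprod W u Qx = (delta ^^ (d - 2)) r [^] card Qx"
  proof -
    have "finprod W u Qx = finprod W (\<lambda>g. (delta ^^ (d - 2)) r) Qx"
    proof (rule finprod_cong')
      fix g assume "g \<in> Qx"
      then have g: "g \<in> Q" "?c g = g" by (auto simp: Qx_def)
      have "h g = g \<otimes>\<^bsub>H\<^esub> inv\<^bsub>H\<^esub> (?c g)" unfolding h_def using x Qc[OF g(1)] by (simp add: H.group_normalize)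
      then have "h g = \<one>\<^bsub>H\<^esub>" unfolding g(2) using Qc[OF g(1)] by simp
      then show "u g = (delta ^^ (d - 2)) r" unfolding u_def using act_one[OF r(2)] by simp
    qed (use r(2) in auto)
    then show ?thesis using finprod_const[OF N.hom_closed[OF r(2)]] by simp
  qed
  moreover have "finprod W u Q = finprod W u Qx \<otimes> finprod W u (Q - Qx)"
  proof -
    have "finprod W u (Qx \<union> (Q - Qx)) = finprod W u Qx \<otimes> finprod W u (Q - Qx)"
      by (rule finprod_Un_disjoint) (use Q(2) uW in \<open>auto simp: Qx_def Pi_def\<close>)
    moreover have "Qx \<union> (Q - Qx) = Q" by (auto simp: Qx_def)
    ultimately show ?thesis by simp
  qed
  moreover have "(delta ^^ (d - 2)) (conj_sum w) = finprod W u Q"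
  proof -
    have "conj_sum w = finprod W (\<lambda>g. act (h g) r) Q"
      unfolding conj_sum_def
    proof (rule finprod_cong')
      fix g assume g: "g \<in> Q"
      have "g \<otimes>\<^bsub>H\<^esub> x \<otimes>\<^bsub>H\<^esub> inv\<^bsub>H\<^esub> g = h g \<otimes>\<^bsub>H\<^esub> x"
        unfolding h_def using x Qc[OF g] by (simp add: H.group_normalize)
      then show "act (g \<otimes>\<^bsub>H\<^esub> x \<otimes>\<^bsub>H\<^esub> inv\<^bsub>H\<^esub> g) w = act (h g) r"
        unfolding r_def using act_mult[OF Qc[OF hQ[OF g]] x wW] by simp
    qed (use act_closed Qc hQ r(2) in auto)
    then show ?thesis
      unfolding u_def using hom_finprod[OF N.homh, of "\<lambda>g. act (h g) r" Q] act_closed Qc hQ r(2) by auto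
  qed
  ultimately have cs: "(delta ^^ (d - 2)) (conj_sum w) = (delta ^^ (d - 2)) r [^] card Qx"
    using N.hom_closed[OF r(2)] by simp
  have "r = w \<otimes> delta w" unfolding r_def delta_def using act_closed[OF x wW] wW by (simp add: m_lcomm[of w])
  then have "(delta ^^ (d - 2)) r = (delta ^^ (d - 2)) w \<otimes> (delta ^^ Suc (d - 2)) w"
    using wW by (simp add: funpow_swap1)
  moreover have "Suc (d - 2) = d - 1" using d by simp
  ultimately have r2: "(delta ^^ (d - 2)) r = (delta ^^ (d - 2)) w \<otimes> (delta ^^ (d - 1)) w" by simp
  have c1: "(delta ^^ (d - 1)) w \<in> carrier W" using group_hom.hom_closed[OF delta_pow_group_hom wW] .
  have "(delta ^^ (d - 2)) (defect w) = (delta ^^ (d - 2)) r [^] card Qx \<otimes> inv ((delta ^^ (d - 2)) w [^] card Qx)"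
    unfolding defect_def using wW cs N.hom_nat_pow[OF wW] by simp
  also have "\<dots> = (delta ^^ (d - 1)) w [^] card Qx"
    unfolding r2 using wW c1 by (simp add: nat_pow_distrib m_ac m_lcomm[of "(delta ^^ (d - 2)) w [^] card Qx"])
  finally show ?thesis .
qed

text \<open>If \<open>x\<close> fixes all of \<open>Y\<close>, then so does every
  \<open>g^-1 (x g x^-1)\<close>, and these generate \<open>Q\<close>. On a vector fixed by
  \<open>Q\<close> the trace is the power with exponent \<open>card Q\<close>, which is prime to
  \<open>p\<close>.\<close>

lemma delta_trivial_imp_trivial:
  assumes gen: "Q \<subseteq> generate H {inv\<^bsub>H\<^esub> g \<otimes>\<^bsub>H\<^esub> (x \<otimes>\<^bsub>H\<^esub> g \<otimes>\<^bsub>H\<^esub> inv\<^bsub>H\<^esub> x) | g. g \<in> Q}"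
    and Y: "stable_set Y" and Y0: "\<And>w. w \<in> Y \<Longrightarrow> orbit_prod Q w = \<one>" and van: "\<And>w. w \<in> Y \<Longrightarrow> delta w = \<one>"
    and w: "w \<in> Y"
  shows "w = \<one>"
proof -
  have YW: "v \<in> carrier W" if "v \<in> Y" for v using Y that by (auto simp: stable_set_def)
  have xY: "act x v = v" if v: "v \<in> Y" for v
    using div_eq_one[OF act_closed[OF x YW[OF v]] YW[OF v]] van[OF v] unfolding delta_def by blast
  have ixY: "act (inv\<^bsub>H\<^esub> x) v = v" if v: "v \<in> Y" for v
    using xY[OF v] act_inv_cancel(1)[OF x YW[OF v]] by simp
  let ?S = "{h \<in> carrier H. act h w = w}"
  have sS: "subgroup ?S H"
  proof (rule H.subgroupI)
    show "?S \<noteq> {}" using act_one[OF YW[OF w]] by blast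
    show "inv\<^bsub>H\<^esub> a \<in> ?S" if "a \<in> ?S" for a using that act_inv_cancel(1)[of a w] YW[OF w] by auto
    show "a \<otimes>\<^bsub>H\<^esub> b \<in> ?S" if "a \<in> ?S" "b \<in> ?S" for a b using that act_mult[of a b w] YW[OF w] by auto
  qed auto
  have "{inv\<^bsub>H\<^esub> g \<otimes>\<^bsub>H\<^esub> (x \<otimes>\<^bsub>H\<^esub> g \<otimes>\<^bsub>H\<^esub> inv\<^bsub>H\<^esub> x) | g. g \<in> Q} \<subseteq> ?S"
  proof
    fix a assume "a \<in> {inv\<^bsub>H\<^esub> g \<otimes>\<^bsub>H\<^esub> (x \<otimes>\<^bsub>H\<^esub> g \<otimes>\<^bsub>H\<^esub> inv\<^bsub>H\<^esub> x) | g. g \<in> Q}"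
    then obtain g where g: "g \<in> Q" "a = inv\<^bsub>H\<^esub> g \<otimes>\<^bsub>H\<^esub> (x \<otimes>\<^bsub>H\<^esub> g \<otimes>\<^bsub>H\<^esub> inv\<^bsub>H\<^esub> x)" by blast
    note gc = Qc[OF g(1)]
    have gw: "act g w \<in> Y" using Y w g(1) by (auto simp: stable_set_def)
    have "act a w = act (inv\<^bsub>H\<^esub> g) (act x (act g (act (inv\<^bsub>H\<^esub> x) w)))"
      unfolding g(2) using gc x YW[OF w] by (simp add: act_mult act_closed)
    also have "\<dots> = w" using ixY[OF w] xY[OF gw] act_inv_cancel(1)[OF gc YW[OF w]] by simp
    finally show "a \<in> ?S" using g(2) gc x by simp
  qed
  then have "Q \<subseteq> ?S" using H.generate_subgroup_incl[OF _ sS] gen by blast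
  have "orbit_prod Q w = finprod W (\<lambda>g. w) Q"
    using \<open>Q \<subseteq> ?S\<close> unfolding orbit_prod_def by (intro finprod_cong') (use YW[OF w] in auto)
  also have "\<dots> = w [^] card Q" by (rule finprod_const[OF YW[OF w]])
  finally have "w [^] card Q = \<one>" using Y0[OF w] by simp
  then show ?thesis using coprime_pow_one[OF YW[OF w] _ cop] by blast
qed

text \<open>The degree of nilpotency is lowered twice, each time down to 1, where
  \<open>delta_trivial_imp_trivial\<close> applies. On the kernel \<open>K\<close> of
  \<open>defect\<close>, the identity \<open>defect_vanish\<close> says that \<open>card Qx\<close>
  times \<open>delta^(d-1)\<close> is zero, so \<open>K\<close> is trivial. On the whole kernel of
  the trace, applying \<open>delta\<close> once more shows that \<open>delta^(d-1)\<close> maps into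
  \<open>K\<close>, hence vanishes too.\<close>

lemma delta_small_imp_trivial:
  assumes gen: "Q \<subseteq> generate H {inv\<^bsub>H\<^esub> g \<otimes>\<^bsub>H\<^esub> (x \<otimes>\<^bsub>H\<^esub> g \<otimes>\<^bsub>H\<^esub> inv\<^bsub>H\<^esub> x) | g. g \<in> Q}"
    and van: "\<And>w. w \<in> carrier W \<Longrightarrow> orbit_prod Q w = \<one> \<Longrightarrow> (delta ^^ (p - 2)) w = \<one>" and p: "p > 2"
    and w: "w \<in> carrier W" "orbit_prod Q w = \<one>"
  shows "w = \<one>"
proof -
  have QH: "Q \<subseteq> carrier H" using Qc by blast
  interpret op: group_hom W W "orbit_prod Q" by (rule orbit_prod_hom[OF QH])
  define K0 where "K0 = {w \<in> carrier W. orbit_prod Q w = \<one>}"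
  \<comment> \<open>Conjugation by \<open>y\<close> permutes the summands of the trace, so the
    kernel of the trace is stable under \<open>x\<close> and its inverse.\<close>
  have op_x: "orbit_prod Q (act y v) = act y (orbit_prod Q v)"
    if y: "y \<in> carrier H" and v: "v \<in> carrier W" and yQ: "\<And>g. g \<in> Q \<Longrightarrow> inv\<^bsub>H\<^esub> y \<otimes>\<^bsub>H\<^esub> g \<otimes>\<^bsub>H\<^esub> y \<in> Q" for y v
  proof -
    let ?c = "\<lambda>g. inv\<^bsub>H\<^esub> y \<otimes>\<^bsub>H\<^esub> g \<otimes>\<^bsub>H\<^esub> y"
    have inj: "inj_on ?c Q" using Qc y by (auto simp: inj_on_def)
    have im: "?c ` Q = Q" using Q(2) inj yQ by (simp add: endo_inj_surj image_subset_iff)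
    have "orbit_prod Q (act y v) = finprod W (\<lambda>g. act y (act (?c g) v)) Q"
      unfolding orbit_prod_def
    proof (rule finprod_cong')
      fix g assume "g \<in> Q"
      then have gc: "g \<in> carrier H" by (rule Qc)
      have "act g (act y v) = act (y \<otimes>\<^bsub>H\<^esub> ?c g) v"
        using gc y v by (simp add: H.group_normalize flip: act_mult)
      then show "act g (act y v) = act y (act (?c g) v)" using gc y v by (simp add: act_mult)
    qed (use act_closed y v Qc in auto)
    also have "\<dots> = act y (finprod W (\<lambda>g. act (?c g) v) Q)"
      by (rule hom_finprod[OF act_hom[OF y], symmetric]) (use act_closed y v Qc in auto)
    also have "finprod W (\<lambda>g. act (?c g) v) Q = orbit_prod Q v"
      unfolding orbit_prod_def using finprod_reindex[of "\<lambda>g. act g v" ?c Q] im inj act_closed v Qc by auto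
    finally show ?thesis .
  qed
  have xinvQ: "inv\<^bsub>H\<^esub> x \<otimes>\<^bsub>H\<^esub> g \<otimes>\<^bsub>H\<^esub> x \<in> Q" if g: "g \<in> Q" for g
  proof -
    have "(\<lambda>g. x \<otimes>\<^bsub>H\<^esub> g \<otimes>\<^bsub>H\<^esub> inv\<^bsub>H\<^esub> x) ` Q = Q"
      using Q(2) xQ Qc x by (intro endo_inj_surj) (auto simp: inj_on_def)
    then obtain k where k: "k \<in> Q" "g = x \<otimes>\<^bsub>H\<^esub> k \<otimes>\<^bsub>H\<^esub> inv\<^bsub>H\<^esub> x" using g by blast
    then show ?thesis using x Qc[OF k(1)] by (simp add: H.group_normalize)
  qed
  have stK0: "stable_set K0"
    unfolding stable_set_def
  proof (intro conjI ballI)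
    fix v assume "v \<in> K0"
    then have v: "v \<in> carrier W" "orbit_prod Q v = \<one>" by (auto simp: K0_def)
    show "inv v \<in> K0" using v by (simp add: K0_def)
    show "act g v \<in> K0" if "g \<in> Q" for g
      using orbit_prod_act(1)[OF Q(1) that v(1)] v act_closed[OF Qc[OF that] v(1)] by (simp add: K0_def)
    show "act x v \<in> K0" using op_x[OF x v(1) xinvQ] v act_unit[OF x] act_closed[OF x] by (simp add: K0_def)
    show "act (inv\<^bsub>H\<^esub> x) v \<in> K0"
      using op_x[of "inv\<^bsub>H\<^esub> x" v] xQ v act_unit[of "inv\<^bsub>H\<^esub> x"] act_closed[of "inv\<^bsub>H\<^esub> x"] x by (simp add: K0_def)
    fix u assume "u \<in> K0"
    then show "v \<otimes> u \<in> K0" using v by (simp add: K0_def)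
  qed (auto simp: K0_def)
  \<comment> \<open>A submodule, since \<open>defect\<close> commutes with \<open>Q\<close> and with
    \<open>x\<close>. This is the benefit of working with \<open>conj_sum\<close>.\<close>
  define K where "K = {w \<in> K0. defect w = \<one>}"
  have KK: "K \<subseteq> K0" and K0W: "K0 \<subseteq> carrier W" by (auto simp: K_def K0_def)
  have stK: "stable_set K"
    unfolding stable_set_def
  proof (intro conjI ballI)
    show "K \<subseteq> carrier W" using KK K0W by blast
    fix v assume "v \<in> K"
    then have v: "v \<in> K0" "defect v = \<one>" by (auto simp: K_def)
    have vW: "v \<in> carrier W" using v K0W by blast
    show "inv v \<in> K" using v vW stK0 by (auto simp: K_def stable_set_def)
    show "act g v \<in> K" if "g \<in> Q" for g
      using defect_Q[OF that vW] act_unit[OF Qc[OF that]] v stK0 that by (auto simp: K_def stable_set_def)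
    show "act x v \<in> K" using defect_x[OF vW] act_unit[OF x] v stK0 by (auto simp: K_def stable_set_def)
    have ix: "act (inv\<^bsub>H\<^esub> x) v \<in> carrier W" using act_closed x vW by simp
    have "act x (defect (act (inv\<^bsub>H\<^esub> x) v)) = \<one>"
      using defect_x[OF ix] v(2) act_inv_cancel(2)[OF x vW] by simp
    then have "defect (act (inv\<^bsub>H\<^esub> x) v) = \<one>"
      using act_inv_cancel(1)[OF x df.hom_closed[OF ix]] act_unit[of "inv\<^bsub>H\<^esub> x"] x by simp
    then show "act (inv\<^bsub>H\<^esub> x) v \<in> K" using v stK0 by (auto simp: K_def stable_set_def)
    fix u assume "u \<in> K"
    then show "v \<otimes> u \<in> K" using v stK0 K0W by (auto simp: K_def stable_set_def subset_iff)
  qed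
  have descend: "\<forall>v\<in>Y. delta v = \<one>"
    if "1 \<le> d" "d \<le> p - 2" "\<forall>v\<in>Y. (delta ^^ d) v = \<one>"
      and st: "\<And>d. 2 \<le> d \<Longrightarrow> d \<le> p - 2 \<Longrightarrow> \<forall>v\<in>Y. (delta ^^ d) v = \<one> \<Longrightarrow> \<forall>v\<in>Y. (delta ^^ (d - 1)) v = \<one>"
    for Y d
    using that(1-3)
  proof (induction d)
    case (Suc d)
    show ?case
    proof (cases "d = 0")
      case True
      then show ?thesis using Suc.prems(3) by simp
    next
      case False
      then have "\<forall>v\<in>Y. (delta ^^ (Suc d - 1)) v = \<one>" using Suc.prems(2,3) by (intro st) auto
      then show ?thesis using Suc.IH Suc.prems(2) False by simp
    qed
  qed simp
  have Ktriv: "v = \<one>" if d: "1 \<le> d" "d \<le> p - 2" and vanK: "\<forall>v\<in>K. (delta ^^ d) v = \<one>" and v: "v \<in> K" for d v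
  proof (rule delta_trivial_imp_trivial[OF gen stK _ _ v])
    have "\<forall>v\<in>K. delta v = \<one>"
    proof (rule descend[OF d vanK], rule ballI)
      fix d v assume d: "2 \<le> d" "d \<le> p - 2" and van: "\<forall>v\<in>K. (delta ^^ d) v = \<one>" and v: "v \<in> K"
      have vW: "v \<in> carrier W" using v KK K0W by blast
      have c: "(delta ^^ (d - 1)) v \<in> carrier W" using group_hom.hom_closed[OF delta_pow_group_hom vW] .
      have "defect v = \<one>" using v by (simp add: K_def)
      then have "(delta ^^ (d - 1)) v [^] card Qx = \<one>"
        using defect_vanish[OF stK _ v d] van group_hom.hom_one[OF delta_pow_group_hom[of "d - 2"]] by simp
      then show "(delta ^^ (d - 1)) v = \<one>" by (rule coprime_pow_one[OF c _ Qx_coprime])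
    qed
    then show "\<And>v. v \<in> K \<Longrightarrow> delta v = \<one>" by blast
    show "\<And>v. v \<in> K \<Longrightarrow> orbit_prod Q v = \<one>" by (simp add: K_def K0_def)
  qed
  show ?thesis
  proof (rule delta_trivial_imp_trivial[OF gen stK0])
    have "1 \<le> p - 2" using p by simp
    moreover have "\<forall>v\<in>K0. (delta ^^ (p - 2)) v = \<one>" using van by (simp add: K0_def)
    ultimately have "\<forall>v\<in>K0. delta v = \<one>"
    proof (rule descend[OF _ order_refl], intro ballI)
      fix d v assume d: "2 \<le> d" "d \<le> p - 2" and vand: "\<forall>v\<in>K0. (delta ^^ d) v = \<one>" and v: "v \<in> K0"
      have vW: "v \<in> carrier W" using v K0W by blast
      have c: "(delta ^^ (d - 1)) v \<in> carrier W" using group_hom.hom_closed[OF delta_pow_group_hom vW] .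
      obtain e where e: "d = Suc (Suc e)" using d(1) by (metis add_2_eq_Suc le_Suc_ex)
      \<comment> \<open>Here \<open>d = e + 2\<close>: one factor \<open>delta\<close> is pulled
        out, because \<open>defect_vanish\<close> carries exactly \<open>e\<close> of them.\<close>
      have "defect ((delta ^^ Suc e) v) = delta ((delta ^^ e) (defect v))"
        unfolding defect_delta[OF vW] by simp
      also have "\<dots> = delta ((delta ^^ Suc e) v [^] card Qx)"
        using defect_vanish[OF stK0 _ v d] vand unfolding e by (simp del: funpow.simps)
      also have "\<dots> = (delta ^^ d) v [^] card Qx"
        using delta.hom_nat_pow[OF c] unfolding e by simp
      finally have "(delta ^^ Suc e) v \<in> K" using vand v stable_delta[OF stK0 v, of "Suc e"]
        by (simp add: K_def del: funpow.simps)
      then show "(delta ^^ (d - 1)) v = \<one>" using Ktriv[of d "(delta ^^ Suc e) v"] d vand KK unfolding e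
        by (auto simp del: funpow.simps)
    qed
    then show "\<And>v. v \<in> K0 \<Longrightarrow> delta v = \<one>" by blast
    show "\<And>v. v \<in> K0 \<Longrightarrow> orbit_prod Q v = \<one>" by (simp add: K0_def)
    show "w \<in> K0" using w by (simp add: K0_def)
  qed
qed

end

text \<open>Induction on the order of \<open>Q\<close> through \<open>Q1 = [Q, x]\<close>. If
  \<open>Q1 = Q\<close>, the kernel of the trace is trivial and \<open>Q\<close> acts trivially.
  Otherwise \<open>x\<close> commutes with \<open>Q1\<close> on \<open>W\<close> by induction; for
  \<open>c = g^-1 (x g x^-1)\<close> this gives \<open>x^p g = g c^p x^p\<close> on
  \<open>W\<close>, so \<open>c^p\<close> acts trivially, and then so does \<open>c\<close>, whose
  order is prime to \<open>p\<close>.\<close>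

theorem (in p_module) commute_of_small_delta:
  assumes "x \<in> carrier H" "subgroup Q H" "finite Q" "coprime (card Q) p"
    and "\<And>g. g \<in> Q \<Longrightarrow> x \<otimes>\<^bsub>H\<^esub> g \<otimes>\<^bsub>H\<^esub> inv\<^bsub>H\<^esub> x \<in> Q"
    and "\<And>g. g \<in> Q \<Longrightarrow> x [^]\<^bsub>H\<^esub> p \<otimes>\<^bsub>H\<^esub> g = g \<otimes>\<^bsub>H\<^esub> x [^]\<^bsub>H\<^esub> p"
    and "\<And>w. w \<in> carrier W \<Longrightarrow> act (x [^]\<^bsub>H\<^esub> p) w = w"
    and "p > 2"
    and "\<And>w. w \<in> carrier W \<Longrightarrow> orbit_prod Q w = \<one> \<Longrightarrow> ((\<lambda>w. act x w \<otimes> inv w) ^^ (p - 2)) w = \<one>"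
    and "g \<in> Q" "w \<in> carrier W"
  shows "act x (act g w) = act g (act x w)"
  using assms(2-7,9-)
proof (induction "card Q" arbitrary: Q g w rule: less_induct)
  case less
  interpret po: p_module_operator W H act p x Q
    using less.prems assms(1) by (intro p_module_operator.intro p_module_operator_axioms.intro p_module_axioms) auto
  note x = assms(1)
  have d: "po.delta = (\<lambda>w. act x w \<otimes> inv w)" by (rule ext) (rule po.delta_def)
  define T where "T = {inv\<^bsub>H\<^esub> g \<otimes>\<^bsub>H\<^esub> (x \<otimes>\<^bsub>H\<^esub> g \<otimes>\<^bsub>H\<^esub> inv\<^bsub>H\<^esub> x) | g. g \<in> Q}"
  have TQ: "T \<subseteq> Q"
  proof
    fix t assume "t \<in> T"
    then obtain g where g: "g \<in> Q" "t = inv\<^bsub>H\<^esub> g \<otimes>\<^bsub>H\<^esub> (x \<otimes>\<^bsub>H\<^esub> g \<otimes>\<^bsub>H\<^esub> inv\<^bsub>H\<^esub> x)" by (auto simp: T_def)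
    show "t \<in> Q"
      unfolding g(2) by (intro subgroup.m_closed[OF less.prems(1)] subgroup.m_inv_closed[OF less.prems(1)] less.prems(4) g(1))
  qed
  define Q1 where "Q1 = generate H T"
  have Q1Q: "Q1 \<subseteq> Q" unfolding Q1_def by (rule H.generate_subgroup_incl[OF TQ less.prems(1)])
  have TH: "T \<subseteq> carrier H" using TQ po.Qc by blast
  have sQ1: "subgroup Q1 H" unfolding Q1_def by (rule H.generate_is_subgroup[OF TH])
  show ?case
  proof (cases "Q1 = Q")
    case True
    have gen: "Q \<subseteq> generate H T" unfolding Q1_def[symmetric] True ..
    have triv: "v = \<one>" if "v \<in> carrier W" "orbit_prod Q v = \<one>" for v
      by (rule po.delta_small_imp_trivial[OF gen[unfolded T_def] _ assms(8) that]) (use less.prems(7) d in simp)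
    have fixed: "act g v = v" if g: "g \<in> Q" and v: "v \<in> carrier W" for g v
    proof -
      have QH: "Q \<subseteq> carrier H" using po.Qc by blast
      interpret op: group_hom W W "orbit_prod Q" by (rule orbit_prod_hom[OF QH])
      have ov: "orbit_prod Q v \<in> carrier W" by (rule orbit_prod_closed[OF QH v])
      have "orbit_prod Q (orbit_prod Q v) = finprod W (\<lambda>g. orbit_prod Q v) Q"
        unfolding orbit_prod_def[of Q "orbit_prod Q v"]
        by (rule finprod_cong') (use orbit_prod_act(2)[OF less.prems(1) _ v] ov in auto)
      also have "\<dots> = orbit_prod Q v [^] card Q" by (rule finprod_const[OF ov])
      \<comment> \<open>Averaging: the power of \<open>v\<close> with exponent \<open>card Q\<close>
        and the trace of \<open>v\<close> have the same trace, so they agree, and that power is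
        fixed by \<open>Q\<close>.\<close>
      finally have o1: "orbit_prod Q (v [^] card Q \<otimes> inv (orbit_prod Q v)) = \<one>"
        using v ov op.hom_nat_pow[OF v, of "card Q"] by simp
      have "v [^] card Q \<otimes> inv (orbit_prod Q v) = \<one>" by (rule triv[OF _ o1]) (use v ov in simp)
      from div_eq_one[OF nat_pow_closed[OF v] ov this] have "v [^] card Q = orbit_prod Q v" .
      then have "act g (v [^] card Q) = v [^] card Q" using orbit_prod_act(2)[OF less.prems(1) g v] by simp
      then have "(act g v \<otimes> inv v) [^] card Q = \<one>"
        using act_closed[OF po.Qc[OF g] v] v act_pow[OF po.Qc[OF g] v] by (simp add: nat_pow_distrib nat_pow_inv)
      then have "act g v \<otimes> inv v = \<one>"
        using coprime_pow_one[of "act g v \<otimes> inv v" "card Q"] act_closed[OF po.Qc[OF g] v] v less.prems(3) by simp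
      then show ?thesis using div_eq_one[OF act_closed[OF po.Qc[OF g] v] v] by blast
    qed
    show ?thesis using fixed[OF less.prems(8)] less.prems(9) act_closed[OF x] by simp
  next
    case False
    then have lt: "card Q1 < card Q" using Q1Q less.prems(2) by (simp add: psubset_card_mono psubsetI)
    have fQ1: "finite Q1" using Q1Q less.prems(2) finite_subset by blast
    have copQ1: "coprime (card Q1) p"
      using H.card_subgroup_dvd[OF less.prems(1) sQ1 Q1Q less.prems(2)] less.prems(3) coprime_divisors[of "card Q1" "card Q" p p] by simp
    have xQ1: "x \<otimes>\<^bsub>H\<^esub> q \<otimes>\<^bsub>H\<^esub> inv\<^bsub>H\<^esub> x \<in> Q1" if "q \<in> Q1" for q
    proof -
      let ?c = "\<lambda>q. x \<otimes>\<^bsub>H\<^esub> q \<otimes>\<^bsub>H\<^esub> inv\<^bsub>H\<^esub> x"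
      have "?c \<in> hom H H" by (rule homI) (use x in \<open>auto simp: H.group_normalize\<close>)
      then interpret c: group_hom H H ?c by (simp add: group_hom_def group_hom_axioms_def H.group_axioms)
      have "?c ` T \<subseteq> T"
      proof
        fix y assume "y \<in> ?c ` T"
        then obtain g where g: "g \<in> Q" "y = ?c (inv\<^bsub>H\<^esub> g \<otimes>\<^bsub>H\<^esub> ?c g)" by (auto simp: T_def)
        have "y = inv\<^bsub>H\<^esub> (?c g) \<otimes>\<^bsub>H\<^esub> ?c (?c g)" unfolding g(2) using x po.Qc[OF g(1)] by (simp add: H.group_normalize)
        then show "y \<in> T" unfolding T_def using less.prems(4)[OF g(1)] by blast
      qed
      then have "?c ` Q1 \<subseteq> Q1"
        unfolding Q1_def c.generate_img[OF TH, symmetric] by (rule H.mono_generate)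
      then show ?thesis using that by blast
    qed
    \<comment> \<open>The trace of \<open>Q\<close> absorbs that of \<open>Q1\<close> up to the
      factor \<open>card Q1\<close>, so the nilpotency hypothesis descends to
      \<open>Q1\<close>.\<close>
    have K0: "orbit_prod Q v = \<one>" if v: "v \<in> carrier W" "orbit_prod Q1 v = \<one>" for v
    proof -
      have QH: "Q \<subseteq> carrier H" using po.Qc by blast
      have ov: "orbit_prod Q v \<in> carrier W" by (rule orbit_prod_closed[OF QH v(1)])
      interpret op: group_hom W W "orbit_prod Q" by (rule orbit_prod_hom[OF QH])
      have "orbit_prod Q v [^] card Q1 = finprod W (\<lambda>q. orbit_prod Q v) Q1" by (rule finprod_const[OF ov, symmetric])
      also have "\<dots> = finprod W (\<lambda>q. orbit_prod Q (act q v)) Q1"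
        by (rule finprod_cong') (use orbit_prod_act(1)[OF less.prems(1) _ v(1)] Q1Q ov in auto)
      also have "\<dots> = orbit_prod Q (orbit_prod Q1 v)"
        unfolding orbit_prod_def[of Q1] by (rule hom_finprod[OF op.homh, symmetric]) (use act_closed Q1Q po.Qc v(1) in blast)
      finally show ?thesis using v(2) coprime_pow_one[OF ov _ copQ1] by simp
    qed
    have IH: "act x (act q v) = act q (act x v)" if "q \<in> Q1" "v \<in> carrier W" for q v
      by (rule less.hyps[OF lt sQ1 fQ1 copQ1 xQ1 _ _ _ that])
        (use less.prems(5,6,7) Q1Q K0 in auto)
    define c where "c = inv\<^bsub>H\<^esub> g \<otimes>\<^bsub>H\<^esub> (x \<otimes>\<^bsub>H\<^esub> g \<otimes>\<^bsub>H\<^esub> inv\<^bsub>H\<^esub> x)"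
    note g = less.prems(8) and w = less.prems(9)
    have gc: "g \<in> carrier H" by (rule po.Qc[OF g])
    have cQ1: "c \<in> Q1" unfolding Q1_def by (rule generate.incl) (use g in \<open>auto simp: T_def c_def\<close>)
    have cH: "c \<in> carrier H" using x gc by (simp add: c_def)
    have cpow: "c [^]\<^bsub>H\<^esub> (i::nat) \<in> Q1" for i
      by (induction i) (simp_all add: subgroup.one_closed[OF sQ1] subgroup.m_closed[OF sQ1] cQ1)
    have xg: "x \<otimes>\<^bsub>H\<^esub> g = g \<otimes>\<^bsub>H\<^esub> c \<otimes>\<^bsub>H\<^esub> x" unfolding c_def using x gc by (simp add: H.group_normalize)
    have xi: "act (x [^]\<^bsub>H\<^esub> i) v \<in> carrier W" if "v \<in> carrier W" for i :: nat and v using act_closed x that by simp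
    have xgw: "act x (act g u) = act g (act c (act x u))" if u: "u \<in> carrier W" for u
    proof -
      have "act x (act g u) = act (g \<otimes>\<^bsub>H\<^esub> c \<otimes>\<^bsub>H\<^esub> x) u" using act_mult[OF x gc u] xg by simp
      then show ?thesis using x gc cH u by (simp add: act_mult act_closed)
    qed
    have iter: "act (x [^]\<^bsub>H\<^esub> i) (act g v) = act g (act (c [^]\<^bsub>H\<^esub> i) (act (x [^]\<^bsub>H\<^esub> i) v))"
      if v: "v \<in> carrier W" for i :: nat and v
    proof (induction i)
      case 0
      then show ?case using act_one v act_closed gc by simp
    next
      case (Suc i)
      let ?v = "act (x [^]\<^bsub>H\<^esub> i) v"
      have "act (x [^]\<^bsub>H\<^esub> Suc i) (act g v) = act x (act g (act (c [^]\<^bsub>H\<^esub> i) ?v))"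
        unfolding H.nat_pow_Suc2[OF x] using Suc x gc v by (simp add: act_mult act_closed)
      also have "\<dots> = act g (act c (act x (act (c [^]\<^bsub>H\<^esub> i) ?v)))"
        by (rule xgw) (use cH xi[OF v, of i] act_closed in simp)
      also have "act x (act (c [^]\<^bsub>H\<^esub> i) ?v) = act (c [^]\<^bsub>H\<^esub> i) (act x ?v)" by (rule IH[OF cpow xi[OF v]])
      also have "act x ?v = act (x [^]\<^bsub>H\<^esub> Suc i) v"
        unfolding H.nat_pow_Suc2[OF x] using x v by (simp add: act_mult)
      also have "act c (act (c [^]\<^bsub>H\<^esub> i) (act (x [^]\<^bsub>H\<^esub> Suc i) v)) = act (c [^]\<^bsub>H\<^esub> Suc i) (act (x [^]\<^bsub>H\<^esub> Suc i) v)"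
        unfolding H.nat_pow_Suc2[OF cH] using cH xi[OF v, of "Suc i"] by (simp only: act_mult H.nat_pow_closed)
      finally show ?case .
    qed
    have cp: "act (c [^]\<^bsub>H\<^esub> p) v = v" if v: "v \<in> carrier W" for v
    proof -
      have "act g v = act g (act (c [^]\<^bsub>H\<^esub> p) v)"
        using iter[OF v, of p] less.prems(6) act_closed[OF gc v] v by simp
      then show ?thesis using act_inv_cancel(1)[OF gc] v act_closed cH by (metis H.nat_pow_closed)
    qed
    have "act c v = v" if v: "v \<in> carrier W" for v
    proof -
      obtain m :: nat where "(c [^]\<^bsub>H\<^esub> m) [^]\<^bsub>H\<^esub> p = c"
        using H.coprime_root[OF sQ1 fQ1, of p] copQ1 cQ1 by (metis coprime_commute)
      then have m: "(c [^]\<^bsub>H\<^esub> p) [^]\<^bsub>H\<^esub> m = c" using cH by (simp add: H.nat_pow_pow mult.commute)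
      have "act ((c [^]\<^bsub>H\<^esub> p) [^]\<^bsub>H\<^esub> i) v = v" for i :: nat
        by (induction i) (use v cp cH act_one act_closed in \<open>auto simp: act_mult\<close>)
      then show ?thesis using m by metis
    qed
    then show ?thesis using xgw[OF w] act_closed[OF x w] by simp
  qed
qed

section \<open>The Frattini quotient of the \<open>p\<close>-core\<close>

lemma prime_power_if_only_prime_factor:
  assumes "n > 0" "Factorial_Ring.prime (p::nat)" "\<And>q. Factorial_Ring.prime q \<Longrightarrow> q dvd n \<Longrightarrow> q = p"
  shows "\<exists>k. n = p ^ k"
proof -
  obtain m where m: "n = p ^ multiplicity p n * m" "\<not> p dvd m"
    using multiplicity_decompose'[of n p] assms(1,2) prime_gt_1_nat[OF assms(2)] by auto
  have "m = 1"
  proof (rule ccontr)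
    assume "m \<noteq> 1"
    then obtain q where q: "Factorial_Ring.prime q" "q dvd m" using prime_factor_nat by blast
    then have "q dvd n" using m(1) dvd_mult by metis
    then show False using assms(3)[OF q(1)] q(2) m(2) by simp
  qed
  then show ?thesis using m(1) by auto
qed

lemma (in group) generate_stable:
  assumes S: "S \<subseteq> carrier G" and D: "D \<subseteq> carrier G" and st: "\<And>d s. d \<in> D \<Longrightarrow> s \<in> S \<Longrightarrow> d \<otimes> s \<otimes> inv d \<in> S"
  shows "stable_subgroup G D (generate G S)"
  unfolding stable_subgroup_def
proof (intro conjI ballI)
  show "subgroup (generate G S) G" by (rule generate_is_subgroup[OF S])
  fix d x assume d: "d \<in> D" and x: "x \<in> generate G S"
  have dc: "d \<in> carrier G" using d D by blast
  let ?c = "\<lambda>q. d \<otimes> q \<otimes> inv d"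
  have "?c \<in> hom G G" by (rule homI) (use dc in \<open>auto simp: group_normalize\<close>)
  then interpret c: group_hom G G ?c by (simp add: group_hom_def group_hom_axioms_def group_axioms)
  have "?c ` S \<subseteq> S" using st[OF d] by blast
  then have "?c ` generate G S \<subseteq> generate G S"
    unfolding c.generate_img[OF S, symmetric] by (rule mono_generate)
  then show "?c x \<in> generate G S" using x by blast
qed

lemma (in group) conj_nat_pow:
  assumes "d \<in> carrier G" "x \<in> carrier G"
  shows "d \<otimes> x [^] (n::nat) \<otimes> inv d = (d \<otimes> x \<otimes> inv d) [^] n"
proof -
  let ?c = "\<lambda>q. d \<otimes> q \<otimes> inv d"
  have "?c \<in> hom G G" by (rule homI) (use assms in \<open>auto simp: group_normalize\<close>)
  then interpret c: group_hom G G ?c by (simp add: group_hom_def group_hom_axioms_def group_axioms)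
  show ?thesis by (rule c.hom_nat_pow[OF assms(2)])
qed

text \<open>For a finite \<open>p\<close>-group \<open>V\<close> these elements generate the
  Frattini subgroup. Generators, rather than an intersection of maximal subgroups, make normality
  and the elementary abelian quotient immediate; the non-generator property is
  \<open>frattini_supplement\<close>.\<close>

definition frattini_gens :: "('a,'b) monoid_scheme \<Rightarrow> nat \<Rightarrow> 'a set \<Rightarrow> 'a set" where
  "frattini_gens G p V = {v [^]\<^bsub>G\<^esub> p | v. v \<in> V}
     \<union> {u \<otimes>\<^bsub>G\<^esub> v \<otimes>\<^bsub>G\<^esub> inv\<^bsub>G\<^esub> u \<otimes>\<^bsub>G\<^esub> inv\<^bsub>G\<^esub> v | u v. u \<in> V \<and> v \<in> V}"

lemma (in group) subgroup_nat_pow: "subgroup V G \<Longrightarrow> v \<in> V \<Longrightarrow> v [^] (n::nat) \<in> V"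
  by (induction n) (simp_all add: subgroup.one_closed subgroup.m_closed)

lemma (in group) frattini_gens_subset:
  assumes V: "subgroup V G"
  shows "frattini_gens G p V \<subseteq> V"
proof
  fix x assume "x \<in> frattini_gens G p V"
  then consider v where "v \<in> V" "x = v [^] p" | u v where "u \<in> V" "v \<in> V" "x = u \<otimes> v \<otimes> inv u \<otimes> inv v"
    by (auto simp: frattini_gens_def)
  then show "x \<in> V"
  proof cases
    case 1
    then show ?thesis using subgroup_nat_pow[OF V] by simp
  next
    case 2
    then show ?thesis by (simp add: subgroup.m_closed[OF V] subgroup.m_inv_closed[OF V])
  qed
qed

lemma (in group) frattini_normal:
  assumes V: "V \<lhd> G"
  shows "generate G (frattini_gens G p V) \<lhd> G"
proof -
  have sV: "subgroup V G" and cV: "\<And>g v. g \<in> carrier G \<Longrightarrow> v \<in> V \<Longrightarrow> g \<otimes> v \<otimes> inv g \<in> V"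
    using V by (auto simp: normal_inv_iff)
  note Vc = subgroup.mem_carrier[OF sV]
  have "stable_subgroup G (carrier G) (generate G (frattini_gens G p V))"
  proof (rule generate_stable)
    show "frattini_gens G p V \<subseteq> carrier G" using frattini_gens_subset[OF sV] subgroup.subset[OF sV] by blast
    fix d s assume d: "d \<in> carrier G" and "s \<in> frattini_gens G p V"
    then consider v where "v \<in> V" "s = v [^] p" | u v where "u \<in> V" "v \<in> V" "s = u \<otimes> v \<otimes> inv u \<otimes> inv v"
      by (auto simp: frattini_gens_def)
    then show "d \<otimes> s \<otimes> inv d \<in> frattini_gens G p V"
    proof cases
      case 1
      then have "d \<otimes> s \<otimes> inv d = (d \<otimes> v \<otimes> inv d) [^] p" using conj_nat_pow[OF d] Vc by simp
      then show ?thesis using cV[OF d 1(1)] unfolding frattini_gens_def by blast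
    next
      case 2
      then have "d \<otimes> s \<otimes> inv d = (d \<otimes> u \<otimes> inv d) \<otimes> (d \<otimes> v \<otimes> inv d) \<otimes> inv (d \<otimes> u \<otimes> inv d) \<otimes> inv (d \<otimes> v \<otimes> inv d)"
        using d Vc by (simp add: group_normalize)
      then show ?thesis using cV[OF d 2(1)] cV[OF d 2(2)] unfolding frattini_gens_def by blast
    qed
  qed simp
  then show ?thesis using normal_iff_stable by simp
qed

text \<open>A proper \<open>A\<close> would lie in a proper subgroup containing all
  \<open>p\<close>-th powers and commutators of \<open>V\<close>, hence also the Frattini subgroup,
  and could not supplement it.\<close>

lemma (in group) frattini_supplement:
  assumes V: "subgroup V G" "finite V" "card V = p ^ k" and p: "Factorial_Ring.prime (p::nat)"
    and A: "subgroup A G" "A \<subseteq> V"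
    and sup: "\<And>v. v \<in> V \<Longrightarrow> \<exists>a\<in>A. v \<otimes> inv a \<in> generate G (frattini_gens G p V)"
  shows "A = V"
proof (rule ccontr)
  assume "A \<noteq> V"
  let ?V = "G\<lparr>carrier := V\<rparr>"
  interpret V: group ?V using subgroup_imp_group[OF V(1)] .
  obtain D where D: "subgroup D ?V" "A \<subseteq> D" "D \<subset> carrier ?V" "\<forall>x\<in>carrier ?V. x [^]\<^bsub>?V\<^esub> p \<in> D"
    "\<forall>x\<in>carrier ?V. \<forall>y\<in>carrier ?V. x \<otimes>\<^bsub>?V\<^esub> y \<otimes>\<^bsub>?V\<^esub> inv\<^bsub>?V\<^esub> x \<otimes>\<^bsub>?V\<^esub> inv\<^bsub>?V\<^esub> y \<in> D"
  proof (rule V.p_group_proper_subgroup[OF _ p, of k A])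
    show "subgroup A ?V" by (rule subgroup_incl[OF A(1) V(1) A(2)])
    show "A \<subset> carrier ?V" using A(2) \<open>A \<noteq> V\<close> by auto
  qed (use V(2,3) in \<open>auto simp: order_def\<close>)
  have sD: "subgroup D G" by (rule incl_subgroup[OF V(1) D(1)])
  have "frattini_gens G p V \<subseteq> D"
    using D(4,5) m_inv_consistent[OF V(1)] unfolding frattini_gens_def by (auto simp flip: nat_pow_consistent)
  then have F: "generate G (frattini_gens G p V) \<subseteq> D" by (rule generate_subgroup_incl[OF _ sD])
  have "V \<subseteq> D"
  proof
    fix v assume v: "v \<in> V"
    then obtain a where a: "a \<in> A" "v \<otimes> inv a \<in> D" using sup F by blast
    then have "v \<otimes> inv a \<otimes> a \<in> D" using D(2) subgroup.m_closed[OF sD a(2)] by blast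
    then show "v \<in> D" using subgroup.mem_carrier[OF V(1) v] subgroup.mem_carrier[OF A(1) a(1)] by (simp add: m_assoc)
  qed
  then show False using D(3) by simp
qed

text \<open>Coprime action: a group of order \<open>q\<close> fixing every coset of the Frattini subgroup has a fixed
  point in each of them, so its fixed points supplement the Frattini subgroup.\<close>
lemma (in group) coprime_action_frattini:
  assumes fin: "finite (carrier G)" and p: "Factorial_Ring.prime (p::nat)" and q: "Factorial_Ring.prime q" "q \<noteq> p"
    and V: "V \<lhd> G" "card V = p ^ k" and B: "subgroup B G" "card B = q"
    and triv: "\<And>b v. b \<in> B \<Longrightarrow> v \<in> V \<Longrightarrow> b \<otimes> v \<otimes> inv b \<otimes> inv v \<in> generate G (frattini_gens G p V)"
    and b: "b \<in> B" and v: "v \<in> V"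
  shows "b \<otimes> v = v \<otimes> b"
proof -
  define \<Phi> where "\<Phi> = generate G (frattini_gens G p V)"
  have sV: "subgroup V G" and cV: "\<And>g v. g \<in> carrier G \<Longrightarrow> v \<in> V \<Longrightarrow> g \<otimes> v \<otimes> inv g \<in> V"
    using V(1) by (auto simp: normal_inv_iff)
  have n\<Phi>: "\<Phi> \<lhd> G" unfolding \<Phi>_def by (rule frattini_normal[OF V(1)])
  have s\<Phi>: "subgroup \<Phi> G" and c\<Phi>: "\<And>g v. g \<in> carrier G \<Longrightarrow> v \<in> \<Phi> \<Longrightarrow> g \<otimes> v \<otimes> inv g \<in> \<Phi>"
    using n\<Phi> by (auto simp: normal_inv_iff)
  have \<Phi>V: "\<Phi> \<subseteq> V" unfolding \<Phi>_def by (rule generate_subgroup_incl[OF frattini_gens_subset[OF sV] sV])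
  have finV: "finite V" using fin subgroup.subset[OF sV] finite_subset by blast
  note Vc = subgroup.mem_carrier[OF sV] and Bc = subgroup.mem_carrier[OF B(1)] and \<Phi>c = subgroup.mem_carrier[OF s\<Phi>]
  define A where "A = {v \<in> V. \<forall>b\<in>B. b \<otimes> v = v \<otimes> b}"
  have "A = V \<inter> {x \<in> carrier G. \<forall>t\<in>B. x \<otimes> t = t \<otimes> x}" using Vc by (auto simp: A_def)
  then have sA: "subgroup A G"
    using subgroups_Inter_pair[OF sV centralizer_subgroup[OF subgroup.subset[OF B(1)]]] by simp
  have sup: "\<exists>a\<in>A. v \<otimes> inv a \<in> generate G (frattini_gens G p V)" if v: "v \<in> V" for v
  proof -
    have "card \<Phi> dvd p ^ k" using card_subgroup_dvd[OF sV s\<Phi> \<Phi>V finV] V(2) by simp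
    then obtain j where j: "card \<Phi> = p ^ j" using divides_primepow_nat[OF p] by auto
    \<comment> \<open>The coset has as many elements as \<open>\<Phi>\<close>, a power of
      \<open>p\<close>, which the prime \<open>q\<close> does not divide; this forces a fixed
      point.\<close>
    have bij: "bij_betw (\<lambda>x. x \<otimes> v) \<Phi> (\<Phi> #> v)"
      using v Vc \<Phi>c by (auto simp: bij_betw_def inj_on_def r_coset_def)
    have cS: "card (\<Phi> #> v) = p ^ j" using bij_betw_same_card[OF bij] j by simp
    have ndvd: "\<not> q dvd card (\<Phi> #> v)"
      unfolding cS using q p by (metis prime_dvd_power primes_dvd_imp_eq)
    obtain s where s: "s \<in> \<Phi> #> v" "\<forall>b\<in>carrier (G\<lparr>carrier := B\<rparr>). b \<otimes> s \<otimes> inv b = s"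
    proof (rule p_group_fixed_point[of "G\<lparr>carrier := B\<rparr>" q 1 "\<Phi> #> v" "\<lambda>b s. b \<otimes> s \<otimes> inv b"])
      show "finite (\<Phi> #> v)" using finite_subset[OF \<Phi>V finV] by (auto simp: r_coset_def)
      have SV: "s \<in> carrier G" if "s \<in> \<Phi> #> v" for s using that \<Phi>c Vc[OF v] by (auto simp: r_coset_def)
      show "b \<otimes> s \<otimes> inv b \<in> \<Phi> #> v" if b: "b \<in> carrier (G\<lparr>carrier := B\<rparr>)" and s: "s \<in> \<Phi> #> v" for b s
      proof -
        obtain f where f: "f \<in> \<Phi>" "s = f \<otimes> v" using s by (auto simp: r_coset_def)
        have bB: "b \<in> B" using b by simp
        have "b \<otimes> s \<otimes> inv b = ((b \<otimes> f \<otimes> inv b) \<otimes> (b \<otimes> v \<otimes> inv b \<otimes> inv v)) \<otimes> v"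
          unfolding f(2) using Bc[OF bB] \<Phi>c[OF f(1)] Vc[OF v] by (simp add: group_normalize)
        moreover have "(b \<otimes> f \<otimes> inv b) \<otimes> (b \<otimes> v \<otimes> inv b \<otimes> inv v) \<in> \<Phi>"
          using subgroup.m_closed[OF s\<Phi> c\<Phi>[OF Bc[OF bB] f(1)]] triv[OF bB v] by (simp add: \<Phi>_def)
        ultimately show ?thesis by (auto simp: r_coset_def)
      qed
      show "\<one>\<^bsub>G\<lparr>carrier := B\<rparr>\<^esub> \<otimes> s \<otimes> inv \<one>\<^bsub>G\<lparr>carrier := B\<rparr>\<^esub> = s" if "s \<in> \<Phi> #> v" for s using SV[OF that] by simp
      show "(b \<otimes>\<^bsub>G\<lparr>carrier := B\<rparr>\<^esub> c) \<otimes> s \<otimes> inv (b \<otimes>\<^bsub>G\<lparr>carrier := B\<rparr>\<^esub> c) = b \<otimes> (c \<otimes> s \<otimes> inv c) \<otimes> inv b"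
        if "b \<in> carrier (G\<lparr>carrier := B\<rparr>)" "c \<in> carrier (G\<lparr>carrier := B\<rparr>)" "s \<in> \<Phi> #> v" for b c s
        using that SV[OF that(3)] Bc by (simp add: group_normalize)
    qed (use subgroup_imp_group[OF B(1)] B(2) q(1) ndvd in \<open>auto simp: order_def\<close>)
    obtain f where f: "f \<in> \<Phi>" "s = f \<otimes> v" using s(1) by (auto simp: r_coset_def)
    have sV': "s \<in> V" unfolding f(2) using subgroup.m_closed[OF sV] \<Phi>V f(1) v by blast
    have "b \<otimes> s = s \<otimes> b" if b: "b \<in> B" for b
    proof -
      have "b \<otimes> s = (b \<otimes> s \<otimes> inv b) \<otimes> b" using Bc[OF b] Vc[OF sV'] by (simp add: m_assoc)
      then show ?thesis using s(2) b by simp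
    qed
    then have "s \<in> A" using sV' by (simp add: A_def)
    moreover have "v \<otimes> inv s = inv f" unfolding f(2) using \<Phi>c[OF f(1)] Vc[OF v] by (simp add: group_normalize)
    then have "v \<otimes> inv s \<in> \<Phi>" using subgroup.m_inv_closed[OF s\<Phi> f(1)] by simp
    ultimately show ?thesis unfolding \<Phi>_def by blast
  qed
  have "A = V" by (rule frattini_supplement[OF sV finV V(2) p sA _ sup]) (auto simp: A_def)
  then show ?thesis using b v by (auto simp: A_def)
qed

text \<open>Let \<open>C\<close> be the centralizer of \<open>V / \<Phi>\<close>. A subgroup of
  \<open>C\<close> of prime order \<open>r\<close> other than \<open>p\<close> centralizes
  \<open>V\<close> by coprime action, so it lies in \<open>V\<close> by the centralizer lemma, which
  its order forbids. Hence \<open>C\<close> is a normal \<open>p\<close>-subgroup and lies in the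
  core.\<close>

lemma (in group) p_core_centralizes_frattini_quotient:
  assumes fin: "finite (carrier G)" and p: "Factorial_Ring.prime (p::nat)" and sep: "pi_separable G p"
    and core: "pi_core False p G = {\<one>}" and V: "V = pi_core True p G"
    and x: "x \<in> carrier G" "\<And>v. v \<in> V \<Longrightarrow> x \<otimes> v \<otimes> inv x \<otimes> inv v \<in> generate G (frattini_gens G p V)"
  shows "x \<in> V"
proof -
  define \<Phi> where "\<Phi> = generate G (frattini_gens G p V)"
  have nV: "V \<lhd> G" "pi_number True p (card V)" and maxV: "\<And>N. N \<lhd> G \<Longrightarrow> pi_number True p (card N) \<Longrightarrow> N \<subseteq> V"
    unfolding V using pi_core[OF fin p] by auto
  obtain k where k: "card V = p ^ k" using nV(2) by (auto simp: pi_number_def)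
  have sV: "subgroup V G" by (rule normal_imp_subgroup[OF nV(1)])
  note Vc = subgroup.mem_carrier[OF sV]
  have n\<Phi>: "\<Phi> \<lhd> G" unfolding \<Phi>_def by (rule frattini_normal[OF nV(1)])
  obtain Q :: "'a set monoid" and h where q: "group_hom G Q h" and sur: "h ` carrier G = carrier Q"
    and ker: "\<And>a. a \<in> carrier G \<Longrightarrow> h a = \<one>\<^bsub>Q\<^esub> \<longleftrightarrow> a \<in> \<Phi>" using quotient_group_hom[OF n\<Phi>] by blast
  interpret q: group_hom G Q h by (rule q)
  define C where "C = {x \<in> carrier G. h x \<in> {y \<in> carrier Q. \<forall>t\<in>h ` V. y \<otimes>\<^bsub>Q\<^esub> t = t \<otimes>\<^bsub>Q\<^esub> y}}"
  have nC: "C \<lhd> G"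
    unfolding C_def by (rule q.normal_preimage[OF q.H.centralizer_normal[OF q.normal_image[OF sur nV(1)]]])
  have Ciff: "x \<in> C \<longleftrightarrow> (\<forall>v\<in>V. x \<otimes> v \<otimes> inv x \<otimes> inv v \<in> \<Phi>)" if x: "x \<in> carrier G" for x
  proof -
    have "h x \<otimes>\<^bsub>Q\<^esub> h v = h v \<otimes>\<^bsub>Q\<^esub> h x \<longleftrightarrow> x \<otimes> v \<otimes> inv x \<otimes> inv v \<in> \<Phi>" if v: "v \<in> V" for v
    proof -
      have "x \<otimes> v \<otimes> inv x \<otimes> inv v \<in> \<Phi> \<longleftrightarrow> h (x \<otimes> v \<otimes> inv x \<otimes> inv v) = \<one>\<^bsub>Q\<^esub>"
        by (rule ker[symmetric]) (use x Vc[OF v] in simp)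
      also have "h (x \<otimes> v \<otimes> inv x \<otimes> inv v) = (h x \<otimes>\<^bsub>Q\<^esub> h v) \<otimes>\<^bsub>Q\<^esub> inv\<^bsub>Q\<^esub> (h v \<otimes>\<^bsub>Q\<^esub> h x)"
        using x Vc[OF v] by (simp add: q.H.group_normalize)
      also have "\<dots> = \<one>\<^bsub>Q\<^esub> \<longleftrightarrow> h x \<otimes>\<^bsub>Q\<^esub> h v = h v \<otimes>\<^bsub>Q\<^esub> h x"
        using q.H.div_eq_one[of "h x \<otimes>\<^bsub>Q\<^esub> h v" "h v \<otimes>\<^bsub>Q\<^esub> h x"] x Vc[OF v] by auto
      finally show ?thesis by simp
    qed
    then show ?thesis using x by (auto simp: C_def)
  qed
  have sC: "subgroup C G" by (rule normal_imp_subgroup[OF nC])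
  note Cc = subgroup.mem_carrier[OF sC]
  have finC: "finite C" using fin subgroup.subset[OF sC] finite_subset by blast
  have "\<exists>k. card C = p ^ k"
  proof (rule prime_power_if_only_prime_factor[OF card_subgroup_pos[OF sC finC] p], rule ccontr)
    fix r assume r: "Factorial_Ring.prime r" "r dvd card C" "r \<noteq> p"
    obtain m where m: "card C = r * m" using r(2) by blast
    \<comment> \<open>Cauchy's theorem, as Sylow's with exponent 1.\<close>
    have "\<exists>B. subgroup B (G\<lparr>carrier := C\<rparr>) \<and> card B = r ^ 1"
      by (rule sylow_thm[OF r(1) subgroup_imp_group[OF sC], of 1 m]) (use m finC in \<open>auto simp: order_def\<close>)
    then obtain B where B: "subgroup B (G\<lparr>carrier := C\<rparr>)" "card B = r" by auto
    have BC: "B \<subseteq> C" using subgroup.subset[OF B(1)] by simp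
    have sB: "subgroup B G" by (rule incl_subgroup[OF sC B(1)])
    have "B \<subseteq> V"
    proof
      fix b assume b: "b \<in> B"
      have "b \<otimes> v = v \<otimes> b" if v: "v \<in> V" for v
      proof (rule coprime_action_frattini[OF fin p r(1) r(3) nV(1) k sB B(2) _ b v])
        fix b v assume "b \<in> B" "v \<in> V"
        then show "b \<otimes> v \<otimes> inv b \<otimes> inv v \<in> generate G (frattini_gens G p V)"
          using Ciff[of b] BC Cc unfolding \<Phi>_def by blast
      qed
      then show "b \<in> V"
        using hall_higman_centralizer[OF fin p sep core, of V b] V subgroup.mem_carrier[OF sB b] by simp
    qed
    then have "r dvd p ^ k" using card_subgroup_dvd[OF sV sB] finite_subset[OF subgroup.subset[OF sV] fin] B(2) k
      by simp
    then show False using r p by (metis prime_dvd_power primes_dvd_imp_eq)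
  qed
  then have "C \<subseteq> V" using maxV[OF nC] by (simp add: pi_number_def)
  moreover have "x \<in> C" using Ciff[OF x(1)] x(2) by (simp add: \<Phi>_def)
  ultimately show ?thesis by blast
qed

text \<open>The situation after the two reductions: \<open>V\<close> is the largest normal
  \<open>p\<close>-subgroup, elementary abelian, and contains its centralizer.\<close>

definition self_centralizing_core :: "('a,'b) monoid_scheme \<Rightarrow> nat \<Rightarrow> 'a set \<Rightarrow> bool" where
  "self_centralizing_core G p V \<longleftrightarrow> V \<lhd> G \<and> (\<exists>k. card V = p ^ k)
    \<and> (\<forall>u\<in>V. \<forall>v\<in>V. u \<otimes>\<^bsub>G\<^esub> v = v \<otimes>\<^bsub>G\<^esub> u) \<and> (\<forall>v\<in>V. v [^]\<^bsub>G\<^esub> p = \<one>\<^bsub>G\<^esub>)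
    \<and> (\<forall>x\<in>carrier G. (\<forall>v\<in>V. x \<otimes>\<^bsub>G\<^esub> v = v \<otimes>\<^bsub>G\<^esub> x) \<longrightarrow> x \<in> V)
    \<and> (\<forall>N k. N \<lhd> G \<longrightarrow> card N = p ^ k \<longrightarrow> N \<subseteq> V)"

text \<open>The image of \<open>V\<close> contains its centralizer by the preceding lemma, and a
  normal \<open>p\<close>-subgroup of the quotient pulls back to one of \<open>G\<close>, because
  the kernel \<open>\<Phi>\<close> lies in \<open>V\<close>. The last clause lets membership in
  \<open>V\<close> be checked in the quotient.\<close>

lemma (in group) frattini_quotient_core:
  assumes fin: "finite (carrier G)" and p: "Factorial_Ring.prime (p::nat)" and sep: "pi_separable G p"
    and core: "pi_core False p G = {\<one>}" and V: "V = pi_core True p G"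
  obtains Q :: "'a set monoid" and h where "group_hom G Q h" "h ` carrier G = carrier Q"
    "self_centralizing_core Q p (h ` V)" "\<And>x. x \<in> carrier G \<Longrightarrow> h x \<in> h ` V \<Longrightarrow> x \<in> V"
proof -
  define \<Phi> where "\<Phi> = generate G (frattini_gens G p V)"
  have nV: "V \<lhd> G" "pi_number True p (card V)" and maxV: "\<And>N. N \<lhd> G \<Longrightarrow> pi_number True p (card N) \<Longrightarrow> N \<subseteq> V"
    unfolding V using pi_core[OF fin p] by auto
  have sV: "subgroup V G" by (rule normal_imp_subgroup[OF nV(1)])
  note Vc = subgroup.mem_carrier[OF sV]
  have n\<Phi>: "\<Phi> \<lhd> G" unfolding \<Phi>_def by (rule frattini_normal[OF nV(1)])
  have s\<Phi>: "subgroup \<Phi> G" by (rule normal_imp_subgroup[OF n\<Phi>])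
  have \<Phi>V: "\<Phi> \<subseteq> V" unfolding \<Phi>_def by (rule generate_subgroup_incl[OF frattini_gens_subset[OF sV] sV])
  have finV: "finite V" using fin subgroup.subset[OF sV] finite_subset by blast
  have gens: "s \<in> \<Phi>" if "s \<in> frattini_gens G p V" for s unfolding \<Phi>_def by (rule generate.incl[OF that])
  obtain Q :: "'a set monoid" and h where q: "group_hom G Q h" and sur: "h ` carrier G = carrier Q"
    and ker: "\<And>a. a \<in> carrier G \<Longrightarrow> h a = \<one>\<^bsub>Q\<^esub> \<longleftrightarrow> a \<in> \<Phi>" using quotient_group_hom[OF n\<Phi>] by blast
  interpret q: group_hom G Q h by (rule q)
  have lift: "x \<in> V" if x: "x \<in> carrier G" "h x \<in> h ` V" for x
  proof -
    obtain v where v: "v \<in> V" "h x = h v" using x(2) by blast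
    have "h (x \<otimes> inv v) = \<one>\<^bsub>Q\<^esub>" using x(1) v Vc by simp
    then have "x \<otimes> inv v \<in> V" using iffD1[OF ker[of "x \<otimes> inv v"]] x(1) Vc[OF v(1)] \<Phi>V by auto
    then have "x \<otimes> inv v \<otimes> v \<in> V" using subgroup.m_closed[OF sV _ v(1)] by blast
    then show ?thesis using x(1) Vc[OF v(1)] by (simp add: m_assoc)
  qed
  have comm_iff: "h x \<otimes>\<^bsub>Q\<^esub> h v = h v \<otimes>\<^bsub>Q\<^esub> h x \<longleftrightarrow> x \<otimes> v \<otimes> inv x \<otimes> inv v \<in> \<Phi>"
    if x: "x \<in> carrier G" and v: "v \<in> carrier G" for x v
  proof -
    have "x \<otimes> v \<otimes> inv x \<otimes> inv v \<in> \<Phi> \<longleftrightarrow> h (x \<otimes> v \<otimes> inv x \<otimes> inv v) = \<one>\<^bsub>Q\<^esub>"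
      by (rule ker[symmetric]) (use x v in simp)
    also have "h (x \<otimes> v \<otimes> inv x \<otimes> inv v) = (h x \<otimes>\<^bsub>Q\<^esub> h v) \<otimes>\<^bsub>Q\<^esub> inv\<^bsub>Q\<^esub> (h v \<otimes>\<^bsub>Q\<^esub> h x)"
      using x v by (simp add: q.H.group_normalize)
    also have "\<dots> = \<one>\<^bsub>Q\<^esub> \<longleftrightarrow> h x \<otimes>\<^bsub>Q\<^esub> h v = h v \<otimes>\<^bsub>Q\<^esub> h x"
      using q.H.div_eq_one[of "h x \<otimes>\<^bsub>Q\<^esub> h v" "h v \<otimes>\<^bsub>Q\<^esub> h x"] x v by auto
    finally show ?thesis by simp
  qed
  have "self_centralizing_core Q p (h ` V)"
    unfolding self_centralizing_core_def
  proof (intro conjI ballI allI impI)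
    show "h ` V \<lhd> Q" by (rule q.normal_image[OF sur nV(1)])
    have "card (h ` V) dvd card V"
      using q.card_image_mult_kernel[OF sV finV] by simp
    then show "\<exists>k. card (h ` V) = p ^ k" using pi_number_dvd[OF p nV(2)] by (simp add: pi_number_def)
    show "u \<otimes>\<^bsub>Q\<^esub> v = v \<otimes>\<^bsub>Q\<^esub> u" if uv: "u \<in> h ` V" "v \<in> h ` V" for u v
    proof -
      obtain a b where ab: "a \<in> V" "u = h a" "b \<in> V" "v = h b" using uv by blast
      have "a \<otimes> b \<otimes> inv a \<otimes> inv b \<in> \<Phi>" by (rule gens) (use ab in \<open>auto simp: frattini_gens_def\<close>)
      then show ?thesis unfolding ab(2,4) using comm_iff[OF Vc[OF ab(1)] Vc[OF ab(3)]] by blast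
    qed
    show "v [^]\<^bsub>Q\<^esub> p = \<one>\<^bsub>Q\<^esub>" if v: "v \<in> h ` V" for v
    proof -
      obtain a where a: "a \<in> V" "v = h a" using v by blast
      have "a [^] p \<in> \<Phi>" by (rule gens) (use a in \<open>auto simp: frattini_gens_def\<close>)
      then have "h (a [^] p) = \<one>\<^bsub>Q\<^esub>" using iffD2[OF ker[of "a [^] p"]] Vc[OF a(1)] by simp
      then show ?thesis unfolding a(2) using q.hom_nat_pow[OF Vc[OF a(1)], of p] by simp
    qed
    show "y \<in> h ` V" if y: "y \<in> carrier Q" and c: "\<forall>v\<in>h ` V. y \<otimes>\<^bsub>Q\<^esub> v = v \<otimes>\<^bsub>Q\<^esub> y" for y
    proof -
      obtain x where x: "x \<in> carrier G" "y = h x" using y sur by blast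
      have "x \<in> V"
        by (rule p_core_centralizes_frattini_quotient[OF fin p sep core V x(1)])
          (use comm_iff[OF x(1) Vc] c x(2) \<Phi>_def in blast)
      then show ?thesis using x(2) by blast
    qed
    show "N \<subseteq> h ` V" if N: "N \<lhd> Q" "card N = p ^ k" for N k
    proof
      fix y assume y: "y \<in> N"
      have sN: "subgroup N Q" by (rule normal_imp_subgroup[OF N(1)])
      let ?N = "{g \<in> carrier G. h g \<in> N}"
      have "{g \<in> carrier G. h g = \<one>\<^bsub>Q\<^esub>} = \<Phi>" using ker subgroup.subset[OF s\<Phi>] by auto
      then have "card ?N = card N * card \<Phi>" using q.card_preimage[OF fin sN] subgroup.subset[OF sN] sur by simp
      moreover have "pi_number True p (card \<Phi>)" by (rule pi_number_dvd[OF p nV(2) card_subgroup_dvd[OF sV s\<Phi> \<Phi>V finV]])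
      moreover have "pi_number True p (card N)" using N(2) by (auto simp: pi_number_def)
      ultimately have "?N \<subseteq> V" using maxV[OF q.normal_preimage[OF N(1)]] pi_number_mult by simp
      moreover obtain x where "x \<in> carrier G" "y = h x" using subgroup.mem_carrier[OF sN y] sur by blast
      ultimately show "y \<in> h ` V" using y by blast
    qed
  qed
  then show ?thesis using that[OF q sur _ lift] by blast
qed

section \<open>Powerfully embedded sections\<close>

text \<open>For normal \<open>L\<close>, the preimage of the subgroup generated by the
  \<open>k\<close>-th powers of \<open>M / L\<close>.\<close>

definition pow_gen :: "('a,'b) monoid_scheme \<Rightarrow> nat \<Rightarrow> 'a set \<Rightarrow> 'a set \<Rightarrow> 'a set" where
  "pow_gen G k L M = generate G ({x [^]\<^bsub>G\<^esub> k | x. x \<in> M} \<union> L)"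

text \<open>\<open>M / L\<close> is powerfully embedded in \<open>P / L\<close>, phrased inside \<open>G\<close> so that no quotient is formed.\<close>
definition eta_step :: "('a,'b) monoid_scheme \<Rightarrow> nat \<Rightarrow> 'a set \<Rightarrow> 'a set \<Rightarrow> 'a set \<Rightarrow> bool" where
  "eta_step G p P L M \<longleftrightarrow> stable_subgroup G P L \<and> stable_subgroup G P M \<and> L \<subseteq> M \<and> M \<subseteq> P
    \<and> (\<forall>x\<in>M. \<forall>g\<in>P. x \<otimes>\<^bsub>G\<^esub> g \<otimes>\<^bsub>G\<^esub> inv\<^bsub>G\<^esub> x \<otimes>\<^bsub>G\<^esub> inv\<^bsub>G\<^esub> g \<in> pow_gen G (if p = 2 then 4 else p) L M)"

lemma (in group) pow_gen_stable:
  assumes "P \<subseteq> carrier G" "stable_subgroup G P L" "stable_subgroup G P M"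
  shows "stable_subgroup G P (pow_gen G k L M)"
proof -
  note Lc = subgroup.mem_carrier[OF stable_subgroupD(1)[OF assms(2)]]
    and Mc = subgroup.mem_carrier[OF stable_subgroupD(1)[OF assms(3)]]
  show ?thesis
    unfolding pow_gen_def
  proof (rule generate_stable)
    show "{x [^] k | x. x \<in> M} \<union> L \<subseteq> carrier G" using Lc Mc by auto
    fix d s assume d: "d \<in> P" and s: "s \<in> {x [^] k | x. x \<in> M} \<union> L"
    show "d \<otimes> s \<otimes> inv d \<in> {x [^] k | x. x \<in> M} \<union> L"
    proof (cases "s \<in> L")
      case True
      then show ?thesis using stable_subgroupD(2)[OF assms(2) d] by simp
    next
      case False
      then obtain x where x: "x \<in> M" "s = x [^] k" using s by blast
      then have "d \<otimes> s \<otimes> inv d = (d \<otimes> x \<otimes> inv d) [^] k" using conj_nat_pow Mc d assms(1) by blast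
      then show ?thesis using stable_subgroupD(2)[OF assms(3) d x(1)] by blast
    qed
  qed (rule assms(1))
qed

lemma pow_gen_incl: "L \<subseteq> pow_gen G k L M" "x \<in> M \<Longrightarrow> x [^]\<^bsub>G\<^esub> k \<in> pow_gen G k L M"
  unfolding pow_gen_def by (blast intro: generate.incl)+

lemma (in group_hom) pow_gen_image:
  assumes "M \<subseteq> carrier G" "L \<subseteq> carrier G"
  shows "h ` pow_gen G k L M = pow_gen H k (h ` L) (h ` M)"
proof -
  have "{x [^] k | x. x \<in> M} \<union> L \<subseteq> carrier G" using assms by auto
  moreover have "h ` ({x [^] k | x. x \<in> M} \<union> L) = {x [^]\<^bsub>H\<^esub> k | x. x \<in> h ` M} \<union> h ` L"
  proof -
    have "h ` {x [^] k | x. x \<in> M} = (\<lambda>x. h (x [^] k)) ` M" by auto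
    also have "\<dots> = (\<lambda>x. h x [^]\<^bsub>H\<^esub> k) ` M" by (rule image_cong) (use assms(1) hom_nat_pow in auto)
    also have "\<dots> = {x [^]\<^bsub>H\<^esub> k | x. x \<in> h ` M}" by auto
    finally show ?thesis by (simp add: image_Un)
  qed
  ultimately show ?thesis unfolding pow_gen_def using generate_img[of "{x [^] k | x. x \<in> M} \<union> L"] by simp
qed

lemma (in group_hom) stable_image:
  assumes "stable_subgroup G P M" "P \<subseteq> carrier G"
  shows "stable_subgroup H (h ` P) (h ` M)"
  unfolding stable_subgroup_def
proof (intro conjI ballI)
  show "subgroup (h ` M) H" by (rule subgroup_img_is_subgroup[OF stable_subgroupD(1)[OF assms(1)]])
  fix d x assume "d \<in> h ` P" "x \<in> h ` M"
  then obtain e y where ey: "e \<in> P" "d = h e" "y \<in> M" "x = h y" by blast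
  then have "d \<otimes>\<^bsub>H\<^esub> x \<otimes>\<^bsub>H\<^esub> inv\<^bsub>H\<^esub> d = h (e \<otimes> y \<otimes> inv e)"
    using assms(2) subgroup.mem_carrier[OF stable_subgroupD(1)[OF assms(1)]] by auto
  then show "d \<otimes>\<^bsub>H\<^esub> x \<otimes>\<^bsub>H\<^esub> inv\<^bsub>H\<^esub> d \<in> h ` M" using stable_subgroupD(2)[OF assms(1) ey(1,3)] by blast
qed

lemma (in group_hom) eta_step_image:
  assumes "eta_step G p P L M" "P \<subseteq> carrier G"
  shows "eta_step H p (h ` P) (h ` L) (h ` M)"
proof -
  have st: "stable_subgroup G P L" "stable_subgroup G P M" "L \<subseteq> M" "M \<subseteq> P"
    and c: "\<And>x g. x \<in> M \<Longrightarrow> g \<in> P \<Longrightarrow> x \<otimes> g \<otimes> inv x \<otimes> inv g \<in> pow_gen G (if p = 2 then 4 else p) L M"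
    using assms(1) by (auto simp: eta_step_def)
  have MG: "M \<subseteq> carrier G" "L \<subseteq> carrier G" using st assms(2) by auto
  have "x \<otimes>\<^bsub>H\<^esub> g \<otimes>\<^bsub>H\<^esub> inv\<^bsub>H\<^esub> x \<otimes>\<^bsub>H\<^esub> inv\<^bsub>H\<^esub> g \<in> pow_gen H (if p = 2 then 4 else p) (h ` L) (h ` M)"
    if xg: "x \<in> h ` M" "g \<in> h ` P" for x g
  proof -
    obtain y k where yk: "y \<in> M" "x = h y" "k \<in> P" "g = h k" using xg by blast
    then have "x \<otimes>\<^bsub>H\<^esub> g \<otimes>\<^bsub>H\<^esub> inv\<^bsub>H\<^esub> x \<otimes>\<^bsub>H\<^esub> inv\<^bsub>H\<^esub> g = h (y \<otimes> k \<otimes> inv y \<otimes> inv k)"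
      using subsetD[OF MG(1) yk(1)] subsetD[OF assms(2) yk(3)] by simp
    then show ?thesis using c[OF yk(1,3)] pow_gen_image[OF MG] by blast
  qed
  then show ?thesis
    unfolding eta_step_def using stable_image[OF st(1) assms(2)] stable_image[OF st(2) assms(2)] st by blast
qed

text \<open>This is the preimage of the centre of \<open>G / N\<close>. Iterated from the trivial
  subgroup it produces the upper central series.\<close>

lemma (in group) normal_central_preimage:
  assumes N: "N \<lhd> G"
  shows "{x \<in> carrier G. \<forall>g\<in>carrier G. x \<otimes> g \<otimes> inv x \<otimes> inv g \<in> N} \<lhd> G"
proof -
  obtain Q :: "'a set monoid" and h where q: "group_hom G Q h" and sur: "h ` carrier G = carrier Q"
    and ker: "\<And>a. a \<in> carrier G \<Longrightarrow> h a = \<one>\<^bsub>Q\<^esub> \<longleftrightarrow> a \<in> N" using quotient_group_hom[OF N] by blast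
  interpret q: group_hom G Q h by (rule q)
  define E where "E = {z \<in> carrier G. h z \<in> {y \<in> carrier Q. \<forall>t\<in>carrier Q. y \<otimes>\<^bsub>Q\<^esub> t = t \<otimes>\<^bsub>Q\<^esub> y}}"
  have nE: "E \<lhd> G"
    unfolding E_def by (rule q.normal_preimage[OF q.H.centralizer_normal]) (rule q.H.normal_self)
  have "h z \<otimes>\<^bsub>Q\<^esub> h g = h g \<otimes>\<^bsub>Q\<^esub> h z \<longleftrightarrow> z \<otimes> g \<otimes> inv z \<otimes> inv g \<in> N"
    if z: "z \<in> carrier G" and g: "g \<in> carrier G" for z g
  proof -
    have "z \<otimes> g \<otimes> inv z \<otimes> inv g \<in> N \<longleftrightarrow> h (z \<otimes> g \<otimes> inv z \<otimes> inv g) = \<one>\<^bsub>Q\<^esub>"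
      by (rule ker[symmetric]) (use z g in simp)
    also have "h (z \<otimes> g \<otimes> inv z \<otimes> inv g) = (h z \<otimes>\<^bsub>Q\<^esub> h g) \<otimes>\<^bsub>Q\<^esub> inv\<^bsub>Q\<^esub> (h g \<otimes>\<^bsub>Q\<^esub> h z)"
      using z g by (simp add: q.H.group_normalize)
    also have "\<dots> = \<one>\<^bsub>Q\<^esub> \<longleftrightarrow> h z \<otimes>\<^bsub>Q\<^esub> h g = h g \<otimes>\<^bsub>Q\<^esub> h z"
      using q.H.div_eq_one[of "h z \<otimes>\<^bsub>Q\<^esub> h g" "h g \<otimes>\<^bsub>Q\<^esub> h z"] z g by auto
    finally show ?thesis by simp
  qed
  then have "E = {x \<in> carrier G. \<forall>g\<in>carrier G. x \<otimes> g \<otimes> inv x \<otimes> inv g \<in> N}"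
    unfolding E_def sur[symmetric] by auto
  then show ?thesis using nE by simp
qed

lemma (in group) normal_le_central_preimage:
  assumes N: "N \<lhd> G"
  shows "N \<subseteq> {x \<in> carrier G. \<forall>g\<in>carrier G. x \<otimes> g \<otimes> inv x \<otimes> inv g \<in> N}"
proof
  fix x assume x: "x \<in> N"
  have s: "subgroup N G" by (rule normal_imp_subgroup[OF N])
  have xc: "x \<in> carrier G" by (rule subgroup.mem_carrier[OF s x])
  have "x \<otimes> g \<otimes> inv x \<otimes> inv g \<in> N" if g: "g \<in> carrier G" for g
  proof -
    have "g \<otimes> inv x \<otimes> inv g \<in> N"
      using N subgroup.m_inv_closed[OF s x] g unfolding normal_inv_iff by blast
    then have "x \<otimes> (g \<otimes> inv x \<otimes> inv g) \<in> N" by (rule subgroup.m_closed[OF s x])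
    then show ?thesis using xc g by (simp add: m_assoc)
  qed
  then show "x \<in> {x \<in> carrier G. \<forall>g\<in>carrier G. x \<otimes> g \<otimes> inv x \<otimes> inv g \<in> N}" using xc by simp
qed

text \<open>Choose \<open>D\<close> maximal. The elements of \<open>Z\<close> that are central
  modulo \<open>D\<close> form a normal subgroup larger than \<open>D\<close>, hence all of
  \<open>Z\<close>. Such a central factor \<open>Z / D\<close> reduces commutator identities to
  class two.\<close>

lemma (in group) normal_chain_step:
  assumes fin: "finite (carrier G)" and p: "Factorial_Ring.prime (p::nat)" "order G = p ^ k"
    and Y: "Y \<lhd> G" and Z: "Z \<lhd> G" and YZ: "Y \<subset> Z"
  obtains D where "D \<lhd> G" "Y \<subseteq> D" "D \<subset> Z" "\<And>z g. z \<in> Z \<Longrightarrow> g \<in> carrier G \<Longrightarrow> z \<otimes> g \<otimes> inv z \<otimes> inv g \<in> D"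
proof -
  define \<C> where "\<C> = {D. D \<lhd> G \<and> Y \<subseteq> D \<and> D \<subset> Z}"
  have sZ: "subgroup Z G" by (rule normal_imp_subgroup[OF Z])
  have "\<C> \<subseteq> Pow Z" by (auto simp: \<C>_def)
  moreover have finZ: "finite Z" using finite_subset[OF subgroup.subset[OF sZ] fin] .
  ultimately have fC: "finite \<C>" using finite_subset by blast
  have "Y \<in> \<C>" using Y YZ by (simp add: \<C>_def)
  then obtain D where D: "D \<in> \<C>" "\<And>E. E \<in> \<C> \<Longrightarrow> D \<subseteq> E \<Longrightarrow> E = D"
    using finite_has_maximal2[OF fC] by metis
  then have nD: "D \<lhd> G" "Y \<subseteq> D" "D \<subset> Z" by (auto simp: \<C>_def)
  have stD: "stable_subgroup G (carrier G) D" and stZ: "stable_subgroup G (carrier G) Z"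
    using nD(1) Z normal_iff_stable by auto
  have "card Z dvd p ^ k" using card_subgroup_dvd[OF subgroup_self sZ subgroup.subset[OF sZ] fin] p(2)
    by (simp add: order_def)
  then obtain j where j: "card Z = p ^ j" using divides_primepow_nat[OF p(1)] by auto
  have cG: "card (carrier G) = p ^ k" using p(2) by (simp add: order_def)
  obtain x where x: "x \<in> Z" "x \<notin> D" "\<forall>g\<in>carrier G. x \<otimes> g \<otimes> inv x \<otimes> inv g \<in> D"
    using p_group_central_step[OF subgroup_self cG p(1) stD stZ finZ nD(3) j] by blast
  define E where "E = {x \<in> carrier G. \<forall>g\<in>carrier G. x \<otimes> g \<otimes> inv x \<otimes> inv g \<in> D}"
  have nE: "E \<lhd> G" unfolding E_def by (rule normal_central_preimage[OF nD(1)])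
  have DE: "D \<subseteq> E" unfolding E_def by (rule normal_le_central_preimage[OF nD(1)])
  have "E \<inter> Z \<lhd> G" by (rule normal_subgroup_intersect[OF nE Z])
  moreover have "D \<subseteq> E \<inter> Z" "E \<inter> Z \<noteq> D"
    using DE nD(3) x subgroup.mem_carrier[OF sZ x(1)] by (auto simp: E_def)
  ultimately have "E \<inter> Z = Z" using D(2)[of "E \<inter> Z"] nD(2) unfolding \<C>_def by blast
  then have "z \<otimes> g \<otimes> inv z \<otimes> inv g \<in> D" if "z \<in> Z" "g \<in> carrier G" for z g
    using that by (auto simp: E_def)
  then show ?thesis using that[OF nD] by blast
qed

section \<open>Calculus with central commutators; powers of powerfully embedded sections\<close>

lemma (in group) commutator_central_mult:
  assumes x: "x \<in> carrier G" and y: "y \<in> carrier G" and z: "z \<in> carrier G"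
    and cy: "\<And>g. g \<in> carrier G \<Longrightarrow> (x \<otimes> y \<otimes> inv x \<otimes> inv y) \<otimes> g = g \<otimes> (x \<otimes> y \<otimes> inv x \<otimes> inv y)"
    and cz: "\<And>g. g \<in> carrier G \<Longrightarrow> (x \<otimes> z \<otimes> inv x \<otimes> inv z) \<otimes> g = g \<otimes> (x \<otimes> z \<otimes> inv x \<otimes> inv z)"
  shows "x \<otimes> (y \<otimes> z) \<otimes> inv x \<otimes> inv (y \<otimes> z) = (x \<otimes> y \<otimes> inv x \<otimes> inv y) \<otimes> (x \<otimes> z \<otimes> inv x \<otimes> inv z)"
proof -
  let ?b = "x \<otimes> z \<otimes> inv x \<otimes> inv z"
  have b: "?b \<in> carrier G" using x z by simp
  have "x \<otimes> (y \<otimes> z) \<otimes> inv x \<otimes> inv (y \<otimes> z) = (x \<otimes> y \<otimes> inv x) \<otimes> (?b \<otimes> inv y)"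
    using x y z by (simp add: group_normalize)
  also have "?b \<otimes> inv y = inv y \<otimes> ?b" by (rule cz) (use y in simp)
  also have "(x \<otimes> y \<otimes> inv x) \<otimes> (inv y \<otimes> ?b) = (x \<otimes> y \<otimes> inv x \<otimes> inv y) \<otimes> ?b"
    using x y b by (simp add: m_assoc del: inv_mult_group)
  finally show ?thesis .
qed

text \<open>\<open>d\<close> is the commutator of \<open>x\<close> and \<open>c\<close>, assumed
  central. Collecting \<open>(c x)^n\<close> leaves \<open>n choose 2\<close> copies of
  \<open>d\<close>; the divisibility of this binomial is what separates odd \<open>p\<close> from
  \<open>p = 2\<close>.\<close>

lemma (in group) class2_pow:
  assumes x: "x \<in> carrier G" and c: "c \<in> carrier G" and d: "d \<in> carrier G"
    and xc: "x \<otimes> c = d \<otimes> c \<otimes> x" and cd: "\<And>g. g \<in> carrier G \<Longrightarrow> d \<otimes> g = g \<otimes> d"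
  shows "x \<otimes> c [^] (n::nat) = d [^] n \<otimes> c [^] n \<otimes> x"
    and "(c \<otimes> x) [^] n = c [^] n \<otimes> x [^] n \<otimes> d [^] (n choose 2)"
proof -
  have dn: "d [^] (k::nat) \<otimes> g = g \<otimes> d [^] k" if g: "g \<in> carrier G" for k g
  proof (induction k)
    case (Suc k)
    have "d [^] Suc k \<otimes> g = d [^] k \<otimes> (g \<otimes> d)" using d g cd[OF g] by (simp add: m_assoc)
    also have "\<dots> = (g \<otimes> d [^] k) \<otimes> d" using d g Suc by (simp flip: m_assoc)
    finally show ?case using d g by (simp add: m_assoc)
  qed (use g in simp)
  show 1: "x \<otimes> c [^] (n::nat) = d [^] n \<otimes> c [^] n \<otimes> x" for n
  proof (induction n)
    case (Suc n)
    have "x \<otimes> c [^] Suc n = (x \<otimes> c [^] n) \<otimes> c" using x c by (simp add: m_assoc)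
    also have "\<dots> = d [^] n \<otimes> c [^] n \<otimes> (x \<otimes> c)" unfolding Suc using x c d by (simp add: m_assoc)
    also have "\<dots> = d [^] n \<otimes> (c [^] n \<otimes> d) \<otimes> c \<otimes> x" unfolding xc using x c d by (simp add: m_assoc)
    also have "c [^] n \<otimes> d = d \<otimes> c [^] n" using cd[of "c [^] n"] c by simp
    finally show ?case using x c d by (simp add: m_assoc)
  qed (use x in simp)
  have 2: "x [^] (k::nat) \<otimes> c = d [^] k \<otimes> (c \<otimes> x [^] k)" for k
  proof (induction k)
    case (Suc k)
    have "x [^] Suc k \<otimes> c = x [^] k \<otimes> (x \<otimes> c)" using x c by (simp add: m_assoc)
    also have "\<dots> = (x [^] k \<otimes> d) \<otimes> c \<otimes> x" unfolding xc using x c d by (simp add: m_assoc)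
    also have "x [^] k \<otimes> d = d \<otimes> x [^] k" using cd[of "x [^] k"] x by simp
    also have "d \<otimes> x [^] k \<otimes> c \<otimes> x = d \<otimes> (x [^] k \<otimes> c) \<otimes> x" using x c d by (simp add: m_assoc)
    also have "\<dots> = d [^] Suc k \<otimes> (c \<otimes> x [^] Suc k)"
      unfolding Suc nat_pow_Suc2[OF d] using x c d by (simp add: m_assoc)
    finally show ?case .
  qed (use c in simp)
  show "(c \<otimes> x) [^] n = c [^] n \<otimes> x [^] n \<otimes> d [^] (n choose 2)"
  proof (induction n)
    case (Suc n)
    have "(c \<otimes> x) [^] Suc n = c [^] n \<otimes> x [^] n \<otimes> (d [^] (n choose 2) \<otimes> (c \<otimes> x))"
      using Suc x c d by (simp add: m_assoc)
    also have "d [^] (n choose 2) \<otimes> (c \<otimes> x) = (c \<otimes> x) \<otimes> d [^] (n choose 2)" by (rule dn) (use x c in simp)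
    also have "c [^] n \<otimes> x [^] n \<otimes> (c \<otimes> x \<otimes> d [^] (n choose 2)) = c [^] n \<otimes> (x [^] n \<otimes> c) \<otimes> x \<otimes> d [^] (n choose 2)"
      using x c d by (simp add: m_assoc)
    also have "\<dots> = c [^] n \<otimes> (d [^] n \<otimes> (c \<otimes> x [^] n \<otimes> x)) \<otimes> d [^] (n choose 2)"
      unfolding 2 using x c d by (simp add: m_assoc)
    also have "d [^] n \<otimes> (c \<otimes> x [^] n \<otimes> x) = (c \<otimes> x [^] n \<otimes> x) \<otimes> d [^] n" by (rule dn) (use x c in simp)
    also have "c [^] n \<otimes> (c \<otimes> x [^] n \<otimes> x \<otimes> d [^] n) \<otimes> d [^] (n choose 2)
        = c [^] Suc n \<otimes> x [^] Suc n \<otimes> (d [^] n \<otimes> d [^] (n choose 2))"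
      using x c d by (simp add: m_assoc)
    also have "d [^] n \<otimes> d [^] (n choose 2) = d [^] (Suc n choose 2)"
      using d by (simp add: nat_pow_mult numeral_2_eq_2)
    finally show ?case .
  qed (simp add: numeral_2_eq_2)
qed

text \<open>The two calculations behind the fact that \<open>N\<^sup>p\<close> is powerfully embedded when \<open>N\<close> is, after passing
  to a quotient in which the \<open>p\<close>-th (fourth) powers of \<open>N\<^sup>p\<close> vanish and \<open>[N\<^sup>p, G]\<close> is central.\<close>
lemma (in group) pow_gen_central_odd:
  assumes p: "Factorial_Ring.prime (p::nat)" "p \<noteq> 2" and M: "M \<lhd> G"
    and comm: "\<And>x g. x \<in> M \<Longrightarrow> g \<in> carrier G \<Longrightarrow> x \<otimes> g \<otimes> inv x \<otimes> inv g \<in> pow_gen G p {\<one>} M"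
    and pow: "\<And>z. z \<in> pow_gen G p {\<one>} M \<Longrightarrow> z [^] p = \<one>"
    and central: "\<And>z g k. z \<in> pow_gen G p {\<one>} M \<Longrightarrow> g \<in> carrier G \<Longrightarrow> k \<in> carrier G \<Longrightarrow>
      (z \<otimes> g \<otimes> inv z \<otimes> inv g) \<otimes> k = k \<otimes> (z \<otimes> g \<otimes> inv z \<otimes> inv g)"
    and z: "z \<in> pow_gen G p {\<one>} M" and g: "g \<in> carrier G"
  shows "z \<otimes> g = g \<otimes> z"
proof -
  have sM: "subgroup M G" by (rule normal_imp_subgroup[OF M])
  note Mc = subgroup.mem_carrier[OF sM]
  have stM: "stable_subgroup G (carrier G) M" using M normal_iff_stable by simp
  have st1: "stable_subgroup G (carrier G) {\<one>}" using one_is_normal normal_iff_stable by simp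
  have sS: "subgroup (pow_gen G p {\<one>} M) G" by (rule stable_subgroupD(1)[OF pow_gen_stable[OF subset_refl st1 stM]])
  note Sc = subgroup.mem_carrier[OF sS]
  have p_choose: "p dvd (p choose 2)"
    by (rule dvd_choose_prime) (use p prime_gt_1_nat[OF p(1)] in auto)
  have gen: "x [^] p \<otimes> g = g \<otimes> x [^] p" if x: "x \<in> M" and g: "g \<in> carrier G" for x g
  proof -
    \<comment> \<open>\<open>g x g^-1 = c x\<close> with \<open>c\<close> in \<open>M^p\<close>;
      comparing \<open>(c x)^p\<close> with \<open>x^p\<close> will show that \<open>g\<close> fixes
      \<open>x^p\<close>.\<close>
    let ?c = "g \<otimes> x \<otimes> inv g \<otimes> inv x"
    have c: "?c \<in> pow_gen G p {\<one>} M"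
      using subgroup.m_inv_closed[OF sS comm[OF x g]] Mc[OF x] g by (simp add: group_normalize)
    note cc = Sc[OF c]
    let ?d = "inv (?c \<otimes> x \<otimes> inv ?c \<otimes> inv x)"
    have dc: "?d \<in> carrier G" using cc Mc[OF x] by (simp del: inv_mult_group)
    have cd: "?d \<otimes> k = k \<otimes> ?d" if k: "k \<in> carrier G" for k
    proof -
      have "inv (?c \<otimes> x \<otimes> inv ?c \<otimes> inv x) \<otimes> k = inv (inv k \<otimes> (?c \<otimes> x \<otimes> inv ?c \<otimes> inv x))"
        using k dc by (subst inv_mult_group) (use cc Mc[OF x] k in \<open>simp_all del: inv_mult_group\<close>)
      also have "\<dots> = inv ((?c \<otimes> x \<otimes> inv ?c \<otimes> inv x) \<otimes> inv k)"
        using central[OF c Mc[OF x], of "inv k"] k by simp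
      also have "\<dots> = k \<otimes> ?d" by (subst inv_mult_group) (use cc Mc[OF x] k in \<open>simp_all del: inv_mult_group\<close>)
      finally show ?thesis .
    qed
    obtain c where c_def: "c = ?c" by simp
    have cC: "c \<in> carrier G" and cS: "c \<in> pow_gen G p {\<one>} M" using c cc c_def by auto
    obtain d where d_def: "d = inv (c \<otimes> x \<otimes> inv c \<otimes> inv x)" by simp
    have dC: "d \<in> carrier G" and dcomm: "\<And>k. k \<in> carrier G \<Longrightarrow> d \<otimes> k = k \<otimes> d"
      using dc cd unfolding d_def c_def by auto
    have xc: "x \<otimes> c = d \<otimes> c \<otimes> x" unfolding d_def using cC Mc[OF x] by (simp add: group_normalize)
    have c1: "c [^] p = \<one>" by (rule pow[OF cS])
    \<comment> \<open>Since \<open>c^p = 1\<close>, moving \<open>x\<close> past \<open>c^p\<close>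
      produces only \<open>d^p\<close>.\<close>
    have "x = d [^] p \<otimes> x" using class2_pow(1)[OF Mc[OF x] cC dC xc dcomm, of p] c1 Mc[OF x] dC by simp
    then have dp: "d [^] p = \<one>" using Mc[OF x] dC by (metis nat_pow_closed r_cancel_one)
    obtain j where "p choose 2 = p * j" using p_choose by (rule dvdE)
    then have "d [^] (p choose 2) = \<one>" using dp dC by (simp flip: nat_pow_pow)
    then have "(c \<otimes> x) [^] p = x [^] p"
      using class2_pow(2)[OF Mc[OF x] cC dC xc dcomm, of p] c1 Mc[OF x] by simp
    moreover have "c \<otimes> x = g \<otimes> x \<otimes> inv g" unfolding c_def using g Mc[OF x] by (simp add: group_normalize)
    ultimately have "g \<otimes> x [^] p \<otimes> inv g = x [^] p" using conj_nat_pow[OF g Mc[OF x]] by simp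
    then have "x [^] p \<otimes> g = g \<otimes> x [^] p \<otimes> inv g \<otimes> g" by simp
    then show ?thesis using g Mc[OF x] by (simp add: m_assoc)
  qed
  let ?Z = "{x \<in> carrier G. \<forall>t\<in>carrier G. x \<otimes> t = t \<otimes> x}"
  have "pow_gen G p {\<one>} M \<subseteq> ?Z"
    unfolding pow_gen_def
    by (rule generate_subgroup_incl[OF _ centralizer_subgroup[OF subset_refl]]) (use gen Mc in auto)
  then show ?thesis using z g by blast
qed

text \<open>As \<open>2 choose 2 = 1\<close>, squares cannot be treated directly, and fourth powers
  come first: commutators with \<open>M^4\<close> have square 1, because eighth powers vanish, and
  \<open>4 choose 2 = 6\<close> is even. Then \<open>M^4\<close> is central of exponent 2, and for
  \<open>c\<close> in \<open>M^4\<close> both \<open>c^2\<close> and the commutator term in the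
  formula for squares vanish.\<close>

lemma (in group) pow_gen_central_two:
  assumes M: "M \<lhd> G"
    and comm: "\<And>x g. x \<in> M \<Longrightarrow> g \<in> carrier G \<Longrightarrow> x \<otimes> g \<otimes> inv x \<otimes> inv g \<in> pow_gen G 4 {\<one>} M"
    and pow: "\<And>z. z \<in> pow_gen G 2 {\<one>} M \<Longrightarrow> z [^] (4::nat) = \<one>"
    and central: "\<And>z g k. z \<in> pow_gen G 2 {\<one>} M \<Longrightarrow> g \<in> carrier G \<Longrightarrow> k \<in> carrier G \<Longrightarrow>
      (z \<otimes> g \<otimes> inv z \<otimes> inv g) \<otimes> k = k \<otimes> (z \<otimes> g \<otimes> inv z \<otimes> inv g)"
    and z: "z \<in> pow_gen G 2 {\<one>} M" and g: "g \<in> carrier G"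
  shows "z \<otimes> g = g \<otimes> z"
proof -
  let ?S = "pow_gen G 2 {\<one>} M" and ?R = "pow_gen G 4 {\<one>} M"
  have sM: "subgroup M G" by (rule normal_imp_subgroup[OF M])
  note Mc = subgroup.mem_carrier[OF sM]
  have stM: "stable_subgroup G (carrier G) M" using M normal_iff_stable by simp
  have st1: "stable_subgroup G (carrier G) {\<one>}" using one_is_normal normal_iff_stable by simp
  have sS: "subgroup ?S G" and sR: "subgroup ?R G"
    by (rule stable_subgroupD(1)[OF pow_gen_stable[OF subset_refl st1 stM]])+
  note Sc = subgroup.mem_carrier[OF sS]
  have p4: "w [^] (4::nat) = (w [^] (2::nat)) [^] (2::nat)" if "w \<in> carrier G" for w
    using that by (simp add: nat_pow_pow)
  have sq: "w [^] (2::nat) = w \<otimes> w" if "w \<in> carrier G" for w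
    using that by (simp add: numeral_2_eq_2)
  have S2: "w [^] (2::nat) \<in> ?S" if "w \<in> M" for w using pow_gen_incl(2)[OF that] .
  have S4: "w [^] (4::nat) \<in> ?S" if "w \<in> M" for w
    unfolding p4[OF Mc[OF that]] by (rule subgroup_nat_pow[OF sS S2[OF that]])
  have w8: "w [^] (8::nat) = \<one>" if "w \<in> M" for w
    using pow[OF S2[OF that]] Mc[OF that] by (simp add: nat_pow_pow)
  have RS: "?R \<subseteq> ?S"
    unfolding pow_gen_def[of G 4]
    by (rule generate_subgroup_incl[OF _ sS]) (use S4 subgroup.one_closed[OF sS] in auto)
  have inv_central: "inv u \<otimes> k = k \<otimes> inv u"
    if u: "u \<in> carrier G" "\<And>k. k \<in> carrier G \<Longrightarrow> u \<otimes> k = k \<otimes> u" and k: "k \<in> carrier G" for u k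
  proof -
    have "inv u \<otimes> k = inv u \<otimes> (k \<otimes> u) \<otimes> inv u" using u(1) k by (simp add: m_assoc)
    also have "\<dots> = k \<otimes> inv u" unfolding u(2)[OF k, symmetric] using u(1) k by (simp add: group_normalize)
    finally show ?thesis .
  qed
  have central': "(g \<otimes> z \<otimes> inv g \<otimes> inv z) \<otimes> k = k \<otimes> (g \<otimes> z \<otimes> inv g \<otimes> inv z)"
    if z: "z \<in> ?S" and g: "g \<in> carrier G" and k: "k \<in> carrier G" for z g k
  proof -
    have "g \<otimes> z \<otimes> inv g \<otimes> inv z = inv (z \<otimes> g \<otimes> inv z \<otimes> inv g)" using Sc[OF z] g by (simp add: group_normalize)
    then show ?thesis using inv_central[OF _ central[OF z g] k] Sc[OF z] g by simp
  qed
  \<comment> \<open>Commutation with \<open>y\<close> is multiplicative on \<open>M^2\<close>, as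
    the resulting commutators are central; so the square of its value at \<open>w^4\<close> is its
    value at \<open>w^8 = 1\<close>.\<close>
  have A: "(y \<otimes> c \<otimes> inv y \<otimes> inv c) [^] (2::nat) = \<one>" if y: "y \<in> M" and c: "c \<in> ?R" for y c
  proof -
    note yc = Mc[OF y]
    let ?f = "\<lambda>z. y \<otimes> z \<otimes> inv y \<otimes> inv z"
    have mult: "?f (a \<otimes> b) = ?f a \<otimes> ?f b" if ab: "a \<in> ?S" "b \<in> ?S" for a b
      by (rule commutator_central_mult[OF yc Sc[OF ab(1)] Sc[OF ab(2)]]) (use central' yc ab in blast)+
    have base: "?f (w [^] (4::nat)) [^] (2::nat) = \<one>" if w: "w \<in> M" for w
    proof -
      have "?f (w [^] (4::nat)) [^] (2::nat) = ?f (w [^] (4::nat) \<otimes> w [^] (4::nat))"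
        unfolding mult[OF S4[OF w] S4[OF w]] by (rule sq) (use yc Mc[OF w] in simp)
      also have "w [^] (4::nat) \<otimes> w [^] (4::nat) = \<one>" using w8[OF w] Mc[OF w] by (simp add: nat_pow_mult)
      finally show ?thesis using yc by simp
    qed
    show ?thesis
      using c unfolding pow_gen_def
    proof (induction rule: generate.induct)
      case one
      then show ?case using yc by simp
    next
      case (incl c)
      then show ?case using base yc by auto
    next
      case (inv c)
      then show ?case
      proof
        assume "c \<in> {x [^] (4::nat) | x. x \<in> M}"
        then obtain w where w: "w \<in> M" "c = w [^] (4::nat)" by blast
        then have "inv c = (inv w) [^] (4::nat)" using Mc nat_pow_inv by simp
        then show ?thesis using base[OF subgroup.m_inv_closed[OF sM w(1)]] by simp
      qed (use yc in simp)
    next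
      case (eng a b)
      then have ab: "a \<in> ?S" "b \<in> ?S" using RS unfolding pow_gen_def[of G 4] by auto
      have fc: "?f a \<in> carrier G" "?f b \<in> carrier G" using yc Sc[OF ab(1)] Sc[OF ab(2)] by simp_all
      have "?f (a \<otimes> b) [^] (2::nat) = ?f a [^] (2::nat) \<otimes> ?f b [^] (2::nat)"
        unfolding mult[OF ab]
        by (rule pow_mult_distrib[OF central'[OF ab(1) yc fc(2)] fc])
      then show ?case unfolding eng.IH by simp
    qed
  qed
  have comm_swap: "g \<otimes> y \<otimes> inv g \<otimes> inv y \<in> ?R" if "y \<in> M" "g \<in> carrier G" for y g
    using subgroup.m_inv_closed[OF sR comm[OF that]] Mc[OF that(1)] that(2) by (simp add: group_normalize)
  have conj_eq: "g \<otimes> y [^] n \<otimes> inv g = ((g \<otimes> y \<otimes> inv g \<otimes> inv y) [^] n \<otimes> y [^] n) \<otimes>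
      (y \<otimes> (g \<otimes> y \<otimes> inv g \<otimes> inv y) \<otimes> inv y \<otimes> inv (g \<otimes> y \<otimes> inv g \<otimes> inv y)) [^] (n choose 2)"
    if y: "y \<in> M" and g: "g \<in> carrier G" for y g and n :: nat
  proof -
    note yc = Mc[OF y]
    obtain c where c_def: "c = g \<otimes> y \<otimes> inv g \<otimes> inv y" by simp
    have cS: "c \<in> ?S" using comm_swap[OF y g] RS c_def by blast
    note cc = Sc[OF cS]
    obtain d where d_def: "d = y \<otimes> c \<otimes> inv y \<otimes> inv c" by simp
    have dc: "d \<in> carrier G" using yc cc d_def by simp
    have "y \<otimes> c = d \<otimes> c \<otimes> y" unfolding d_def using yc cc by (simp add: group_normalize)
    from class2_pow(2)[OF yc cc dc this, of n]
    have "(c \<otimes> y) [^] n = c [^] n \<otimes> y [^] n \<otimes> d [^] (n choose 2)"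
      using central'[OF cS yc] d_def by blast
    moreover have "c \<otimes> y = g \<otimes> y \<otimes> inv g" unfolding c_def using g yc by (simp add: group_normalize)
    ultimately show ?thesis using conj_nat_pow[OF g yc] unfolding d_def c_def by simp
  qed
  have fixed: "x \<otimes> g = g \<otimes> x" if "g \<otimes> x \<otimes> inv g = x" "g \<in> carrier G" "x \<in> carrier G" for x g
  proof -
    have "x \<otimes> g = (g \<otimes> x \<otimes> inv g) \<otimes> g" using that(1) by simp
    then show ?thesis using that(2,3) by (simp add: m_assoc)
  qed
  have y4: "y [^] (4::nat) \<otimes> g = g \<otimes> y [^] (4::nat)" if y: "y \<in> M" and g: "g \<in> carrier G" for y g
  proof (rule fixed[OF _ g])
    let ?c = "g \<otimes> y \<otimes> inv g \<otimes> inv y"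
    let ?d = "y \<otimes> ?c \<otimes> inv y \<otimes> inv ?c"
    have cR: "?c \<in> ?R" by (rule comm_swap[OF y g])
    then have c4: "?c [^] (4::nat) = \<one>" using pow RS by blast
    have dC: "?d \<in> carrier G" using Mc[OF y] Sc RS cR by (simp add: subset_iff)
    have "(4::nat) choose 2 = 2 * 3" by (simp add: choose_two)
    then have "?d [^] ((4::nat) choose 2) = (?d [^] (2::nat)) [^] (3::nat)" using dC by (simp only: nat_pow_pow)
    then have "?d [^] ((4::nat) choose 2) = \<one>" unfolding A[OF y cR] by simp
    then show "g \<otimes> y [^] (4::nat) \<otimes> inv g = y [^] (4::nat)"
      unfolding conj_eq[OF y g, of 4] c4 using Mc[OF y] by simp
  qed (use Mc[OF y] in simp)
  let ?Z = "{x \<in> carrier G. \<forall>t\<in>carrier G. x \<otimes> t = t \<otimes> x}"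
  have sZ: "subgroup ?Z G" by (rule centralizer_subgroup[OF subset_refl])
  have "?R \<subseteq> ?Z"
    unfolding pow_gen_def by (rule generate_subgroup_incl[OF _ sZ]) (use y4 Mc in auto)
  then have Rcentral: "c \<otimes> k = k \<otimes> c" if "c \<in> ?R" "k \<in> carrier G" for c k using that by blast
  have R2: "c [^] (2::nat) = \<one>" if c: "c \<in> ?R" for c
  proof -
    have base: "(w [^] (4::nat)) [^] (2::nat) = \<one>" if "w \<in> M" for w
      using w8[OF that] Mc[OF that] by (simp add: nat_pow_pow)
    show ?thesis
      using c unfolding pow_gen_def
    proof (induction rule: generate.induct)
      case (incl c)
      then show ?case using base by auto
    next
      case (inv c)
      then show ?case
      proof
        assume "c \<in> {x [^] (4::nat) | x. x \<in> M}"
        then obtain w where w: "w \<in> M" "c = w [^] (4::nat)" by blast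
        then have "inv c = (inv w) [^] (4::nat)" using Mc nat_pow_inv by simp
        then show ?thesis using base[OF subgroup.m_inv_closed[OF sM w(1)]] by simp
      qed simp
    next
      case (eng a b)
      then have ab: "a \<in> ?R" "b \<in> ?R" unfolding pow_gen_def by auto
      have c: "a \<in> carrier G" "b \<in> carrier G" using subgroup.mem_carrier[OF sR] ab by auto
      have "(a \<otimes> b) [^] (2::nat) = a [^] (2::nat) \<otimes> b [^] (2::nat)"
        by (rule pow_mult_distrib[OF Rcentral[OF ab(1) c(2)] c])
      then show ?case unfolding eng.IH by simp
    qed simp
  qed
  have y2: "y [^] (2::nat) \<otimes> g = g \<otimes> y [^] (2::nat)" if y: "y \<in> M" and g: "g \<in> carrier G" for y g
  proof (rule fixed[OF _ g])
    let ?c = "g \<otimes> y \<otimes> inv g \<otimes> inv y"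
    let ?d = "y \<otimes> ?c \<otimes> inv y \<otimes> inv ?c"
    have cR: "?c \<in> ?R" by (rule comm_swap[OF y g])
    have cC: "?c \<in> carrier G" using Mc[OF y] g by simp
    have "y \<otimes> ?c = ?c \<otimes> y" using Rcentral[OF cR Mc[OF y]] by simp
    then have "?d = ?c \<otimes> y \<otimes> inv y \<otimes> inv ?c" by (simp only:)
    also have "\<dots> = \<one>" using Mc[OF y] cC by (simp add: m_assoc del: inv_mult_group)
    finally have "?d = \<one>" .
    then show "g \<otimes> y [^] (2::nat) \<otimes> inv g = y [^] (2::nat)"
      unfolding conj_eq[OF y g, of 2] R2[OF cR] using Mc[OF y] by simp
  qed (use Mc[OF y] in simp)
  have "?S \<subseteq> ?Z"
    unfolding pow_gen_def by (rule generate_subgroup_incl[OF _ sZ]) (use y2 Mc in auto)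
  then show ?thesis using z g by blast
qed

lemma (in group) pow_gen_central:
  assumes p: "Factorial_Ring.prime (p::nat)" and M: "M \<lhd> G"
    and comm: "\<And>x g. x \<in> M \<Longrightarrow> g \<in> carrier G \<Longrightarrow> x \<otimes> g \<otimes> inv x \<otimes> inv g \<in> pow_gen G (if p = 2 then 4 else p) {\<one>} M"
    and pow: "\<And>z. z \<in> pow_gen G p {\<one>} M \<Longrightarrow> z [^] (if p = 2 then 4 else p) = \<one>"
    and central: "\<And>z g k. z \<in> pow_gen G p {\<one>} M \<Longrightarrow> g \<in> carrier G \<Longrightarrow> k \<in> carrier G \<Longrightarrow>
      (z \<otimes> g \<otimes> inv z \<otimes> inv g) \<otimes> k = k \<otimes> (z \<otimes> g \<otimes> inv z \<otimes> inv g)"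
    and z: "z \<in> pow_gen G p {\<one>} M" and g: "g \<in> carrier G"
  shows "z \<otimes> g = g \<otimes> z"
proof (cases "p = 2")
  case True
  show ?thesis by (rule pow_gen_central_two[OF M _ _ _ _ g]) (use True comm pow central z in auto)
next
  case False
  show ?thesis by (rule pow_gen_central_odd[OF p False M _ _ _ z g]) (use False comm pow central in auto)
qed

text \<open>Let \<open>M1 = M^p L\<close> and let \<open>Y\<close> be the bound required for
  \<open>[M1, G]\<close>. If it failed, let \<open>Z\<close> be generated by \<open>Y\<close> and
  \<open>[M1, G]\<close>, and take \<open>D\<close> between \<open>Y\<close> and \<open>Z\<close>
  with \<open>Z / D\<close> central. Modulo \<open>D\<close> the required powers of
  \<open>M1\<close> vanish and \<open>[M1, G]\<close> is central, so \<open>pow_gen_central\<close>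
  makes \<open>M1\<close> central; then \<open>Z\<close> lies in \<open>D\<close>, which is
  absurd.\<close>

lemma (in group) eta_step_pow_normal:
  assumes fin: "finite (carrier G)" and p: "Factorial_Ring.prime (p::nat)" "order G = p ^ k"
    and step: "eta_step G p (carrier G) L M"
  shows "eta_step G p (carrier G) L (pow_gen G p L M)"
proof -
  let ?e = "if p = 2 then 4 else p"
  have st: "stable_subgroup G (carrier G) L" "stable_subgroup G (carrier G) M" "L \<subseteq> M"
    and comm: "\<And>x g. x \<in> M \<Longrightarrow> g \<in> carrier G \<Longrightarrow> x \<otimes> g \<otimes> inv x \<otimes> inv g \<in> pow_gen G ?e L M"
    using step by (auto simp: eta_step_def)
  define M1 where "M1 = pow_gen G p L M"
  define Y where "Y = pow_gen G ?e L M1"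
  have st1: "stable_subgroup G (carrier G) M1" unfolding M1_def by (rule pow_gen_stable[OF subset_refl st(1,2)])
  have stY: "stable_subgroup G (carrier G) Y" unfolding Y_def by (rule pow_gen_stable[OF subset_refl st(1) st1])
  have sM1: "subgroup M1 G" and sM: "subgroup M G" and sL: "subgroup L G" using st st1 stable_subgroupD(1) by auto
  note M1c = subgroup.mem_carrier[OF sM1]
  have LM1: "L \<subseteq> M1" unfolding M1_def by (rule pow_gen_incl(1))
  have LY: "L \<subseteq> Y" unfolding Y_def by (rule pow_gen_incl(1))
  have "x \<otimes> g \<otimes> inv x \<otimes> inv g \<in> Y" if "x \<in> M1" "g \<in> carrier G" for x g
  proof (rule ccontr)
    assume ne: "x \<otimes> g \<otimes> inv x \<otimes> inv g \<notin> Y"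
    define S where "S = {x \<otimes> g \<otimes> inv x \<otimes> inv g | x g. x \<in> M1 \<and> g \<in> carrier G} \<union> Y"
    define Z where "Z = generate G S"
    have SG: "S \<subseteq> carrier G" using M1c subgroup.subset[OF stable_subgroupD(1)[OF stY]] by (auto simp: S_def)
    have SZ: "S \<subseteq> Z" unfolding Z_def by (rule subsetI) (rule generate.incl)
    have nZ: "Z \<lhd> G"
      unfolding normal_iff_stable Z_def
    proof (rule generate_stable[OF SG subset_refl])
      fix d s assume d: "d \<in> carrier G" and "s \<in> S"
      then consider "s \<in> Y" | x g where "x \<in> M1" "g \<in> carrier G" "s = x \<otimes> g \<otimes> inv x \<otimes> inv g" by (auto simp: S_def)
      then show "d \<otimes> s \<otimes> inv d \<in> S"
      proof cases
        case 1
        then show ?thesis using stable_subgroupD(2)[OF stY d] by (simp add: S_def)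
      next
        case 2
        then have "d \<otimes> s \<otimes> inv d = (d \<otimes> x \<otimes> inv d) \<otimes> (d \<otimes> g \<otimes> inv d) \<otimes> inv (d \<otimes> x \<otimes> inv d) \<otimes> inv (d \<otimes> g \<otimes> inv d)"
          using d M1c by (simp add: group_normalize)
        moreover have "d \<otimes> g \<otimes> inv d \<in> carrier G" using d 2 by simp
        ultimately show ?thesis using stable_subgroupD(2)[OF st1 d 2(1)] unfolding S_def by blast
      qed
    qed
    have "Y \<subset> Z" using ne that SZ by (auto simp: S_def)
    moreover have "Y \<lhd> G" using stY normal_iff_stable by simp
    ultimately obtain D where D: "D \<lhd> G" "Y \<subseteq> D" "D \<subset> Z"
      and ZD: "\<And>z g. z \<in> Z \<Longrightarrow> g \<in> carrier G \<Longrightarrow> z \<otimes> g \<otimes> inv z \<otimes> inv g \<in> D"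
      using normal_chain_step[OF fin p _ nZ] by blast
    obtain Q :: "'a set monoid" and h where q: "group_hom G Q h" and sur: "h ` carrier G = carrier Q"
      and ker: "\<And>a. a \<in> carrier G \<Longrightarrow> h a = \<one>\<^bsub>Q\<^esub> \<longleftrightarrow> a \<in> D" using quotient_group_hom[OF D(1)] by blast
    interpret q: group_hom G Q h by (rule q)
    have comm_iff: "h x \<otimes>\<^bsub>Q\<^esub> h v = h v \<otimes>\<^bsub>Q\<^esub> h x \<longleftrightarrow> x \<otimes> v \<otimes> inv x \<otimes> inv v \<in> D"
      if x: "x \<in> carrier G" and v: "v \<in> carrier G" for x v
    proof -
      have "x \<otimes> v \<otimes> inv x \<otimes> inv v \<in> D \<longleftrightarrow> h (x \<otimes> v \<otimes> inv x \<otimes> inv v) = \<one>\<^bsub>Q\<^esub>"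
        by (rule ker[symmetric]) (use x v in simp)
      also have "h (x \<otimes> v \<otimes> inv x \<otimes> inv v) = (h x \<otimes>\<^bsub>Q\<^esub> h v) \<otimes>\<^bsub>Q\<^esub> inv\<^bsub>Q\<^esub> (h v \<otimes>\<^bsub>Q\<^esub> h x)"
        using x v by (simp add: q.H.group_normalize)
      also have "\<dots> = \<one>\<^bsub>Q\<^esub> \<longleftrightarrow> h x \<otimes>\<^bsub>Q\<^esub> h v = h v \<otimes>\<^bsub>Q\<^esub> h x"
        using q.H.div_eq_one[of "h x \<otimes>\<^bsub>Q\<^esub> h v" "h v \<otimes>\<^bsub>Q\<^esub> h x"] x v by auto
      finally show ?thesis by simp
    qed
    have hL: "h ` L = {\<one>\<^bsub>Q\<^esub>}"
    proof -
      have "h l = \<one>\<^bsub>Q\<^esub>" if "l \<in> L" for l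
        by (rule iffD2[OF ker[OF subgroup.mem_carrier[OF sL that]]]) (use that LY D(2) in blast)
      then show ?thesis using subgroup.one_closed[OF sL] by auto
    qed
    have img: "pow_gen Q n {\<one>\<^bsub>Q\<^esub>} (h ` M) = h ` pow_gen G n L M" for n
      using q.pow_gen_image[OF subgroup.subset[OF sM] subgroup.subset[OF sL]] hL by simp
    have nM: "M \<lhd> G" using st(2) normal_iff_stable by simp
    have "S \<subseteq> D"
    proof
      fix s assume "s \<in> S"
      then consider "s \<in> Y" | x g where "x \<in> M1" "g \<in> carrier G" "s = x \<otimes> g \<otimes> inv x \<otimes> inv g" by (auto simp: S_def)
      then show "s \<in> D"
      proof cases
        case 2
        have "h x \<otimes>\<^bsub>Q\<^esub> h g = h g \<otimes>\<^bsub>Q\<^esub> h x"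
        proof (rule q.H.pow_gen_central[OF p(1) q.normal_image[OF sur nM]])
          show "x \<otimes>\<^bsub>Q\<^esub> g \<otimes>\<^bsub>Q\<^esub> inv\<^bsub>Q\<^esub> x \<otimes>\<^bsub>Q\<^esub> inv\<^bsub>Q\<^esub> g \<in> pow_gen Q ?e {\<one>\<^bsub>Q\<^esub>} (h ` M)"
            if xg: "x \<in> h ` M" "g \<in> carrier Q" for x g
          proof -
            obtain y k where yk: "y \<in> M" "x = h y" "k \<in> carrier G" "g = h k" using xg unfolding sur[symmetric] by blast
            then have "x \<otimes>\<^bsub>Q\<^esub> g \<otimes>\<^bsub>Q\<^esub> inv\<^bsub>Q\<^esub> x \<otimes>\<^bsub>Q\<^esub> inv\<^bsub>Q\<^esub> g = h (y \<otimes> k \<otimes> inv y \<otimes> inv k)"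
              using subgroup.mem_carrier[OF sM yk(1)] by simp
            then show ?thesis unfolding img using comm[OF yk(1,3)] by blast
          qed
          show "z [^]\<^bsub>Q\<^esub> ?e = \<one>\<^bsub>Q\<^esub>" if z: "z \<in> pow_gen Q p {\<one>\<^bsub>Q\<^esub>} (h ` M)" for z
          proof -
            obtain m where m: "m \<in> M1" "z = h m" using z unfolding img M1_def by blast
            have "m [^] ?e \<in> D" using pow_gen_incl(2)[OF m(1)] D(2) unfolding Y_def by blast
            then have "h (m [^] ?e) = \<one>\<^bsub>Q\<^esub>" using iffD2[OF ker[OF nat_pow_closed[OF M1c[OF m(1)]]]] by blast
            then show ?thesis unfolding m(2) using q.hom_nat_pow[OF M1c[OF m(1)], of ?e] by simp
          qed
          show "(z \<otimes>\<^bsub>Q\<^esub> g \<otimes>\<^bsub>Q\<^esub> inv\<^bsub>Q\<^esub> z \<otimes>\<^bsub>Q\<^esub> inv\<^bsub>Q\<^esub> g) \<otimes>\<^bsub>Q\<^esub> k = k \<otimes>\<^bsub>Q\<^esub> (z \<otimes>\<^bsub>Q\<^esub> g \<otimes>\<^bsub>Q\<^esub> inv\<^bsub>Q\<^esub> z \<otimes>\<^bsub>Q\<^esub> inv\<^bsub>Q\<^esub> g)"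
            if zgk: "z \<in> pow_gen Q p {\<one>\<^bsub>Q\<^esub>} (h ` M)" "g \<in> carrier Q" "k \<in> carrier Q" for z g k
          proof -
            obtain m where m: "m \<in> M1" "z = h m" using zgk(1) unfolding img M1_def by blast
            obtain a b where ab: "a \<in> carrier G" "g = h a" "b \<in> carrier G" "k = h b" using zgk(2,3)
              unfolding sur[symmetric] by blast
            let ?c = "m \<otimes> a \<otimes> inv m \<otimes> inv a"
            have cG: "?c \<in> carrier G" using M1c[OF m(1)] ab(1) by simp
            have "?c \<in> Z" using SZ m(1) ab(1) by (auto simp: S_def)
            then have "h ?c \<otimes>\<^bsub>Q\<^esub> h b = h b \<otimes>\<^bsub>Q\<^esub> h ?c" using comm_iff[OF cG ab(3)] ZD ab(3) by blast
            then show ?thesis unfolding m(2) ab(2,4) using M1c[OF m(1)] ab(1) by simp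
          qed
          show "h x \<in> pow_gen Q p {\<one>\<^bsub>Q\<^esub>} (h ` M)" unfolding img using 2(1) by (simp add: M1_def)
          show "h g \<in> carrier Q" using 2(2) by simp
        qed
        then show ?thesis unfolding 2(3) using comm_iff[OF M1c[OF 2(1)] 2(2)] by blast
      qed (use D(2) in blast)
    qed
    then have "Z \<subseteq> D" unfolding Z_def by (rule generate_subgroup_incl[OF _ normal_imp_subgroup[OF D(1)]])
    then show False using D(3) by blast
  qed
  then show ?thesis
    unfolding eta_step_def M1_def[symmetric] using st st1 LM1 subgroup.subset[OF sM1] by (simp add: Y_def)
qed

text \<open>Lets results about a group of prime power order be used for a Sylow subgroup inside
  \<open>G\<close>.\<close>

lemma (in group) eta_step_restrict:
  assumes P: "subgroup P G"
  shows "eta_step (G\<lparr>carrier := P\<rparr>) p P L M \<longleftrightarrow> eta_step G p P L M"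
proof -
  interpret P: group "G\<lparr>carrier := P\<rparr>" using subgroup_imp_group[OF P] .
  have st: "stable_subgroup (G\<lparr>carrier := P\<rparr>) P N \<longleftrightarrow> N \<subseteq> P \<and> stable_subgroup G P N" for N
    using normal_in_subgroup_iff[OF P, of N] P.normal_iff_stable[of N] by simp
  have pg: "pow_gen (G\<lparr>carrier := P\<rparr>) k L M = pow_gen G k L M" if "L \<subseteq> P" "M \<subseteq> P" for k
  proof -
    have "{x [^] k | x. x \<in> M} \<union> L \<subseteq> P" using that subgroup_nat_pow[OF P] by auto
    from generate_consistent[OF this P] show ?thesis
      unfolding pow_gen_def by (simp add: nat_pow_consistent flip: nat_pow_consistent)
  qed
  show ?thesis
  proof (cases "L \<subseteq> M \<and> M \<subseteq> P")
    case True
    then have LP: "L \<subseteq> P" by blast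
    have "(\<forall>x\<in>M. \<forall>g\<in>P. x \<otimes>\<^bsub>G\<lparr>carrier := P\<rparr>\<^esub> g \<otimes>\<^bsub>G\<lparr>carrier := P\<rparr>\<^esub> inv\<^bsub>G\<lparr>carrier := P\<rparr>\<^esub> x \<otimes>\<^bsub>G\<lparr>carrier := P\<rparr>\<^esub> inv\<^bsub>G\<lparr>carrier := P\<rparr>\<^esub> g \<in> pow_gen G e L M)
       \<longleftrightarrow> (\<forall>x\<in>M. \<forall>g\<in>P. x \<otimes> g \<otimes> inv x \<otimes> inv g \<in> pow_gen G e L M)" for e
      by (intro ball_cong refl) (simp add: m_inv_consistent[OF P] subsetD[OF conjunct2[OF True]])
    then show ?thesis unfolding eta_step_def st using pg[of _, OF LP] True LP by simp
  qed (auto simp: eta_step_def)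
qed

lemma (in group) eta_step_pow:
  assumes P: "subgroup P G" "finite P" "card P = p ^ k" and p: "Factorial_Ring.prime (p::nat)"
    and step: "eta_step G p P L M"
  shows "eta_step G p P L (pow_gen G p L M)"
proof -
  interpret P: group "G\<lparr>carrier := P\<rparr>" using subgroup_imp_group[OF P(1)] .
  have MP: "M \<subseteq> P" "L \<subseteq> P" using step by (auto simp: eta_step_def)
  have "{x [^] p | x. x \<in> M} \<union> L \<subseteq> P" using MP subgroup_nat_pow[OF P(1)] by auto
  from generate_consistent[OF this P(1)] have pg: "pow_gen (G\<lparr>carrier := P\<rparr>) p L M = pow_gen G p L M"
    unfolding pow_gen_def by (simp flip: nat_pow_consistent)
  have "eta_step (G\<lparr>carrier := P\<rparr>) p P L (pow_gen (G\<lparr>carrier := P\<rparr>) p L M)"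
    using P.eta_step_pow_normal[of p k L M] P p step eta_step_restrict[OF P(1)] by (simp add: order_def)
  then show ?thesis using pg eta_step_restrict[OF P(1)] by simp
qed

section \<open>Powerfully embedded sections acting on the core\<close>

lemma funpow_diff: "m \<le> n \<Longrightarrow> (f ^^ n) u = (f ^^ (n - m)) ((f ^^ m) u)"
  by (metis comp_apply funpow_add le_add_diff_inverse2)

text \<open>On an abelian normal subgroup this is the operator \<open>x - 1\<close> in
  multiplicative notation.\<close>

definition cdiff :: "('a,'b) monoid_scheme \<Rightarrow> 'a \<Rightarrow> 'a \<Rightarrow> 'a" where
  "cdiff G x v = x \<otimes>\<^bsub>G\<^esub> v \<otimes>\<^bsub>G\<^esub> inv\<^bsub>G\<^esub> x \<otimes>\<^bsub>G\<^esub> inv\<^bsub>G\<^esub> v"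

text \<open>A complement of \<open>V\<close> in \<open>E\<close> is constructed rather than assumed:
  the transfer restricts to \<open>V\<close> as the power by the index \<open>n\<close>, which is
  invertible because \<open>n\<close> is prime to \<open>p\<close>.\<close>

locale split_extension = abelian_normal_pair +
  fixes p k :: nat
  assumes nV: "V \<lhd> G" and nE: "E \<lhd> G" and p: "Factorial_Ring.prime p"
    and exp: "\<And>v. v \<in> V \<Longrightarrow> v [^] p = \<one>" and cardV: "card V = p ^ k" and copE: "coprime (card E div card V) p"
begin

lemma cV: "g \<in> carrier G \<Longrightarrow> v \<in> V \<Longrightarrow> g \<otimes> v \<otimes> inv g \<in> V" using nV by (simp add: normal_inv_iff)
lemma cE: "g \<in> carrier G \<Longrightarrow> v \<in> E \<Longrightarrow> g \<otimes> v \<otimes> inv g \<in> E" using nE by (simp add: normal_inv_iff)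

lemma finV: "finite V" using finE VE finite_subset by blast

lemma cop_nV: "coprime n (card V)"
  using copE by (simp add: cardV)

lemma root: assumes "v \<in> V" obtains u where "u \<in> V" "u [^] n = v"
  using coprime_root[OF V finV cop_nV] assms V_pow by metis

lemma pow_n_one: "v \<in> V \<Longrightarrow> v [^] n = \<one> \<Longrightarrow> v = \<one>"
  by (rule coprime_pow_eq_one[OF V finV cop_nV])

lemma pow_mult_V: "u \<in> V \<Longrightarrow> v \<in> V \<Longrightarrow> (u \<otimes> v) [^] (m::nat) = u [^] m \<otimes> v [^] m"
  by (rule pow_mult_distrib[OF comm Vc Vc])

lemma pow_inv_V: "v \<in> V \<Longrightarrow> (inv v) [^] (m::nat) = inv (v [^] m)"
  using Vc nat_pow_inv by simp

lemma conj_V_trivial: "u \<in> V \<Longrightarrow> v \<in> V \<Longrightarrow> u \<otimes> v \<otimes> inv u = v"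
  using comm[of u v] Vc by (simp add: m_assoc)

abbreviation "F \<equiv> transfer"

lemma FV: "a \<in> E \<Longrightarrow> F a \<in> V" and Fm: "a \<in> E \<Longrightarrow> b \<in> E \<Longrightarrow> F (a \<otimes> b) = F a \<otimes> (a \<otimes> F b \<otimes> inv a)"
  and Fp: "v \<in> V \<Longrightarrow> F v = v [^] n"
  using crossed_transfer by (simp_all add: crossed_power_hom_def)

lemma F_Vmult: "v \<in> V \<Longrightarrow> a \<in> E \<Longrightarrow> F (v \<otimes> a) = v [^] n \<otimes> F a"
  using Fm[of v a] Fp[of v] VE conj_V_trivial[OF _ FV] by auto

text \<open>The complement of \<open>V\<close> in \<open>E\<close>, replacing the Schur-Zassenhaus
  theorem. \<open>E = V Q0\<close> is \<open>E_decomp\<close>, and \<open>V\<close> meets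
  \<open>Q0\<close> trivially because the \<open>n\<close>-th power is injective on
  \<open>V\<close>.\<close>

definition Q0 where "Q0 = {a \<in> E. F a = \<one>}"

lemma Q0_subgroup: "subgroup Q0 G"
proof (rule subgroupI)
  show "Q0 \<subseteq> carrier G" using Ec by (auto simp: Q0_def)
  show "Q0 \<noteq> {}" using Fp[OF subgroup.one_closed[OF V]] subgroup.one_closed[OF E] by (auto simp: Q0_def)
  fix a assume "a \<in> Q0"
  then have a: "a \<in> E" "F a = \<one>" by (auto simp: Q0_def)
  have "\<one> = F a \<otimes> (a \<otimes> F (inv a) \<otimes> inv a)"
    using Fm[OF a(1) E_inv[OF a(1)]] Fp[OF subgroup.one_closed[OF V]] Ec[OF a(1)] by simp
  then have 1: "a \<otimes> F (inv a) \<otimes> inv a = \<one>" using a Ec Vc[OF FV[OF E_inv[OF a(1)]]] by simp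
  have "F (inv a) = inv a \<otimes> (a \<otimes> F (inv a) \<otimes> inv a) \<otimes> a"
    using Ec[OF a(1)] Vc[OF FV[OF E_inv[OF a(1)]]] by (simp add: group_normalize)
  then have "F (inv a) = \<one>" unfolding 1 using Ec[OF a(1)] by simp
  then show "inv a \<in> Q0" using E_inv[OF a(1)] by (simp add: Q0_def)
  fix b assume "b \<in> Q0"
  then show "a \<otimes> b \<in> Q0" using a Fm[of a b] E_mult Ec[OF a(1)] by (simp add: Q0_def)
qed

lemma Q0E: "q \<in> Q0 \<Longrightarrow> q \<in> E" by (simp add: Q0_def)
lemma Q0c: "q \<in> Q0 \<Longrightarrow> q \<in> carrier G" using Q0E Ec by blast

lemma E_decomp: assumes "a \<in> E" obtains u q where "u \<in> V" "q \<in> Q0" "a = u \<otimes> q"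
proof -
  \<comment> \<open>Left multiplication by an element of \<open>V\<close> changes \<open>F\<close>
    by its \<open>n\<close>-th power, so an \<open>n\<close>-th root of \<open>F a\<close> is the
    right correction.\<close>
  obtain u where u: "u \<in> V" "u [^] n = F a" using root[OF FV[OF assms]] .
  have "F (inv u \<otimes> a) = inv (u [^] n) \<otimes> F a"
    using F_Vmult[OF V_inv[OF u(1)] assms] pow_inv_V[OF u(1)] by simp
  then have "inv u \<otimes> a \<in> Q0" using u(2) Vc[OF FV[OF assms]] E_mult[OF subsetD[OF VE V_inv[OF u(1)]] assms]
    by (simp add: Q0_def)
  moreover have "a = u \<otimes> (inv u \<otimes> a)" using Vc[OF u(1)] Ec[OF assms] by (simp add: inv_cancel_left)
  ultimately show ?thesis using that u(1) by blast
qed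

lemma Q0_coprime: "coprime (card Q0) p"
proof -
  obtain Q :: "'a set monoid" and h where q: "group_hom G Q h" and sur: "h ` carrier G = carrier Q"
    and ker: "\<And>a. a \<in> carrier G \<Longrightarrow> h a = \<one>\<^bsub>Q\<^esub> \<longleftrightarrow> a \<in> V" using quotient_group_hom[OF nV] by blast
  interpret q: group_hom G Q h by (rule q)
  have finQ0: "finite Q0" using finE by (simp add: Q0_def)
  have "{x \<in> Q0. h x = \<one>\<^bsub>Q\<^esub>} = {\<one>}"
  proof (intro equalityI subsetI)
    fix x assume "x \<in> {x \<in> Q0. h x = \<one>\<^bsub>Q\<^esub>}"
    then have x: "x \<in> Q0" "x \<in> V" using ker[of x] Q0c by auto
    then have "x [^] n = \<one>" using Fp[OF x(2)] by (simp add: Q0_def)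
    then show "x \<in> {\<one>}" using pow_n_one[OF x(2)] by simp
  qed (use subgroup.one_closed[OF Q0_subgroup] in auto)
  then have c: "card Q0 = card (h ` Q0)" using q.card_image_mult_kernel[OF Q0_subgroup finQ0] by simp
  have kE: "{x \<in> E. h x = \<one>\<^bsub>Q\<^esub>} = V" using ker VE Ec by auto
  have "card E = card (h ` E) * card V" using q.card_image_mult_kernel[OF E finE] kE by simp
  then have hE: "card (h ` E) = n" using card_subgroup_pos[OF V finV] by simp
  have "card (h ` Q0) dvd card (h ` E)"
    by (rule q.H.card_subgroup_dvd[OF q.subgroup_img_is_subgroup[OF E] q.subgroup_img_is_subgroup[OF Q0_subgroup]])
      (use finE in \<open>auto simp: Q0_def\<close>)
  then show ?thesis using c hE copE coprime_divisors[of "card Q0" n p p] by simp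
qed

text \<open>Plays the role of the Frattini argument: once \<open>w \<otimes> x\<close> commutes with
  the transfer, it normalizes the kernel \<open>Q0\<close>.\<close>

lemma twist:
  assumes x: "x \<in> carrier G"
  obtains w where "w \<in> V" "\<And>a. a \<in> E \<Longrightarrow> F ((w \<otimes> x) \<otimes> a \<otimes> inv (w \<otimes> x)) = (w \<otimes> x) \<otimes> F a \<otimes> inv (w \<otimes> x)"
proof -
  define F2 where "F2 = (\<lambda>a. x \<otimes> F (inv x \<otimes> a \<otimes> x) \<otimes> inv x)"
  have cEi: "inv x \<otimes> a \<otimes> x \<in> E" if "a \<in> E" for a using cE[of "inv x" a] that x by simp
  have cVi: "inv x \<otimes> a \<otimes> x \<in> V" if "a \<in> V" for a using cV[of "inv x" a] that x by simp
  have C2: "crossed_power_hom G V E n F2"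
    unfolding F2_def by (rule crossed_conj[OF crossed_transfer x cV[OF x] cVi cEi])
  then have F2V: "\<And>a. a \<in> E \<Longrightarrow> F2 a \<in> V" and F2m: "\<And>a b. a \<in> E \<Longrightarrow> b \<in> E \<Longrightarrow> F2 (a \<otimes> b) = F2 a \<otimes> (a \<otimes> F2 b \<otimes> inv a)"
    and F2p: "\<And>v. v \<in> V \<Longrightarrow> F2 v = v [^] n" by (simp_all add: crossed_power_hom_def)
  obtain D where D: "D \<in> V" "\<forall>a\<in>E. (F2 a \<otimes> inv (F a)) [^] n = D \<otimes> (a \<otimes> inv D \<otimes> inv a)"
    using crossed_power_hom_diff[OF C2 crossed_transfer] .
  \<comment> \<open>Two successive roots: the first strips the \<open>n\<close>-th power off the
    coboundary identity, the second allows for \<open>F2\<close> being the \<open>n\<close>-th power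
    on \<open>V\<close>.\<close>
  obtain D1 where D1: "D1 \<in> V" "D1 [^] n = D" using root[OF D(1)] .
  obtain w where w: "w \<in> V" "w [^] n = D1" using root[OF D1(1)] .
  note wc = Vc[OF w(1)]
  have \<delta>: "F2 a \<otimes> inv (F a) = D1 \<otimes> (a \<otimes> inv D1 \<otimes> inv a)" if a: "a \<in> E" for a
  proof -
    let ?l = "F2 a \<otimes> inv (F a)" and ?r = "D1 \<otimes> (a \<otimes> inv D1 \<otimes> inv a)"
    have lV: "?l \<in> V" by (intro V_mult V_inv F2V FV a)
    have rV: "?r \<in> V" by (intro V_mult V_inv conj D1(1) a)
    have cc: "a \<otimes> inv D1 \<otimes> inv a \<in> V" by (intro V_inv conj D1(1) a)
    have "?r [^] n = D1 [^] n \<otimes> (a \<otimes> inv D1 \<otimes> inv a) [^] n" by (rule pow_mult_V[OF D1(1) cc])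
    also have "(a \<otimes> inv D1 \<otimes> inv a) [^] n = a \<otimes> inv D \<otimes> inv a"
      using conj_pow[OF a V_inv[OF D1(1)], of n] pow_inv_V[OF D1(1)] D1(2) by simp
    finally have "?l [^] n = ?r [^] n" using D(2)[rule_format, OF a] D1(2) by simp
    then have "(?l \<otimes> inv ?r) [^] n = \<one>"
      using pow_mult_V[OF lV V_inv[OF rV], of n] pow_inv_V[OF rV, of n] Vc[OF V_pow[OF rV]] by simp
    then have "?l \<otimes> inv ?r = \<one>" by (rule pow_n_one[OF V_mult[OF lV V_inv[OF rV]]])
    then show ?thesis by (rule div_eq_one[OF Vc[OF lV] Vc[OF rV]])
  qed
  let ?y = "w \<otimes> x"
  have yc: "?y \<in> carrier G" using wc x by simp
  have key: "?y \<otimes> F (inv ?y \<otimes> a \<otimes> ?y) \<otimes> inv ?y = F a" if a: "a \<in> E" for a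
  proof -
    let ?v = "inv w \<otimes> (a \<otimes> w \<otimes> inv a)"
    have vV: "?v \<in> V" by (intro V_mult V_inv conj w(1) a)
    have cc: "a \<otimes> w \<otimes> inv a \<in> V" by (intro conj w(1) a)
    have e: "inv w \<otimes> a \<otimes> w = ?v \<otimes> a" using wc Ec[OF a] by (simp add: group_normalize)
    have e2: "inv ?y \<otimes> a \<otimes> ?y = inv x \<otimes> (inv w \<otimes> a \<otimes> w) \<otimes> x" using wc x Ec[OF a] by (simp add: group_normalize)
    have wa: "inv w \<otimes> a \<otimes> w \<in> E" using cE[of "inv w" a] a wc by simp
    have "?y \<otimes> F (inv ?y \<otimes> a \<otimes> ?y) \<otimes> inv ?y = w \<otimes> F2 (inv w \<otimes> a \<otimes> w) \<otimes> inv w"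
      unfolding e2 F2_def using wc x Vc[OF FV[OF cEi[OF wa]]] by (simp add: inv_mult_group m_assoc)
    also have "\<dots> = F2 (?v \<otimes> a)" unfolding e[symmetric] by (rule conj_V_trivial[OF w(1) F2V[OF wa]])
    also have "\<dots> = ?v [^] n \<otimes> F2 a"
      using F2m[OF subsetD[OF VE vV] a] F2p[OF vV] conj_V_trivial[OF vV F2V[OF a]] by simp
    also have "?v [^] n = inv D1 \<otimes> (a \<otimes> D1 \<otimes> inv a)"
      using pow_mult_V[OF V_inv[OF w(1)] cc, of n] pow_inv_V[OF w(1), of n] conj_pow[OF a w(1), of n] w(2) by simp
    also have "inv D1 \<otimes> (a \<otimes> D1 \<otimes> inv a) = inv (D1 \<otimes> (a \<otimes> inv D1 \<otimes> inv a))"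
    proof -
      have c1: "a \<otimes> D1 \<otimes> inv a \<in> V" by (intro conj D1(1) a)
      have "inv (D1 \<otimes> (a \<otimes> inv D1 \<otimes> inv a)) = (a \<otimes> D1 \<otimes> inv a) \<otimes> inv D1"
        using Vc[OF D1(1)] Ec[OF a] by (simp add: group_normalize)
      then show ?thesis using comm[OF V_inv[OF D1(1)] c1] by simp
    qed
    also have "\<dots> \<otimes> F2 a = F a"
    proof -
      have f: "F2 a \<in> carrier G" "F a \<in> carrier G" using F2V FV a Vc by auto
      have "inv (F2 a \<otimes> inv (F a)) \<otimes> F2 a = F a" using f by (simp add: group_normalize)
      then show ?thesis unfolding \<delta>[OF a] .
    qed
    finally show ?thesis .
  qed
  have "F (?y \<otimes> a \<otimes> inv ?y) = ?y \<otimes> F a \<otimes> inv ?y" if a: "a \<in> E" for a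
  proof -
    have "inv ?y \<otimes> (?y \<otimes> a \<otimes> inv ?y) \<otimes> ?y = a" using yc Ec[OF a] by (simp add: m_assoc inv_cancel_left)
    then show ?thesis using key[OF cE[OF yc a]] by simp
  qed
  then show ?thesis using that w(1) by blast
qed

text \<open>A power of \<open>y\<close> that lies in \<open>V\<close> normalizes \<open>Q0\<close>,
  so its commutators with \<open>Q0\<close> lie in both \<open>V\<close> and \<open>Q0\<close>,
  which meet trivially.\<close>

lemma twist_pow:
  assumes y: "y \<in> carrier G" and Fy: "\<And>a. a \<in> E \<Longrightarrow> F (y \<otimes> a \<otimes> inv y) = y \<otimes> F a \<otimes> inv y"
  shows "q \<in> Q0 \<Longrightarrow> y \<otimes> q \<otimes> inv y \<in> Q0" "y [^] (m::nat) \<in> V \<Longrightarrow> q \<in> Q0 \<Longrightarrow> y [^] m \<otimes> q = q \<otimes> y [^] m"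
proof -
  have c: "y \<otimes> q \<otimes> inv y \<in> Q0" if "q \<in> Q0" for q
    using that cE[OF y Q0E[OF that]] Fy[OF Q0E[OF that]] y by (simp add: Q0_def)
  then show "q \<in> Q0 \<Longrightarrow> y \<otimes> q \<otimes> inv y \<in> Q0" .
  have cm: "y [^] m \<otimes> q \<otimes> inv (y [^] m) \<in> Q0" if q: "q \<in> Q0" for q and m :: nat
  proof (induction m)
    case (Suc m)
    have e: "y [^] Suc m = y \<otimes> y [^] m" using y by (rule nat_pow_Suc2)
    have "y [^] Suc m \<otimes> q \<otimes> inv (y [^] Suc m) = y \<otimes> (y [^] m \<otimes> q \<otimes> inv (y [^] m)) \<otimes> inv y"
      unfolding e using y Q0c[OF q] by (simp only: group_normalize nat_pow_closed m_closed inv_closed)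
    then show ?case using c[OF Suc] by simp
  qed (use q Q0c[OF q] in simp)
  show "y [^] m \<otimes> q = q \<otimes> y [^] m" if u: "y [^] m \<in> V" and q: "q \<in> Q0"
  proof -
    let ?u = "y [^] m"
    let ?v = "?u \<otimes> (q \<otimes> inv ?u \<otimes> inv q)"
    have vV: "?v \<in> V" by (intro V_mult V_inv conj u Q0E[OF q])
    have e: "?u \<otimes> q \<otimes> inv ?u = ?v \<otimes> q" using Vc[OF u] Q0c[OF q] by (simp add: group_normalize)
    have "?v [^] n = \<one>"
      using F_Vmult[OF vV Q0E[OF q]] cm[OF q, of m] q Vc[OF V_pow[OF vV]] unfolding e by (simp add: Q0_def)
    then have "?v = \<one>" by (rule pow_n_one[OF vV])
    then have "?u \<otimes> q \<otimes> inv ?u = q" unfolding e using Q0c[OF q] by simp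
    then have "?u \<otimes> q \<otimes> inv ?u \<otimes> ?u = q \<otimes> ?u" by simp
    then show ?thesis using Vc[OF u] Q0c[OF q] by (simp add: m_assoc)
  qed
qed

section \<open>V as a module: trace over the complement, projection away from its fixed
  points\<close>

lemma pm: "p_module GV G (\<lambda>g v. g \<otimes> v \<otimes> inv g) p"
proof (intro p_module.intro p_module_axioms.intro V_comm_group group_axioms p)
  show "(\<lambda>v. g \<otimes> v \<otimes> inv g) \<in> hom GV GV" if "g \<in> carrier G" for g
    using cV[OF that] that by (intro homI) (auto simp: group_normalize Vc)
  show "v [^]\<^bsub>GV\<^esub> p = \<one>\<^bsub>GV\<^esub>" if "v \<in> carrier GV" for v
    using exp[of v] that by (simp flip: nat_pow_consistent)
qed (auto simp: group_normalize Vc)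

lemma cdiff_V: "x \<in> carrier G \<Longrightarrow> v \<in> V \<Longrightarrow> cdiff G x v \<in> V"
  unfolding cdiff_def by (intro V_mult V_inv cV)

lemma cdiff_pow_V: "x \<in> carrier G \<Longrightarrow> v \<in> V \<Longrightarrow> (cdiff G x ^^ m) v \<in> V"
  by (induction m) (auto simp: cdiff_V)

lemma cdiff_twist: assumes "x \<in> carrier G" "w \<in> V" "v \<in> V" shows "cdiff G (w \<otimes> x) v = cdiff G x v"
proof -
  have "(w \<otimes> x) \<otimes> v \<otimes> inv (w \<otimes> x) = w \<otimes> (x \<otimes> v \<otimes> inv x) \<otimes> inv w"
    using assms Vc by (simp add: group_normalize)
  then show ?thesis unfolding cdiff_def using conj_V_trivial[OF assms(2) cV[OF assms(1,3)]] by simp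
qed

lemma cdiff_pow_eq:
  assumes "\<And>v. v \<in> V \<Longrightarrow> f v = cdiff G x v" "x \<in> carrier G" "v \<in> V"
  shows "(f ^^ m) v = (cdiff G x ^^ m) v"
  by (induction m) (use assms cdiff_pow_V in auto)

text \<open>\<open>(w x)^p\<close> is the product of the conjugates of \<open>w\<close> by
  \<open>x^0, ..., x^(p-1)\<close>, times \<open>x^p\<close>. By \<open>finprod_prime_newton\<close>
  that product is \<open>(x - 1)^(p-1)\<close> applied to \<open>w\<close>.\<close>

lemma twist_nat_pow:
  assumes x: "x \<in> carrier G" and w: "w \<in> V" and van: "(cdiff G x ^^ (p - 1)) w = \<one>"
  shows "(w \<otimes> x) [^] p = x [^] p"
proof -
  interpret GV: comm_group GV by (rule V_comm_group)
  define a where "a = (\<lambda>i::nat. x [^] i \<otimes> w \<otimes> inv (x [^] i))"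
  have aV: "a i \<in> V" for i unfolding a_def using cV[OF nat_pow_closed[OF x] w] .
  have "(w \<otimes> x) [^] m = finprod GV a {..<m} \<otimes> x [^] m" for m :: nat
  proof (induction m)
    case (Suc m)
    have fV: "finprod GV a {..<m} \<in> V" using GV.finprod_closed[of a "{..<m}"] aV by simp
    have "f \<otimes> x [^] m \<otimes> (w \<otimes> x) = f \<otimes> (a m \<otimes> x [^] Suc m)" if "f \<in> carrier G" for f
      unfolding a_def using x Vc[OF w] that by (simp add: m_assoc inv_cancel_left)
    then have "(w \<otimes> x) [^] Suc m = finprod GV a {..<m} \<otimes> (a m \<otimes> x [^] Suc m)"
      using Vc[OF fV] Suc by simp
    also have "\<dots> = (a m \<otimes> finprod GV a {..<m}) \<otimes> x [^] Suc m"
      using comm[OF fV aV[of m]] Vc[OF fV] Vc[OF aV[of m]] x by (simp flip: m_assoc)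
    also have "a m \<otimes> finprod GV a {..<m} = finprod GV a {..<Suc m}"
      using aV by (simp add: lessThan_Suc)
    finally show ?case .
  qed simp
  moreover have "finprod GV a {..<p} = \<one>"
  proof -
    have d: "(GV.fdiff ^^ m) a i = x [^] i \<otimes> (cdiff G x ^^ m) w \<otimes> inv (x [^] i)" for m i
    proof (induction m arbitrary: i)
      case (Suc m)
      let ?u = "(cdiff G x ^^ m) w"
      have uV: "?u \<in> V" by (rule cdiff_pow_V[OF x w])
      have e: "x [^] Suc i = x [^] i \<otimes> x" by simp
      have c: "x [^] i \<otimes> ?u \<otimes> inv (x [^] i) \<in> V" by (rule cV[OF nat_pow_closed[OF x] uV])
      have "(GV.fdiff ^^ Suc m) a i = (x [^] Suc i \<otimes> ?u \<otimes> inv (x [^] Suc i)) \<otimes> inv (x [^] i \<otimes> ?u \<otimes> inv (x [^] i))"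
        by (simp add: GV.fdiff_def Suc m_inv_consistent[OF V c])
      also have "\<dots> = x [^] i \<otimes> cdiff G x ?u \<otimes> inv (x [^] i)"
      proof -
        have "(x [^] i \<otimes> x) \<otimes> z \<otimes> inv (x [^] i \<otimes> x) \<otimes> inv (x [^] i \<otimes> z \<otimes> inv (x [^] i))
            = x [^] i \<otimes> (x \<otimes> z \<otimes> inv x \<otimes> inv z) \<otimes> inv (x [^] i)" if "z \<in> carrier G" for z
          using x that by (simp add: group_normalize)
        from this[OF Vc[OF uV]] show ?thesis unfolding e cdiff_def[of G x ?u] .
      qed
      finally show ?case by simp
    qed (simp add: a_def)
    have "finprod GV a {..<p} = (GV.fdiff ^^ (p - 1)) a 0"
      by (rule GV.finprod_prime_newton) (use aV p exp in \<open>auto simp flip: nat_pow_consistent\<close>)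
    then show ?thesis using d[of "p - 1" 0] van by simp
  qed
  ultimately show ?thesis using x by simp
qed

definition orbp where "orbp = p_module.orbit_prod GV (\<lambda>g v. g \<otimes> v \<otimes> inv g) Q0"

text \<open>\<open>V\<close> acts trivially on itself, so only the factor of \<open>a\<close> in
  \<open>Q0\<close> matters, and \<open>commute_of_small_delta\<close> applies to
  \<open>Q0\<close>.\<close>

lemma commute_if_small:
  assumes y: "y \<in> carrier G" and Fy: "\<And>a. a \<in> E \<Longrightarrow> F (y \<otimes> a \<otimes> inv y) = y \<otimes> F a \<otimes> inv y"
    and yp: "y [^] p \<in> V" and p2: "p > 2"
    and van: "\<And>v. v \<in> V \<Longrightarrow> orbp v = \<one> \<Longrightarrow> (cdiff G y ^^ (p - 2)) v = \<one>"
    and a: "a \<in> E" and v: "v \<in> V"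
  shows "y \<otimes> (a \<otimes> v \<otimes> inv a) \<otimes> inv y = a \<otimes> (y \<otimes> v \<otimes> inv y) \<otimes> inv a"
proof -
  interpret pm: p_module GV G "\<lambda>g v. g \<otimes> v \<otimes> inv g" p by (rule pm)
  obtain u q where uq: "u \<in> V" "q \<in> Q0" "a = u \<otimes> q" using E_decomp[OF a] .
  have red: "a \<otimes> v \<otimes> inv a = q \<otimes> v \<otimes> inv q" if v: "v \<in> V" for v
  proof -
    have "a \<otimes> v \<otimes> inv a = u \<otimes> (q \<otimes> v \<otimes> inv q) \<otimes> inv u"
      unfolding uq(3) using Vc[OF uq(1)] Q0c[OF uq(2)] Vc[OF v] by (simp add: group_normalize)
    then show ?thesis using conj_V_trivial[OF uq(1) cV[OF Q0c[OF uq(2)] v]] by simp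
  qed
  have finQ0: "finite Q0" using finE by (simp add: Q0_def)
  have "y \<otimes> (q \<otimes> v \<otimes> inv q) \<otimes> inv y = q \<otimes> (y \<otimes> v \<otimes> inv y) \<otimes> inv q"
  proof (rule pm.commute_of_small_delta[OF y Q0_subgroup finQ0 Q0_coprime])
    show "((\<lambda>w. y \<otimes> w \<otimes> inv y \<otimes>\<^bsub>GV\<^esub> inv\<^bsub>GV\<^esub> w) ^^ (p - 2)) w = \<one>\<^bsub>GV\<^esub>"
      if "w \<in> carrier GV" "pm.orbit_prod Q0 w = \<one>\<^bsub>GV\<^esub>" for w
    proof -
      have "((\<lambda>w. y \<otimes> w \<otimes> inv y \<otimes>\<^bsub>GV\<^esub> inv\<^bsub>GV\<^esub> w) ^^ (p - 2)) w = (cdiff G y ^^ (p - 2)) w"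
        by (rule cdiff_pow_eq[OF _ y]) (use that m_inv_consistent[OF V] in \<open>auto simp: cdiff_def\<close>)
      then show ?thesis using van[of w] that by (simp add: orbp_def)
    qed
    show "y [^] p \<otimes> w \<otimes> inv (y [^] p) = w" if "w \<in> carrier GV" for w using conj_V_trivial[OF yp] that by simp
  qed (use twist_pow[OF y Fy] yp p2 uq(2) v in auto)
  then show ?thesis using red[OF v] red[OF cV[OF y v]] by simp
qed

text \<open>\<open>card Q0\<close> times the projection onto \<open>[V, Q0]\<close> along the fixed
  points of \<open>Q0\<close>. The multiple avoids a division and is harmless because
  \<open>card Q0\<close> is prime to \<open>p\<close>.\<close>

definition prj where "prj v = v [^] card Q0 \<otimes> inv (orbp v)"

lemma orbp_props:
  shows "v \<in> V \<Longrightarrow> orbp v \<in> V" "v \<in> V \<Longrightarrow> u \<in> V \<Longrightarrow> orbp (v \<otimes> u) = orbp v \<otimes> orbp u"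
    "v \<in> V \<Longrightarrow> orbp (inv v) = inv (orbp v)" "orbp \<one> = \<one>"
    "v \<in> V \<Longrightarrow> (\<And>q. q \<in> Q0 \<Longrightarrow> v \<otimes> q = q \<otimes> v) \<Longrightarrow> orbp v = v [^] card Q0"
proof -
  interpret pm: p_module GV G "\<lambda>g v. g \<otimes> v \<otimes> inv g" p by (rule pm)
  interpret o: group_hom GV GV orbp
    unfolding orbp_def by (rule pm.orbit_prod_hom[OF subgroup.subset[OF Q0_subgroup]])
  show 1: "orbp v \<in> V" if "v \<in> V" for v using o.hom_closed[of v] that by simp
  show "orbp (v \<otimes> u) = orbp v \<otimes> orbp u" if "v \<in> V" "u \<in> V" for v u using o.hom_mult[of v u] that by simp
  show "orbp (inv v) = inv (orbp v)" if "v \<in> V" for v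
    using o.hom_inv[of v] that m_inv_consistent[OF V] 1[OF that] by simp
  show "orbp \<one> = \<one>" using o.hom_one by simp
  show "orbp v = v [^] card Q0" if v: "v \<in> V" and q: "\<And>q. q \<in> Q0 \<Longrightarrow> v \<otimes> q = q \<otimes> v" for v
  proof -
    have "orbp v = finprod GV (\<lambda>q. v) Q0"
      unfolding orbp_def pm.orbit_prod_def
    proof (rule pm.finprod_cong')
      show "g \<otimes> v \<otimes> inv g = v" if g: "g \<in> Q0" for g
        unfolding q[OF g, symmetric] using Q0c[OF g] Vc[OF v] by (simp add: m_assoc)
    qed (use v in auto)
    also have "\<dots> = v [^] card Q0" using pm.finprod_const[of v Q0] v by (simp flip: nat_pow_consistent)
    finally show ?thesis .
  qed
qed

lemma orbp_conj:
  assumes y: "y \<in> carrier G" and yQ: "\<And>q. q \<in> Q0 \<Longrightarrow> y \<otimes> q \<otimes> inv y \<in> Q0" and v: "v \<in> V"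
  shows "orbp (y \<otimes> v \<otimes> inv y) = y \<otimes> orbp v \<otimes> inv y"
proof -
  interpret pm: p_module GV G "\<lambda>g v. g \<otimes> v \<otimes> inv g" p by (rule pm)
  have finQ0: "finite Q0" using finE by (simp add: Q0_def)
  let ?c = "\<lambda>q. y \<otimes> q \<otimes> inv y"
  let ?f = "\<lambda>g. g \<otimes> (y \<otimes> v \<otimes> inv y) \<otimes> inv g"
  have inj: "inj_on ?c Q0" using Q0c y by (auto simp: inj_on_def)
  have im: "?c ` Q0 = Q0" using finQ0 inj yQ by (simp add: endo_inj_surj image_subset_iff)
  have fV: "?f g \<in> V" if "g \<in> Q0" for g by (intro cV Q0c[OF that] y v)
  have "y \<otimes> orbp v \<otimes> inv y = finprod GV (\<lambda>g. y \<otimes> (g \<otimes> v \<otimes> inv g) \<otimes> inv y) Q0"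
    unfolding orbp_def pm.orbit_prod_def
    by (rule pm.hom_finprod[OF pm.act_hom[OF y]]) (use cV Q0c v in auto)
  also have "\<dots> = finprod GV (\<lambda>g. ?f (?c g)) Q0"
  proof (rule pm.finprod_cong')
    show "y \<otimes> (g \<otimes> v \<otimes> inv g) \<otimes> inv y = ?f (?c g)" if "g \<in> Q0" for g
      using y Vc[OF v] Q0c[OF that] by (simp add: group_normalize)
  qed (use fV yQ in auto)
  also have "\<dots> = orbp (y \<otimes> v \<otimes> inv y)"
    unfolding orbp_def pm.orbit_prod_def using pm.finprod_reindex[of ?f ?c Q0] im inj fV by simp
  finally show ?thesis by simp
qed

lemma prj_props:
  shows "v \<in> V \<Longrightarrow> prj v \<in> V" "v \<in> V \<Longrightarrow> u \<in> V \<Longrightarrow> prj (v \<otimes> u) = prj v \<otimes> prj u"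
    "v \<in> V \<Longrightarrow> prj (inv v) = inv (prj v)" "prj \<one> = \<one>"
    "v \<in> V \<Longrightarrow> (\<And>q. q \<in> Q0 \<Longrightarrow> v \<otimes> q = q \<otimes> v) \<Longrightarrow> prj v = \<one>"
    "v \<in> V \<Longrightarrow> orbp v = \<one> \<Longrightarrow> prj v = v [^] card Q0"
proof -
  show 1: "prj v \<in> V" if "v \<in> V" for v unfolding prj_def by (intro V_mult V_inv V_pow orbp_props(1) that)
  show 2: "prj (v \<otimes> u) = prj v \<otimes> prj u" if v: "v \<in> V" and u: "u \<in> V" for v u
  proof -
    note o = orbp_props(1)[OF v] orbp_props(1)[OF u] and P = V_pow[OF v, of "card Q0"] V_pow[OF u, of "card Q0"]
    interpret GV: comm_group GV by (rule V_comm_group)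
    have ac: "(a \<otimes> b) \<otimes> inv (c \<otimes> d) = a \<otimes> inv c \<otimes> (b \<otimes> inv d)" if abcd: "a \<in> V" "b \<in> V" "c \<in> V" "d \<in> V" for a b c d
    proof -
      have "(a \<otimes> b) \<otimes> inv (c \<otimes> d) = a \<otimes> (b \<otimes> inv d) \<otimes> inv c" using abcd Vc by (simp add: group_normalize)
      also have "\<dots> = a \<otimes> ((b \<otimes> inv d) \<otimes> inv c)" using abcd Vc by (simp add: m_assoc)
      also have "(b \<otimes> inv d) \<otimes> inv c = inv c \<otimes> (b \<otimes> inv d)" by (rule comm) (use abcd V_mult V_inv in auto)
      finally show ?thesis using abcd Vc by (simp add: m_assoc)
    qed
    show ?thesis unfolding prj_def pow_mult_V[OF v u] orbp_props(2)[OF v u] by (rule ac[OF P o])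
  qed
  show 4: "prj \<one> = \<one>" by (simp add: prj_def orbp_props)
  show "prj (inv v) = inv (prj v)" if v: "v \<in> V" for v
  proof -
    have "prj (inv v) \<otimes> prj v = \<one>" using 2[OF V_inv[OF v] v] 4 Vc[OF v] by simp
    then show ?thesis by (rule inv_equality[symmetric]) (use 1[OF v] 1[OF V_inv[OF v]] Vc in auto)
  qed
  show "prj v = \<one>" if "v \<in> V" "\<And>q. q \<in> Q0 \<Longrightarrow> v \<otimes> q = q \<otimes> v" for v
  proof -
    have "orbp v = v [^] card Q0" by (rule orbp_props(5)) (use that in auto)
    then show ?thesis unfolding prj_def using Vc[OF V_pow[OF that(1)]] by simp
  qed
  show "prj v = v [^] card Q0" if "v \<in> V" "orbp v = \<one>" for v
    unfolding prj_def that(2) using Vc[OF V_pow[OF that(1)]] by simp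
qed

text \<open>\<open>y\<close> permutes \<open>Q0\<close> and hence commutes with the trace.\<close>

lemma prj_cdiff:
  assumes y: "y \<in> carrier G" and yQ: "\<And>q. q \<in> Q0 \<Longrightarrow> y \<otimes> q \<otimes> inv y \<in> Q0" and v: "v \<in> V"
  shows "prj (cdiff G y v) = cdiff G y (prj v)" "orbp (cdiff G y v) = cdiff G y (orbp v)"
proof -
  note yv = cV[OF y v]
  show o: "orbp (cdiff G y v) = cdiff G y (orbp v)"
    unfolding cdiff_def
    using orbp_props(2)[OF yv V_inv[OF v]] orbp_props(3)[OF v] orbp_conj[OF y _ v] yQ by simp
  have "prj (y \<otimes> v \<otimes> inv y) = y \<otimes> prj v \<otimes> inv y"
  proof -
    have "orbp (y \<otimes> v \<otimes> inv y) = y \<otimes> orbp v \<otimes> inv y" by (rule orbp_conj) (use y yQ v in auto)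
    then have "prj (y \<otimes> v \<otimes> inv y) = (y \<otimes> v [^] card Q0 \<otimes> inv y) \<otimes> inv (y \<otimes> orbp v \<otimes> inv y)"
      by (simp only: prj_def conj_nat_pow[OF y Vc[OF v]])
    then show ?thesis
      using y Vc[OF V_pow[OF v]] Vc[OF orbp_props(1)[OF v]] by (simp add: prj_def group_normalize)
  qed
  then show "prj (cdiff G y v) = cdiff G y (prj v)"
    unfolding cdiff_def using prj_props(2)[OF yv V_inv[OF v]] prj_props(3)[OF v] by simp
qed

lemma coprime_pow_Q0: assumes "v \<in> V" "v [^] card Q0 = \<one>" shows "v = \<one>"
proof (rule coprime_pow_eq_one[OF V finV _ assms])
  show "coprime (card Q0) (card V)" using Q0_coprime by (simp add: cardV)
qed

end

text \<open>\<open>L\<close> lies in a proper subgroup of \<open>M\<close> that contains all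
  \<open>p\<close>-th powers. This strict descent drives the induction on the order of
  \<open>M\<close>.\<close>

lemma (in group) eta_step_pow_psubset:
  assumes P: "subgroup P G" "finite P" "card P = p ^ k" and p: "Factorial_Ring.prime (p::nat)"
    and step: "eta_step G p P L M" and LM: "L \<noteq> M"
  shows "pow_gen G p L M \<subset> M"
proof -
  have st: "stable_subgroup G P L" "stable_subgroup G P M" "L \<subseteq> M" "M \<subseteq> P" using step by (auto simp: eta_step_def)
  note sM = stable_subgroupD(1)[OF st(2)] and sL = stable_subgroupD(1)[OF st(1)]
  interpret M: group "G\<lparr>carrier := M\<rparr>" using subgroup_imp_group[OF sM] .
  have finM: "finite M" using st(4) P(2) finite_subset by blast
  have "card M dvd p ^ k" using card_subgroup_dvd[OF P(1) sM st(4) P(2)] P(3) by simp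
  then obtain j where j: "card M = p ^ j" using divides_primepow_nat[OF p] by auto
  obtain D where D: "subgroup D (G\<lparr>carrier := M\<rparr>)" "L \<subseteq> D" "D \<subset> carrier (G\<lparr>carrier := M\<rparr>)"
    "\<forall>x\<in>carrier (G\<lparr>carrier := M\<rparr>). x [^]\<^bsub>G\<lparr>carrier := M\<rparr>\<^esub> p \<in> D"
  proof (rule M.p_group_proper_subgroup[OF _ p, of j L])
    show "subgroup L (G\<lparr>carrier := M\<rparr>)" by (rule subgroup_incl[OF sL sM st(3)])
    show "L \<subset> carrier (G\<lparr>carrier := M\<rparr>)" using st(3) LM by auto
  qed (use finM j in \<open>auto simp: order_def\<close>)
  have "pow_gen G p L M \<subseteq> D"
    unfolding pow_gen_def
    by (rule generate_subgroup_incl[OF _ incl_subgroup[OF sM D(1)]]) (use D(2,4) in \<open>auto simp flip: nat_pow_consistent\<close>)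
  then show ?thesis using D(3) by auto
qed

text \<open>Here the bound \<open>i < p - 2\<close> enters: an element of \<open>M\<close> acts on \<open>V\<close> with nilpotency degree at most
  \<open>i + 2\<close>, and at most \<open>i + 1\<close> on the complement of the fixed points of the \<open>p'\<close>-group.\<close>
lemma (in split_extension) eta_step_commutes:
  assumes P: "subgroup P G" "V \<subseteq> P" and VN: "\<And>j. j \<le> i \<Longrightarrow> Ns j \<subseteq> V" and N0: "Ns 0 = {\<one>}"
    and steps: "\<And>j. j < i \<Longrightarrow> eta_step G p P (Ns j) (Ns (Suc j))"
    and step: "eta_step G p P (Ns i) M" and step1: "eta_step G p P (Ns i) (pow_gen G p (Ns i) M)"
    and M1V: "pow_gen G p (Ns i) M \<subseteq> V" and i: "i < p - 2"
    and x: "x \<in> M" and a: "a \<in> E" and v: "v \<in> V"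
  shows "x \<otimes> (a \<otimes> v \<otimes> inv a) \<otimes> inv x = a \<otimes> (x \<otimes> v \<otimes> inv x) \<otimes> inv a"
proof -
  have p2: "p > 2" "p \<noteq> 2" using i by auto
  define M1 where "M1 = pow_gen G p (Ns i) M"
  note Pc = subgroup.mem_carrier[OF P(1)]
  have st: "stable_subgroup G P (Ns i)" "stable_subgroup G P M" "Ns i \<subseteq> M" "M \<subseteq> P"
    and comM: "\<And>x g. x \<in> M \<Longrightarrow> g \<in> P \<Longrightarrow> x \<otimes> g \<otimes> inv x \<otimes> inv g \<in> M1"
    using step p2 by (auto simp: eta_step_def M1_def)
  have Mc: "x \<in> carrier G" if "x \<in> M" for x using that st(4) Pc by blast
  \<comment> \<open>Subgroups of \<open>V\<close> have exponent \<open>p\<close>, so for a step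
    inside \<open>V\<close> the powers add nothing to \<open>L\<close>, and the commutators fall
    into \<open>L\<close> itself.\<close>
  have pow_triv: "pow_gen G p L N \<subseteq> L" if "subgroup L G" "N \<subseteq> V" for L N
    unfolding pow_gen_def
    by (rule generate_subgroup_incl[OF _ that(1)]) (use that exp subgroup.one_closed[OF that(1)] in auto)
  have swap: "cdiff G g z \<in> L" if "eta_step G p P L N" "N \<subseteq> V" "z \<in> N" "g \<in> P" for L N z g
  proof -
    have sL: "subgroup L G" using that(1) stable_subgroupD(1) by (auto simp: eta_step_def)
    have "z \<otimes> g \<otimes> inv z \<otimes> inv g \<in> pow_gen G p L N" using that(1,3,4) p2 by (simp add: eta_step_def)
    then have "z \<otimes> g \<otimes> inv z \<otimes> inv g \<in> L" using pow_triv[OF sL that(2)] by blast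
    then have "inv (z \<otimes> g \<otimes> inv z \<otimes> inv g) \<in> L" by (rule subgroup.m_inv_closed[OF sL])
    then show ?thesis unfolding cdiff_def using Pc[OF that(4)] Vc[OF subsetD[OF that(2,3)]]
      by (simp add: group_normalize)
  qed
  \<comment> \<open>Inside \<open>V\<close> each commutator with an element of \<open>P\<close> goes
    down one term of the series.\<close>
  have down: "(cdiff G g ^^ t) l \<in> Ns (i - t)" if "l \<in> Ns i" "g \<in> P" "t \<le> i" for l g t
    using that(3)
  proof (induction t)
    case (Suc t)
    have e: "i - t = Suc (i - Suc t)" using Suc.prems by simp
    have "eta_step G p P (Ns (i - Suc t)) (Ns (i - t))" unfolding e by (rule steps) (use Suc.prems in simp)
    from swap[OF this VN _ that(2)] show ?case using Suc by simp
  qed (use that in simp)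
  have toM1: "cdiff G g u \<in> M1" if "g \<in> M" "u \<in> V" for g u
    using comM[OF that(1)] that(2) P(2) unfolding cdiff_def by blast
  \<comment> \<open>\<open>V\<close> is sent into \<open>M1\<close>, then into \<open>Ns i\<close>,
    then to the identity in \<open>i\<close> steps: degree \<open>i + 2 \<le> p - 1\<close>, just
    enough for \<open>twist_nat_pow\<close>.\<close>
  have nilp: "(cdiff G g ^^ (p - 1)) u = \<one>" if g: "g \<in> M" and u: "u \<in> V" for g u
  proof -
    have gP: "g \<in> P" using g st(4) by blast
    have "cdiff G g (cdiff G g u) \<in> Ns i"
      using swap[OF step1 M1V _ gP] toM1[OF g u] by (simp add: M1_def)
    then have "(cdiff G g ^^ i) (cdiff G g (cdiff G g u)) \<in> Ns (i - i)" by (rule down[OF _ gP]) simp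
    then have 1: "(cdiff G g ^^ (i + 2)) u = \<one>" using N0 by (simp add: funpow_swap1)
    have "(cdiff G g ^^ m) \<one> = \<one>" for m by (induction m) (use Mc[OF g] in \<open>auto simp: cdiff_def\<close>)
    moreover have "(cdiff G g ^^ (p - 1)) u = (cdiff G g ^^ (p - 1 - (i + 2))) ((cdiff G g ^^ (i + 2)) u)"
      by (rule funpow_diff) (use i in simp)
    ultimately show ?thesis using 1 by simp
  qed
  have xpV: "g [^] p \<in> V" if "g \<in> M" for g
    using pow_gen_incl(2)[OF that] M1V by blast
  \<comment> \<open>\<open>g^p\<close> equals the \<open>p\<close>-th power of the corrected element
    \<open>w \<otimes> g\<close>, which commutes with \<open>Q0\<close>; so \<open>prj\<close> kills
    the \<open>p\<close>-th powers of \<open>M\<close>.\<close>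
  have fixp: "prj (g [^] p) = \<one>" if g: "g \<in> M" for g
  proof -
    obtain w where w: "w \<in> V" "\<And>a. a \<in> E \<Longrightarrow> F ((w \<otimes> g) \<otimes> a \<otimes> inv (w \<otimes> g)) = (w \<otimes> g) \<otimes> F a \<otimes> inv (w \<otimes> g)"
      using twist[OF Mc[OF g]] by blast
    have e: "(w \<otimes> g) [^] p = g [^] p" by (rule twist_nat_pow[OF Mc[OF g] w(1) nilp[OF g w(1)]])
    show ?thesis
    proof (rule prj_props(5)[OF xpV[OF g]])
      fix q assume q: "q \<in> Q0"
      have "(w \<otimes> g) [^] p \<otimes> q = q \<otimes> (w \<otimes> g) [^] p"
        by (rule twist_pow(2)[OF _ w(2)]) (use Vc[OF w(1)] Mc[OF g] xpV[OF g] e q in auto)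
      then show "g [^] p \<otimes> q = q \<otimes> g [^] p" by (simp only: e)
    qed
  qed
  obtain w where w: "w \<in> V" and Fy: "\<And>a. a \<in> E \<Longrightarrow> F ((w \<otimes> x) \<otimes> a \<otimes> inv (w \<otimes> x)) = (w \<otimes> x) \<otimes> F a \<otimes> inv (w \<otimes> x)"
    using twist[OF Mc[OF x]] by blast
  define y where "y = w \<otimes> x"
  have xc: "x \<in> carrier G" by (rule Mc[OF x])
  have yc: "y \<in> carrier G" using Vc[OF w] xc by (simp add: y_def)
  have cy: "cdiff G y u = cdiff G x u" if "u \<in> V" for u unfolding y_def by (rule cdiff_twist[OF xc w that])
  have yQ: "y \<otimes> q \<otimes> inv y \<in> Q0" if "q \<in> Q0" for q
    by (rule twist_pow(1)[OF yc]) (use Fy that in \<open>auto simp: y_def\<close>)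
  have xP: "x \<in> P" using x st(4) by blast
  have sNi: "subgroup (Ns i) G" by (rule stable_subgroupD(1)[OF st(1)])
  \<comment> \<open>The elements of \<open>V\<close> that agree with one of \<open>Ns i\<close>
    modulo the fixed points of \<open>Q0\<close>. This subgroup contains \<open>M1\<close>, which
    saves one commutator: after projection \<open>M1\<close> counts as \<open>Ns i\<close>.\<close>
  define B where "B = {u \<in> V. \<exists>l\<in>Ns i. prj u = prj l}"
  have sB: "subgroup B G"
  proof (rule subgroupI)
    show "B \<subseteq> carrier G" using Vc by (auto simp: B_def)
    show "B \<noteq> {}" using subgroup.one_closed[OF V] subgroup.one_closed[OF sNi] by (auto simp: B_def)
    fix b assume "b \<in> B"
    then obtain l where b: "b \<in> V" "l \<in> Ns i" "prj b = prj l" by (auto simp: B_def)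
    have lV: "l \<in> V" using b(2) VN[of i] by auto
    show "inv b \<in> B"
      using prj_props(3)[OF b(1)] prj_props(3)[OF lV] b(3) V_inv[OF b(1)] subgroup.m_inv_closed[OF sNi b(2)]
      unfolding B_def by (auto intro!: bexI[of _ "inv l"])
    fix c assume "c \<in> B"
    then obtain k where c: "c \<in> V" "k \<in> Ns i" "prj c = prj k" by (auto simp: B_def)
    have kV: "k \<in> V" using c(2) VN[of i] by auto
    show "b \<otimes> c \<in> B"
      using prj_props(2)[OF b(1) c(1)] prj_props(2)[OF lV kV] b(3) c(3) V_mult[OF b(1) c(1)] subgroup.m_closed[OF sNi b(2) c(2)]
      unfolding B_def by (auto intro!: bexI[of _ "l \<otimes> k"])
  qed
  have M1B: "M1 \<subseteq> B"
    unfolding M1_def pow_gen_def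
  proof (rule generate_subgroup_incl[OF _ sB], rule subsetI)
    fix s assume "s \<in> {x [^] p | x. x \<in> M} \<union> Ns i"
    then show "s \<in> B"
    proof
      assume "s \<in> {x [^] p | x. x \<in> M}"
      then obtain g where g: "g \<in> M" "s = g [^] p" by blast
      then show ?thesis using fixp[OF g(1)] xpV[OF g(1)] prj_props(4) subgroup.one_closed[OF sNi]
        by (auto simp: B_def intro!: bexI[of _ \<one>])
    qed (use VN[of i] in \<open>auto simp: B_def\<close>)
  qed
  \<comment> \<open>On vectors of trivial trace \<open>prj\<close> is an invertible power, so the
    degree can be read off after projection: one step to \<open>Ns i\<close> and \<open>i\<close>
    more give \<open>i + 1 \<le> p - 2\<close>.\<close>
  have small: "(cdiff G y ^^ (p - 2)) u = \<one>" if u: "u \<in> V" "orbp u = \<one>" for u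
  proof -
    have cdV: "(cdiff G x ^^ m) z \<in> V" if "z \<in> V" for m z by (rule cdiff_pow_V[OF xc that])
    have eqy: "(cdiff G y ^^ m) z = (cdiff G x ^^ m) z" if "z \<in> V" for m z
      by (rule cdiff_pow_eq[OF cy xc that])
    have prj_pow: "prj ((cdiff G x ^^ m) z) = (cdiff G x ^^ m) (prj z)" if z: "z \<in> V" for m z
    proof (induction m)
      case (Suc m)
      have "prj (cdiff G y ((cdiff G x ^^ m) z)) = cdiff G y (prj ((cdiff G x ^^ m) z))"
        by (rule prj_cdiff(1)[OF yc _ cdV[OF z]]) (rule yQ)
      then show ?case using cy[OF cdV[OF z]] cy[OF cdV[OF prj_props(1)[OF z]]] Suc by simp
    qed simp
    have orbp_pow: "orbp ((cdiff G x ^^ m) u) = \<one>" for m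
    proof (induction m)
      case (Suc m)
      have "orbp (cdiff G y ((cdiff G x ^^ m) u)) = cdiff G y (orbp ((cdiff G x ^^ m) u))"
        by (rule prj_cdiff(2)[OF yc _ cdV[OF u(1)]]) (rule yQ)
      moreover have "cdiff G y \<one> = \<one>" using yc by (simp add: cdiff_def)
      ultimately show ?case using cy[OF cdV[OF u(1)]] Suc by simp
    qed (use u(2) in simp)
    obtain l where l: "l \<in> Ns i" "prj (cdiff G x u) = prj l" using toM1[OF x u(1)] M1B by (auto simp: B_def)
    have lV: "l \<in> V" using l(1) VN[of i] by auto
    have "prj ((cdiff G x ^^ Suc i) u) = prj ((cdiff G x ^^ i) (cdiff G x u))" by (simp add: funpow_swap1)
    also have "\<dots> = prj ((cdiff G x ^^ i) l)"
      unfolding prj_pow[OF cdiff_V[OF xc u(1)]] prj_pow[OF lV] l(2) ..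
    also have "(cdiff G x ^^ i) l = \<one>" using down[OF l(1) xP order_refl] N0 by simp
    finally have "prj ((cdiff G x ^^ Suc i) u) = \<one>" using prj_props(4) by simp
    then have "((cdiff G x ^^ Suc i) u) [^] card Q0 = \<one>"
      using prj_props(6)[OF cdV[OF u(1)] orbp_pow, of "Suc i"] by simp
    then have 1: "(cdiff G x ^^ Suc i) u = \<one>" by (rule coprime_pow_Q0[OF cdV[OF u(1)]])
    have "(cdiff G x ^^ m) \<one> = \<one>" for m by (induction m) (use xc in \<open>auto simp: cdiff_def\<close>)
    moreover have "(cdiff G x ^^ (p - 2)) u = (cdiff G x ^^ (p - 2 - Suc i)) ((cdiff G x ^^ Suc i) u)"
      by (rule funpow_diff) (use i in simp)
    ultimately show ?thesis using 1 eqy[OF u(1)] by (simp del: funpow.simps)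
  qed
  have "y [^] p = x [^] p" unfolding y_def by (rule twist_nat_pow[OF xc w nilp[OF x w]])
  then have ypV: "y [^] p \<in> V" using xpV[OF x] by simp
  have "y \<otimes> (a \<otimes> v \<otimes> inv a) \<otimes> inv y = a \<otimes> (y \<otimes> v \<otimes> inv y) \<otimes> inv a"
    by (rule commute_if_small[OF yc _ ypV p2(1) small a v]) (use Fy in \<open>auto simp: y_def\<close>)
  moreover have yx: "y \<otimes> u \<otimes> inv y = x \<otimes> u \<otimes> inv x" if u: "u \<in> V" for u
  proof -
    have "y \<otimes> u \<otimes> inv y = w \<otimes> (x \<otimes> u \<otimes> inv x) \<otimes> inv w"
      unfolding y_def using Vc[OF w] xc Vc[OF u] by (simp add: group_normalize)
    then show ?thesis using conj_V_trivial[OF w cV[OF xc u]] by simp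
  qed
  ultimately show ?thesis using yx[OF v] yx[OF conj[OF a v]] by simp
qed

lemma (in group) eta_chain_in_core:
  assumes fin: "finite (carrier G)" and p: "Factorial_Ring.prime (p::nat)" and sep: "pi_separable G p"
    and core: "self_centralizing_core G p V" and P: "subgroup P G" "card P = p ^ k" "V \<subseteq> P"
    and N0: "Ns 0 = {\<one>}" and steps: "\<And>j. j < m \<Longrightarrow> eta_step G p P (Ns j) (Ns (Suc j))"
    and m: "m \<le> (if p = 2 then 1 else p - 2)"
  shows "Ns m \<subseteq> V"
proof -
  have nV: "V \<lhd> G" and cardV: "\<exists>k. card V = p ^ k" and comm: "\<And>u v. u \<in> V \<Longrightarrow> v \<in> V \<Longrightarrow> u \<otimes> v = v \<otimes> u"
    and exp: "\<And>v. v \<in> V \<Longrightarrow> v [^] p = \<one>"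
    and selfc: "\<And>x. x \<in> carrier G \<Longrightarrow> (\<And>v. v \<in> V \<Longrightarrow> x \<otimes> v = v \<otimes> x) \<Longrightarrow> x \<in> V"
    and maxV: "\<And>N k. N \<lhd> G \<Longrightarrow> card N = p ^ k \<Longrightarrow> N \<subseteq> V"
    using core unfolding self_centralizing_core_def by blast+
  have sV: "subgroup V G" and cV: "\<And>g v. g \<in> carrier G \<Longrightarrow> v \<in> V \<Longrightarrow> g \<otimes> v \<otimes> inv g \<in> V"
    using nV by (auto simp: normal_inv_iff)
  note Vc = subgroup.mem_carrier[OF sV] and Pc = subgroup.mem_carrier[OF P(1)]
  have finP: "finite P" using fin subgroup.subset[OF P(1)] finite_subset by blast
  obtain Q :: "'a set monoid" and h where q: "group_hom G Q h" and sur: "h ` carrier G = carrier Q"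
    and ker: "\<And>a. a \<in> carrier G \<Longrightarrow> h a = \<one>\<^bsub>Q\<^esub> \<longleftrightarrow> a \<in> V" using quotient_group_hom[OF nV] by blast
  interpret q: group_hom G Q h by (rule q)
  have finQ: "finite (carrier Q)" unfolding sur[symmetric] using fin by simp
  have sepQ: "pi_separable Q p" by (rule q.pi_separable_image[OF fin p sur sep])
  have kV: "{g \<in> carrier G. h g = \<one>\<^bsub>Q\<^esub>} = V" using ker subgroup.subset[OF sV] by auto
  have cardpre: "card {g \<in> carrier G. h g \<in> N} = card N * card V" if "N \<lhd> Q" for N
    using q.card_preimage[OF fin normal_imp_subgroup[OF that]] subgroup.subset[OF normal_imp_subgroup[OF that]] sur kV by simp
  \<comment> \<open>A normal \<open>p\<close>-subgroup of \<open>G / V\<close> pulls back to one of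
    \<open>G\<close>, which lies in \<open>V\<close>. This makes the centralizer lemma available for
    \<open>O_p'(G / V)\<close>.\<close>
  have coreQ: "pi_core True p Q = {\<one>\<^bsub>Q\<^esub>}"
  proof -
    define N where "N = pi_core True p Q"
    have N: "N \<lhd> Q" "\<exists>k. card N = p ^ k" using q.H.pi_core(1,2)[OF finQ p, of True] by (auto simp: N_def pi_number_def)
    obtain i j where "card N = p ^ i" "card V = p ^ j" using N(2) cardV by blast
    then have "card {g \<in> carrier G. h g \<in> N} = p ^ (i + j)" using cardpre[OF N(1)] by (simp add: power_add)
    then have sub: "{g \<in> carrier G. h g \<in> N} \<subseteq> V" by (rule maxV[OF q.normal_preimage[OF N(1)]])
    have "y = \<one>\<^bsub>Q\<^esub>" if y: "y \<in> N" for y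
    proof -
      obtain g where g: "g \<in> carrier G" "y = h g"
        using subgroup.mem_carrier[OF normal_imp_subgroup[OF N(1)] y] unfolding sur[symmetric] by blast
      then have "g \<in> V" using sub y by blast
      then show ?thesis using ker[OF g(1)] g(2) by blast
    qed
    then show ?thesis using subgroup.one_closed[OF normal_imp_subgroup[OF N(1)]] unfolding N_def by blast
  qed
  define T where "T = pi_core False p Q"
  have T: "T \<lhd> Q" "coprime (card T) p" using q.H.pi_core(1,2)[OF finQ p, of False] by (auto simp: T_def pi_number_def)
  have sT: "subgroup T Q" by (rule normal_imp_subgroup[OF T(1)])
  have finT: "finite T" using finQ subgroup.subset[OF sT] finite_subset by blast
  define E where "E = {g \<in> carrier G. h g \<in> T}"
  have nE: "E \<lhd> G" unfolding E_def by (rule q.normal_preimage[OF T(1)])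
  have sE: "subgroup E G" by (rule normal_imp_subgroup[OF nE])
  have VE: "V \<subseteq> E"
  proof
    fix v assume v: "v \<in> V"
    have "h v = \<one>\<^bsub>Q\<^esub>" by (rule iffD2[OF ker[OF Vc[OF v]] v])
    then show "v \<in> E" using subgroup.one_closed[OF sT] Vc[OF v] by (simp add: E_def)
  qed
  have finV: "finite V" using fin subgroup.subset[OF sV] finite_subset by blast
  have nind: "card E div card V = card T"
    using cardpre[OF T(1)] card_subgroup_pos[OF sV finV] by (simp add: E_def)
  obtain kv where kv: "card V = p ^ kv" using cardV by blast
  interpret se: split_extension G V E p kv
  proof (intro split_extension.intro split_extension_axioms.intro abelian_normal_pair.intro abelian_normal_pair_axioms.intro)
    show "a \<otimes> v \<otimes> inv a \<in> V" if "a \<in> E" "v \<in> V" for a v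
      by (rule cV[OF subgroup.mem_carrier[OF sE that(1)] that(2)])
    show "finite E" using fin by (simp add: E_def)
    show "coprime (card E div card V) p" using nind T(2) by simp
  qed (use group_axioms sV sE VE comm nV nE p exp kv in auto)
  have "\<forall>j\<le>i. Ns j \<subseteq> V" if "i \<le> m" for i
    using that
  proof (induction i)
    case 0
    then show ?case using N0 subgroup.one_closed[OF sV] by simp
  next
    case (Suc i)
    then have VN: "\<And>j. j \<le> i \<Longrightarrow> Ns j \<subseteq> V" by simp
    \<comment> \<open>Generalized from the next term to every \<open>M\<close> one step above
      \<open>Ns i\<close>, since the subgroup generated by powers of a term need not be a term of
      the series.\<close>
    have "M \<subseteq> V" if "eta_step G p P (Ns i) M" for M
      using that
    proof (induction "card M" arbitrary: M rule: less_induct)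
      case less
      note step = less.prems
      have st: "stable_subgroup G P (Ns i)" "stable_subgroup G P M" "Ns i \<subseteq> M" "M \<subseteq> P" using step
        by (auto simp: eta_step_def)
      show ?case
      proof (cases "Ns i = M")
        case True
        then show ?thesis using VN by blast
      next
        case False
        have finM: "finite M" using st(4) finP finite_subset by blast
        have ps: "pow_gen G p (Ns i) M \<subset> M" by (rule eta_step_pow_psubset[OF P(1) finP P(2) p step False])
        have step1: "eta_step G p P (Ns i) (pow_gen G p (Ns i) M)" by (rule eta_step_pow[OF P(1) finP P(2) p step])
        have M1V: "pow_gen G p (Ns i) M \<subseteq> V" by (rule less.hyps[OF psubset_card_mono[OF finM ps] step1])
        show ?thesis
        proof
          fix x assume x: "x \<in> M"
          have xP: "x \<in> P" using x st(4) by blast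
          have xc: "x \<in> carrier G" by (rule Pc[OF xP])
          have xpV: "x [^] p \<in> V" using pow_gen_incl(2)[OF x] M1V by blast
          show "x \<in> V"
          proof (cases "p = 2")
            case True
            \<comment> \<open>For \<open>p = 2\<close> only the step from the trivial subgroup
              occurs. Squares from \<open>M\<close> lie in \<open>V\<close>, which has exponent 2,
              so the bound \<open>M^4\<close> on the commutators is trivial.\<close>
            then have i0: "i = 0" using m Suc.prems by simp
            have four: "z [^] (4::nat) = \<one>" if z: "z \<in> M" for z
            proof -
              have zc: "z \<in> carrier G" using z st(4) Pc by blast
              have "z [^] p \<in> V" using pow_gen_incl(2)[OF z] M1V by blast
              then have "(z [^] (2::nat)) [^] (2::nat) = \<one>" using exp True by simp
              then show ?thesis using zc by (simp add: nat_pow_pow)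
            qed
            have "pow_gen G 4 {\<one>} M \<subseteq> {\<one>}"
              unfolding pow_gen_def by (rule generate_subgroup_incl[OF _ triv_subgroup]) (use four in auto)
            moreover have "x \<otimes> v \<otimes> inv x \<otimes> inv v \<in> pow_gen G 4 {\<one>} M" if "v \<in> V" for v
              using step x that P(3) True i0 N0 by (auto simp: eta_step_def)
            ultimately have c0: "x \<otimes> v \<otimes> inv x \<otimes> inv v = \<one>" if "v \<in> V" for v using that by blast
            have c: "x \<otimes> v \<otimes> inv (v \<otimes> x) = \<one>" if v: "v \<in> V" for v
              using c0[OF v] xc Vc[OF v] by (simp add: group_normalize)
            show ?thesis
            proof (rule selfc[OF xc])
              fix v assume v: "v \<in> V"
              show "x \<otimes> v = v \<otimes> x" by (rule div_eq_one[OF _ _ c[OF v]]) (use xc Vc[OF v] in auto)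
            qed
          next
            case False
            have ip: "i < p - 2" using m Suc.prems False by simp
            have act: "x \<otimes> (a \<otimes> v \<otimes> inv a) \<otimes> inv x = a \<otimes> (x \<otimes> v \<otimes> inv x) \<otimes> inv a" if "a \<in> E" "v \<in> V" for a v
              by (rule se.eta_step_commutes[where Ns = Ns, OF P(1) P(3) VN N0 _ step step1 M1V ip x that])
                (use steps Suc.prems in auto)
            \<comment> \<open>\<open>x\<close> and \<open>a\<close> commute as operators on
              \<open>V\<close>, so their commutator centralizes \<open>V\<close> and therefore lies
              in it.\<close>
            have cV': "x \<otimes> a \<otimes> inv x \<otimes> inv a \<in> V" if a: "a \<in> E" for a
            proof (rule selfc)
              have ac: "a \<in> carrier G" by (rule subgroup.mem_carrier[OF sE a])
              show "x \<otimes> a \<otimes> inv x \<otimes> inv a \<in> carrier G" using xc ac by simp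
              fix v assume v: "v \<in> V"
              let ?u = "inv x \<otimes> (inv a \<otimes> v \<otimes> a) \<otimes> x"
              have u1: "inv a \<otimes> v \<otimes> a \<in> V" using cV[of "inv a" v] ac v by simp
              have uV: "?u \<in> V" using cV[OF _ u1, of "inv x"] xc by simp
              have "x \<otimes> (a \<otimes> ?u \<otimes> inv a) \<otimes> inv x = v"
                unfolding act[OF a uV] using xc ac Vc[OF v] by (simp add: group_normalize)
              moreover have "x \<otimes> (a \<otimes> ?u \<otimes> inv a) \<otimes> inv x = (x \<otimes> a \<otimes> inv x \<otimes> inv a) \<otimes> v \<otimes> inv (x \<otimes> a \<otimes> inv x \<otimes> inv a)"
                using xc ac Vc[OF v] by (simp add: group_normalize)
              ultimately have e: "(x \<otimes> a \<otimes> inv x \<otimes> inv a) \<otimes> v \<otimes> inv (x \<otimes> a \<otimes> inv x \<otimes> inv a) = v" by simp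
              have "(x \<otimes> a \<otimes> inv x \<otimes> inv a) \<otimes> v = ((x \<otimes> a \<otimes> inv x \<otimes> inv a) \<otimes> v \<otimes> inv (x \<otimes> a \<otimes> inv x \<otimes> inv a)) \<otimes> (x \<otimes> a \<otimes> inv x \<otimes> inv a)"
                using xc ac Vc[OF v] by (simp add: group_normalize)
              then show "(x \<otimes> a \<otimes> inv x \<otimes> inv a) \<otimes> v = v \<otimes> (x \<otimes> a \<otimes> inv x \<otimes> inv a)" unfolding e .
            qed
            have hxT: "h x \<in> T"
            proof (rule q.H.hall_higman_centralizer[OF finQ p sepQ coreQ])
              show "T = pi_core (\<not> True) p Q" by (simp add: T_def)
              show "h x \<in> carrier Q" using xc by simp
              fix t assume t: "t \<in> T"
              then obtain a where a: "a \<in> carrier G" "t = h a"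
                using subgroup.mem_carrier[OF sT] unfolding sur[symmetric] by blast
              then have "a \<in> E" using t by (simp add: E_def)
              then have "h (x \<otimes> a \<otimes> inv x \<otimes> inv a) = \<one>\<^bsub>Q\<^esub>"
                using iffD2[OF ker[OF subgroup.mem_carrier[OF sV cV']]] cV' by blast
              then have c: "(h x \<otimes>\<^bsub>Q\<^esub> h a) \<otimes>\<^bsub>Q\<^esub> inv\<^bsub>Q\<^esub> (h a \<otimes>\<^bsub>Q\<^esub> h x) = \<one>\<^bsub>Q\<^esub>"
                using xc a(1) by (simp add: q.H.group_normalize)
              show "h x \<otimes>\<^bsub>Q\<^esub> t = t \<otimes>\<^bsub>Q\<^esub> h x"
                unfolding a(2) by (rule q.H.div_eq_one[OF _ _ c]) (use xc a(1) in auto)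
            qed
            \<comment> \<open>The image of \<open>x\<close> lies in a group of order prime to
              \<open>p\<close> and has trivial \<open>p\<close>-th power, so it is trivial.\<close>
            have "h (x [^] p) = \<one>\<^bsub>Q\<^esub>" by (rule iffD2[OF ker[OF Vc[OF xpV]] xpV])
            then have "(h x) [^]\<^bsub>Q\<^esub> p = \<one>\<^bsub>Q\<^esub>" using q.hom_nat_pow[OF xc, of p] by simp
            then have "h x = \<one>\<^bsub>Q\<^esub>"
              using q.H.coprime_pow_eq_one[OF sT finT _ hxT] T(2) by (simp add: coprime_commute)
            then show ?thesis using iffD1[OF ker[OF xc]] by blast
          qed
        qed
      qed
    qed
    then have "Ns (Suc i) \<subseteq> V" using steps[of i] Suc.prems by simp
    then show ?case using VN by (auto simp: le_Suc_eq)
  qed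
  then show ?thesis by blast
qed

text \<open>The product of \<open>P\<close> and \<open>N\<close>, as the preimage of the image of
  \<open>P\<close>, has order a power of \<open>p\<close> dividing the order of \<open>G\<close>; it
  cannot exceed \<open>P\<close>.\<close>

lemma (in group) normal_p_subgroup_le_sylow:
  assumes fin: "finite (carrier G)" and p: "Factorial_Ring.prime (p::nat)"
    and P: "subgroup P G" "card P = p ^ k" "order G = card P * r" "coprime r p"
    and N: "N \<lhd> G" "card N = p ^ j"
  shows "N \<subseteq> P"
proof -
  obtain Q :: "'a set monoid" and h where q: "group_hom G Q h" and sur: "h ` carrier G = carrier Q"
    and ker: "\<And>a. a \<in> carrier G \<Longrightarrow> h a = \<one>\<^bsub>Q\<^esub> \<longleftrightarrow> a \<in> N" using quotient_group_hom[OF N(1)] by blast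
  interpret q: group_hom G Q h by (rule q)
  have sN: "subgroup N G" by (rule normal_imp_subgroup[OF N(1)])
  have finP: "finite P" using fin subgroup.subset[OF P(1)] finite_subset by blast
  define S where "S = {g \<in> carrier G. h g \<in> h ` P}"
  have shP: "subgroup (h ` P) Q" by (rule q.subgroup_img_is_subgroup[OF P(1)])
  have sS: "subgroup S G" unfolding S_def by (rule q.subgroup_preimage[OF shP])
  have kN: "{g \<in> carrier G. h g = \<one>\<^bsub>Q\<^esub>} = N" using ker subgroup.subset[OF sN] by auto
  have "card S = card (h ` P) * card N"
    unfolding S_def using q.card_preimage[OF fin shP] subgroup.subset[OF P(1)] kN by auto
  moreover have "card (h ` P) dvd p ^ k"
    using q.card_image_mult_kernel[OF P(1) finP] P(2) by simp
  then obtain i where "card (h ` P) = p ^ i" using divides_primepow_nat[OF p] by auto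
  ultimately have cS: "card S = p ^ (i + j)" using N(2) by (simp add: power_add)
  have finS: "finite S" using fin by (simp add: S_def)
  have "card S dvd p ^ k * r"
    using card_subgroup_dvd[OF subgroup_self sS subgroup.subset[OF sS] fin] P(2,3) by (simp add: order_def)
  moreover have "coprime (card S) r" using P(4) unfolding cS by (simp add: coprime_commute)
  ultimately have "card S dvd p ^ k" by (simp add: coprime_dvd_mult_left_iff)
  then have "card S \<le> card P" using P(2) prime_gt_0_nat[OF p] by (simp add: dvd_imp_le)
  moreover have "P \<subseteq> S" using subgroup.subset[OF P(1)] by (auto simp: S_def)
  ultimately have "P = S" using card_seteq[OF finS] by blast
  moreover have "N \<subseteq> S"
  proof
    fix x assume x: "x \<in> N"
    have xc: "x \<in> carrier G" by (rule subgroup.mem_carrier[OF sN x])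
    have "h x = \<one>\<^bsub>Q\<^esub>" by (rule iffD2[OF ker[OF xc] x])
    then show "x \<in> S" using subgroup.one_closed[OF shP] xc by (simp add: S_def)
  qed
  ultimately show ?thesis by simp
qed

text \<open>The index of the image divides the index of \<open>P\<close>, so it stays prime to
  \<open>p\<close>. The Sylow condition is carried as a factorization of the order because it has to
  pass through several quotients.\<close>

lemma (in group_hom) sylow_image:
  assumes fin: "finite (carrier G)" and p: "Factorial_Ring.prime (p::nat)" and sur: "h ` carrier G = carrier H"
    and P: "subgroup P G" "card P = p ^ k" "order G = card P * r" "coprime r p"
  obtains k' r' where "card (h ` P) = p ^ k'" "order H = card (h ` P) * r'" "coprime r' p"
proof -
  have finP: "finite P" using fin subgroup.subset[OF P(1)] finite_subset by blast
  have sP: "subgroup (h ` P) H" by (rule subgroup_img_is_subgroup[OF P(1)])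
  have "card (h ` P) dvd p ^ k" using card_image_mult_kernel[OF P(1) finP] P(2) by simp
  then obtain k' where k': "card (h ` P) = p ^ k'" using divides_primepow_nat[OF p] by auto
  have finH: "finite (carrier H)" unfolding sur[symmetric] using fin by simp
  have "card (h ` P) dvd order H"
    unfolding order_def by (rule H.card_subgroup_dvd[OF H.subgroup_self sP subgroup.subset[OF sP] finH])
  then obtain r' where r': "order H = card (h ` P) * r'" by (rule dvdE)
  obtain n where "card (carrier G) * card (h ` P) = card P * card (h ` carrier G) * n"
    using index_image[OF P(1) G.subgroup_self subgroup.subset[OF P(1)] fin] .
  then have "card P * card (h ` P) * r = card P * card (h ` P) * (r' * n)"
    using P(3) r' sur by (simp add: order_def mult_ac)
  moreover have "card P > 0" "card (h ` P) > 0" using P(2) k' prime_gt_0_nat[OF p] by simp_all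
  ultimately have "r = r' * n" by simp
  then have "coprime r' p" using P(4) by simp
  then show ?thesis using that k' r' by blast
qed

text \<open>\<open>A\<close> is \<open>O_p'(G)\<close> and \<open>B\<close> the preimage of
  \<open>V = O_p(G / A)\<close>. The inclusion is proved one quotient further down, modulo the
  Frattini subgroup of \<open>V\<close>, and \<open>lift\<close> brings it back.\<close>

lemma (in group) eta_chain_in_p'_p_core:
  assumes fin: "finite (carrier G)" and p: "Factorial_Ring.prime (p::nat)" and sep: "pi_separable G p"
    and P: "subgroup P G" "card P = p ^ k" "order G = card P * r" "coprime r p"
    and N0: "Ns 0 = {\<one>}" and steps: "\<And>j. j < m \<Longrightarrow> eta_step G p P (Ns j) (Ns (Suc j))"
    and m: "m \<le> (if p = 2 then 1 else p - 2)"
  obtains A B e where "A \<lhd> G" "B \<lhd> G" "A \<subseteq> B" "coprime (card A) p" "card B = card A * p ^ e" "Ns m \<subseteq> B"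
proof -
  define A where "A = pi_core False p G"
  have nA: "A \<lhd> G" "coprime (card A) p" and maxA: "\<And>N. N \<lhd> G \<Longrightarrow> coprime (card N) p \<Longrightarrow> N \<subseteq> A"
    unfolding A_def using pi_core[OF fin p, where b = False] by (auto simp: pi_number_def)
  have sA: "subgroup A G" by (rule normal_imp_subgroup[OF nA(1)])
  obtain Q :: "'a set monoid" and h where q: "group_hom G Q h" and sur: "h ` carrier G = carrier Q"
    and ker: "\<And>a. a \<in> carrier G \<Longrightarrow> h a = \<one>\<^bsub>Q\<^esub> \<longleftrightarrow> a \<in> A" using quotient_group_hom[OF nA(1)] by blast
  interpret q: group_hom G Q h by (rule q)
  have finQ: "finite (carrier Q)" unfolding sur[symmetric] using fin by simp
  have sepQ: "pi_separable Q p" by (rule q.pi_separable_image[OF fin p sur sep])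
  have kA: "{g \<in> carrier G. h g = \<one>\<^bsub>Q\<^esub>} = A" using ker subgroup.subset[OF sA] by auto
  have cardpre: "card {g \<in> carrier G. h g \<in> N} = card N * card A" if "N \<lhd> Q" for N
    using q.card_preimage[OF fin normal_imp_subgroup[OF that]] subgroup.subset[OF normal_imp_subgroup[OF that]] sur kA by simp
  have coreQ: "pi_core False p Q = {\<one>\<^bsub>Q\<^esub>}"
  proof -
    define N where "N = pi_core False p Q"
    have N: "N \<lhd> Q" "coprime (card N) p" using q.H.pi_core(1,2)[OF finQ p, of False] by (auto simp: N_def pi_number_def)
    have sub: "{g \<in> carrier G. h g \<in> N} \<subseteq> A"
      by (rule maxA[OF q.normal_preimage[OF N(1)]]) (use cardpre[OF N(1)] N(2) nA(2) in simp)
    have "y = \<one>\<^bsub>Q\<^esub>" if y: "y \<in> N" for y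
    proof -
      obtain g where g: "g \<in> carrier G" "y = h g"
        using subgroup.mem_carrier[OF normal_imp_subgroup[OF N(1)] y] unfolding sur[symmetric] by blast
      then have "g \<in> A" using sub y by blast
      then show ?thesis using ker[OF g(1)] g(2) by blast
    qed
    then show ?thesis using subgroup.one_closed[OF normal_imp_subgroup[OF N(1)]] unfolding N_def by blast
  qed
  define V where "V = pi_core True p Q"
  have nV: "V \<lhd> Q" "\<exists>e. card V = p ^ e" unfolding V_def using q.H.pi_core(1,2)[OF finQ p, of True]
    by (auto simp: pi_number_def)
  have sV: "subgroup V Q" by (rule normal_imp_subgroup[OF nV(1)])
  obtain R :: "'a set set monoid" and f where f: "group_hom Q R f" and surf: "f ` carrier Q = carrier R"
    and scc: "self_centralizing_core R p (f ` V)" and lift: "\<And>x. x \<in> carrier Q \<Longrightarrow> f x \<in> f ` V \<Longrightarrow> x \<in> V"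
    using q.H.frattini_quotient_core[OF finQ p sepQ coreQ V_def] by blast
  interpret f: group_hom Q R f by (rule f)
  have finR: "finite (carrier R)" unfolding surf[symmetric] using finQ by simp
  obtain k1 r1 where P1: "card (h ` P) = p ^ k1" "order Q = card (h ` P) * r1" "coprime r1 p"
    using q.sylow_image[OF fin p sur P] .
  have sP1: "subgroup (h ` P) Q" by (rule q.subgroup_img_is_subgroup[OF P(1)])
  obtain k2 r2 where P2: "card (f ` h ` P) = p ^ k2" "order R = card (f ` h ` P) * r2" "coprime r2 p"
    using f.sylow_image[OF finQ p surf sP1 P1] .
  have sP2: "subgroup (f ` h ` P) R" by (rule f.subgroup_img_is_subgroup[OF sP1])
  have nfV: "f ` V \<lhd> R" and "\<exists>j. card (f ` V) = p ^ j" using scc by (auto simp: self_centralizing_core_def)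
  then obtain j where j: "card (f ` V) = p ^ j" by blast
  have VP: "f ` V \<subseteq> f ` h ` P" by (rule f.H.normal_p_subgroup_le_sylow[OF finR p sP2 P2 nfV j])
  have "f ` h ` Ns m \<subseteq> f ` V"
  proof (rule f.H.eta_chain_in_core[where Ns = "\<lambda>i. f ` h ` Ns i", OF finR p _ scc sP2 P2(1) VP _ _ m])
    show "pi_separable R p" by (rule f.pi_separable_image[OF finQ p surf sepQ])
    show "f ` h ` Ns 0 = {\<one>\<^bsub>R\<^esub>}" using N0 by simp
    show "eta_step R p (f ` h ` P) (f ` h ` Ns i) (f ` h ` Ns (Suc i))" if "i < m" for i
      by (rule f.eta_step_image[OF q.eta_step_image[OF steps[OF that] subgroup.subset[OF P(1)]] subgroup.subset[OF sP1]])
  qed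
  define B where "B = {g \<in> carrier G. h g \<in> V}"
  have NmG: "Ns m \<subseteq> carrier G"
  proof (cases m)
    case (Suc j)
    then have "Ns m \<subseteq> P" using steps[of j] by (auto simp: eta_step_def)
    then show ?thesis using subgroup.subset[OF P(1)] by blast
  qed (use N0 in simp)
  have "Ns m \<subseteq> B"
  proof
    fix x assume x: "x \<in> Ns m"
    then have xc: "x \<in> carrier G" using NmG by blast
    have "f (h x) \<in> f ` V" using \<open>f ` h ` Ns m \<subseteq> f ` V\<close> x by blast
    then have "h x \<in> V" by (rule lift[rotated]) (use xc in simp)
    then show "x \<in> B" using xc by (simp add: B_def)
  qed
  moreover have "A \<subseteq> B"
  proof
    fix a assume a: "a \<in> A"
    have ac: "a \<in> carrier G" by (rule subgroup.mem_carrier[OF sA a])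
    have "h a = \<one>\<^bsub>Q\<^esub>" by (rule iffD2[OF ker[OF ac] a])
    then show "a \<in> B" using subgroup.one_closed[OF sV] ac by (simp add: B_def)
  qed
  moreover have "B \<lhd> G" unfolding B_def by (rule q.normal_preimage[OF nV(1)])
  moreover obtain e where "card V = p ^ e" using nV(2) by blast
  then have "card B = card A * p ^ e" using cardpre[OF nV(1)] by (simp add: B_def)
  ultimately show ?thesis using that nA by blast
qed

section \<open>The \<open>p\<close>-length\<close>

lemma (in group) eta_step_of_powerfully_embedded:
  assumes L: "L \<lhd> G" and M: "M \<lhd> G" and LM: "L \<subseteq> M"
    and pe: "powerfully_embedded (G Mod L) p ((\<lambda>x. L #> x) ` M)"
  shows "eta_step G p (carrier G) L M"
proof -
  interpret L: normal L G by (rule L)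
  define Q where "Q = G Mod L"
  define h where "h = (\<lambda>x. L #> x)"
  interpret q: group_hom G Q h
    using L.r_coset_hom_Mod L.factorgroup_is_group group_axioms
    by (simp add: group_hom_def group_hom_axioms_def Q_def h_def)
  have sur: "h ` carrier G = carrier Q" by (simp add: carrier_FactGroup Q_def h_def)
  have ker: "x \<in> L" if "x \<in> carrier G" "h x = \<one>\<^bsub>Q\<^esub>" for x
    using coset_join1[OF _ that(1) L.subgroup_axioms] that(2) by (simp add: Q_def h_def)
  define e where "e = (if p = 2 then 4 else p)"
  have pe': "comm_sg Q (h ` M) (carrier Q) \<subseteq> pow_sg Q (h ` M) e"
    using pe unfolding powerfully_embedded_def Q_def[symmetric] h_def[symmetric] e_def by blast
  have sM: "subgroup M G" by (rule normal_imp_subgroup[OF M])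
  note Mc = subgroup.mem_carrier[OF sM]
  have LG: "L \<subseteq> carrier G" and MG: "M \<subseteq> carrier G" using L.subset subgroup.subset[OF sM] .
  have st: "stable_subgroup G (carrier G) L" "stable_subgroup G (carrier G) M" using L M normal_iff_stable by auto
  have sE: "subgroup (pow_gen G e L M) G" by (rule stable_subgroupD(1)[OF pow_gen_stable[OF order_refl st]])
  have "x \<otimes> g \<otimes> inv x \<otimes> inv g \<in> pow_gen G e L M" if x: "x \<in> M" and g: "g \<in> carrier G" for x g
  proof -
    let ?c = "x \<otimes> g \<otimes> inv x \<otimes> inv g"
    have c: "?c \<in> carrier G" using Mc[OF x] g by simp
    have "h ?c = h x \<otimes>\<^bsub>Q\<^esub> h g \<otimes>\<^bsub>Q\<^esub> inv\<^bsub>Q\<^esub> h x \<otimes>\<^bsub>Q\<^esub> inv\<^bsub>Q\<^esub> h g" using Mc[OF x] g by simp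
    moreover have "h x \<in> h ` M" "h g \<in> carrier Q" using x g by auto
    ultimately have "h ?c \<in> comm_sg Q (h ` M) (carrier Q)"
      unfolding comm_sg_def by (intro generate.incl) blast
    then have "h ?c \<in> pow_sg Q (h ` M) e" using pe' by blast
    also have "pow_sg Q (h ` M) e \<subseteq> pow_gen Q e (h ` L) (h ` M)"
      unfolding pow_sg_def pow_gen_def by (rule q.H.mono_generate) blast
    also have "\<dots> = h ` pow_gen G e L M" by (rule q.pow_gen_image[OF MG LG, symmetric])
    finally obtain z where z: "z \<in> pow_gen G e L M" "h ?c = h z" by blast
    have zc: "z \<in> carrier G" by (rule subgroup.mem_carrier[OF sE z(1)])
    have "h (?c \<otimes> inv z) = \<one>\<^bsub>Q\<^esub>" using c zc z(2) by (simp del: q.hom_mult add: q.hom_mult[of ?c "inv z"])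
    then have "?c \<otimes> inv z \<in> L" by (rule ker[rotated]) (use c zc in simp)
    then have "?c \<otimes> inv z \<in> pow_gen G e L M" by (rule subsetD[OF pow_gen_incl(1)])
    then have "(?c \<otimes> inv z) \<otimes> z \<in> pow_gen G e L M" by (rule subgroup.m_closed[OF sE _ z(1)])
    then show ?thesis unfolding m_assoc[OF c inv_closed[OF zc] zc] l_inv[OF zc] r_one[OF c] .
  qed
  then show ?thesis unfolding eta_step_def e_def using st LM MG by blast
qed

lemma (in group) eta_series_step:
  assumes P: "subgroup P G" and eta: "eta_series (G\<lparr>carrier := P\<rparr>) p Ns"
  shows "eta_step G p P (Ns i) (Ns (Suc i))"
proof -
  interpret P: group "G\<lparr>carrier := P\<rparr>" using subgroup_imp_group[OF P] .
  have "eta_step (G\<lparr>carrier := P\<rparr>) p (carrier (G\<lparr>carrier := P\<rparr>)) (Ns i) (Ns (Suc i))"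
    by (rule P.eta_step_of_powerfully_embedded) (use eta in \<open>auto simp: eta_series_def\<close>)
  then show ?thesis using eta_step_restrict[OF P] by simp
qed

text \<open>The powerful height is a least number, which is meaningful only if some
  \<open>\<eta>\<close>-series reaches the group. The upper central series does: its factors are
  central, so the commutator subgroups to be bounded are trivial.\<close>

lemma (in group) p_group_eta_series:
  assumes fin: "finite (carrier G)" and p: "Factorial_Ring.prime (p::nat)" "order G = p ^ k"
  obtains Ns n where "eta_series G p Ns" "Ns n = carrier G"
proof -
  define c where "c N = {x \<in> carrier G. \<forall>g\<in>carrier G. x \<otimes> g \<otimes> inv x \<otimes> inv g \<in> N}" for N
  define U where "U n = (c ^^ n) {\<one>}" for n
  have U0: "U 0 = {\<one>}" and USuc: "U (Suc n) = c (U n)" for n by (simp_all add: U_def)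
  have nU: "U n \<lhd> G" for n
  proof (induction n)
    case 0
    then show ?case unfolding U0 by (rule one_is_normal)
  next
    case (Suc n)
    then show ?case unfolding USuc c_def by (rule normal_central_preimage)
  qed
  have UU: "U n \<subseteq> U (Suc n)" for n unfolding USuc c_def by (rule normal_le_central_preimage[OF nU])
  have "powerfully_embedded (G Mod U n) p ((\<lambda>x. U n #> x) ` U (Suc n))" for n
  proof -
    interpret N: normal "U n" G by (rule nU)
    interpret q: group_hom G "G Mod U n" "\<lambda>x. U n #> x"
      using N.r_coset_hom_Mod N.factorgroup_is_group group_axioms by (simp add: group_hom_def group_hom_axioms_def)
    let ?h = "\<lambda>x. U n #> x"
    have sur: "?h ` carrier G = carrier (G Mod U n)" by (simp add: carrier_FactGroup)
    have nh: "?h ` U (Suc n) \<lhd> G Mod U n" by (rule q.normal_image[OF sur nU])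
    have "{y \<otimes>\<^bsub>G Mod U n\<^esub> z \<otimes>\<^bsub>G Mod U n\<^esub> inv\<^bsub>G Mod U n\<^esub> y \<otimes>\<^bsub>G Mod U n\<^esub> inv\<^bsub>G Mod U n\<^esub> z | y z.
        y \<in> ?h ` U (Suc n) \<and> z \<in> carrier (G Mod U n)} \<subseteq> {\<one>\<^bsub>G Mod U n\<^esub>}" (is "?S \<subseteq> _")
    proof
      fix s assume "s \<in> ?S"
      then obtain x g where xg: "x \<in> U (Suc n)" "g \<in> carrier G"
        "s = ?h x \<otimes>\<^bsub>G Mod U n\<^esub> ?h g \<otimes>\<^bsub>G Mod U n\<^esub> inv\<^bsub>G Mod U n\<^esub> ?h x \<otimes>\<^bsub>G Mod U n\<^esub> inv\<^bsub>G Mod U n\<^esub> ?h g"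
        unfolding sur[symmetric] by blast
      have x: "x \<in> carrier G" "x \<otimes> g \<otimes> inv x \<otimes> inv g \<in> U n" using xg(1,2) by (auto simp: USuc c_def)
      have "s = ?h (x \<otimes> g \<otimes> inv x \<otimes> inv g)"
        unfolding xg(3) using x(1) xg(2) by (simp only: q.hom_mult q.hom_inv m_closed inv_closed)
      also have "\<dots> = U n" using coset_join2[OF _ N.subgroup_axioms x(2)] x(1) xg(2) by simp
      finally show "s \<in> {\<one>\<^bsub>G Mod U n\<^esub>}" by simp
    qed
    then have "comm_sg (G Mod U n) (?h ` U (Suc n)) (carrier (G Mod U n)) \<subseteq> {\<one>\<^bsub>G Mod U n\<^esub>}"
      unfolding comm_sg_def by (rule q.H.generate_subgroup_incl[OF _ q.H.triv_subgroup])
    also have "{\<one>\<^bsub>G Mod U n\<^esub>} \<subseteq> pow_sg (G Mod U n) (?h ` U (Suc n)) e" for e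
      unfolding pow_sg_def using generate.one[of "G Mod U n"] by blast
    finally show ?thesis unfolding powerfully_embedded_def using nh by blast
  qed
  then have eta: "eta_series G p U" unfolding eta_series_def using U0 UU nU by blast
  have sub: "U n \<subseteq> carrier G" for n using subgroup.subset[OF normal_imp_subgroup[OF nU]] .
  \<comment> \<open>Until the series reaches the group its terms grow strictly, so
    \<open>order G\<close> steps suffice.\<close>
  have "U n = carrier G \<or> n < card (U n)" for n
  proof (induction n)
    case 0
    then show ?case by (simp add: U0)
  next
    case (Suc n)
    show ?case
    proof (cases "U n = carrier G")
      case True
      then show ?thesis using UU[of n] sub[of "Suc n"] by blast
    next
      case False
      have cG: "card (carrier G) = p ^ k" using p(2) by (simp add: order_def)
      have st: "stable_subgroup G (carrier G) (U n)" "stable_subgroup G (carrier G) (carrier G)"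
        using nU normal_self normal_iff_stable by auto
      have ps: "U n \<subset> carrier G" using False sub by blast
      obtain x where x: "x \<in> carrier G" "x \<notin> U n" "\<forall>g\<in>carrier G. x \<otimes> g \<otimes> inv x \<otimes> inv g \<in> U n"
        using p_group_central_step[OF subgroup_self cG p(1) st fin ps cG] by blast
      then have "x \<in> U (Suc n)" by (simp add: USuc c_def)
      then have "U n \<subset> U (Suc n)" using UU x(2) by blast
      then have "card (U n) < card (U (Suc n))" using psubset_card_mono[OF finite_subset[OF sub fin]] by blast
      then show ?thesis using Suc False by simp
    qed
  qed
  then have "U (order G) = carrier G \<or> order G < card (U (order G))" .
  then have "U (order G) = carrier G" using card_mono[OF fin sub[of "order G"]] by (simp add: order_def)
  then show ?thesis using that eta by blast
qed

text \<open>Modulo \<open>K\<close> the series restarts from the trivial subgroup at index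
  \<open>t\<close>, and the next block of terms is absorbed by a \<open>p'\<close>-factor followed
  by a \<open>p\<close>-factor.\<close>

lemma (in group) eta_chain_step:
  assumes fin: "finite (carrier G)" and p: "Factorial_Ring.prime (p::nat)" and sep: "pi_separable G p"
    and P: "subgroup P G" "card P = p ^ k" "order G = card P * r" "coprime r p"
    and steps: "\<And>j. eta_step G p P (Ns j) (Ns (Suc j))"
    and K: "K \<lhd> G" "Ns t \<subseteq> K"
  obtains A B a b where "A \<lhd> G" "B \<lhd> G" "K \<subseteq> A" "A \<subseteq> B" "card A = card K * a" "coprime a p"
    "card B = card A * p ^ b" "Ns (t + (if p = 2 then 1 else p - 2)) \<subseteq> B"
proof -
  let ?d = "if p = 2 then 1 else p - 2"
  obtain Q :: "'a set monoid" and h where q: "group_hom G Q h" and sur: "h ` carrier G = carrier Q"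
    and ker: "\<And>a. a \<in> carrier G \<Longrightarrow> h a = \<one>\<^bsub>Q\<^esub> \<longleftrightarrow> a \<in> K" using quotient_group_hom[OF K(1)] by blast
  interpret q: group_hom G Q h by (rule q)
  have finQ: "finite (carrier Q)" unfolding sur[symmetric] using fin by simp
  have sepQ: "pi_separable Q p" by (rule q.pi_separable_image[OF fin p sur sep])
  have sK: "subgroup K G" by (rule normal_imp_subgroup[OF K(1)])
  have kK: "{g \<in> carrier G. h g = \<one>\<^bsub>Q\<^esub>} = K" using ker subgroup.subset[OF sK] by auto
  have cardpre: "card {g \<in> carrier G. h g \<in> N} = card N * card K" if "N \<lhd> Q" for N
    using q.card_preimage[OF fin normal_imp_subgroup[OF that]] subgroup.subset[OF normal_imp_subgroup[OF that]] sur kK by simp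
  obtain k1 r1 where P1: "card (h ` P) = p ^ k1" "order Q = card (h ` P) * r1" "coprime r1 p"
    using q.sylow_image[OF fin p sur P] .
  have sP1: "subgroup (h ` P) Q" by (rule q.subgroup_img_is_subgroup[OF P(1)])
  have NP: "Ns j \<subseteq> P" for j using steps[of j] by (auto simp: eta_step_def)
  \<comment> \<open>Nonemptiness makes the image of \<open>Ns t\<close> equal to the trivial
    subgroup instead of merely contained in it.\<close>
  have "Ns t \<noteq> {}" using steps[of t] subgroup.one_closed by (force simp: eta_step_def stable_subgroup_def)
  moreover have "h x = \<one>\<^bsub>Q\<^esub>" if "x \<in> Ns t" for x
    using subsetD[OF K(2) that] by (rule iffD2[OF ker[OF subgroup.mem_carrier[OF sK]], rotated]) (use subsetD[OF K(2) that] in auto)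
  ultimately have N0: "h ` Ns (t + 0) = {\<one>\<^bsub>Q\<^esub>}" by auto
  obtain A B e where AB: "A \<lhd> Q" "B \<lhd> Q" "A \<subseteq> B" "coprime (card A) p" "card B = card A * p ^ e" "h ` Ns (t + ?d) \<subseteq> B"
  proof (rule q.H.eta_chain_in_p'_p_core[where Ns = "\<lambda>i. h ` Ns (t + i)", OF finQ p sepQ sP1 P1 N0 _ order_refl])
    show "eta_step Q p (h ` P) (h ` Ns (t + j)) (h ` Ns (t + Suc j))" for j
      using q.eta_step_image[OF steps[of "t + j"] subgroup.subset[OF P(1)]] by simp
  qed
  define A' where "A' = {g \<in> carrier G. h g \<in> A}"
  define B' where "B' = {g \<in> carrier G. h g \<in> B}"
  have "A' \<lhd> G" "B' \<lhd> G" unfolding A'_def B'_def by (rule q.normal_preimage, rule AB)+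
  moreover have "A' \<subseteq> B'" using AB(3) by (auto simp: A'_def B'_def)
  moreover have "K \<subseteq> A'"
  proof
    fix x assume x: "x \<in> K"
    have xc: "x \<in> carrier G" by (rule subgroup.mem_carrier[OF sK x])
    have "h x = \<one>\<^bsub>Q\<^esub>" by (rule iffD2[OF ker[OF xc] x])
    then show "x \<in> A'" using subgroup.one_closed[OF normal_imp_subgroup[OF AB(1)]] xc by (simp add: A'_def)
  qed
  moreover have "card A' = card K * card A" using cardpre[OF AB(1)] by (simp add: A'_def)
  moreover from this have "card B' = card A' * p ^ e" using cardpre[OF AB(2)] AB(5) by (simp add: B'_def)
  moreover have "Ns (t + ?d) \<subseteq> B'" using AB(6) NP subgroup.subset[OF P(1)] by (fastforce simp: B'_def)
  ultimately show ?thesis using that AB(4) by blast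
qed

text \<open>Even positions carry the \<open>p'\<close>-factors and odd positions the
  \<open>p\<close>-factors, so the flag of \<open>pi_number\<close> is the parity and
  \<open>2 * l\<close> factors contain \<open>l\<close> of the second kind.\<close>

lemma (in group) eta_series_pi_chain:
  assumes fin: "finite (carrier G)" and p: "Factorial_Ring.prime (p::nat)" and sep: "pi_separable G p"
    and P: "subgroup P G" "card P = p ^ k" "order G = card P * r" "coprime r p"
    and N0: "Ns 0 = {\<one>}" and steps: "\<And>j. eta_step G p P (Ns j) (Ns (Suc j))"
  obtains Ks where "Ks 0 = {\<one>}" "\<And>i. i \<le> 2 * l \<Longrightarrow> Ks i \<lhd> G"
    "\<And>i. i < 2 * l \<Longrightarrow> Ks i \<subseteq> Ks (Suc i) \<and> (\<exists>n. card (Ks (Suc i)) = card (Ks i) * n \<and> pi_number (odd i) p n)"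
    "Ns (l * (if p = 2 then 1 else p - 2)) \<subseteq> Ks (2 * l)"
proof -
  let ?d = "if p = 2 then 1 else p - 2"
  have "\<exists>Ks. Ks 0 = {\<one>} \<and> (\<forall>i\<le>2 * l. Ks i \<lhd> G) \<and>
    (\<forall>i<2 * l. Ks i \<subseteq> Ks (Suc i) \<and> (\<exists>n. card (Ks (Suc i)) = card (Ks i) * n \<and> pi_number (odd i) p n)) \<and>
    Ns (l * ?d) \<subseteq> Ks (2 * l)"
  proof (induction l)
    case 0
    show ?case by (rule exI[of _ "\<lambda>_. {\<one>}"]) (use N0 one_is_normal in simp)
  next
    case (Suc l)
    then obtain Ks where Ks: "Ks 0 = {\<one>}" "\<And>i. i \<le> 2 * l \<Longrightarrow> Ks i \<lhd> G"
      "\<And>i. i < 2 * l \<Longrightarrow> Ks i \<subseteq> Ks (Suc i) \<and> (\<exists>n. card (Ks (Suc i)) = card (Ks i) * n \<and> pi_number (odd i) p n)"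
      "Ns (l * ?d) \<subseteq> Ks (2 * l)" by blast
    obtain A B a b where AB: "A \<lhd> G" "B \<lhd> G" "Ks (2 * l) \<subseteq> A" "A \<subseteq> B" "card A = card (Ks (2 * l)) * a" "coprime a p"
      "card B = card A * p ^ b" "Ns (l * ?d + ?d) \<subseteq> B"
      using eta_chain_step[OF fin p sep P steps Ks(2)[OF order_refl] Ks(4)] .
    define Ls where "Ls = Ks(2 * l + 1 := A, 2 * l + 2 := B)"
    have Ls: "Ls i = Ks i" if "i \<le> 2 * l" for i using that by (simp add: Ls_def)
    have LA: "Ls (Suc (2 * l)) = A" and LB: "Ls (Suc (Suc (2 * l))) = B" by (simp_all add: Ls_def)
    have "Ls i \<lhd> G" if "i \<le> 2 * Suc l" for i
    proof -
      have "i \<le> 2 * l \<or> i = Suc (2 * l) \<or> i = Suc (Suc (2 * l))" using that by auto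
      then show ?thesis using Ls Ks(2) LA LB AB(1,2) by auto
    qed
    moreover have "Ls i \<subseteq> Ls (Suc i) \<and> (\<exists>n. card (Ls (Suc i)) = card (Ls i) * n \<and> pi_number (odd i) p n)"
      if i: "i < 2 * Suc l" for i
    proof -
      consider "i < 2 * l" | "i = 2 * l" | "i = Suc (2 * l)" using i by fastforce
      then show ?thesis
      proof cases
        case 1
        then show ?thesis using Ks(3)[OF 1] by (simp add: Ls)
      next
        case 2
        then show ?thesis using AB(3,5,6) by (auto simp: Ls LA pi_number_def)
      next
        case 3
        then show ?thesis using AB(4,7) by (auto simp: LA LB pi_number_def)
      qed
    qed
    moreover have "Ns (Suc l * ?d) \<subseteq> Ls (2 * Suc l)" using AB(8) LB by (simp add: add.commute)
    moreover have "Ls 0 = {\<one>}" using Ks(1) Ls by simp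
    ultimately show ?case by blast
  qed
  then show ?thesis using that by blast
qed

text \<open>Appending \<open>G\<close> adds a factor at the even position \<open>2 * l\<close>, of
  order prime to \<open>p\<close>. Every factor that is not a \<open>p'\<close>-group therefore
  stands at one of the \<open>l\<close> odd positions.\<close>

lemma (in group) p_length_le:
  assumes fin: "finite (carrier G)" and K0: "Ks 0 = {\<one>}" and nK: "\<And>i. i \<le> 2 * l \<Longrightarrow> Ks i \<lhd> G"
    and step: "\<And>i. i < 2 * l \<Longrightarrow> Ks i \<subseteq> Ks (Suc i) \<and> (\<exists>n. card (Ks (Suc i)) = card (Ks i) * n \<and> pi_number (odd i) p n)"
    and top: "order G = card (Ks (2 * l)) * s" "coprime s p"
  shows "p_length G p \<le> l"
proof -
  define Ms where "Ms i = (if i \<le> 2 * l then Ks i else carrier G)" for i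
  define m where "m = Suc (2 * l)"
  have nM: "Ms i \<lhd> G" for i using nK normal_self by (simp add: Ms_def)
  have sM: "subgroup (Ms i) G" for i by (rule normal_imp_subgroup[OF nM])
  have step': "Ms i \<subseteq> Ms (Suc i) \<and> (\<exists>n. card (Ms (Suc i)) = card (Ms i) * n \<and> pi_number (odd i) p n)"
    if i: "i < m" for i
  proof (cases "i < 2 * l")
    case True
    then show ?thesis using step[OF True] by (simp add: Ms_def)
  next
    case False
    then have "i = 2 * l" using i by (simp add: m_def)
    then show ?thesis
      using top subgroup.subset[OF normal_imp_subgroup[OF nK[of "2 * l"]]]
        by (auto simp: Ms_def order_def pi_number_def)
  qed
  have norm: "Ms i \<lhd> G\<lparr>carrier := Ms (Suc i)\<rparr>" if "i < m" for i
    using normal_in_subgroup_iff[OF sM] step'[OF that] nM[of i] subgroup.mem_carrier[OF sM[of "Suc i"]]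
    unfolding normal_iff_stable stable_subgroup_def by blast
  have factor: "pi_number (odd i) p (order (series_factor G Ms i))" if i: "i < m" for i
  proof -
    interpret S: group "G\<lparr>carrier := Ms (Suc i)\<rparr>" using subgroup_imp_group[OF sM] .
    have f: "finite (Ms (Suc i))" "finite (Ms i)" using fin subgroup.subset[OF sM] finite_subset by blast+
    obtain n where n: "card (Ms (Suc i)) = card (Ms i) * n" "pi_number (odd i) p n" using step'[OF i] by blast
    have "order (series_factor G Ms i) * card (Ms i) = card (Ms (Suc i))"
      using S.lagrange[OF normal_imp_subgroup[OF norm[OF i]]] f by (simp add: series_factor_def FactGroup_def order_def)
    then have "order (series_factor G Ms i) = n" using n(1) card_subgroup_pos[OF sM f(2)] by (simp add: mult.commute)
    then show ?thesis using n(2) by simp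
  qed
  have "p_series G p Ms m"
    unfolding p_series_def
  proof (intro conjI allI impI)
    show "p_group (series_factor G Ms i) p \<or> p'_group (series_factor G Ms i) p" if "i < m" for i
      using factor[OF that] by (cases "odd i") (auto simp: p_group_def p'_group_def pi_number_def)
  qed (use K0 sM norm in \<open>auto simp: Ms_def m_def\<close>)
  then have "p_length G p \<le> card {i. i < m \<and> \<not> p'_group (series_factor G Ms i) p}"
    unfolding p_length_def using nM by (intro Least_le) blast
  also have "\<dots> \<le> card ((\<lambda>i. 2 * i + 1) ` {..<l})"
  proof (rule card_mono)
    show "{i. i < m \<and> \<not> p'_group (series_factor G Ms i) p} \<subseteq> (\<lambda>i. 2 * i + 1) ` {..<l}"
    proof
      fix i assume "i \<in> {i. i < m \<and> \<not> p'_group (series_factor G Ms i) p}"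
      then have i: "i < m" "\<not> p'_group (series_factor G Ms i) p" by auto
      then have "odd i" using factor[OF i(1)] by (cases "odd i") (auto simp: p'_group_def pi_number_def)
      then obtain j where "i = 2 * j + 1" by (rule oddE)
      then show "i \<in> (\<lambda>i. 2 * i + 1) ` {..<l}" using i(1) by (auto simp: m_def)
    qed
  qed simp
  also have "\<dots> \<le> l" using card_image_le[of "{..<l}" "\<lambda>i. 2 * i + 1"] by simp
  finally show ?thesis .
qed

lemma (in group) p_length_le_powerful_class:
  assumes fin: "finite (carrier G)" and p: "Factorial_Ring.prime (p::nat)" and sol: "p_solvable G p"
    and syl: "sylow_subgroup G p P"
    and l: "powerful_class (G\<lparr>carrier := P\<rparr>) p \<le> l * (if p = 2 then 1 else p - 2)"
  shows "p_length G p \<le> l"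
proof -
  let ?d = "if p = 2 then 1 else p - 2"
  let ?k = "powerful_class (G\<lparr>carrier := P\<rparr>) p"
  have P: "subgroup P G" "card P = p ^ multiplicity p (order G)" using syl by (auto simp: sylow_subgroup_def)
  have oG: "order G \<noteq> 0" using fin one_closed by (auto simp: order_def)
  obtain r where r: "order G = card P * r" "\<not> p dvd r"
    unfolding P(2) using multiplicity_decompose'[OF oG] p not_prime_unit[of p] by metis
  have cr: "coprime r p" using prime_imp_coprime[OF p r(2)] by (simp add: coprime_commute)
  have sep: "pi_separable G p" by (rule p_solvable_imp_pi_separable[OF fin sol])
  interpret P: group "G\<lparr>carrier := P\<rparr>" using subgroup_imp_group[OF P(1)] .
  have finP: "finite P" using fin subgroup.subset[OF P(1)] finite_subset by blast
  \<comment> \<open>Existence turns the \<open>LEAST\<close> in the powerful class into a value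
    attained by an actual series.\<close>
  have "\<exists>n Ns. eta_series (G\<lparr>carrier := P\<rparr>) p Ns \<and> Ns n = P"
    using P.p_group_eta_series[OF _ p, of "multiplicity p (order G)"] finP P(2)
    by (simp add: order_def) metis
  then obtain Ns where Ns: "eta_series (G\<lparr>carrier := P\<rparr>) p Ns" "Ns ?k = P"
    unfolding powerful_class_def powerful_height_def
      using LeastI_ex[of "\<lambda>n. \<exists>Ns. eta_series (G\<lparr>carrier := P\<rparr>) p Ns \<and> Ns n = P"] by auto
  have N0: "Ns 0 = {\<one>}" and mono: "\<And>i. Ns i \<subseteq> Ns (Suc i)" using Ns(1) by (auto simp: eta_series_def)
  note steps = eta_series_step[OF P(1) Ns(1)]
  obtain Ks where Ks: "Ks 0 = {\<one>}" "\<And>i. i \<le> 2 * l \<Longrightarrow> Ks i \<lhd> G"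
    "\<And>i. i < 2 * l \<Longrightarrow> Ks i \<subseteq> Ks (Suc i) \<and> (\<exists>n. card (Ks (Suc i)) = card (Ks i) * n \<and> pi_number (odd i) p n)"
    "Ns (l * ?d) \<subseteq> Ks (2 * l)"
    using eta_series_pi_chain[OF fin p sep P r(1) cr N0 steps, of l] by blast
  have sK: "subgroup (Ks (2 * l)) G" using normal_imp_subgroup[OF Ks(2)] by simp
  have finK: "finite (Ks (2 * l))" using fin subgroup.subset[OF sK] finite_subset by blast
  \<comment> \<open>The series ascends and reaches \<open>P\<close> at the powerful class, which is
    at most \<open>l * ?d\<close>; so the index of \<open>Ks (2 * l)\<close> in \<open>G\<close> is
    prime to \<open>p\<close>.\<close>
  have "P \<subseteq> Ks (2 * l)" using lift_Suc_mono_le[of Ns, OF mono l] Ns(2) Ks(4) by blast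
  then have "card P dvd card (Ks (2 * l))" by (rule card_subgroup_dvd[OF sK P(1) _ finK])
  moreover have "card (Ks (2 * l)) dvd order G"
    unfolding order_def by (rule card_subgroup_dvd[OF subgroup_self sK subgroup.subset[OF sK] fin])
  ultimately obtain u s where us: "card (Ks (2 * l)) = card P * u" "order G = card (Ks (2 * l)) * s" by (elim dvdE)
  then have "card P * r = card P * (u * s)" using r(1)[symmetric] unfolding us by (simp only: mult.assoc)
  then have "r = u * s" using P(2) prime_gt_0_nat[OF p] by simp
  then have "coprime s p" using cr by simp
  then show ?thesis using p_length_le[OF fin Ks(1,2,3) us(2)] by blast
qed

theorem theorem1p2:
  fixes G :: "('a,'b) monoid_scheme" and p :: nat and P :: "'a set"
  assumes "group G" and "finite (carrier G)" and "Factorial_Ring.prime p"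
    and "p_solvable G p" and "sylow_subgroup G p P"
  shows "(p > 2 \<longrightarrow> int (p_length G p) \<le>
            \<lceil>real (powerful_class (G\<lparr>carrier := P\<rparr>) p) / real (p - 2)\<rceil>)
       \<and> (p = 2 \<longrightarrow> p_length G p \<le> powerful_class (G\<lparr>carrier := P\<rparr>) p)"
proof (intro conjI impI)
  note bound = group.p_length_le_powerful_class[OF assms]
  let ?k = "powerful_class (G\<lparr>carrier := P\<rparr>) p"
  show "p_length G p \<le> ?k" if "p = 2" by (rule bound) (simp add: that)
  assume p: "p > 2"
  \<comment> \<open>The least number of blocks of length \<open>p - 2\<close> that cover the class;
    passing through \<open>nat\<close> loses nothing because the ceiling is nonnegative.\<close>
  define l where "l = nat \<lceil>real ?k / real (p - 2)\<rceil>"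
  have "0 \<le> real ?k / real (p - 2)" by simp
  then have "0 \<le> \<lceil>real ?k / real (p - 2)\<rceil>" using ceiling_mono[of 0] by (simp only: ceiling_zero)
  then have l: "int l = \<lceil>real ?k / real (p - 2)\<rceil>" unfolding l_def by (rule nat_0_le)
  have "real ?k / real (p - 2) \<le> real l" using le_of_int_ceiling[of "real ?k / real (p - 2)"] unfolding l[symmetric]
    by simp
  then have "real ?k \<le> real (l * (p - 2))" using p by (simp add: divide_le_eq)
  then have "?k \<le> l * (p - 2)" by (simp only: of_nat_le_iff)
  then have "p_length G p \<le> l" using p by (intro bound) simp
  then show "int (p_length G p) \<le> \<lceil>real ?k / real (p - 2)\<rceil>" unfolding l[symmetric] by simp
qed

end
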